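(* Let $n\ge 4$, $3\le k\le n-1$, $1<p<n$, and write $x=(y,z)\in\mathbb{R}^n=\mathbb{R}^k\times\mathbb{R}^{n-k}$. Let $$u_0(y,z)=C_{p,n,k}\,\big[(1+|y|)^2+|z|^2\big]^{-\frac{n-p}{2(p-1)}},\qquad C_{p,n,k}=(k-1)^{\frac{n-p}{p(p-1)}}(n-p)^{\frac{n-p}{p}}(p-1)^{-\frac{n-p}{p}}.$$ If $u(y,z)=\lambda^{\frac{n-p}{p}}u_0(\lambda y,\lambda z+z_0)$ for some $\lambda>0$ and $z_0\in\mathbb{R}^{n-k}$, then $u$ is an extremal function for the Hardy-Sobolev-Maz'ya inequality $$\left(\int_{\mathbb{R}^n}\frac{|v|^{\frac{p(n-1)}{n-p}}}{|y|}\,dx\right)^{\frac{n-p}{p(n-1)}}\le S\left(\int_{\mathbb{R}^n}|\nabla v|^p\,dx\right)^{\frac1p}\qquad (v\in D^{1,p}(\mathbb{R}^n)),$$ where $S$ is the best (smallest possible) constant.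
   Context: $D^{1,p}(\mathbb{R}^n)$ is the closure of $C_c^\infty(\mathbb{R}^n)$ with respect to the norm $\|u\|=\left(\int_{\mathbb{R}^n}|\nabla u|^p\,dx\right)^{1/p}$. An extremal function for the inequality is a nonzero $u\in D^{1,p}(\mathbb{R}^n)$ for which equality holds with the best constant $S$. *)

theory Defs
  imports "HOL-Analysis.Analysis"
begin

text \<open>Iterated (directional) Frechet derivatives; on a finite-dimensional space
  \<open>smooth\<close> is the usual \<open>C\<^sup>\<infinity>\<close>.\<close>

fun times_differentiable :: "nat \<Rightarrow> ('a::euclidean_space \<Rightarrow> real) \<Rightarrow> bool" where
  "times_differentiable 0 f \<longleftrightarrow> continuous_on UNIV f"
| "times_differentiable (Suc m) f \<longleftrightarrow>
     (\<forall>x. f differentiable (at x)) \<and>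
     (\<forall>v. times_differentiable m (\<lambda>x. frechet_derivative f (at x) v))"

definition smooth :: "('a::euclidean_space \<Rightarrow> real) \<Rightarrow> bool" where
  "smooth f \<longleftrightarrow> (\<forall>m. times_differentiable m f)"

definition test_function :: "('a::euclidean_space \<Rightarrow> real) \<Rightarrow> bool" where
  "test_function f \<longleftrightarrow> smooth f \<and> compact (closure {x. f x \<noteq> 0})"

definition grad :: "('a::euclidean_space \<Rightarrow> real) \<Rightarrow> 'a \<Rightarrow> 'a" where
  "grad f x = (\<Sum>b\<in>Basis. frechet_derivative f (at x) b *\<^sub>R b)"

definition locally_integrable ::
    "('a::euclidean_space \<Rightarrow> 'b::{banach, second_countable_topology}) \<Rightarrow> bool" where
  "locally_integrable f \<longleftrightarrow> (\<forall>K. compact K \<longrightarrow> set_integrable lborel K f)"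

definition has_weak_gradient ::
    "('a::euclidean_space \<Rightarrow> real) \<Rightarrow> ('a \<Rightarrow> 'a) \<Rightarrow> bool" where
  "has_weak_gradient u g \<longleftrightarrow>
     locally_integrable u \<and> locally_integrable g \<and>
     (\<forall>\<phi>. test_function \<phi> \<longrightarrow>
        (LINT x|lborel. u x *\<^sub>R grad \<phi> x) = - (LINT x|lborel. \<phi> x *\<^sub>R g x))"

text \<open>The weak gradient is determined up to a null set, so quantities
  defined by integrating it do not depend on the choice made here.\<close>

definition weak_gradient :: "('a::euclidean_space \<Rightarrow> real) \<Rightarrow> 'a \<Rightarrow> 'a" where
  "weak_gradient u = (SOME g. has_weak_gradient u g)"

definition in_Lp ::
    "real \<Rightarrow> ('a::euclidean_space \<Rightarrow> 'b::{banach, second_countable_topology}) \<Rightarrow> bool" where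
  "in_Lp q f \<longleftrightarrow> f \<in> borel_measurable lborel \<and> integrable lborel (\<lambda>x. norm (f x) powr q)"

definition gradient_norm :: "real \<Rightarrow> ('a::euclidean_space \<Rightarrow> real) \<Rightarrow> real" where
  "gradient_norm p u = (LINT x|lborel. norm (weak_gradient u x) powr p) powr (1 / p)"

definition sobolev_conjugate :: "real \<Rightarrow> real \<Rightarrow> real" where
  "sobolev_conjugate n p = n * p / (n - p)"

text \<open>For \<open>1 < p < n\<close> the closure is taken inside the space of functions in
  \<open>L\<^bsup>np/(n-p)\<^esup>\<close> whose weak gradient is in \<open>L\<^sup>p\<close>. On this space the gradient norm is a
  norm modulo null sets (the only constant it contains is zero), and by the Sobolev
  inequality the closure is the completion of the test functions.\<close>

definition D1p :: "real \<Rightarrow> ('a::euclidean_space \<Rightarrow> real) set" where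
  "D1p p = {u. in_Lp (sobolev_conjugate (real DIM('a)) p) u \<and>
               (\<exists>g. has_weak_gradient u g) \<and> in_Lp p (weak_gradient u) \<and>
               (\<forall>\<epsilon>>0. \<exists>\<phi>. test_function \<phi> \<and> gradient_norm p (\<lambda>x. u x - \<phi> x) < \<epsilon>)}"

definition hsm_exponent :: "real \<Rightarrow> real \<Rightarrow> real" where
  "hsm_exponent n p = p * (n - 1) / (n - p)"

text \<open>Here \<open>(real ^ 'k) \<times> (real ^ 'm)\<close> carries the Euclidean product norm, and the integrands
  below vanish where \<open>y = 0\<close>, a null set, because of division by zero.\<close>

definition hsm_integrand ::
    "real \<Rightarrow> ((real ^ 'k) \<times> (real ^ 'm) \<Rightarrow> real) \<Rightarrow> (real ^ 'k) \<times> (real ^ 'm) \<Rightarrow> real" where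
  "hsm_integrand p v x =
     \<bar>v x\<bar> powr hsm_exponent (real DIM((real ^ 'k) \<times> (real ^ 'm))) p / norm (fst x)"

definition hsm_norm :: "real \<Rightarrow> ((real ^ 'k) \<times> (real ^ 'm) \<Rightarrow> real) \<Rightarrow> real" where
  "hsm_norm p v = (LINT x|lborel. hsm_integrand p v x)
     powr (1 / hsm_exponent (real DIM((real ^ 'k) \<times> (real ^ 'm))) p)"

text \<open>Integrability is part of the inequality: without it the Bochner
  integral on the left would be zero instead of infinite.\<close>

definition hsm_inequality ::
    "real \<Rightarrow> real \<Rightarrow> ((real ^ 'k) \<times> (real ^ 'm) \<Rightarrow> real) \<Rightarrow> bool" where
  "hsm_inequality p S v \<longleftrightarrow>
     integrable lborel (hsm_integrand p v) \<and> hsm_norm p v \<le> S * gradient_norm p v"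

definition hsm_best_constant :: "'k::finite itself \<Rightarrow> 'm::finite itself \<Rightarrow> real \<Rightarrow> real \<Rightarrow> bool" where
  "hsm_best_constant _ _ p S \<longleftrightarrow>
     (\<forall>v \<in> (D1p p :: ((real ^ 'k) \<times> (real ^ 'm) \<Rightarrow> real) set). hsm_inequality p S v) \<and>
     (\<forall>S'. (\<forall>v \<in> (D1p p :: ((real ^ 'k) \<times> (real ^ 'm) \<Rightarrow> real) set). hsm_inequality p S' v)
        \<longrightarrow> S \<le> S')"

definition hsm_extremal ::
    "real \<Rightarrow> real \<Rightarrow> ((real ^ 'k) \<times> (real ^ 'm) \<Rightarrow> real) \<Rightarrow> bool" where
  "hsm_extremal p S u \<longleftrightarrow>
     u \<in> D1p p \<and> \<not> (AE x in lborel. u x = 0) \<and> hsm_norm p u = S * gradient_norm p u"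

definition hsm_coefficient :: "real \<Rightarrow> real \<Rightarrow> real \<Rightarrow> real" where
  "hsm_coefficient p n k =
     (k - 1) powr ((n - p) / (p * (p - 1))) * (n - p) powr ((n - p) / p)
       * (p - 1) powr (- ((n - p) / p))"

definition hsm_u0 :: "real \<Rightarrow> real \<Rightarrow> real \<Rightarrow> real ^ 'k \<Rightarrow> real ^ 'm \<Rightarrow> real" where
  "hsm_u0 p n k y z = hsm_coefficient p n k *
     ((1 + norm y)\<^sup>2 + (norm z)\<^sup>2) powr (- ((n - p) / (2 * (p - 1))))"

end

theory Submission
  imports Defs
begin

text \<open>The inequality is proved by mass transport, as for the sharp Sobolev trace inequality. Put
  \<open>\<mu> = 1/\<lambda>\<close>, \<open>\<zeta> = -z\<^sub>0/\<lambda>\<close>, \<open>\<rho>(y,z)\<^sup>2 = (\<mu> + |y|)\<^sup>2 + |z - \<zeta>|\<^sup>2\<close> and \<open>e(x) = (\<mu> y/|y|, -\<zeta>)\<close>, so that \<open>u\<close> is a multiple of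
  \<open>\<rho>\<close> to the power \<open>-a\<close>, \<open>a = (n-p)/(p-1)\<close>. Let \<open>T\<close> transport the density \<open>|\<phi>|\<close> to the power \<open>np/(n-p)\<close> of a test
  function to a multiple \<open>G\<close> of the same power of \<open>u\<close>. With \<open>q = p(n-1)/(n-p)\<close> the arithmetic-geometric mean
  inequality gives \<open>n \<integral> G\<^bsup>1-1/n\<^esup> \<le> \<integral> |\<phi>|\<^bsup>q\<^esup> div T\<close>, and since \<open>div e = \<mu>(k-1)/|y|\<close>, integrating \<open>|\<phi>|\<^bsup>q\<^esup> div (T + e)\<close> by
  parts produces the Hardy term. The other side is bounded by Hoelder's inequality and
  \<open>|T(x) + e(x)| \<le> \<rho>(T(x))\<close>. Optimising over the norm of \<open>\<phi>\<close> in \<open>L\<^bsup>np/(n-p)\<^esup>\<close> yields the sharp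
  inequality, and discarding the Hardy term yields the Sobolev inequality, which carries the result to
  the closure. Only the diagonal of \<open>DT\<close> enters, so the triangular Knothe map suffices. It is built one
  coordinate at a time and need be differentiable only in one variable. For \<open>u\<close> every step is an
  equality with \<open>T\<close> the identity.\<close>

subsection \<open>Monotone rearrangement on the line\<close>

text \<open>The shift e comes from \<rho>: off y = 0 the vector x + e(x) is half the gradient of
  \<rho> squared, and its length is exactly \<rho>(x). The gradient of u is therefore parallel to x
  + e(x), which makes Cauchy-Schwarz and Hoelder sharp for u. The powers fit because G^(1-1/n) and G
  times \<rho>^(p/(p-1)) are multiples of one and the same power of \<rho>, so that a single
  integral \<open>I\<close> occurs on both sides.

  Two obstacles shape the argument. A transport onto all of space would be unbounded, which leaves
  integrability in the partial integration open; so the target is cut down to a cube, which grows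
  only after the inequality has been integrated. And the derivatives of the Knothe map exist only
  along lines that meet the set where the source is positive; so the partial integration is done
  line by line, with the sign of the diagonal entries in place of regularity: integrals of
  nonnegative terms over growing windows converge monotonically, and integrability is a result
  instead of an assumption.\<close>

lemma continuous_LINT:
  fixes f :: "real \<Rightarrow> real \<Rightarrow> real"
  assumes c: "\<And>s. continuous_on UNIV (\<lambda>t. f t s)"
    and m: "\<And>t. f t \<in> borel_measurable lborel"
    and w: "integrable lborel w" and b: "\<And>t s. \<bar>f t s\<bar> \<le> w s"
  shows "continuous_on UNIV (\<lambda>t. LINT s|lborel. f t s)"
proof (rule continuous_on_sequentiallyI)
  fix u :: "nat \<Rightarrow> real" and a assume u: "u \<longlonglongrightarrow> a"
  show "(\<lambda>n. LINT s|lborel. f (u n) s) \<longlonglongrightarrow> (LINT s|lborel. f a s)"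
  proof (rule integral_dominated_convergence[where w=w])
    show "AE s in lborel. (\<lambda>n. f (u n) s) \<longlonglongrightarrow> f a s"
    proof (rule AE_I2)
      fix s show "(\<lambda>n. f (u n) s) \<longlonglongrightarrow> f a s"
        using continuous_on_tendsto_compose[OF c[of s] u] by auto
    qed
  qed (use m w b in auto)
qed

text \<open>A Lebesgue integral with an indicator, so that measurability in a parameter follows from
  the theorem on parametric integrals. For \<open>s < a\<close> the value is 0, so
  \<open>prim\<close> need not be differentiable at \<open>a\<close> itself.\<close>

definition prim :: "real \<Rightarrow> (real \<Rightarrow> real) \<Rightarrow> real \<Rightarrow> real" where
  "prim a g s = (LINT t|lborel. indicator {a..s} t * g t)"

lemma prim_integrable:
  fixes g :: "real \<Rightarrow> real"
  assumes "continuous_on UNIV g"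
  shows "integrable lborel (\<lambda>t. indicator {a..s} t * g t)"
  using borel_integrable_atLeastAtMost'[of a s g] continuous_on_subset[OF assms]
  unfolding set_integrable_def by simp

lemma prim_eq_integral:
  fixes g :: "real \<Rightarrow> real"
  assumes "continuous_on UNIV g"
  shows "prim a g s = integral {a..s} g"
  using set_borel_integral_eq_integral(2)[of "{a..s}" g] prim_integrable[OF assms, of a s]
  unfolding prim_def set_lebesgue_integral_def set_integrable_def by simp

lemma prim_has_deriv:
  fixes g :: "real \<Rightarrow> real"
  assumes g: "continuous_on UNIV g" and "a < s"
  shows "(prim a g has_real_derivative g s) (at s)"
proof -
  have "((\<lambda>u. integral {a..u} g) has_real_derivative g s) (at s within {a..s+1})"
    by (rule integral_has_real_derivative) (use assms in \<open>auto intro: continuous_on_subset\<close>)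
  then have "((\<lambda>u. integral {a..u} g) has_real_derivative g s) (at s)"
    using at_within_Icc_at[of a s "s+1"] assms(2) by simp
  moreover have "prim a g = (\<lambda>u. integral {a..u} g)"
    using prim_eq_integral[OF g] by auto
  ultimately show ?thesis by simp
qed

lemma prim_combine:
  fixes g :: "real \<Rightarrow> real"
  assumes g: "continuous_on UNIV g" and "a \<le> b" "b \<le> s"
  shows "prim a g s = prim a g b + prim b g s"
  unfolding prim_eq_integral[OF g]
  by (rule Henstock_Kurzweil_Integration.integral_combine[symmetric])
     (use assms in \<open>auto intro!: integrable_continuous_interval intro: continuous_on_subset\<close>)

lemma prim_strict_mono:
  fixes g :: "real \<Rightarrow> real"
  assumes g: "continuous_on UNIV g" "\<And>x. g x > 0" and "a \<le> s" "s < t"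
  shows "prim a g s < prim a g t"
proof -
  have "prim s g t > 0"
  proof -
    have "prim s g t \<ge> 0" unfolding prim_def by (rule Bochner_Integration.integral_nonneg)
      (use g in \<open>auto simp: less_imp_le\<close>)
    moreover have "prim s g t \<noteq> 0"
    proof
      assume "prim s g t = 0"
      then have "integral (cbox s t) g = 0" using prim_eq_integral[OF g(1)] by simp
      then have "g s = 0"
        using integral_eq_0_iff[of s t g] continuous_on_subset[OF g(1)] g(2) assms(4)
        by (auto simp: less_imp_le)
      then show False using g(2)[of s] by simp
    qed
    ultimately show ?thesis by simp
  qed
  then show ?thesis using prim_combine[OF g(1), of a s t] assms by simp
qed

text \<open>\<open>THE\<close> is well defined only for \<open>0 \<le> v \<le> prim (-R) g R\<close> and \<open>g > 0\<close>.\<close>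

definition qinv :: "real \<Rightarrow> (real \<Rightarrow> real) \<Rightarrow> real \<Rightarrow> real" where
  "qinv R g v = (THE s. s \<in> {-R..R} \<and> prim (-R) g s = v)"

context
  fixes g :: "real \<Rightarrow> real"
  assumes g: "continuous_on UNIV g" "\<And>x. g x > 0"
begin

lemma prim_le_iff:
  assumes "a \<le> s" "a \<le> t"
  shows "prim a g s \<le> prim a g t \<longleftrightarrow> s \<le> t"
  using prim_strict_mono[OF g, of a] assms by (metis linorder_not_le nle_le order_less_le)

lemma prim_self: "prim a g a = 0"
  unfolding prim_eq_integral[OF g(1)] by simp

lemma prim_continuous: "continuous_on {a..b} (prim a g)"
  unfolding prim_eq_integral[OF g(1), abs_def]
  by (rule indefinite_integral_continuous_1)
     (use g in \<open>auto intro!: integrable_continuous_interval intro: continuous_on_subset\<close>)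

lemma qinv_unique:
  assumes "s \<in> {-R..R}"
  shows "qinv R g (prim (-R) g s) = s"
  unfolding qinv_def
proof (rule the_equality)
  fix s' assume "s' \<in> {-R..R} \<and> prim (-R) g s' = prim (-R) g s"
  then show "s' = s" using prim_le_iff[of "-R" s s'] prim_le_iff[of "-R" s' s] assms by auto
qed (use assms in auto)

lemma qinv_ex:
  assumes "R > 0" "0 \<le> v" "v \<le> prim (-R) g R"
  obtains s where "s \<in> {-R..R}" "prim (-R) g s = v"
proof -
  have "\<exists>s. -R \<le> s \<and> s \<le> R \<and> prim (-R) g s = v"
    by (rule IVT') (use assms prim_self prim_continuous in auto)
  then show ?thesis using that by auto
qed

lemma qinv_props:
  assumes "R > 0" "0 \<le> v" "v \<le> prim (-R) g R"
  shows "qinv R g v \<in> {-R..R}" "prim (-R) g (qinv R g v) = v"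
  using qinv_ex[OF assms] qinv_unique by metis+

lemma qinv_le_iff:
  assumes "R > 0" "0 \<le> v" "v \<le> prim (-R) g R" "s \<in> {-R..R}"
  shows "qinv R g v \<le> s \<longleftrightarrow> v \<le> prim (-R) g s"
  using qinv_props[OF assms(1-3)] prim_le_iff[of "-R" "qinv R g v" s] assms(4) by auto

text \<open>Inverse function rule; continuity of the inverse comes from compactness of the window.
  The two end values are left out because beyond them \<open>qinv\<close> is an unspecified
  description.\<close>

lemma qinv_deriv_interior:
  assumes R: "R > 0" and v: "0 < v" "v < prim (-R) g R"
  shows "(qinv R g has_real_derivative inverse (g (qinv R g v))) (at v)"
proof (rule DERIV_inverse_function)
  let ?H = "prim (-R) g"
  have im: "?H ` {-R..R} = {0..?H R}"
  proof
    show "?H ` {-R..R} \<subseteq> {0..?H R}"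
      using prim_le_iff[of "-R" "-R"] prim_le_iff[of "-R" _ R] prim_self[of "-R"] by force
    show "{0..?H R} \<subseteq> ?H ` {-R..R}"
      using qinv_props[OF R] by (auto simp: image_iff) (metis atLeastAtMost_iff)
  qed
  have "continuous_on (?H ` {-R..R}) (qinv R g)"
    by (rule continuous_on_inv) (use prim_continuous qinv_unique in auto)
  then show "isCont (qinv R g) v"
    unfolding im using v by (auto intro: continuous_on_interior)
  have q: "qinv R g v \<in> {-R..R}" "?H (qinv R g v) = v" using qinv_props[OF R] v by auto
  have "qinv R g v \<noteq> -R" using q v prim_self by auto
  then show "(?H has_real_derivative g (qinv R g v)) (at (qinv R g v))"
    by (intro prim_has_deriv g) (use q in auto)
  show "g (qinv R g v) \<noteq> 0" using g(2)[of "qinv R g v"] by simp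
  show "\<And>y. 0 < y \<Longrightarrow> y < ?H R \<Longrightarrow> ?H (qinv R g y) = y"
    using qinv_props(2)[OF R] by auto
qed (use v in auto)

text \<open>A larger window only shifts the argument by the mass gained on the left. The end values
  0 and \<open>prim (-R) g R\<close> become interior values of the larger window, where the
  derivative of the inverse is available.\<close>

lemma qinv_extend:
  assumes R: "R > 0" and v: "0 \<le> v" "v \<le> prim (-R) g R"
  shows "qinv R g v = qinv (R+1) g (v + prim (-R-1) g (-R))"
proof -
  note q = qinv_props[OF R v]
  have "prim (-(R+1)) g (qinv R g v) = v + prim (-R-1) g (-R)"
    using prim_combine[OF g(1), of "-(R+1)" "-R" "qinv R g v"] q by auto
  then show ?thesis using qinv_unique[of "qinv R g v" "R+1"] q by auto
qed

text \<open>The inner function is allowed to attain 0 and the full mass, as a cumulative function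
  does outside the support; the window \<open>R+1\<close> gives a two-sided derivative there as
  well.\<close>

lemma qinv_comp_deriv:
  fixes v :: "real \<Rightarrow> real"
  assumes R: "R > 0" and v: "\<And>x. 0 \<le> v x" "\<And>x. v x \<le> prim (-R) g R"
    and d: "(v has_real_derivative v') (at x)"
  shows "((\<lambda>x. qinv R g (v x)) has_real_derivative v' / g (qinv R g (v x))) (at x)"
proof -
  let ?c = "prim (-R-1) g (-R)"
  have eq: "qinv R g (v y) = qinv (R+1) g (v y + ?c)" for y using qinv_extend[OF R v] .
  have c0: "?c > 0" using prim_strict_mono[OF g, of "-R-1" "-R-1" "-R"] prim_self by auto
  have "prim (-(R+1)) g (R+1) = ?c + prim (-R) g R + prim R g (R+1)"
    using prim_combine[OF g(1), of "-(R+1)" "-R" "R+1"] prim_combine[OF g(1), of "-R" "R" "R+1"] R by auto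
  moreover have "prim R g (R+1) > 0" using prim_strict_mono[OF g, of R R "R+1"] prim_self by auto
  ultimately have "v x + ?c < prim (-(R+1)) g (R+1)" using v(2)[of x] by linarith
  then have "(qinv (R+1) g has_real_derivative inverse (g (qinv (R+1) g (v x + ?c)))) (at (v x + ?c))"
    by (intro qinv_deriv_interior) (use c0 v(1)[of x] R in auto)
  then have "((\<lambda>x. qinv (R+1) g (v x + ?c)) has_real_derivative
      inverse (g (qinv (R+1) g (v x + ?c))) * v') (at x)"
    by (rule DERIV_chain2) (use d in \<open>auto intro!: derivative_eq_intros\<close>)
  then show ?thesis unfolding eq by (simp add: field_simps)
qed

end

section \<open>Cumulative functions of densities with bounded support\<close>

definition cum :: "(real \<Rightarrow> real) \<Rightarrow> real \<Rightarrow> real" where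
  "cum f s = (LINT t|lborel. indicator {..s} t * f t)"

context
  fixes f :: "real \<Rightarrow> real" and M :: real
  assumes f: "continuous_on UNIV f" "\<And>x. 0 \<le> f x" "\<And>x. \<bar>x\<bar> > M \<Longrightarrow> f x = 0"
begin

lemma cum_eq_prim: "a < -M \<Longrightarrow> cum f s = prim a f s"
  unfolding cum_def prim_def
  by (rule Bochner_Integration.integral_cong) (use f(3) in \<open>auto split: split_indicator\<close>)

lemma cum_deriv: "(cum f has_real_derivative f s) (at s)"
proof -
  let ?a = "min (-M) s - 1"
  have "cum f = prim ?a f" using cum_eq_prim[of ?a] by auto
  then show ?thesis using prim_has_deriv[OF f(1), of ?a s] by auto
qed

lemma cont_supp_integrable: "integrable lborel f"
proof -
  have "f = (\<lambda>t. indicator {-M..M} t * f t)" using f(3) by (force split: split_indicator)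
  then show ?thesis using prim_integrable[OF f(1), of "-M" M] by simp
qed

lemma cum_bounds: "0 \<le> cum f s" "cum f s \<le> (LINT t|lborel. f t)"
proof -
  show "0 \<le> cum f s" unfolding cum_def by (rule Bochner_Integration.integral_nonneg) (use f in auto)
  have "integrable lborel (\<lambda>t. indicator {..s} t * f t)"
    using integrable_mult_indicator[OF _ cont_supp_integrable, of "{..s}"] by simp
  then show "cum f s \<le> (LINT t|lborel. f t)" unfolding cum_def
    by (intro integral_mono cont_supp_integrable) (use f in \<open>auto split: split_indicator\<close>)
qed

lemma cum_lo: "s < -M \<Longrightarrow> cum f s = 0"
proof -
  assume s: "s < -M"
  have "(\<lambda>t. indicator {..s} t * f t) = (\<lambda>t. 0)" using f(3) s by (auto split: split_indicator)
  then show ?thesis unfolding cum_def by simp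
qed

lemma cum_hi: "s > M \<Longrightarrow> cum f s = (LINT t|lborel. f t)"
proof -
  assume s: "s > M"
  have "(\<lambda>t. indicator {..s} t * f t) = f" using f(3) s by (force split: split_indicator)
  then show ?thesis unfolding cum_def by simp
qed

text \<open>With total mass zero \<open>cum f\<close> would be constant, but its derivative is
  \<open>f\<close>.\<close>

lemma cont_supp_integral_pos: 
  assumes "f t > 0" shows "(LINT t|lborel. f t) > 0"
proof (rule ccontr)
  assume "\<not> ?thesis"
  then have "cum f s = 0" for s using cum_bounds[of s] by linarith
  then have "cum f = (\<lambda>s. 0)" by auto
  then have "f t = 0" using cum_deriv[of t] DERIV_unique[of "\<lambda>_. 0" "f t" t 0] by auto
  then show False using assms by simp
qed

end

text \<open>The monotone rearrangement solves \<open>prim (-R) g (\<tau> t) = c * cum f t\<close>,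
  where \<open>c\<close> equalises the masses. Differentiation gives \<open>g (\<tau> t)\<close>
  times the derivative of \<open>\<tau>\<close> equal to \<open>c * f t\<close>, and the transport
  formula is substitution along \<open>\<tau>\<close>. Continuity of both densities makes
  \<open>\<tau>\<close> differentiable at every point, with no exceptional set.\<close>

lemma transport_1d:
  fixes f g :: "real \<Rightarrow> real" and h :: "real \<Rightarrow> ennreal" and M R :: real
  assumes f: "continuous_on UNIV f" "\<And>x. 0 \<le> f x" "\<And>x. \<bar>x\<bar> > M \<Longrightarrow> f x = 0"
    and g: "continuous_on UNIV g" "\<And>x. g x > 0" and R: "R > 0"
    and pos: "(LINT t|lborel. f t) > 0" and h[measurable]: "h \<in> borel_measurable borel"
  defines "c \<equiv> prim (-R) g R / (LINT t|lborel. f t)"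
  defines "\<tau> \<equiv> \<lambda>t. qinv R g (c * cum f t)"
  shows "\<And>t. (\<tau> has_real_derivative c * f t / g (\<tau> t)) (at t)"
    and "ennreal c * (\<integral>\<^sup>+t. ennreal (f t) * h (\<tau> t) \<partial>lborel) = (\<integral>\<^sup>+s. ennreal (g s) * h s * indicator {-R..R} s \<partial>lborel)"
proof -
  have P0: "prim (-R) g R > 0" using prim_strict_mono[OF g, of "-R" "-R" R] prim_self[OF g] R by auto
  have c0: "c > 0" unfolding c_def using P0 pos by simp
  have vb: "0 \<le> c * cum f t" "c * cum f t \<le> prim (-R) g R" for t
  proof -
    show "0 \<le> c * cum f t" using c0 cum_bounds(1)[where M=M, OF f] by simp
    have "c * cum f t \<le> c * (LINT t|lborel. f t)" using c0 cum_bounds(2)[where M=M, OF f] by simp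
    also have "\<dots> = prim (-R) g R" unfolding c_def using pos by simp
    finally show "c * cum f t \<le> prim (-R) g R" .
  qed
  show der: "(\<tau> has_real_derivative c * f t / g (\<tau> t)) (at t)" for t
    unfolding \<tau>_def
    by (rule qinv_comp_deriv[OF g R vb]) (rule DERIV_cmult, rule cum_deriv[where M=M, OF f])
  \<comment> \<open>Strictly beyond the support, whatever the sign of \<open>M\<close>: there
    \<open>cum f\<close> is exactly 0 or the full mass, so that \<open>\<tau>\<close> attains both
    ends of the window.\<close>
  define M1 where "M1 = \<bar>M\<bar> + 1"
  have lo: "\<tau> (-M1) = -R"
    unfolding \<tau>_def using cum_lo[where M=M and s="-M1", OF f] qinv_unique[OF g, of "-R" R] prim_self[OF g, of "-R"] R
    by (auto simp: M1_def)
  have "c * cum f M1 = prim (-R) g R" using cum_hi[where M=M and s=M1, OF f] pos by (auto simp: c_def M1_def)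
  then have hi: "\<tau> M1 = R"
    unfolding \<tau>_def using qinv_unique[OF g, of R R] R by auto
  have ct: "continuous_on UNIV \<tau>"
    by (intro continuous_at_imp_continuous_on ballI DERIV_isCont[OF der])
  have gm[measurable]: "g \<in> borel_measurable borel" using borel_measurable_continuous_onI[OF g(1)] .
  have "(\<integral>\<^sup>+s. ennreal (g s) * h s * indicator {-R..R} s \<partial>lborel)
      = (\<integral>\<^sup>+t. (ennreal (g (\<tau> t)) * h (\<tau> t)) * ennreal (c * f t / g (\<tau> t)) * indicator {-M1..M1} t \<partial>lborel)"
  proof -
    have "(\<integral>\<^sup>+s. (ennreal (g s) * h s) * indicator {\<tau> (-M1)..\<tau> M1} s \<partial>lborel)
        = (\<integral>\<^sup>+t. (ennreal (g (\<tau> t)) * h (\<tau> t)) * ennreal (c * f t / g (\<tau> t)) * indicator {-M1..M1} t \<partial>lborel)"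
    proof (rule nn_integral_substitution_aux)
      show "(\<tau> has_real_derivative c * f t / g (\<tau> t)) (at t)" for t by (rule der)
      have "continuous_on UNIV (\<lambda>t. c * f t / g (\<tau> t))"
        by (intro continuous_intros f(1) continuous_on_compose2[OF g(1) ct])
           (use g(2) in \<open>auto simp: less_imp_neq[symmetric]\<close>)
      then show "continuous_on {-M1..M1} (\<lambda>t. c * f t / g (\<tau> t))"
        by (rule continuous_on_subset) simp
      show "0 \<le> c * f t / g (\<tau> t)" for t
        using c0 f(2)[of t] g(2)[of "\<tau> t"] by simp
      show "-M1 < M1" by (simp add: M1_def)
      show "(\<lambda>s. ennreal (g s) * h s) \<in> borel_measurable borel" by measurable
    qed simp
    then show ?thesis unfolding lo hi .
  qed
  also have "\<dots> = (\<integral>\<^sup>+t. ennreal c * (ennreal (f t) * h (\<tau> t)) \<partial>lborel)"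
  proof (rule nn_integral_cong)
    fix t
    have a: "ennreal (g (\<tau> t)) * ennreal (c * f t / g (\<tau> t)) = ennreal c * ennreal (f t)"
      using g(2)[of "\<tau> t"] c0 f(2)[of t]
      by (subst ennreal_mult[symmetric]) (auto simp: ennreal_mult)
    show "(ennreal (g (\<tau> t)) * h (\<tau> t)) * ennreal (c * f t / g (\<tau> t)) * indicator {-M1..M1} t
        = ennreal c * (ennreal (f t) * h (\<tau> t))"
    proof (cases "t \<in> {-M1..M1}")
      case True then show ?thesis using a by (simp add: mult_ac)
    next
      case False
      then have "f t = 0" using f(3)[of t] by (auto simp: M1_def)
      then show ?thesis by simp
    qed
  qed
  also have "\<dots> = ennreal c * (\<integral>\<^sup>+t. ennreal (f t) * h (\<tau> t) \<partial>lborel)"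
    by (rule nn_integral_cmult)
       (use borel_measurable_continuous_onI[OF f(1)] borel_measurable_continuous_onI[OF ct] in measurable)
  finally show "ennreal c * (\<integral>\<^sup>+t. ennreal (f t) * h (\<tau> t) \<partial>lborel) = (\<integral>\<^sup>+s. ennreal (g s) * h s * indicator {-R..R} s \<partial>lborel)"
    by simp
qed

subsection \<open>The Knothe map\<close>

abbreviation LL :: "'i set \<Rightarrow> ('i \<Rightarrow> real) measure" where
  "LL I \<equiv> PiM I (\<lambda>_. lborel)"

interpretation LLp: product_sigma_finite "\<lambda>_. lborel :: real measure"
  by standard

text \<open>Continuity is required along coordinate lines only: the transport in one variable uses
  no more, and it survives integrating out a variable by dominated convergence. The upper bound and
  the window \<open>M\<close> supply the majorant.\<close>

definition source_density :: "'i set \<Rightarrow> real \<Rightarrow> (('i \<Rightarrow> real) \<Rightarrow> real) \<Rightarrow> bool" where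
  "source_density I M F \<longleftrightarrow> F \<in> borel_measurable (LL I) \<and> (\<exists>C. \<forall>x\<in>space (LL I). F x \<le> C) \<and>
     (\<forall>x\<in>space (LL I). 0 \<le> F x) \<and>
     (\<forall>x\<in>space (LL I). \<forall>i\<in>I. \<bar>x i\<bar> > M \<longrightarrow> F x = 0) \<and>
     (\<forall>x\<in>space (LL I). \<forall>i\<in>I. continuous_on UNIV (\<lambda>t. F (x(i := t))))"

text \<open>Positivity is required on the whole space and not just on the cube that receives the
  mass, because the inverse cumulative function is differentiated at its end values by enlarging the
  window.\<close>

definition target_density :: "'i set \<Rightarrow> (('i \<Rightarrow> real) \<Rightarrow> real) \<Rightarrow> bool" where
  "target_density I G \<longleftrightarrow> G \<in> borel_measurable (LL I) \<and> (\<exists>C. \<forall>x\<in>space (LL I). G x \<le> C) \<and>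
     (\<forall>x\<in>space (LL I). 0 < G x) \<and>
     (\<forall>x\<in>space (LL I). \<forall>i\<in>I. continuous_on UNIV (\<lambda>t. G (x(i := t))))"

definition cubeI :: "'i set \<Rightarrow> real \<Rightarrow> ('i \<Rightarrow> real) set" where
  "cubeI I R = {y. \<forall>i\<in>I. y i \<in> {-R..R}}"

text \<open>\<open>D i\<close> is the partial derivative of the \<open>i\<close>-th component of \<open>T\<close> in the \<open>i\<close>-th variable. Only these
  diagonal entries exist; as the Jacobian is triangular, their product is its determinant. On lines
  where \<open>F\<close> vanishes identically nothing is claimed.\<close>

definition knothe_map :: "'i set \<Rightarrow> real \<Rightarrow> (('i \<Rightarrow> real) \<Rightarrow> real) \<Rightarrow> (('i \<Rightarrow> real) \<Rightarrow> real) \<Rightarrow>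
    (('i \<Rightarrow> real) \<Rightarrow> ('i \<Rightarrow> real)) \<Rightarrow> ('i \<Rightarrow> ('i \<Rightarrow> real) \<Rightarrow> real) \<Rightarrow> bool" where
  "knothe_map I R F G T D \<longleftrightarrow>
     T \<in> measurable (LL I) (LL I) \<and> (\<forall>x\<in>space (LL I). \<forall>i\<in>I. T x i \<in> {-R..R}) \<and>
     (\<forall>h\<in>borel_measurable (LL I). (\<integral>\<^sup>+x. ennreal (F x) * h (T x) \<partial>LL I)
         = (\<integral>\<^sup>+y. ennreal (G y) * h y * indicator (cubeI I R) y \<partial>LL I)) \<and>
     (\<forall>i\<in>I. D i \<in> borel_measurable (LL I)) \<and> (\<forall>x\<in>space (LL I). \<forall>i\<in>I. 0 \<le> D i x) \<and>
     (\<forall>x\<in>space (LL I). F x > 0 \<longrightarrow> F x = G (T x) * (\<Prod>i\<in>I. D i x)) \<and>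
     (\<forall>x\<in>space (LL I). \<forall>i\<in>I. (\<exists>t. F (x(i := t)) > 0) \<longrightarrow>
        (\<forall>t. ((\<lambda>s. T (x(i := s)) i) has_real_derivative D i (x(i := t))) (at t)))"

lemma space_LL_upd: "x \<in> space (LL I) \<Longrightarrow> x(i := t) \<in> space (LL (insert i I))"
  by (auto simp: space_PiM PiE_def extensional_def)

lemma space_LL_upd': "x \<in> space (LL I) \<Longrightarrow> i \<in> I \<Longrightarrow> x(i := t) \<in> space (LL I)"
  using space_LL_upd[of x I i t] by (simp add: insert_absorb)

lemma measurable_LL_line:
  assumes [measurable]: "F \<in> borel_measurable (LL (insert i I))"
  shows "(\<lambda>(x, t). F (x(i := t))) \<in> borel_measurable (LL I \<Otimes>\<^sub>M lborel)"
proof -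
  have "(\<lambda>p. F ((\<lambda>(x, t). x(i := t)) p)) \<in> borel_measurable (LL I \<Otimes>\<^sub>M lborel)"
    by (rule measurable_compose[OF measurable_add_dim assms])
  then show ?thesis by (simp add: case_prod_beta')
qed

lemma measurable_LL_line1:
  assumes "F \<in> borel_measurable (LL (insert i I))" "x \<in> space (LL I)"
  shows "(\<lambda>t. F (x(i := t))) \<in> borel_measurable borel"
  using measurable_Pair2[OF measurable_LL_line[OF assms(1)] assms(2)] by simp

lemma source_density_marginal:
  assumes F: "source_density (insert i I) M F" and i: "i \<notin> I"
  defines "F' \<equiv> \<lambda>x. LINT t|lborel. F (x(i := t))"
  shows "\<And>x. x \<in> space (LL I) \<Longrightarrow> continuous_on UNIV (\<lambda>t. F (x(i := t)))"
    and "\<And>x t. x \<in> space (LL I) \<Longrightarrow> 0 \<le> F (x(i := t))"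
    and "\<And>x t. x \<in> space (LL I) \<Longrightarrow> \<bar>t\<bar> > M \<Longrightarrow> F (x(i := t)) = 0"
    and "source_density I M F'"
    and "finite I \<Longrightarrow> (\<integral>\<^sup>+x. F' x \<partial>LL I) = (\<integral>\<^sup>+x. F x \<partial>LL (insert i I))"
proof -
  have Fm[measurable]: "F \<in> borel_measurable (LL (insert i I))" using F unfolding source_density_def by auto
  obtain C where C: "\<And>x. x \<in> space (LL (insert i I)) \<Longrightarrow> F x \<le> C" using F unfolding source_density_def by auto
  show 1: "continuous_on UNIV (\<lambda>t. F (x(i := t)))" if "x \<in> space (LL I)" for x
  proof -
    have "continuous_on UNIV (\<lambda>t. F ((x(i := 0))(i := t)))"
      using F space_LL_upd[OF that, of i 0] unfolding source_density_def by blast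
    then show ?thesis by simp
  qed
  show 2: "0 \<le> F (x(i := t))" if "x \<in> space (LL I)" for x t
    using F space_LL_upd[OF that, of i t] unfolding source_density_def by blast
  show 3: "F (x(i := t)) = 0" if "x \<in> space (LL I)" "\<bar>t\<bar> > M" for x t
    using F space_LL_upd[OF that(1), of i t] that(2) unfolding source_density_def by (metis fun_upd_same insertI1)
  have int: "integrable lborel (\<lambda>t. F (x(i := t)))" if "x \<in> space (LL I)" for x
    by (rule cont_supp_integrable[where M=M]) (use 1 2 3 that in auto)
  have bd: "\<bar>F (x(i := t))\<bar> \<le> max 0 C * indicator {-M..M} t" if "x \<in> space (LL I)" for x t
    using C[OF space_LL_upd[OF that, of i t]] 2[OF that, of t] 3[OF that, of t]
    by (cases "\<bar>t\<bar> \<le> M") (auto split: split_indicator)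
  have ib: "integrable lborel (\<lambda>t. max 0 C * indicator {-M..M} t)"
    by (intro integrable_mult_right integrable_real_indicator) (auto simp: emeasure_lborel_Icc_eq)
  show "source_density I M F'" unfolding source_density_def
  proof (intro conjI ballI impI)
    show "F' \<in> borel_measurable (LL I)" unfolding F'_def
      using lborel.borel_measurable_lebesgue_integral[OF measurable_LL_line[OF Fm]] by simp
    show "\<exists>C. \<forall>x\<in>space (LL I). F' x \<le> C"
    proof (intro exI ballI)
      fix x assume x: "x \<in> space (LL I)"
      show "F' x \<le> (LINT t|lborel. max 0 C * indicator {-M..M} t)" unfolding F'_def
        by (rule integral_mono[OF int[OF x] ib]) (use bd[OF x] in \<open>auto intro: order_trans[OF abs_ge_self]\<close>)
    qed
    show "0 \<le> F' x" if "x \<in> space (LL I)" for x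
      unfolding F'_def by (rule Bochner_Integration.integral_nonneg) (use 2 that in auto)
    show "F' x = 0" if x: "x \<in> space (LL I)" and j: "j \<in> I" and M: "\<bar>x j\<bar> > M" for x j
    proof -
      have "F (x(i := t)) = 0" for t
        using F space_LL_upd[OF x, of i t] j i M unfolding source_density_def
        by (metis fun_upd_other insertI2)
      then show ?thesis unfolding F'_def by simp
    qed
    show "continuous_on UNIV (\<lambda>t. F' (x(j := t)))" if x: "x \<in> space (LL I)" and j: "j \<in> I" for x j
      unfolding F'_def
    proof (rule continuous_LINT[OF _ _ ib])
      have ij: "i \<noteq> j" using i j by auto
      show "continuous_on UNIV (\<lambda>t. F (x(j := t, i := s)))" for s
      proof -
        have "continuous_on UNIV (\<lambda>t. F ((x(i := s))(j := t)))"
          using F space_LL_upd[OF x, of i s] j unfolding source_density_def by blast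
        then show ?thesis using ij by (simp add: fun_upd_twist)
      qed
      show "(\<lambda>s. F (x(j := t, i := s))) \<in> borel_measurable lborel" for t
        using measurable_LL_line1[OF Fm space_LL_upd'[OF x j]] by simp
      show "\<bar>F (x(j := t, i := s))\<bar> \<le> max 0 C * indicator {-M..M} s" for t s
        by (rule bd[OF space_LL_upd'[OF x j]])
    qed
  qed
  assume fin: "finite I"
  have "(\<integral>\<^sup>+x. F x \<partial>LL (insert i I)) = (\<integral>\<^sup>+x. (\<integral>\<^sup>+t. F (x(i := t)) \<partial>lborel) \<partial>LL I)"
    by (rule LLp.product_nn_integral_insert[OF fin i]) simp
  also have "\<dots> = (\<integral>\<^sup>+x. F' x \<partial>LL I)"
    by (rule nn_integral_cong) (use nn_integral_eq_integral[OF int] 2 in \<open>auto simp: F'_def\<close>)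
  finally show "(\<integral>\<^sup>+x. F' x \<partial>LL I) = (\<integral>\<^sup>+x. F x \<partial>LL (insert i I))" by simp
qed

lemma indicator_cubeI_upd:
  assumes "i \<notin> I"
  shows "indicator (cubeI (insert i I) R) (y(i := s)) = (indicator (cubeI I R) y * indicator {-R..R} s :: 'b::{comm_monoid_mult,semiring_1})"
  using assms by (auto simp: cubeI_def split: split_indicator)

lemma cubeI_sets[measurable]: "finite I \<Longrightarrow> cubeI I R \<inter> space (LL I) \<in> sets (LL I)"
proof -
  assume "finite I"
  have "{y \<in> space (LL I). \<forall>i\<in>I. y i \<in> {-R..R}} \<in> sets (LL I)"
    using \<open>finite I\<close> by measurable
  moreover have "{y \<in> space (LL I). \<forall>i\<in>I. y i \<in> {-R..R}} = cubeI I R \<inter> space (LL I)"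
    by (auto simp: cubeI_def)
  ultimately show ?thesis by simp
qed

lemma cubeI_indicator_measurable[measurable]:
  "finite I \<Longrightarrow> (indicator (cubeI I R) :: _ \<Rightarrow> ennreal) \<in> borel_measurable (LL I)"
  by (subst borel_measurable_indicator_iff) (auto intro: cubeI_sets)

text \<open>Only the new variable is confined to its window. The marginal is thus still positive for
  all values of the remaining variables, and its mass on the smaller cube is the mass of
  \<open>G\<close> on the larger one.\<close>

lemma target_density_marginal:
  assumes G: "target_density (insert i I) G" and i: "i \<notin> I" and R: "R > 0"
  defines "G' \<equiv> \<lambda>y. prim (-R) (\<lambda>s. G (y(i := s))) R"
  shows "\<And>x. x \<in> space (LL I) \<Longrightarrow> continuous_on UNIV (\<lambda>t. G (x(i := t)))"
    and "\<And>x t. x \<in> space (LL I) \<Longrightarrow> 0 < G (x(i := t))"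
    and "target_density I G'"
    and "finite I \<Longrightarrow> (\<integral>\<^sup>+x. ennreal (G' x) * indicator (cubeI I R) x \<partial>LL I)
         = (\<integral>\<^sup>+x. ennreal (G x) * indicator (cubeI (insert i I) R) x \<partial>LL (insert i I))"
proof -
  have Gm[measurable]: "G \<in> borel_measurable (LL (insert i I))" using G unfolding target_density_def by auto
  obtain C where C: "\<And>x. x \<in> space (LL (insert i I)) \<Longrightarrow> G x \<le> C" using G unfolding target_density_def by auto
  show 1: "continuous_on UNIV (\<lambda>t. G (x(i := t)))" if "x \<in> space (LL I)" for x
  proof -
    have "continuous_on UNIV (\<lambda>t. G ((x(i := 0))(i := t)))"
      using G space_LL_upd[OF that, of i 0] unfolding target_density_def by blast
    then show ?thesis by simp
  qed
  show 2: "0 < G (x(i := t))" if "x \<in> space (LL I)" for x t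
    using G space_LL_upd[OF that, of i t] unfolding target_density_def by blast
  have int: "integrable lborel (\<lambda>t. indicator {-R..R} t * G (x(i := t)))" if "x \<in> space (LL I)" for x
    by (rule prim_integrable[OF 1[OF that]])
  have bd: "\<bar>indicator {-R..R} t * G (x(i := t))\<bar> \<le> C * indicator {-R..R} t" if "x \<in> space (LL I)" for x t
    using C[OF space_LL_upd[OF that, of i t]] 2[OF that, of t]
    by (auto split: split_indicator)
  have ib: "integrable lborel (\<lambda>t. C * indicator {-R..R} t)"
    by (intro integrable_mult_right integrable_real_indicator) (auto simp: emeasure_lborel_Icc_eq)
  show "target_density I G'" unfolding target_density_def
  proof (intro conjI ballI impI)
    have "(\<lambda>p. indicator {-R..R} (snd p) * (\<lambda>(x, t). G (x(i := t))) p) \<in> borel_measurable (LL I \<Otimes>\<^sub>M lborel)"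
      using measurable_LL_line[OF Gm] by (intro borel_measurable_times) measurable
    then show "G' \<in> borel_measurable (LL I)" unfolding G'_def prim_def
      by (intro lborel.borel_measurable_lebesgue_integral) (simp add: case_prod_beta')
    show "\<exists>C. \<forall>x\<in>space (LL I). G' x \<le> C"
    proof (intro exI ballI)
      fix x assume x: "x \<in> space (LL I)"
      show "G' x \<le> (LINT t|lborel. C * indicator {-R..R} t)" unfolding G'_def prim_def
        by (rule integral_mono[OF int[OF x] ib]) (rule order_trans[OF abs_ge_self bd[OF x]])
    qed
    show "0 < G' x" if "x \<in> space (LL I)" for x
      unfolding G'_def using prim_strict_mono[OF 1[OF that] 2[OF that], of "-R" "-R" R]
        prim_self[OF 1[OF that] 2[OF that], of "-R"] R by auto
    show "continuous_on UNIV (\<lambda>t. G' (x(j := t)))" if x: "x \<in> space (LL I)" and j: "j \<in> I" for x j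
      unfolding G'_def prim_def
    proof (rule continuous_LINT[OF _ _ ib])
      have ij: "i \<noteq> j" using i j by auto
      show "continuous_on UNIV (\<lambda>t. indicator {-R..R} s * G (x(j := t, i := s)))" for s
      proof -
        have "continuous_on UNIV (\<lambda>t. G ((x(i := s))(j := t)))"
          using G space_LL_upd[OF x, of i s] j unfolding target_density_def by blast
        then show ?thesis using ij by (simp add: fun_upd_twist continuous_on_mult_left)
      qed
      show "(\<lambda>s. indicator {-R..R} s * G (x(j := t, i := s))) \<in> borel_measurable lborel" for t
        using measurable_LL_line1[OF Gm space_LL_upd'[OF x j]] by simp
      show "\<bar>indicator {-R..R} s * G (x(j := t, i := s))\<bar> \<le> C * indicator {-R..R} s" for t s
        by (rule bd[OF space_LL_upd'[OF x j]])
    qed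
  qed
  assume fin: "finite I"
  have m: "(\<lambda>x. ennreal (G x) * indicator (cubeI (insert i I) R) x) \<in> borel_measurable (LL (insert i I))"
    using fin by (intro borel_measurable_times_ennreal cubeI_indicator_measurable) auto
  have "(\<integral>\<^sup>+x. ennreal (G x) * indicator (cubeI (insert i I) R) x \<partial>LL (insert i I))
     = (\<integral>\<^sup>+x. (\<integral>\<^sup>+t. ennreal (G (x(i := t))) * indicator (cubeI (insert i I) R) (x(i := t)) \<partial>lborel) \<partial>LL I)"
    by (rule LLp.product_nn_integral_insert[OF fin i m])
  also have "\<dots> = (\<integral>\<^sup>+x. ennreal (G' x) * indicator (cubeI I R) x \<partial>LL I)"
  proof (rule nn_integral_cong)
    fix x assume x: "x \<in> space (LL I)"
    have "(\<integral>\<^sup>+t. ennreal (G (x(i := t))) * indicator (cubeI (insert i I) R) (x(i := t)) \<partial>lborel)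
        = (\<integral>\<^sup>+t. ennreal (indicator {-R..R} t * G (x(i := t))) * indicator (cubeI I R) x \<partial>lborel)"
      by (rule nn_integral_cong) (auto simp: indicator_cubeI_upd[OF i] split: split_indicator)
    also have "\<dots> = (\<integral>\<^sup>+t. ennreal (indicator {-R..R} t * G (x(i := t))) \<partial>lborel) * indicator (cubeI I R) x"
      by (rule nn_integral_multc) (use measurable_LL_line1[OF Gm x] in simp)
    also have "(\<integral>\<^sup>+t. ennreal (indicator {-R..R} t * G (x(i := t))) \<partial>lborel) = ennreal (G' x)"
      using nn_integral_eq_integral[OF int[OF x]] 2[OF x] by (auto simp: G'_def prim_def less_imp_le)
    finally show "(\<integral>\<^sup>+t. ennreal (G (x(i := t))) * indicator (cubeI (insert i I) R) (x(i := t)) \<partial>lborel)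
       = ennreal (G' x) * indicator (cubeI I R) x" .
  qed
  finally show "(\<integral>\<^sup>+x. ennreal (G' x) * indicator (cubeI I R) x \<partial>LL I)
         = (\<integral>\<^sup>+x. ennreal (G x) * indicator (cubeI (insert i I) R) x \<partial>LL (insert i I))" by simp
qed

text \<open>The new coordinate is transported fibrewise: the slice of \<open>F\<close> above
  \<open>x\<close> goes to the slice of \<open>G\<close> above \<open>T' x\<close>, while the old
  coordinates are moved by \<open>T'\<close> alone. This keeps the map triangular and leaves the old
  diagonal entries as they were.\<close>

lemma knothe_map_insert:
  assumes fin: "finite I" and i: "i \<notin> I" and R: "R > 0"
    and F: "source_density (insert i I) M F" and G: "target_density (insert i I) G"
  defines "F' \<equiv> \<lambda>x. LINT t|lborel. F (x(i := t))"
    and "G' \<equiv> \<lambda>y. prim (-R) (\<lambda>s. G (y(i := s))) R"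
  assumes K: "knothe_map I R F' G' T' D'"
  shows "\<exists>T D. knothe_map (insert i I) R F G T D"
proof -
  note Fp = source_density_marginal[OF F i, folded F'_def]
  note Gp = target_density_marginal[OF G i R, folded G'_def]
  have Fm[measurable]: "F \<in> borel_measurable (LL (insert i I))" using F unfolding source_density_def by auto
  have Gm[measurable]: "G \<in> borel_measurable (LL (insert i I))" using G unfolding target_density_def by auto
  have F'm[measurable]: "F' \<in> borel_measurable (LL I)" using Fp(4) unfolding source_density_def by auto
  have G'm[measurable]: "G' \<in> borel_measurable (LL I)" using Gp(3) unfolding target_density_def by auto
  have F'0: "0 \<le> F' x" if "x \<in> space (LL I)" for x using Fp(4) that unfolding source_density_def by auto
  have G'0: "0 < G' x" if "x \<in> space (LL I)" for x using Gp(3) that unfolding target_density_def by auto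
  have T'm[measurable]: "T' \<in> measurable (LL I) (LL I)" using K unfolding knothe_map_def by auto
  have T'sp: "T' x \<in> space (LL I)" if "x \<in> space (LL I)" for x using measurable_space[OF T'm that] .
  have rm[measurable]: "(\<lambda>x. restrict x I) \<in> measurable (LL (insert i I)) (LL I)"
    by (rule measurable_restrict_subset) auto
  have rsp: "restrict x I \<in> space (LL I)" if "x \<in> space (LL (insert i I))" for x
    using measurable_space[OF rm that] .
  \<comment> \<open>The ratio of the slice masses. Where \<open>F' x = 0\<close>, division by zero
    gives \<open>c x = 0\<close> and \<open>\<tau> x\<close> is constantly \<open>-R\<close>; such
    fibres carry no mass.\<close>
  define c where "c x = G' (T' x) / F' x" for x
  define g where "g x s = G ((T' x)(i := s))" for x s
  define f where "f x t = F (x(i := t))" for x t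
  define v where "v x t = c x * cum (f x) t" for x t
  define \<tau> where "\<tau> x t = qinv R (g x) (v x t)" for x t
  define T where "T x = (T' (restrict x I))(i := \<tau> (restrict x I) (x i))" for x
  define D where "D j x = (if j = i then c (restrict x I) * F x / G (T x) else D' j (restrict x I))" for j x
  have gc: "continuous_on UNIV (g x)" "\<And>s. 0 < g x s" if "x \<in> space (LL I)" for x
    unfolding g_def using Gp(1,2) T'sp[OF that] by auto
  have fc: "continuous_on UNIV (f x)" "\<And>s. 0 \<le> f x s" "\<And>s. \<bar>s\<bar> > M \<Longrightarrow> f x s = 0" if "x \<in> space (LL I)" for x
    unfolding f_def using Fp(1,2,3) that by auto
  have G'g: "G' (T' x) = prim (-R) (g x) R" for x unfolding G'_def g_def ..
  have F'f: "F' x = (LINT t|lborel. f x t)" for x unfolding F'_def f_def ..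
  have c0: "0 \<le> c x" if "x \<in> space (LL I)" for x
    unfolding c_def using F'0[OF that] G'0[OF T'sp[OF that]] by simp
  have v: "0 \<le> v x t" "v x t \<le> prim (-R) (g x) R" if x: "x \<in> space (LL I)" for x t
  proof -
    show "0 \<le> v x t" unfolding v_def
      using c0[OF x] cum_bounds(1)[where M=M, OF fc[OF x]] by simp
    show "v x t \<le> prim (-R) (g x) R"
    proof (cases "F' x = 0")
      case True then show ?thesis using G'0[OF T'sp[OF x]] by (simp add: v_def c_def G'g)
    next
      case False
      have "v x t \<le> c x * F' x" unfolding v_def F'f
        using cum_bounds(2)[where M=M, OF fc[OF x]] c0[OF x] by (simp add: mult_left_mono)
      also have "\<dots> = prim (-R) (g x) R" using False by (simp add: c_def G'g)
      finally show ?thesis .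
    qed
  qed
  have \<tau>R: "\<tau> x t \<in> {-R..R}" if "x \<in> space (LL I)" for x t
    unfolding \<tau>_def by (rule qinv_props(1)[OF gc[OF that] R v[OF that]])
  have upd: "restrict (x(i := t)) I = x" if "x \<in> space (LL I)" for x t
  proof -
    have "x \<in> extensional I" using that by (auto simp: space_PiM PiE_def)
    then show ?thesis using i by (auto simp: restrict_def fun_eq_iff extensional_def)
  qed
  have upd': "(restrict x I)(i := x i) = x" if "x \<in> space (LL (insert i I))" for x
  proof -
    have "x \<in> extensional (insert i I)" using that by (auto simp: space_PiM PiE_def)
    then show ?thesis using i by (auto simp: restrict_def fun_eq_iff extensional_def)
  qed
  have Tupd: "T (x(i := t)) = (T' x)(i := \<tau> x t)" if "x \<in> space (LL I)" for x t
    unfolding T_def upd[OF that] by simp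
  have cm[measurable]: "c \<in> borel_measurable (LL I)" unfolding c_def by measurable
  have vm: "(\<lambda>x. v (restrict x I) (x i)) \<in> borel_measurable (LL (insert i I))"
  proof -
    have xi[measurable]: "(\<lambda>p. fst p i) \<in> borel_measurable (LL (insert i I) \<Otimes>\<^sub>M lborel)"
      using measurable_compose[OF measurable_fst measurable_component_singleton[of i "insert i I" "\<lambda>_. lborel"]] by simp
    have pm: "(\<lambda>p. (restrict (fst p) I, snd p)) \<in> measurable (LL (insert i I) \<Otimes>\<^sub>M lborel) (LL I \<Otimes>\<^sub>M lborel)"
      by measurable
    have fm[measurable]: "(\<lambda>p. f (restrict (fst p) I) (snd p)) \<in> borel_measurable (LL (insert i I) \<Otimes>\<^sub>M lborel)"
      using measurable_compose[OF pm measurable_LL_line[OF Fm]] by (simp add: f_def case_prod_beta')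
    have "(\<lambda>p. (if snd p \<le> fst p i then 1 else 0) * f (restrict (fst p) I) (snd p)) \<in> borel_measurable (LL (insert i I) \<Otimes>\<^sub>M lborel)"
      by measurable
    also have "(\<lambda>p. (if snd p \<le> fst p i then 1 else 0) * f (restrict (fst p) I) (snd p)) =
       (\<lambda>(x, t). indicator {..x i} t * f (restrict x I) t)"
      by (auto simp: fun_eq_iff)
    finally have "(\<lambda>x. LINT t|lborel. indicator {..x i} t * f (restrict x I) t) \<in> borel_measurable (LL (insert i I))"
      by (rule lborel.borel_measurable_lebesgue_integral)
    then show ?thesis unfolding v_def cum_def by measurable
  qed
  \<comment> \<open>\<open>\<tau>\<close> is a definite description, so its measurability is read
    off from sublevel sets: by \<open>qinv_le_iff\<close> they compare \<open>v\<close> with a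
    cumulative function of the target slice, and both are measurable parametric integrals.\<close>
  have \<tau>m: "(\<lambda>x. \<tau> (restrict x I) (x i)) \<in> borel_measurable (LL (insert i I))"
    unfolding borel_measurable_iff_le
  proof
    fix a :: real
    consider "a < -R" | "a \<in> {-R..R}" | "a > R" by force
    then show "{x \<in> space (LL (insert i I)). \<tau> (restrict x I) (x i) \<le> a} \<in> sets (LL (insert i I))"
    proof cases
      case 1
      have "\<not> \<tau> (restrict x I) (x i) \<le> a" if "x \<in> space (LL (insert i I))" for x
        using \<tau>R[OF rsp[OF that], of "x i"] 1 by auto
      then have "{x \<in> space (LL (insert i I)). \<tau> (restrict x I) (x i) \<le> a} = {}" by blast
      then show ?thesis by (simp only: sets.empty_sets)
    next
      case 3
      have "\<tau> (restrict x I) (x i) \<le> a" if "x \<in> space (LL (insert i I))" for x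
        using \<tau>R[OF rsp[OF that], of "x i"] 3 by auto
      then have "{x \<in> space (LL (insert i I)). \<tau> (restrict x I) (x i) \<le> a} = space (LL (insert i I))" by blast
      then show ?thesis by (simp only: sets.top)
    next
      case 2
      have eq: "{x \<in> space (LL (insert i I)). \<tau> (restrict x I) (x i) \<le> a}
         = {x \<in> space (LL (insert i I)). v (restrict x I) (x i) \<le> prim (-R) (g (restrict x I)) a}"
        unfolding \<tau>_def using qinv_le_iff[OF gc[OF rsp] R v[OF rsp] 2] by auto
      have pm: "(\<lambda>p. (T' (restrict (fst p) I), snd p)) \<in> measurable (LL (insert i I) \<Otimes>\<^sub>M lborel) (LL I \<Otimes>\<^sub>M lborel)"
        by measurable
      have [measurable]: "(\<lambda>p. g (restrict (fst p) I) (snd p)) \<in> borel_measurable (LL (insert i I) \<Otimes>\<^sub>M lborel)"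
        using measurable_compose[OF pm measurable_LL_line[OF Gm]] by (simp add: g_def case_prod_beta')
      have "(\<lambda>p. indicator {-R..a} (snd p) * g (restrict (fst p) I) (snd p)) \<in> borel_measurable (LL (insert i I) \<Otimes>\<^sub>M lborel)"
        by measurable
      then have "(\<lambda>x. LINT t|lborel. indicator {-R..a} t * g (restrict x I) t) \<in> borel_measurable (LL (insert i I))"
        by (intro lborel.borel_measurable_lebesgue_integral) (simp add: case_prod_beta')
      then have "(\<lambda>x. prim (-R) (g (restrict x I)) a) \<in> borel_measurable (LL (insert i I))"
        unfolding prim_def .
      then show ?thesis unfolding eq using vm by measurable
    qed
  qed
  have Tm[measurable]: "T \<in> measurable (LL (insert i I)) (LL (insert i I))"
  proof -
    have "(\<lambda>x. (T' (restrict x I), \<tau> (restrict x I) (x i))) \<in> measurable (LL (insert i I)) (LL I \<Otimes>\<^sub>M lborel)"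
      using \<tau>m by measurable
    from measurable_compose[OF this measurable_add_dim] show ?thesis
      by (simp add: T_def[abs_def])
  qed
  have der: "((\<lambda>t. \<tau> x t) has_real_derivative c x * f x t / g x (\<tau> x t)) (at t)"
    and tra: "\<And>h. h \<in> borel_measurable borel \<Longrightarrow> ennreal (c x) * (\<integral>\<^sup>+t. ennreal (f x t) * h (\<tau> x t) \<partial>lborel) = (\<integral>\<^sup>+s. ennreal (g x s) * h s * indicator {-R..R} s \<partial>lborel)"
    if x: "x \<in> space (LL I)" and pos: "F' x > 0" for x t
  proof -
    note tr = transport_1d[where M=M, OF fc[OF x] gc[OF x] R pos[unfolded F'f], folded G'g F'f, folded c_def, folded v_def, folded \<tau>_def]
    show "((\<lambda>t. \<tau> x t) has_real_derivative c x * f x t / g x (\<tau> x t)) (at t)"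
      using tr(1)[of "\<lambda>_. 0" t] by simp
    show "ennreal (c x) * (\<integral>\<^sup>+t. ennreal (f x t) * h (\<tau> x t) \<partial>lborel) = (\<integral>\<^sup>+s. ennreal (g x s) * h s * indicator {-R..R} s \<partial>lborel)"
      if "h \<in> borel_measurable borel" for h using tr(2)[of h] that by simp
  qed
  have cubem: "(indicator (cubeI I R) :: _ \<Rightarrow> ennreal) \<in> borel_measurable (LL I)" by (rule cubeI_indicator_measurable[OF fin])
  have cubem': "(indicator (cubeI (insert i I) R) :: _ \<Rightarrow> ennreal) \<in> borel_measurable (LL (insert i I))"
    by (rule cubeI_indicator_measurable) (use fin in simp)
  have push: "(\<integral>\<^sup>+x. ennreal (F x) * h (T x) \<partial>LL (insert i I))
         = (\<integral>\<^sup>+y. ennreal (G y) * h y * indicator (cubeI (insert i I) R) y \<partial>LL (insert i I))"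
    if hm[measurable]: "h \<in> borel_measurable (LL (insert i I))" for h
  proof -
    \<comment> \<open>The mean of \<open>h\<close> over the fibre above \<open>y\<close> with
      respect to the slice of \<open>G\<close>. It depends on the old coordinates only, so the
      transport property of \<open>T'\<close> applies to it.\<close>
    define k where "k y = ennreal (1 / G' y) * (\<integral>\<^sup>+s. ennreal (G (y(i := s))) * h (y(i := s)) * indicator {-R..R} s \<partial>lborel)" for y
    have km[measurable]: "k \<in> borel_measurable (LL I)"
    proof -
      have [measurable]: "(\<lambda>p. G ((fst p)(i := snd p))) \<in> borel_measurable (LL I \<Otimes>\<^sub>M lborel)"
        using measurable_LL_line[OF Gm] by (simp add: case_prod_beta')
      have [measurable]: "(\<lambda>p. h ((fst p)(i := snd p))) \<in> borel_measurable (LL I \<Otimes>\<^sub>M lborel)"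
        using measurable_compose[OF measurable_add_dim hm] by (simp add: case_prod_beta')
      have "(\<lambda>p. ennreal (G ((fst p)(i := snd p))) * h ((fst p)(i := snd p)) * indicator {-R..R} (snd p)) \<in> borel_measurable (LL I \<Otimes>\<^sub>M lborel)"
        by measurable
      then have "(\<lambda>y. \<integral>\<^sup>+s. ennreal (G (y(i := s))) * h (y(i := s)) * indicator {-R..R} s \<partial>lborel) \<in> borel_measurable (LL I)"
        by (intro lborel.borel_measurable_nn_integral) (simp add: case_prod_beta')
      then show ?thesis unfolding k_def by measurable
    qed
    have "(\<integral>\<^sup>+x. ennreal (F x) * h (T x) \<partial>LL (insert i I))
        = (\<integral>\<^sup>+x. (\<integral>\<^sup>+t. ennreal (F (x(i := t))) * h (T (x(i := t))) \<partial>lborel) \<partial>LL I)"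
      by (rule LLp.product_nn_integral_insert[OF fin i]) measurable
    also have "\<dots> = (\<integral>\<^sup>+x. ennreal (F' x) * k (T' x) \<partial>LL I)"
    proof (rule nn_integral_cong)
      fix x assume x: "x \<in> space (LL I)"
      have hline: "(\<lambda>s. h ((T' x)(i := s))) \<in> borel_measurable borel"
        using measurable_compose[OF measurable_Pair1'[OF T'sp[OF x]] measurable_compose[OF measurable_add_dim hm]]
        by simp
      show "(\<integral>\<^sup>+t. ennreal (F (x(i := t))) * h (T (x(i := t))) \<partial>lborel) = ennreal (F' x) * k (T' x)"
      proof (cases "F' x > 0")
        case False
        then have F'z: "F' x = 0" using F'0[OF x] by simp
        have "F (x(i := t)) = 0" for t
          using cont_supp_integral_pos[where M=M, OF fc[OF x], of t] F'z fc(2)[OF x, of t]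
          unfolding F'f f_def by fastforce
        then show ?thesis using F'z by simp
      next
        case True
        have cF: "F' x * (1 / G' (T' x)) * c x = 1" using True G'0[OF T'sp[OF x]] by (simp add: c_def)
        have "(\<integral>\<^sup>+t. ennreal (F (x(i := t))) * h (T (x(i := t))) \<partial>lborel)
           = (\<integral>\<^sup>+t. ennreal (f x t) * h ((T' x)(i := \<tau> x t)) \<partial>lborel)" (is "_ = ?A")
          unfolding f_def Tupd[OF x] ..
        also have "\<dots> = ennreal (F' x * (1 / G' (T' x)) * c x) * ?A" unfolding cF by simp
        also have "\<dots> = ennreal (F' x) * (ennreal (1 / G' (T' x)) * (ennreal (c x) * ?A))"
        proof -
          have n: "0 \<le> F' x" "0 \<le> 1 / G' (T' x)" "0 \<le> c x"
            using F'0[OF x] G'0[OF T'sp[OF x]] c0[OF x] by auto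
          show ?thesis
            by (subst ennreal_mult[OF mult_nonneg_nonneg[OF n(1,2)] n(3)], subst ennreal_mult[OF n(1,2)])
               (simp only: mult.assoc)
        qed
        also have "ennreal (c x) * ?A = (\<integral>\<^sup>+s. ennreal (g x s) * h ((T' x)(i := s)) * indicator {-R..R} s \<partial>lborel)"
          by (rule tra[OF x True hline])
        finally show ?thesis unfolding k_def g_def .
      qed
    qed
    also have "\<dots> = (\<integral>\<^sup>+y. ennreal (G' y) * k y * indicator (cubeI I R) y \<partial>LL I)"
      using K km unfolding knothe_map_def by blast
    also have "\<dots> = (\<integral>\<^sup>+y. (\<integral>\<^sup>+s. ennreal (G (y(i := s))) * h (y(i := s)) * indicator (cubeI (insert i I) R) (y(i := s)) \<partial>lborel) \<partial>LL I)"
    proof (rule nn_integral_cong)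
      fix y assume y: "y \<in> space (LL I)"
      have hline: "(\<lambda>s. h (y(i := s))) \<in> borel_measurable borel"
        using measurable_compose[OF measurable_Pair1'[OF y] measurable_compose[OF measurable_add_dim hm]]
        by simp
      have Gline: "(\<lambda>s. G (y(i := s))) \<in> borel_measurable borel" by (rule measurable_LL_line1[OF Gm y])
      have "ennreal (G' y) * k y = ennreal (G' y * (1 / G' y)) * (\<integral>\<^sup>+s. ennreal (G (y(i := s))) * h (y(i := s)) * indicator {-R..R} s \<partial>lborel)"
        unfolding k_def using G'0[OF y] by (simp add: ennreal_mult less_imp_le mult.assoc[symmetric] del: times_divide_eq_right)
      also have "\<dots> = (\<integral>\<^sup>+s. ennreal (G (y(i := s))) * h (y(i := s)) * indicator {-R..R} s \<partial>lborel)"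
        using G'0[OF y] by simp
      finally have "ennreal (G' y) * k y * indicator (cubeI I R) y = (\<integral>\<^sup>+s. ennreal (G (y(i := s))) * h (y(i := s)) * indicator {-R..R} s \<partial>lborel) * indicator (cubeI I R) y"
        by simp
      also have "\<dots> = (\<integral>\<^sup>+s. ennreal (G (y(i := s))) * h (y(i := s)) * indicator {-R..R} s * indicator (cubeI I R) y \<partial>lborel)"
        by (rule nn_integral_multc[symmetric]) (use hline Gline in measurable)
      also have "\<dots> = (\<integral>\<^sup>+s. ennreal (G (y(i := s))) * h (y(i := s)) * indicator (cubeI (insert i I) R) (y(i := s)) \<partial>lborel)"
        by (simp add: indicator_cubeI_upd[OF i] mult_ac)
      finally show "ennreal (G' y) * k y * indicator (cubeI I R) y = (\<integral>\<^sup>+s. ennreal (G (y(i := s))) * h (y(i := s)) * indicator (cubeI (insert i I) R) (y(i := s)) \<partial>lborel)" .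
    qed
    also have "\<dots> = (\<integral>\<^sup>+y. ennreal (G y) * h y * indicator (cubeI (insert i I) R) y \<partial>LL (insert i I))"
      by (rule LLp.product_nn_integral_insert[OF fin i, symmetric]) (use cubem' in measurable)
    finally show ?thesis .
  qed
  have FF': "F' (restrict x I) > 0" if "x \<in> space (LL (insert i I))" "F (x(i := t)) > 0" for x t
  proof -
    have "x(i := t) = (restrict x I)(i := t)" using upd'[OF that(1)] by (metis fun_upd_upd)
    then show ?thesis unfolding F'f
      using cont_supp_integral_pos[where M=M, OF fc[OF rsp[OF that(1)]], of t] that(2) by (simp add: f_def[abs_def])
  qed
  have "knothe_map (insert i I) R F G T D"
    unfolding knothe_map_def
  proof (intro conjI ballI impI allI)
    show "T \<in> measurable (LL (insert i I)) (LL (insert i I))" by (rule Tm)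
    show "T x j \<in> {-R..R}" if "x \<in> space (LL (insert i I))" "j \<in> insert i I" for x j
      using that rsp[OF that(1)] \<tau>R[OF rsp[OF that(1)]] K unfolding T_def knothe_map_def by (cases "j = i") auto
    show "(\<integral>\<^sup>+x. ennreal (F x) * h (T x) \<partial>LL (insert i I))
         = (\<integral>\<^sup>+y. ennreal (G y) * h y * indicator (cubeI (insert i I) R) y \<partial>LL (insert i I))"
      if "h \<in> borel_measurable (LL (insert i I))" for h by (rule push[OF that])
    show "D j \<in> borel_measurable (LL (insert i I))" if "j \<in> insert i I" for j
    proof (cases "j = i")
      case True
      have "D j = (\<lambda>x. c (restrict x I) * F x / G (T x))" using True by (auto simp: D_def)
      then show ?thesis by simp
    next
      case False
      have [measurable]: "D' j \<in> borel_measurable (LL I)" using that False K unfolding knothe_map_def by auto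
      have "D j = (\<lambda>x. D' j (restrict x I))" using False by (auto simp: D_def)
      then show ?thesis by simp
    qed
    show "0 \<le> D j x" if x: "x \<in> space (LL (insert i I))" and j: "j \<in> insert i I" for x j
    proof (cases "j = i")
      case True
      have "0 < G (T x)" using G measurable_space[OF Tm x] unfolding target_density_def by auto
      moreover have "0 \<le> F x" using F x unfolding source_density_def by auto
      ultimately show ?thesis using True c0[OF rsp[OF x]] by (simp add: D_def)
    next
      case False then show ?thesis using j rsp[OF x] K unfolding D_def knothe_map_def by auto
    qed
    show "F x = G (T x) * (\<Prod>j\<in>insert i I. D j x)" if x: "x \<in> space (LL (insert i I))" and pos: "F x > 0" for x
    proof -
      have F'p: "F' (restrict x I) > 0" using FF'[OF x, of "x i"] pos by simp
      have G'p: "G' (T' (restrict x I)) > 0" by (rule G'0[OF T'sp[OF rsp[OF x]]])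
      have GT: "0 < G (T x)" using G measurable_space[OF Tm x] unfolding target_density_def by auto
      have e1: "F' (restrict x I) = G' (T' (restrict x I)) * (\<Prod>j\<in>I. D' j (restrict x I))"
        using K F'p rsp[OF x] unfolding knothe_map_def by blast
      have e2: "(\<Prod>j\<in>I. D j x) = (\<Prod>j\<in>I. D' j (restrict x I))"
        by (rule prod.cong) (use i in \<open>auto simp: D_def\<close>)
      \<comment> \<open>The slice masses cancel: \<open>c\<close> contributes \<open>G'\<close> at
        the image divided by \<open>F'\<close>, and the old diagonal entries contribute the inverse
        ratio.\<close>
      have "G (T x) * (\<Prod>j\<in>insert i I. D j x) = c (restrict x I) * F x * (\<Prod>j\<in>I. D' j (restrict x I))"
        using GT fin i by (simp add: e2) (simp add: D_def)
      also have "\<dots> = F x * (G' (T' (restrict x I)) * (\<Prod>j\<in>I. D' j (restrict x I))) / F' (restrict x I)"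
        by (simp add: c_def)
      also have "\<dots> = F x" unfolding e1[symmetric] using F'p by simp
      finally show ?thesis by simp
    qed
    show "((\<lambda>s. T (x(j := s)) j) has_real_derivative D j (x(j := t))) (at t)"
      if x: "x \<in> space (LL (insert i I))" and j: "j \<in> insert i I" and ex: "\<exists>t. F (x(j := t)) > 0" for x j t
    proof (cases "j = i")
      case True
      let ?r = "restrict x I"
      obtain t0 where "F (x(i := t0)) > 0" using ex True by auto
      then have F'p: "F' ?r > 0" using FF'[OF x] by auto
      have xs: "x(i := s) = ?r(i := s)" for s using upd'[OF x] by (metis fun_upd_upd)
      have a: "T (x(i := s)) = (T' ?r)(i := \<tau> ?r s)" for s unfolding xs Tupd[OF rsp[OF x]] ..
      have "D i (x(i := t)) = c ?r * f ?r t / g ?r (\<tau> ?r t)"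
        unfolding D_def xs upd[OF rsp[OF x]] Tupd[OF rsp[OF x]] f_def g_def by simp
      then show ?thesis using der[OF rsp[OF x] F'p, of t] True by (simp add: a)
    next
      case False
      then have jI: "j \<in> I" using j by auto
      let ?r = "restrict x I"
      have rj: "restrict (x(j := s)) I = ?r(j := s)" for s
        using jI by (auto simp: fun_eq_iff restrict_def)
      obtain t0 where t0: "F (x(j := t0)) > 0" using ex by auto
      have xj: "x(j := t0) \<in> space (LL (insert i I))" using space_LL_upd'[OF x j] .
      \<comment> \<open>One positive value of \<open>F\<close> gives a slice of positive mass, hence
        the old map is differentiable along the projected line.\<close>
      have "F' (restrict (x(j := t0)) I) > 0"
        using FF'[OF xj, of "x i"] t0 False by (metis fun_upd_other fun_upd_triv)
      then have "\<exists>t. F' (?r(j := t)) > 0" unfolding rj by auto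
      then have "((\<lambda>s. T' (?r(j := s)) j) has_real_derivative D' j (?r(j := t))) (at t)"
        using K rsp[OF x] jI unfolding knothe_map_def by blast
      then show ?thesis using False by (simp add: T_def D_def rj)
    qed
  qed
  then show ?thesis by blast
qed

text \<open>Equality of the masses is inherited by the marginals down to the empty set of
  coordinates. There the product space is one point of mass one, and the equality says that both
  densities agree.\<close>

theorem knothe_map_exists:
  assumes "finite I" and R: "R > 0" and "source_density I M F" and "target_density I G"
    and "(\<integral>\<^sup>+x. F x \<partial>LL I) = (\<integral>\<^sup>+x. ennreal (G x) * indicator (cubeI I R) x \<partial>LL I)"
  shows "\<exists>T D. knothe_map I R F G T D"
  using assms
proof (induction I arbitrary: F G rule: finite_induct)
  case empty
  have sp: "space (LL {}) = {\<lambda>_. undefined}" by (simp add: space_PiM)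
  let ?u = "\<lambda>_. undefined"
  have cu: "indicator (cubeI {} R) = (\<lambda>_. 1::ennreal)" by (auto simp: cubeI_def)
  have "ennreal (F ?u) = ennreal (G ?u)"
    using empty.prems(4) by (simp add: cu PiM_empty nn_integral_count_space_finite)
  moreover have "0 \<le> F ?u" "0 < G ?u" using empty.prems(2,3) unfolding source_density_def target_density_def sp by auto
  ultimately have eq: "F ?u = G ?u" by simp
  have "knothe_map {} R F G (\<lambda>x. x) (\<lambda>_ _. 0)"
    unfolding knothe_map_def sp
    by (auto simp: cu PiM_empty nn_integral_count_space_finite eq)
  then show ?case by blast
next
  case (insert i I)
  note Fp = source_density_marginal[OF insert.prems(2) insert.hyps(2)]
  note Gp = target_density_marginal[OF insert.prems(3) insert.hyps(2) insert.prems(1)]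
  have "\<exists>T D. knothe_map I R (\<lambda>x. LINT t|lborel. F (x(i := t))) (\<lambda>y. prim (-R) (\<lambda>s. G (y(i := s))) R) T D"
    by (rule insert.IH[OF insert.prems(1) Fp(4) Gp(3)])
       (use Fp(5)[OF insert.hyps(1)] Gp(4)[OF insert.hyps(1)] insert.prems(4) in simp)
  then obtain T' D' where
    "knothe_map I R (\<lambda>x. LINT t|lborel. F (x(i := t))) (\<lambda>y. prim (-R) (\<lambda>s. G (y(i := s))) R) T' D'" by blast
  then show ?case by (rule knothe_map_insert[OF insert.hyps insert.prems(1-3)])
qed

section \<open>From functions on coordinates to vectors of a Euclidean space\<close>

definition of_coords :: "('a::euclidean_space \<Rightarrow> real) \<Rightarrow> 'a" where
  "of_coords f = (\<Sum>b\<in>Basis. f b *\<^sub>R b)"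

definition coords :: "'a::euclidean_space \<Rightarrow> 'a \<Rightarrow> real" where
  "coords x = (\<lambda>b\<in>Basis. x \<bullet> b)"

definition cube :: "real \<Rightarrow> 'a::euclidean_space set" where
  "cube R = {x. \<forall>b\<in>Basis. x \<bullet> b \<in> {-R..R}}"

lemma of_coords_coords [simp]: "of_coords (coords x) = x"
  by (simp add: of_coords_def coords_def euclidean_representation)

lemma of_coords_inner: "b \<in> Basis \<Longrightarrow> of_coords f \<bullet> b = f b"
  by (simp add: of_coords_def inner_sum_left_Basis)

lemma coords_of_coords: "f \<in> space (LL Basis) \<Longrightarrow> coords (of_coords f) = f"
proof
  fix b :: 'a assume f: "f \<in> space (LL Basis)"
  then have "f \<in> extensional Basis" by (auto simp: space_PiM PiE_def)
  then show "coords (of_coords f) b = f b"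
    by (cases "b \<in> Basis") (simp_all add: coords_def of_coords_inner extensional_def)
qed

lemma coords_space [simp]: "coords x \<in> space (LL Basis)"
  by (simp add: coords_def space_PiM)

lemma of_coords_measurable [measurable]: "of_coords \<in> borel_measurable (LL Basis)"
  unfolding of_coords_def[abs_def] by measurable

lemma coords_measurable [measurable]: "coords \<in> measurable borel (LL Basis)"
  unfolding coords_def[abs_def] by (rule measurable_restrict) simp

lemma nn_integral_coords:
  fixes H :: "'a::euclidean_space \<Rightarrow> ennreal"
  assumes "H \<in> borel_measurable borel"
  shows "(\<integral>\<^sup>+x. H x \<partial>lborel) = (\<integral>\<^sup>+f. H (of_coords f) \<partial>LL Basis)"
proof -
  have "(lborel :: 'a measure) = distr (LL Basis) borel of_coords"
    unfolding of_coords_def[abs_def] by (rule lborel_eq)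
  then show ?thesis using nn_integral_distr[OF of_coords_measurable, of H] assms by simp
qed

lemma of_coords_upd: "b \<in> Basis \<Longrightarrow> of_coords (f(b := t)) = of_coords f + (t - f b) *\<^sub>R b"
proof (rule euclidean_eqI)
  fix c :: 'a assume "b \<in> Basis" "c \<in> Basis"
  then show "of_coords (f(b := t)) \<bullet> c = (of_coords f + (t - f b) *\<^sub>R b) \<bullet> c"
    by (cases "c = b") (simp_all add: of_coords_inner inner_add_left inner_Basis)
qed

lemma coords_add: "b \<in> Basis \<Longrightarrow> coords (x + s *\<^sub>R b) = (coords x)(b := x \<bullet> b + s)"
proof
  fix c assume "b \<in> Basis"
  then show "coords (x + s *\<^sub>R b) c = ((coords x)(b := x \<bullet> b + s)) c"
    by (cases "c = b"; cases "c \<in> Basis") (simp_all add: coords_def inner_add_left inner_Basis)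
qed

lemma cube_indicator: "indicator (cubeI Basis R) f = indicator (cube R) (of_coords f)"
  by (simp add: indicator_def cubeI_def cube_def of_coords_inner)

lemma cube_closed: "closed (cube R :: 'a::euclidean_space set)"
proof -
  have "(cube R :: 'a set) = cbox (\<Sum>b\<in>Basis. (-R) *\<^sub>R b) (\<Sum>b\<in>Basis. R *\<^sub>R b)"
    by (auto simp: cube_def mem_box inner_sum_left_Basis simp del: scaleR_minus_left)
  then show ?thesis by (simp only: closed_cbox)
qed

lemma cube_borel [measurable]: "cube R \<in> sets borel"
  using cube_closed by (rule borel_closed)

lemma bounded_cube: "bounded (cube R :: 'a::euclidean_space set)"
proof -
  have "(cube R :: 'a set) \<subseteq> cbox (\<Sum>b\<in>Basis. (-R) *\<^sub>R b) (\<Sum>b\<in>Basis. R *\<^sub>R b)"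
    by (auto simp: cube_def mem_box inner_sum_left_Basis simp del: scaleR_minus_left)
  then show ?thesis using bounded_cbox bounded_subset by blast
qed

theorem knothe_euclidean:
  fixes F G :: "'a::euclidean_space \<Rightarrow> real"
  assumes R: "R > 0"
    and F: "continuous_on UNIV F" "\<And>x. 0 \<le> F x" "\<And>x. F x \<le> CF" "\<And>x b. b \<in> Basis \<Longrightarrow> \<bar>x \<bullet> b\<bar> > M \<Longrightarrow> F x = 0"
    and G: "continuous_on UNIV G" "\<And>x. 0 < G x" "\<And>x. G x \<le> CG"
    and mass: "(\<integral>\<^sup>+x. ennreal (F x) \<partial>lborel) = (\<integral>\<^sup>+x. ennreal (G x) * indicator (cube R) x \<partial>lborel)"
  obtains T :: "'a \<Rightarrow> 'a" and D :: "'a \<Rightarrow> 'a \<Rightarrow> real"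
  where "T \<in> borel_measurable borel" "\<And>x. T x \<in> cube R"
    and "\<And>h. h \<in> borel_measurable borel \<Longrightarrow> (\<integral>\<^sup>+x. ennreal (F x) * h (T x) \<partial>lborel)
           = (\<integral>\<^sup>+y. ennreal (G y) * h y * indicator (cube R) y \<partial>lborel)"
    and "\<And>b. b \<in> Basis \<Longrightarrow> D b \<in> borel_measurable borel" "\<And>b x. b \<in> Basis \<Longrightarrow> 0 \<le> D b x"
    and "\<And>x. F x > 0 \<Longrightarrow> F x = G (T x) * (\<Prod>b\<in>Basis. D b x)"
    and "\<And>x b t. b \<in> Basis \<Longrightarrow> \<exists>t. F (x + t *\<^sub>R b) > 0 \<Longrightarrow>
          ((\<lambda>s. T (x + s *\<^sub>R b) \<bullet> b) has_real_derivative D b (x + t *\<^sub>R b)) (at t)"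
proof -
  have [measurable]: "F \<in> borel_measurable borel" "G \<in> borel_measurable borel"
    using F(1) G(1) by (auto intro: borel_measurable_continuous_onI)
  have line: "continuous_on UNIV (\<lambda>t. H (of_coords (x(b := t))))" if "continuous_on UNIV H" "b \<in> Basis"
    for H :: "'a \<Rightarrow> real" and x b
    unfolding of_coords_upd[OF that(2)]
    by (rule continuous_on_compose2[OF that(1)]) (auto intro!: continuous_intros)
  have s: "source_density Basis M (\<lambda>f. F (of_coords f))"
    unfolding source_density_def using F line[OF F(1)] by (auto simp: of_coords_inner)
  have t: "target_density Basis (\<lambda>f. G (of_coords f))"
    unfolding target_density_def using G line[OF G(1)] by auto
  have "(\<integral>\<^sup>+f. F (of_coords f) \<partial>LL Basis) = (\<integral>\<^sup>+f. ennreal (G (of_coords f)) * indicator (cubeI Basis R) f \<partial>LL Basis)"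
    using mass unfolding cube_indicator by (subst (asm) (1 2) nn_integral_coords) auto
  then obtain T D where K: "knothe_map Basis R (\<lambda>f. F (of_coords f)) (\<lambda>f. G (of_coords f)) T D"
    using knothe_map_exists[OF finite_Basis R s t] by blast
  have Kh: "(\<integral>\<^sup>+f. ennreal (F (of_coords f)) * h (T f) \<partial>LL Basis)
      = (\<integral>\<^sup>+f. ennreal (G (of_coords f)) * h f * indicator (cubeI Basis R) f \<partial>LL Basis)"
    if "h \<in> borel_measurable (LL Basis)" for h
    using K[unfolded knothe_map_def, THEN conjunct2, THEN conjunct2, THEN conjunct1] that by (rule bspec)
  have Kd: "\<forall>f\<in>space (LL Basis). \<forall>i\<in>Basis. (\<exists>t. F (of_coords (f(i := t))) > 0) \<longrightarrow>
        (\<forall>t. ((\<lambda>s. T (f(i := s)) i) has_real_derivative D i (f(i := t))) (at t))"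
    using K unfolding knothe_map_def by (elim conjE)
  have Kp: "\<forall>f\<in>space (LL Basis). F (of_coords f) > 0 \<longrightarrow> F (of_coords f) = G (of_coords (T f)) * (\<Prod>i\<in>Basis. D i f)"
    using K unfolding knothe_map_def by (elim conjE)
  have Tm[measurable]: "T \<in> measurable (LL Basis) (LL Basis)" using K unfolding knothe_map_def by auto
  have Dm: "D b \<in> borel_measurable (LL Basis)" if "b \<in> Basis" for b using K that unfolding knothe_map_def by auto
  show ?thesis
  proof (rule that[of "\<lambda>x. of_coords (T (coords x))" "\<lambda>b x. D b (coords x)"])
    show "(\<lambda>x. of_coords (T (coords x))) \<in> borel_measurable borel" by measurable
    show "of_coords (T (coords x)) \<in> cube R" for x
      using K by (auto simp: cube_def of_coords_inner knothe_map_def)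
    show "(\<integral>\<^sup>+x. ennreal (F x) * h (of_coords (T (coords x))) \<partial>lborel)
           = (\<integral>\<^sup>+y. ennreal (G y) * h y * indicator (cube R) y \<partial>lborel)" if [measurable]: "h \<in> borel_measurable borel" for h
    proof -
      have hm: "(\<lambda>f. h (of_coords f)) \<in> borel_measurable (LL Basis)" by measurable
      have "(\<integral>\<^sup>+x. ennreal (F x) * h (of_coords (T (coords x))) \<partial>lborel)
        = (\<integral>\<^sup>+f. ennreal (F (of_coords f)) * h (of_coords (T (coords (of_coords f)))) \<partial>LL Basis)"
        by (rule nn_integral_coords) measurable
      also have "\<dots> = (\<integral>\<^sup>+f. ennreal (F (of_coords f)) * h (of_coords (T f)) \<partial>LL Basis)"
        by (rule nn_integral_cong) (simp add: coords_of_coords)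
      also have "\<dots> = (\<integral>\<^sup>+f. ennreal (G (of_coords f)) * h (of_coords f) * indicator (cubeI Basis R) f \<partial>LL Basis)"
        by (rule Kh[OF hm])
      also have "\<dots> = (\<integral>\<^sup>+y. ennreal (G y) * h y * indicator (cube R) y \<partial>lborel)"
        unfolding cube_indicator by (rule nn_integral_coords[symmetric]) measurable
      finally show ?thesis .
    qed
    show "(\<lambda>x. D b (coords x)) \<in> borel_measurable borel" if "b \<in> Basis" for b
      using Dm[OF that] by measurable
    show "0 \<le> D b (coords x)" if "b \<in> Basis" for b x
      using K that unfolding knothe_map_def by auto
    show "F x = G (of_coords (T (coords x))) * (\<Prod>b\<in>Basis. D b (coords x))" if "F x > 0" for x
    proof -
      show ?thesis using Kp[rule_format, of "coords x"] that by simp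
    qed
    show "((\<lambda>s. of_coords (T (coords (x + s *\<^sub>R b))) \<bullet> b) has_real_derivative D b (coords (x + t *\<^sub>R b))) (at t)"
      if b: "b \<in> Basis" and ex: "\<exists>t. F (x + t *\<^sub>R b) > 0" for x b t
    proof -
      obtain t0 where "F (x + t0 *\<^sub>R b) > 0" using ex by auto
      then have "F (of_coords (coords (x + t0 *\<^sub>R b))) > 0" by simp
      then have "F (of_coords ((coords x)(b := x \<bullet> b + t0))) > 0" using coords_add[OF b] by metis
      then have "\<exists>t. F (of_coords ((coords x)(b := t))) > 0" by blast
      then have "((\<lambda>s. T ((coords x)(b := s)) b) has_real_derivative D b ((coords x)(b := x \<bullet> b + t))) (at (x \<bullet> b + t))"
        using Kd[THEN bspec, OF coords_space, THEN bspec, OF b] by blast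
      \<comment> \<open>The line is now parametrised from \<open>x\<close> and not from its point
        with \<open>b\<close>-coordinate zero, hence the shift of the parameter.\<close>
      then have "((\<lambda>s. T ((coords x)(b := x \<bullet> b + s)) b) has_real_derivative D b ((coords x)(b := x \<bullet> b + t))) (at t)"
        by (rule DERIV_chain2[where f="\<lambda>s. T ((coords x)(b := s)) b" and g="\<lambda>s. x \<bullet> b + s" and Db=1, simplified])
           (auto intro!: derivative_eq_intros)
      then show ?thesis by (simp add: of_coords_inner[OF b] coords_add[OF b])
    qed
  qed
qed

subsection \<open>Integration along lines\<close>

lemma nn_integral_translate:
  fixes H :: "'a::euclidean_space \<Rightarrow> ennreal"
  assumes [measurable]: "H \<in> borel_measurable borel"
  shows "(\<integral>\<^sup>+x. H (x + c) \<partial>lborel) = (\<integral>\<^sup>+x. H x \<partial>lborel)"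
proof -
  have "(\<integral>\<^sup>+x. H x \<partial>lborel) = (\<integral>\<^sup>+x. H x \<partial>distr lborel borel ((+) c))"
    by (simp add: lborel_distr_plus)
  also have "\<dots> = (\<integral>\<^sup>+x. H (c + x) \<partial>lborel)" by (rule nn_integral_distr) auto
  finally show ?thesis by (simp add: add.commute)
qed

text \<open>By translation invariance it suffices to average the line integrals over a slab of width one.\<close>

lemma nn_integral_lines:
  fixes H :: "'a::euclidean_space \<Rightarrow> ennreal"
  assumes b: "b \<in> Basis" and [measurable]: "H \<in> borel_measurable borel"
  shows "(\<integral>\<^sup>+x. H x \<partial>lborel) = (\<integral>\<^sup>+x. indicator {0..1} (x \<bullet> b) * (\<integral>\<^sup>+t. H (x + t *\<^sub>R b) \<partial>lborel) \<partial>lborel)"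
proof -
  have bb: "b \<bullet> b = 1" using b by simp
  have ind: "(indicator {0..1::real} :: real \<Rightarrow> ennreal) \<in> borel_measurable borel" by measurable
  have slab: "(\<integral>\<^sup>+t. indicator {0..1} (s - t) \<partial>lborel) = (1::ennreal)" for s :: real
  proof -
    have "(\<lambda>t. indicator {0..1} (s - t) :: ennreal) = indicator {s - 1..s}"
      by (auto simp: indicator_def fun_eq_iff)
    then show ?thesis by (simp add: emeasure_lborel_Icc_eq)
  qed
  have "(\<integral>\<^sup>+x. indicator {0..1} (x \<bullet> b) * (\<integral>\<^sup>+t. H (x + t *\<^sub>R b) \<partial>lborel) \<partial>lborel)
      = (\<integral>\<^sup>+x. (\<integral>\<^sup>+t. indicator {0..1} (x \<bullet> b) * H (x + t *\<^sub>R b) \<partial>lborel) \<partial>lborel)"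
    by (intro nn_integral_cong nn_integral_cmult[symmetric]) simp
  also have "\<dots> = (\<integral>\<^sup>+t. (\<integral>\<^sup>+x. indicator {0..1} (x \<bullet> b) * H (x + t *\<^sub>R b) \<partial>lborel) \<partial>lborel)"
    by (rule lborel_pair.Fubini'[symmetric]) (use ind in measurable)
  also have "\<dots> = (\<integral>\<^sup>+t. (\<integral>\<^sup>+x. indicator {0..1} (x \<bullet> b - t) * H x \<partial>lborel) \<partial>lborel)"
  proof (rule nn_integral_cong)
    fix t :: real
    have "(\<integral>\<^sup>+x. (\<lambda>x. indicator {0..1} (x \<bullet> b - t) * H x) (x + t *\<^sub>R b) \<partial>lborel) = (\<integral>\<^sup>+x. indicator {0..1} (x \<bullet> b - t) * H x \<partial>lborel)"
      by (rule nn_integral_translate) (use ind in measurable)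
    then show "(\<integral>\<^sup>+x. indicator {0..1} (x \<bullet> b) * H (x + t *\<^sub>R b) \<partial>lborel) = (\<integral>\<^sup>+x. indicator {0..1} (x \<bullet> b - t) * H x \<partial>lborel)"
      by (simp add: inner_add_left bb)
  qed
  also have "\<dots> = (\<integral>\<^sup>+x. (\<integral>\<^sup>+t. indicator {0..1} (x \<bullet> b - t) * H x \<partial>lborel) \<partial>lborel)"
    by (rule lborel_pair.Fubini') (use ind in measurable)
  also have "\<dots> = (\<integral>\<^sup>+x. (\<integral>\<^sup>+t. indicator {0..1} (x \<bullet> b - t) \<partial>lborel) * H x \<partial>lborel)"
    by (intro nn_integral_cong nn_integral_multc) (use ind in measurable)
  also have "\<dots> = (\<integral>\<^sup>+x. H x \<partial>lborel)" by (simp add: slab)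
  finally show ?thesis by simp
qed

lemma integral_window_limit:
  fixes f :: "real \<Rightarrow> real"
  assumes "integrable lborel f"
  shows "(\<lambda>n. LINT t|lborel. indicator {-real n..real n} t * f t) \<longlonglongrightarrow> (LINT t|lborel. f t)"
proof (rule integral_dominated_convergence[where w="\<lambda>t. \<bar>f t\<bar>"])
  show "AE t in lborel. (\<lambda>n. indicator {-real n..real n} t * f t) \<longlonglongrightarrow> f t"
  proof (rule AE_I2)
    fix t :: real
    obtain N :: nat where N: "\<bar>t\<bar> \<le> real N" using real_arch_simple by blast
    have "\<forall>n\<ge>N. indicator {-real n..real n} t * f t = f t"
    proof (intro allI impI)
      fix n assume "n \<ge> N"
      then have "real N \<le> real n" by simp
      then show "indicator {-real n..real n} t * f t = f t" using N by (auto simp: indicator_def)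
    qed
    then show "(\<lambda>n. indicator {-real n..real n} t * f t) \<longlonglongrightarrow> f t"
      by (intro tendsto_eventually) (unfold eventually_sequentially, blast)
  qed
  show "\<And>n. AE t in lborel. norm (indicator {-real n..real n} t * f t) \<le> \<bar>f t\<bar>"
    by (auto split: split_indicator)
qed (use assms in auto)

lemma window_has_integral:
  fixes f :: "real \<Rightarrow> real"
  assumes "integrable lborel f"
  shows "(f has_integral (LINT t|lborel. indicator {a..b} t * f t)) {a..b}"
proof -
  have "set_integrable lborel {a..b} f"
    unfolding set_integrable_def by (rule integrable_mult_indicator) (use assms in auto)
  from set_borel_integral_eq_integral[OF this] show ?thesis
    by (simp add: set_lebesgue_integral_def has_integral_integral)
qed

lemma tendsto_window:
  fixes P :: "real \<Rightarrow> real"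
  assumes "(P \<longlongrightarrow> 0) at_top" "(P \<longlongrightarrow> 0) at_bot"
  shows "(\<lambda>n. P (real n) - P (- real n)) \<longlonglongrightarrow> 0"
proof -
  have "(\<lambda>n. P (real n)) \<longlonglongrightarrow> 0"
    by (rule filterlim_compose[OF assms(1) filterlim_real_sequentially])
  moreover have "(\<lambda>n. P (- real n)) \<longlonglongrightarrow> 0"
    by (rule filterlim_compose[OF assms(2)])
       (rule filterlim_compose[OF filterlim_uminus_at_bot_at_top filterlim_real_sequentially])
  ultimately show ?thesis using tendsto_diff by fastforce
qed

lemma integral_deriv_zero:
  fixes P P' :: "real \<Rightarrow> real"
  assumes d: "\<And>t. (P has_real_derivative P' t) (at t)" and i: "integrable lborel P'"
    and l: "(P \<longlongrightarrow> 0) at_top" "(P \<longlongrightarrow> 0) at_bot"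
  shows "(LINT t|lborel. P' t) = 0"
proof -
  have "(LINT t|lborel. indicator {-real n..real n} t * P' t) = P (real n) - P (- real n)" for n
  proof -
    have "(P' has_integral (P (real n) - P (- real n))) {-real n..real n}"
      by (rule fundamental_theorem_of_calculus)
         (use d in \<open>auto simp: has_real_derivative_iff_has_vector_derivative[symmetric] intro: has_field_derivative_at_within\<close>)
    then show ?thesis using window_has_integral[OF i] has_integral_unique by blast
  qed
  then have "(\<lambda>n. P (real n) - P (- real n)) \<longlonglongrightarrow> (LINT t|lborel. P' t)"
    using integral_window_limit[OF i] by simp
  then show ?thesis using tendsto_window[OF l] LIMSEQ_unique by blast
qed

text \<open>Integrability of \<open>w * S'\<close> is a conclusion. On a window the fundamental
  theorem expresses its integral by boundary terms and the integral of \<open>w' * S\<close>, both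
  of which converge; as the integrand is nonnegative, monotone convergence finishes.\<close>

lemma parts_line:
  fixes w S w' S' :: "real \<Rightarrow> real"
  assumes dw: "\<And>t. (w has_real_derivative w' t) (at t)" and dS: "\<And>t. (S has_real_derivative S' t) (at t)"
    and nn: "\<And>t. 0 \<le> w t" "\<And>t. 0 \<le> S' t" and [measurable]: "S' \<in> borel_measurable borel"
    and i: "integrable lborel (\<lambda>t. w' t * S t)"
    and l: "((\<lambda>t. w t * S t) \<longlongrightarrow> 0) at_top" "((\<lambda>t. w t * S t) \<longlongrightarrow> 0) at_bot"
  shows "integrable lborel (\<lambda>t. w t * S' t)" "(LINT t|lborel. w t * S' t) = - (LINT t|lborel. w' t * S t)"
proof -
  let ?P = "\<lambda>t. w t * S t"
  have [measurable]: "w \<in> borel_measurable borel"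
    by (intro borel_measurable_continuous_onI continuous_at_imp_continuous_on ballI DERIV_isCont[OF dw])
  have hi: "((\<lambda>t. w t * S' t) has_integral (?P b - ?P a - (LINT t|lborel. indicator {a..b} t * (w' t * S t)))) {a..b}"
    if "a \<le> b" for a b
  proof -
    have "((\<lambda>t. w' t * S t + w t * S' t) has_integral (?P b - ?P a)) {a..b}"
    proof (rule fundamental_theorem_of_calculus[OF that])
      fix t assume "t \<in> {a..b}"
      have "(?P has_real_derivative (w' t * S t + w t * S' t)) (at t)"
        using DERIV_mult[OF dw[of t] dS[of t]] by (simp add: mult.commute add.commute)
      then show "(?P has_vector_derivative (w' t * S t + w t * S' t)) (at t within {a..b})"
        by (simp add: has_real_derivative_iff_has_vector_derivative has_vector_derivative_at_within)
    qed
    from has_integral_diff[OF this window_has_integral[OF i]] show ?thesis by simp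
  qed
  let ?f = "\<lambda>n t. indicator {-real n..real n} t * (w t * S' t)"
  define J where "J n = ?P (real n) - ?P (-real n) - (LINT t|lborel. indicator {-real n..real n} t * (w' t * S t))" for n :: nat
  have "((\<lambda>t. if t \<in> {-real n..real n} then w t * S' t else 0) has_integral J n) UNIV" for n
    unfolding has_integral_restrict_UNIV J_def by (rule hi) simp
  moreover have "(\<lambda>t. if t \<in> {-real n..real n} then w t * S' t else 0) = ?f n" for n
    by (auto simp: indicator_def)
  ultimately have J: "(?f n has_integral J n) UNIV" for n by metis
  have J0: "0 \<le> J n" for n by (rule has_integral_nonneg[OF J]) (use nn in \<open>auto simp: indicator_def\<close>)
  have nnJ: "(\<integral>\<^sup>+t. ennreal (?f n t) \<partial>lborel) = ennreal (J n)" for n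
    by (rule nn_integral_has_integral_lborel[OF _ _ J]) (use nn in auto)
  have hb: "has_bochner_integral lborel (?f n) (J n)" for n
    by (rule has_bochner_integral_nn_integral[OF _ _ _ nnJ]) (use nn J0 in auto)
  have Jlim: "J \<longlonglongrightarrow> 0 - (LINT t|lborel. w' t * S t)"
    unfolding J_def[abs_def] by (intro tendsto_diff tendsto_window[OF l] integral_window_limit[OF i])
  have mono: "AE t in lborel. mono (\<lambda>n. ?f n t)"
    by (rule AE_I2) (use nn in \<open>auto simp: mono_def indicator_def\<close>)
  have lim: "AE t in lborel. (\<lambda>n. ?f n t) \<longlonglongrightarrow> w t * S' t"
  proof (rule AE_I2)
    fix t :: real
    obtain N :: nat where N: "\<bar>t\<bar> \<le> real N" using real_arch_simple by blast
    have "\<forall>n\<ge>N. ?f n t = w t * S' t"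
    proof (intro allI impI)
      fix n assume "n \<ge> N"
      then have "real N \<le> real n" by simp
      then show "?f n t = w t * S' t" using N by (auto simp: indicator_def)
    qed
    then show "(\<lambda>n. ?f n t) \<longlonglongrightarrow> w t * S' t"
      by (intro tendsto_eventually) (unfold eventually_sequentially, blast)
  qed
  have fi: "integrable lborel (?f n)" and fv: "integral\<^sup>L lborel (?f n) = J n" for n
    using hb[of n] by (auto simp: has_bochner_integral_iff)
  have Jl: "(\<lambda>n. integral\<^sup>L lborel (?f n)) \<longlonglongrightarrow> 0 - (LINT t|lborel. w' t * S t)" unfolding fv by (rule Jlim)
  have um: "(\<lambda>t. w t * S' t) \<in> borel_measurable lborel" by simp
  show "integrable lborel (\<lambda>t. w t * S' t)" by (rule integrable_monotone_convergence[OF fi mono lim Jl um])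
  show "(LINT t|lborel. w t * S' t) = - (LINT t|lborel. w' t * S t)"
    using integral_monotone_convergence[OF fi mono lim Jl um] by simp
qed

text \<open>The iterated integral in \<open>nn_integral_lines\<close> is finite; that formula only
  sees base points in a slab, hence the condition on \<open>x \<bullet> b\<close>.\<close>

lemma AE_line_integrable:
  fixes f :: "'a::euclidean_space \<Rightarrow> real"
  assumes b: "b \<in> Basis" and f: "integrable lborel f"
  shows "AE x in lborel. x \<bullet> b \<in> {0..1} \<longrightarrow> integrable lborel (\<lambda>t. f (x + t *\<^sub>R b))"
proof -
  have [measurable]: "f \<in> borel_measurable borel" using f by simp
  have ind: "(indicator {0..1::real} :: real \<Rightarrow> ennreal) \<in> borel_measurable borel" by measurable
  have "(\<integral>\<^sup>+x. indicator {0..1} (x \<bullet> b) * (\<integral>\<^sup>+t. ennreal (norm (f (x + t *\<^sub>R b))) \<partial>lborel) \<partial>lborel) = (\<integral>\<^sup>+x. norm (f x) \<partial>lborel)"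
    by (rule nn_integral_lines[OF b, symmetric]) simp
  also have "\<dots> < \<infinity>" using f by (simp add: integrable_iff_bounded)
  finally have "AE x in lborel. indicator {0..1} (x \<bullet> b) * (\<integral>\<^sup>+t. ennreal (norm (f (x + t *\<^sub>R b))) \<partial>lborel) \<noteq> \<infinity>"
    by (intro nn_integral_PInf_AE) (use ind in \<open>auto\<close>)
  then show ?thesis
    by eventually_elim (auto simp: integrable_iff_bounded less_top)
qed

text \<open>On almost every line the positive and the negative part of the derivative have the same
  integral, and the two parts are integrated over the lines separately.\<close>

lemma integral_deriv_along_zero:
  fixes P P' :: "'a::euclidean_space \<Rightarrow> real"
  assumes b: "b \<in> Basis" and i: "integrable lborel P'"
    and ae: "AE x in lborel. (\<forall>t. ((\<lambda>s. P (x + s *\<^sub>R b)) has_real_derivative P' (x + t *\<^sub>R b)) (at t)) \<and>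
      ((\<lambda>t. P (x + t *\<^sub>R b)) \<longlongrightarrow> 0) at_top \<and> ((\<lambda>t. P (x + t *\<^sub>R b)) \<longlongrightarrow> 0) at_bot"
  shows "(LINT x|lborel. P' x) = 0"
proof -
  have [measurable]: "P' \<in> borel_measurable borel" using i by simp
  have "(\<integral>\<^sup>+x. ennreal (P' x) \<partial>lborel) = (\<integral>\<^sup>+x. ennreal (- P' x) \<partial>lborel)"
    unfolding nn_integral_lines[OF b, of "\<lambda>x. ennreal (P' x)", simplified] nn_integral_lines[OF b, of "\<lambda>x. ennreal (- P' x)", simplified]
  proof (rule nn_integral_cong_AE, use AE_line_integrable[OF b i] ae in eventually_elim)
    case (elim x)
    show ?case
    proof (cases "x \<bullet> b \<in> {0..1}")
      case True
      then have ix: "integrable lborel (\<lambda>t. P' (x + t *\<^sub>R b))" using elim by simp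
      have z: "(LINT t|lborel. P' (x + t *\<^sub>R b)) = 0"
        by (rule integral_deriv_zero[OF _ ix, of "\<lambda>t. P (x + t *\<^sub>R b)"]) (use elim in auto)
      have "(\<integral>\<^sup>+t. ennreal (P' (x + t *\<^sub>R b)) \<partial>lborel) = (\<integral>\<^sup>+t. ennreal (- P' (x + t *\<^sub>R b)) \<partial>lborel)"
      proof -
        have "(\<integral>\<^sup>+t. ennreal (P' (x + t *\<^sub>R b)) \<partial>lborel) \<noteq> \<infinity>" "(\<integral>\<^sup>+t. ennreal (- P' (x + t *\<^sub>R b)) \<partial>lborel) \<noteq> \<infinity>"
          using ix by (auto simp: real_integrable_def)
        then show ?thesis using z unfolding real_lebesgue_integral_def[OF ix]
          by (cases "\<integral>\<^sup>+t. ennreal (P' (x + t *\<^sub>R b)) \<partial>lborel"; cases "\<integral>\<^sup>+t. ennreal (- P' (x + t *\<^sub>R b)) \<partial>lborel") auto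
      qed
      then show ?thesis by simp
    qed simp
  qed
  then show ?thesis unfolding real_lebesgue_integral_def[OF i] by simp
qed

text \<open>The alternative that \<open>w\<close> vanishes on the whole line serves the transport,
  which has derivatives only along lines on which the source is somewhere positive; on the other
  lines both integrands are zero.\<close>

lemma parts_along:
  fixes w S w' S' :: "'a::euclidean_space \<Rightarrow> real"
  assumes b: "b \<in> Basis" and i: "integrable lborel (\<lambda>x. w' x * S x)"
    and nn: "\<And>x. 0 \<le> w x" "\<And>x. 0 \<le> S' x"
    and [measurable]: "w \<in> borel_measurable borel" "S' \<in> borel_measurable borel"
    and ae: "AE x in lborel. (\<forall>t. ((\<lambda>s. w (x + s *\<^sub>R b)) has_real_derivative w' (x + t *\<^sub>R b)) (at t)) \<and>
      ((\<forall>t. w (x + t *\<^sub>R b) = 0) \<or>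
       (\<forall>t. ((\<lambda>s. S (x + s *\<^sub>R b)) has_real_derivative S' (x + t *\<^sub>R b)) (at t)) \<and>
       ((\<lambda>t. w (x + t *\<^sub>R b) * S (x + t *\<^sub>R b)) \<longlongrightarrow> 0) at_top \<and>
       ((\<lambda>t. w (x + t *\<^sub>R b) * S (x + t *\<^sub>R b)) \<longlongrightarrow> 0) at_bot)"
  shows "integrable lborel (\<lambda>x. w x * S' x)" "(LINT x|lborel. w x * S' x) = - (LINT x|lborel. w' x * S x)"
proof -
  \<comment> \<open>The negative part of \<open>?g\<close> stands alone on one side, as an extended
    nonnegative integral. In this form the equation makes sense, and can be integrated over the
    lines, before \<open>w * S'\<close> is known to be integrable.\<close>
  let ?g = "\<lambda>x. w' x * S x"
  have [measurable]: "?g \<in> borel_measurable borel" using i by simp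
  have "(\<integral>\<^sup>+x. ennreal (w x * S' x) + ennreal (?g x) \<partial>lborel) = (\<integral>\<^sup>+x. ennreal (- ?g x) \<partial>lborel)"
    unfolding nn_integral_lines[OF b, of "\<lambda>x. ennreal (w x * S' x) + ennreal (?g x)", simplified]
      nn_integral_lines[OF b, of "\<lambda>x. ennreal (- ?g x)", simplified]
  proof (rule nn_integral_cong_AE, use AE_line_integrable[OF b i] ae in eventually_elim)
    case (elim x)
    show ?case
    proof (cases "x \<bullet> b \<in> {0..1}")
      case True
      then have ix: "integrable lborel (\<lambda>t. ?g (x + t *\<^sub>R b))" using elim by simp
      have dw: "((\<lambda>s. w (x + s *\<^sub>R b)) has_real_derivative w' (x + t *\<^sub>R b)) (at t)" for t using elim by blast
      have "integrable lborel (\<lambda>t. w (x + t *\<^sub>R b) * S' (x + t *\<^sub>R b)) \<and>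
         (LINT t|lborel. w (x + t *\<^sub>R b) * S' (x + t *\<^sub>R b)) = - (LINT t|lborel. ?g (x + t *\<^sub>R b))"
      proof (cases "\<forall>t. w (x + t *\<^sub>R b) = 0")
        case True
        then have "w' (x + t *\<^sub>R b) = 0" for t
          using dw[of t] DERIV_unique[OF _ DERIV_const[of 0], of "w' (x + t *\<^sub>R b)" t] by simp
        then show ?thesis using True by simp
      next
        case False
        then have *: "\<forall>t. ((\<lambda>s. S (x + s *\<^sub>R b)) has_real_derivative S' (x + t *\<^sub>R b)) (at t)"
          "((\<lambda>t. w (x + t *\<^sub>R b) * S (x + t *\<^sub>R b)) \<longlongrightarrow> 0) at_top"
          "((\<lambda>t. w (x + t *\<^sub>R b) * S (x + t *\<^sub>R b)) \<longlongrightarrow> 0) at_bot" using elim(2) by blast+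
        show ?thesis
          using parts_line[OF dw *(1)[rule_format] nn(1) nn(2) _ ix *(2,3)] by simp
      qed
      then have iy: "integrable lborel (\<lambda>t. w (x + t *\<^sub>R b) * S' (x + t *\<^sub>R b))"
        and eq: "(LINT t|lborel. w (x + t *\<^sub>R b) * S' (x + t *\<^sub>R b)) = - (LINT t|lborel. ?g (x + t *\<^sub>R b))" by auto
      have A: "(\<integral>\<^sup>+t. ennreal (w (x + t *\<^sub>R b) * S' (x + t *\<^sub>R b)) \<partial>lborel) = ennreal (LINT t|lborel. w (x + t *\<^sub>R b) * S' (x + t *\<^sub>R b))"
        by (rule nn_integral_eq_integral[OF iy]) (use nn in auto)
      have A0: "0 \<le> (LINT t|lborel. w (x + t *\<^sub>R b) * S' (x + t *\<^sub>R b))"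
        by (rule Bochner_Integration.integral_nonneg) (use nn in auto)
      have f1: "(\<integral>\<^sup>+t. ennreal (?g (x + t *\<^sub>R b)) \<partial>lborel) \<noteq> \<infinity>" and f2: "(\<integral>\<^sup>+t. ennreal (- ?g (x + t *\<^sub>R b)) \<partial>lborel) \<noteq> \<infinity>"
        using ix by (auto simp: real_integrable_def)
      obtain r1 where r1: "(\<integral>\<^sup>+t. ennreal (?g (x + t *\<^sub>R b)) \<partial>lborel) = ennreal r1" "r1 \<ge> 0" using f1 by (cases "\<integral>\<^sup>+t. ennreal (?g (x + t *\<^sub>R b)) \<partial>lborel") auto
      obtain r2 where r2: "(\<integral>\<^sup>+t. ennreal (- ?g (x + t *\<^sub>R b)) \<partial>lborel) = ennreal r2" "r2 \<ge> 0" using f2 by (cases "\<integral>\<^sup>+t. ennreal (- ?g (x + t *\<^sub>R b)) \<partial>lborel") auto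
      have "(LINT t|lborel. ?g (x + t *\<^sub>R b)) = r1 - r2"
        unfolding real_lebesgue_integral_def[OF ix] r1 r2 using r1(2) r2(2) by simp
      then have "(LINT t|lborel. w (x + t *\<^sub>R b) * S' (x + t *\<^sub>R b)) + r1 = r2" using eq by simp
      then have "ennreal (LINT t|lborel. w (x + t *\<^sub>R b) * S' (x + t *\<^sub>R b)) + ennreal r1 = ennreal r2"
        using A0 r1(2) by (simp add: ennreal_plus[symmetric] del: ennreal_plus)
      then have "(\<integral>\<^sup>+t. ennreal (w (x + t *\<^sub>R b) * S' (x + t *\<^sub>R b)) + ennreal (?g (x + t *\<^sub>R b)) \<partial>lborel) = (\<integral>\<^sup>+t. ennreal (- ?g (x + t *\<^sub>R b)) \<partial>lborel)"
        using ix by (subst nn_integral_add) (auto simp: A r1 r2)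
      then show ?thesis by simp
    qed simp
  qed
  also have "(\<integral>\<^sup>+x. ennreal (w x * S' x) + ennreal (?g x) \<partial>lborel) = (\<integral>\<^sup>+x. ennreal (w x * S' x) \<partial>lborel) + (\<integral>\<^sup>+x. ennreal (?g x) \<partial>lborel)"
    by (rule nn_integral_add) auto
  finally have eq: "(\<integral>\<^sup>+x. ennreal (w x * S' x) \<partial>lborel) + (\<integral>\<^sup>+x. ennreal (?g x) \<partial>lborel) = (\<integral>\<^sup>+x. ennreal (- ?g x) \<partial>lborel)" .
  have f1: "(\<integral>\<^sup>+x. ennreal (?g x) \<partial>lborel) \<noteq> \<infinity>" and f2: "(\<integral>\<^sup>+x. ennreal (- ?g x) \<partial>lborel) \<noteq> \<infinity>"
    using i by (auto simp: real_integrable_def)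
  obtain r1 where r1: "(\<integral>\<^sup>+x. ennreal (?g x) \<partial>lborel) = ennreal r1" "r1 \<ge> 0" using f1 by (cases "\<integral>\<^sup>+x. ennreal (?g x) \<partial>lborel") auto
  obtain r2 where r2: "(\<integral>\<^sup>+x. ennreal (- ?g x) \<partial>lborel) = ennreal r2" "r2 \<ge> 0" using f2 by (cases "\<integral>\<^sup>+x. ennreal (- ?g x) \<partial>lborel") auto
  have "(\<integral>\<^sup>+x. ennreal (w x * S' x) \<partial>lborel) \<noteq> \<infinity>" using eq r2 by (metis ennreal_add_eq_top infinity_ennreal_def ennreal_neq_top)
  then obtain r where r: "(\<integral>\<^sup>+x. ennreal (w x * S' x) \<partial>lborel) = ennreal r" "r \<ge> 0" by (cases "\<integral>\<^sup>+x. ennreal (w x * S' x) \<partial>lborel") auto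
  have rr: "r + r1 = r2" using eq unfolding r r1 r2 using r(2) r1(2) r2(2)
    by (simp add: ennreal_plus[symmetric] del: ennreal_plus)
  have hb: "has_bochner_integral lborel (\<lambda>x. w x * S' x) r"
    by (rule has_bochner_integral_nn_integral[OF _ _ r(2) r(1)]) (use nn in auto)
  then show "integrable lborel (\<lambda>x. w x * S' x)" by (simp add: has_bochner_integral_iff)
  have "(LINT x|lborel. ?g x) = r1 - r2"
    unfolding real_lebesgue_integral_def[OF i] r1 r2 using r1(2) r2(2) by simp
  then show "(LINT x|lborel. w x * S' x) = - (LINT x|lborel. ?g x)"
    using hb rr by (simp add: has_bochner_integral_iff)
qed

subsection \<open>Smooth functions and cutoffs\<close>

lemma times_differentiable_SucI:
  assumes "\<And>x. (f has_derivative f' x) (at x)" "\<And>v. times_differentiable m (\<lambda>x. f' x v)"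
  shows "times_differentiable (Suc m) f"
proof -
  have "frechet_derivative f (at x) = f' x" for x using frechet_derivative_at[OF assms(1)] by simp
  then show ?thesis using assms by (auto simp: differentiable_def)
qed

lemma times_differentiable_has_derivative:
  "times_differentiable (Suc m) f \<Longrightarrow> (f has_derivative frechet_derivative f (at x)) (at x)"
  by (simp add: frechet_derivative_works[symmetric])

lemma times_differentiable_continuous: "times_differentiable m f \<Longrightarrow> continuous_on UNIV f"
  by (cases m) (auto intro!: continuous_at_imp_continuous_on differentiable_imp_continuous_within)

lemma times_differentiable_down: "times_differentiable (Suc m) f \<Longrightarrow> times_differentiable m f"
proof (induction m arbitrary: f)
  case 0 then show ?case using times_differentiable_continuous[of "Suc 0" f] by simp
next
  case (Suc m)
  show ?case unfolding times_differentiable.simps(2)[of m]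
  proof (intro conjI allI)
    show "f differentiable at x" for x using Suc.prems by simp
    show "times_differentiable m (\<lambda>x. frechet_derivative f (at x) v)" for v
      by (rule Suc.IH) (use Suc.prems in simp)
  qed
qed

lemma times_differentiable_const: "times_differentiable m (\<lambda>x. c)"
proof (induction m arbitrary: c)
  case (Suc m)
  show ?case by (rule times_differentiable_SucI[of _ "\<lambda>x v. 0"]) (use Suc in auto)
qed simp

lemma times_differentiable_linear:
  assumes "bounded_linear f" shows "times_differentiable m f"
proof (cases m)
  case 0 then show ?thesis using linear_continuous_on[OF assms] by simp
next
  case (Suc k)
  show ?thesis unfolding Suc
    by (rule times_differentiable_SucI[of _ "\<lambda>x. f"])
       (use bounded_linear_imp_has_derivative[OF assms] times_differentiable_const in auto)
qed

lemma times_differentiable_add: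
  "times_differentiable m f \<Longrightarrow> times_differentiable m g \<Longrightarrow> times_differentiable m (\<lambda>x. f x + g x)"
proof (induction m arbitrary: f g)
  case 0 then show ?case by (simp add: continuous_on_add)
next
  case (Suc m)
  show ?case
    by (rule times_differentiable_SucI[OF has_derivative_add[OF times_differentiable_has_derivative[OF Suc.prems(1)]
          times_differentiable_has_derivative[OF Suc.prems(2)]]])
       (use Suc in simp)
qed

lemma times_differentiable_mult:
  "times_differentiable m f \<Longrightarrow> times_differentiable m g \<Longrightarrow> times_differentiable m (\<lambda>x. f x * g x)"
proof (induction m arbitrary: f g)
  case 0 then show ?case by (simp add: continuous_on_mult)
next
  case (Suc m)
  have "times_differentiable m f" "times_differentiable m g" using Suc.prems times_differentiable_down by blast+
  then show ?case
    by (intro times_differentiable_SucI[OF has_derivative_mult[OF times_differentiable_has_derivative[OF Suc.prems(1)]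
          times_differentiable_has_derivative[OF Suc.prems(2)]]] times_differentiable_add Suc.IH)
       (use Suc.prems in auto)
qed

lemma times_differentiable_powr:
  "times_differentiable m f \<Longrightarrow> (\<And>x. 0 < f x) \<Longrightarrow> times_differentiable m (\<lambda>x. f x powr r)"
proof (induction m arbitrary: r)
  case 0 then show ?case by (auto intro!: continuous_intros simp: order_less_imp_not_eq2)
next
  case (Suc m)
  let ?f' = "\<lambda>x v. (r * f x powr (r - 1)) * frechet_derivative f (at x) v"
  have d: "((\<lambda>x. f x powr r) has_derivative ?f' x) (at x)" for x
  proof -
    have "((\<lambda>z. z powr r) has_derivative (\<lambda>h. (r * f x powr (r - 1)) * h)) (at (f x))"
      using has_real_derivative_powr[OF Suc.prems(2), of r x] by (simp add: has_field_derivative_def)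
    from has_derivative_compose[OF times_differentiable_has_derivative[OF Suc.prems(1)] this]
    show ?thesis .
  qed
  have "times_differentiable m f" using Suc.prems times_differentiable_down by blast
  then show ?case
    by (intro times_differentiable_SucI[OF d] times_differentiable_mult times_differentiable_const Suc.IH)
       (use Suc.prems in auto)
qed

lemma times_differentiable_scale:
  "times_differentiable m f \<Longrightarrow> times_differentiable m (\<lambda>x. f (c *\<^sub>R x))"
proof (induction m arbitrary: f)
  case 0 then show ?case by (auto intro!: continuous_intros elim!: continuous_on_compose2)
next
  case (Suc m)
  let ?f' = "\<lambda>x v. frechet_derivative f (at (c *\<^sub>R x)) (c *\<^sub>R v)"
  have d: "((\<lambda>x. f (c *\<^sub>R x)) has_derivative ?f' x) (at x)" for x
    by (rule has_derivative_compose[OF _ times_differentiable_has_derivative[OF Suc.prems]])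
       (auto intro!: derivative_eq_intros)
  show ?case by (rule times_differentiable_SucI[OF d], rule Suc.IH) (use Suc.prems in simp)
qed

text \<open>The functions exp(-1/t) t^(-j) extended by zero, a family closed under differentiation
  up to linear combinations: smoothness of all members follows by one induction on the order with
  \<open>j\<close> arbitrary.\<close>

definition flat :: "nat \<Rightarrow> real \<Rightarrow> real" where
  "flat j t = (if t > 0 then exp (- inverse t) * inverse t ^ j else 0)"

text \<open>A single term of the exponential series bounds (1/t)^(j+2) by (j+2)! exp(1/t). The
  square on the right makes the difference quotient at 0 tend to 0, and 0 is the only point where
  the derivative is not elementary.\<close>

lemma flat_bound: "\<bar>flat j t\<bar> \<le> fact (j + 2) * t\<^sup>2"
proof (cases "t > 0")
  case True
  define y c where "y = inverse t" and "c = (fact (j + 2) :: real)"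
  have y: "y > 0" "y * t = 1" and c: "c > 0" using True by (auto simp: y_def c_def)
  have "(\<Sum>n\<in>{j+2}. y ^ n /\<^sub>R fact n) \<le> exp y"
    unfolding exp_def by (rule sum_le_suminf[OF summable_exp_generic]) (use y in auto)
  then have "y ^ (j + 2) \<le> c * exp y"
    using c by (simp only: sum.insert_if finite.emptyI empty_iff if_False sum.empty c_def[symmetric]) (simp add: field_simps)
  then have "y ^ (j + 2) * (t\<^sup>2 * exp (- y)) \<le> c * exp y * (t\<^sup>2 * exp (- y))"
    by (rule mult_right_mono) simp
  moreover have "y ^ (j + 2) * (t\<^sup>2 * exp (- y)) = exp (- y) * y ^ j * (y * t)\<^sup>2"
    by (simp only: power_add power_mult_distrib mult_ac)
  moreover have "c * exp y * (t\<^sup>2 * exp (- y)) = c * t\<^sup>2" by (simp add: exp_minus)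
  ultimately have "exp (- y) * y ^ j \<le> c * t\<^sup>2" by (simp only: y(2) power_one mult_1_right)
  then show ?thesis using True unfolding c_def flat_def y_def by simp
qed (simp add: flat_def)

lemma flat_deriv: "(flat j has_real_derivative (- real j * flat (j + 1) t + flat (j + 2) t)) (at t)"
proof -
  consider "t > 0" | "t < 0" | "t = 0" by linarith
  then show ?thesis
  proof cases
    case 1
    let ?y = "inverse t"
    have "((\<lambda>y. exp (- y) * y ^ j) has_real_derivative (exp (- ?y) * (real j * ?y ^ (j - 1)) - exp (- ?y) * ?y ^ j)) (at ?y)"
      by (auto intro!: derivative_eq_intros simp: algebra_simps)
    from DERIV_chain2[OF this DERIV_inverse[of t]]
    have "((\<lambda>t. exp (- inverse t) * inverse t ^ j) has_real_derivative
       ((exp (- ?y) * (real j * ?y ^ (j - 1)) - exp (- ?y) * ?y ^ j) * - (?y ^ Suc (Suc 0)))) (at t)"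
      using 1 by simp
    moreover have "(exp (- ?y) * (real j * ?y ^ (j - 1)) - exp (- ?y) * ?y ^ j) * - (?y ^ Suc (Suc 0))
       = - real j * flat (j + 1) t + flat (j + 2) t"
      using 1 by (cases j) (simp_all add: flat_def algebra_simps)
    ultimately have "((\<lambda>t. exp (- inverse t) * inverse t ^ j) has_real_derivative (- real j * flat (j + 1) t + flat (j + 2) t)) (at t)"
      by simp
    then show ?thesis
      by (rule has_field_derivative_transform_within_open[of _ _ _ "{0<..}"]) (use 1 in \<open>auto simp: flat_def\<close>)
  next
    case 2
    have "((\<lambda>t. 0) has_real_derivative (- real j * flat (j + 1) t + flat (j + 2) t)) (at t)"
      using 2 by (simp add: flat_def)
    then show ?thesis
      by (rule has_field_derivative_transform_within_open[of _ _ _ "{..<0}"]) (use 2 in \<open>auto simp: flat_def\<close>)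
  next
    case 3
    have "((\<lambda>h. flat j h / h) \<longlongrightarrow> 0) (at 0)"
    proof (rule Lim_null_comparison)
      show "\<forall>\<^sub>F h in at 0. norm (flat j h / h) \<le> fact (j + 2) * \<bar>h\<bar>"
      proof (rule eventually_at_topological[THEN iffD2], intro exI[of _ UNIV] conjI ballI impI)
        fix h :: real assume "h \<noteq> 0"
        define C where "C = (fact (j + 2) :: real)"
        have "\<bar>flat j h\<bar> \<le> C * \<bar>h\<bar> * \<bar>h\<bar>"
          using flat_bound[of j h] unfolding C_def[symmetric] by (simp add: power2_eq_square mult.assoc)
        then show "norm (flat j h / h) \<le> fact (j + 2) * \<bar>h\<bar>"
          using \<open>h \<noteq> 0\<close> unfolding C_def[symmetric] by (simp add: pos_divide_le_eq)
      qed auto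
      show "((\<lambda>h. fact (j + 2) * \<bar>h\<bar>) \<longlongrightarrow> 0) (at (0::real))"
        by (rule tendsto_eq_intros tendsto_mult_right_zero tendsto_rabs_zero | simp)+
    qed
    then show ?thesis using 3 by (simp add: DERIV_def flat_def)
  qed
qed

lemma times_differentiable_flat:
  "times_differentiable m f \<Longrightarrow> times_differentiable m (\<lambda>x. flat j (f x))"
proof (induction m arbitrary: j)
  case 0
  have "continuous_on UNIV (flat j)"
    by (intro continuous_at_imp_continuous_on ballI DERIV_isCont[OF flat_deriv])
  then show ?case using 0 by (auto intro: continuous_on_compose2)
next
  case (Suc m)
  let ?f' = "\<lambda>x v. (- real j * flat (j + 1) (f x) + flat (j + 2) (f x)) * frechet_derivative f (at x) v"
  have d: "((\<lambda>x. flat j (f x)) has_derivative ?f' x) (at x)" for x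
    by (rule has_derivative_compose[OF times_differentiable_has_derivative[OF Suc.prems]])
       (use flat_deriv[of j "f x"] in \<open>simp add: has_field_derivative_def\<close>)
  have "times_differentiable m f" using Suc.prems times_differentiable_down by blast
  then show ?case
    by (intro times_differentiable_SucI[OF d] times_differentiable_mult times_differentiable_add times_differentiable_const Suc.IH)
       (use Suc.prems in auto)
qed

lemma flat_0_props: "0 \<le> flat 0 t" "flat 0 t \<le> 1" "flat 0 t > 0 \<longleftrightarrow> t > 0" "flat 0 t = 0 \<longleftrightarrow> t \<le> 0"
  by (auto simp: flat_def)

lemma smooth_const: "smooth (\<lambda>x. c)" by (simp add: smooth_def times_differentiable_const)
lemma smooth_linear: "bounded_linear f \<Longrightarrow> smooth f" by (simp add: smooth_def times_differentiable_linear)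
lemma smooth_add: "smooth f \<Longrightarrow> smooth g \<Longrightarrow> smooth (\<lambda>x. f x + g x)" by (simp add: smooth_def times_differentiable_add)
lemma smooth_mult: "smooth f \<Longrightarrow> smooth g \<Longrightarrow> smooth (\<lambda>x. f x * g x)" by (simp add: smooth_def times_differentiable_mult)
lemma smooth_powr: "smooth f \<Longrightarrow> (\<And>x. 0 < f x) \<Longrightarrow> smooth (\<lambda>x. f x powr r)" by (simp add: smooth_def times_differentiable_powr)
lemma smooth_scale: "smooth f \<Longrightarrow> smooth (\<lambda>x. f (c *\<^sub>R x))" by (simp add: smooth_def times_differentiable_scale)
lemma smooth_flat: "smooth f \<Longrightarrow> smooth (\<lambda>x. flat j (f x))" by (simp add: smooth_def times_differentiable_flat)

lemma smooth_diff: "smooth f \<Longrightarrow> smooth g \<Longrightarrow> smooth (\<lambda>x. f x - g x)"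
  using smooth_add[of f "\<lambda>x. (-1) * g x"] smooth_mult[OF smooth_const[of "-1"], of g] by simp

lemma smooth_sum: "finite I \<Longrightarrow> (\<And>i. i \<in> I \<Longrightarrow> smooth (f i)) \<Longrightarrow> smooth (\<lambda>x. \<Sum>i\<in>I. f i x)"
  by (induction I rule: finite_induct) (auto intro: smooth_const smooth_add)

lemma smooth_prod: "finite I \<Longrightarrow> (\<And>i. i \<in> I \<Longrightarrow> smooth (f i)) \<Longrightarrow> smooth (\<lambda>x. \<Prod>i\<in>I. f i x)"
  by (induction I rule: finite_induct) (auto intro: smooth_const smooth_mult)

lemma smooth_inner: "smooth (\<lambda>x. x \<bullet> v)"
  by (rule smooth_linear) (rule bounded_linear_inner_left)

lemma smooth_has_derivative: "smooth f \<Longrightarrow> (f has_derivative frechet_derivative f (at x)) (at x)"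
  using times_differentiable_has_derivative[of 0 f] by (simp add: smooth_def del: times_differentiable.simps)

lemma smooth_continuous: "smooth f \<Longrightarrow> continuous_on S f"
  using times_differentiable_continuous[of 0 f] continuous_on_subset unfolding smooth_def by blast

lemma smooth_frechet: "smooth f \<Longrightarrow> smooth (\<lambda>x. frechet_derivative f (at x) v)"
  unfolding smooth_def using times_differentiable.simps(2) by blast

lemma smoothI_deriv:
  assumes "\<And>x. (f has_derivative f' x) (at x)" "\<And>v. smooth (\<lambda>x. f' x v)"
  shows "smooth f"
  unfolding smooth_def
proof
  fix m show "times_differentiable m f"
    using times_differentiable_SucI[OF assms(1), of m] assms(2) times_differentiable_down unfolding smooth_def by blast
qed

section \<open>Gradients of smooth functions and of test functions\<close>

lemma grad_inner:
  assumes "(f has_derivative f') (at x)"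
  shows "grad f x \<bullet> v = f' v"
proof -
  have e: "frechet_derivative f (at x) = f'" using frechet_derivative_at[OF assms] by simp
  interpret bounded_linear f' using assms by (rule has_derivative_bounded_linear)
  have "f' v = f' (\<Sum>b\<in>Basis. (v \<bullet> b) *\<^sub>R b)" by (simp add: euclidean_representation)
  also have "\<dots> = (\<Sum>b\<in>Basis. (v \<bullet> b) * f' b)" by (simp add: sum scaleR)
  finally show ?thesis unfolding grad_def e by (simp add: inner_sum_left inner_commute[of v] mult.commute)
qed

lemma smooth_grad_inner: "smooth f \<Longrightarrow> grad f x \<bullet> v = frechet_derivative f (at x) v"
  by (rule grad_inner) (rule smooth_has_derivative)

lemma has_derivative_line:
  assumes "(f has_derivative f') (at (x + t *\<^sub>R b))"
  shows "((\<lambda>s. f (x + s *\<^sub>R b)) has_real_derivative f' b) (at t)"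
proof -
  have "((\<lambda>s. x + s *\<^sub>R b) has_derivative (\<lambda>h. h *\<^sub>R b)) (at t)" by (auto intro!: derivative_eq_intros)
  from has_derivative_compose[OF this assms]
  have "((\<lambda>s. f (x + s *\<^sub>R b)) has_derivative (\<lambda>h. f' (h *\<^sub>R b))) (at t)" .
  moreover interpret bounded_linear f' using assms by (rule has_derivative_bounded_linear)
  have "(\<lambda>h. f' (h *\<^sub>R b)) = (\<lambda>h. f' b * h)" by (auto simp: scaleR mult.commute)
  ultimately show ?thesis by (simp add: has_field_derivative_def)
qed

lemma smooth_line:
  assumes "smooth f"
  shows "((\<lambda>s. f (x + s *\<^sub>R b)) has_real_derivative (grad f (x + t *\<^sub>R b) \<bullet> b)) (at t)"
  using has_derivative_line[OF smooth_has_derivative[OF assms]] smooth_grad_inner[OF assms] by simp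

lemma smooth_grad_continuous: "smooth f \<Longrightarrow> continuous_on S (grad f)"
  unfolding grad_def[abs_def] by (intro continuous_intros smooth_continuous smooth_frechet)

lemma test_function_iff: "test_function f \<longleftrightarrow> smooth f \<and> bounded {x. f x \<noteq> 0}"
  by (simp add: test_function_def)

lemma test_functionI: "smooth f \<Longrightarrow> bounded S \<Longrightarrow> (\<And>x. x \<notin> S \<Longrightarrow> f x = 0) \<Longrightarrow> test_function f"
  unfolding test_function_iff by (blast intro: bounded_subset)

lemma test_function_smooth: "test_function f \<Longrightarrow> smooth f" by (simp add: test_function_def)

lemma test_function_diff: "test_function f \<Longrightarrow> test_function g \<Longrightarrow> test_function (\<lambda>x. f x - g x)"
  by (rule test_functionI[of _ "{x. f x \<noteq> 0} \<union> {x. g x \<noteq> 0}"]) (auto simp: test_function_iff intro: smooth_diff)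

lemma test_function_frechet:
  assumes "test_function f" shows "test_function (\<lambda>x. frechet_derivative f (at x) v)"
proof (rule test_functionI)
  show "smooth (\<lambda>x. frechet_derivative f (at x) v)" using assms by (simp add: test_function_def smooth_frechet)
  show "bounded (closure {x. f x \<noteq> 0})" using assms by (simp add: test_function_iff bounded_closure)
  fix x assume x: "x \<notin> closure {x. f x \<noteq> 0}"
  have z: "f y = 0" if "y \<notin> closure {x. f x \<noteq> 0}" for y
    using that closure_subset[of "{x. f x \<noteq> 0}"] by blast
  have "((\<lambda>x. 0) has_derivative (\<lambda>h. 0)) (at x)" by simp
  then have "(f has_derivative (\<lambda>h. 0)) (at x)"
  proof (rule has_derivative_transform_within_open)
    show "open (- closure {x. f x \<noteq> 0})" by (rule open_Compl) (rule closed_closure)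
    show "x \<in> - closure {x. f x \<noteq> 0}" by (unfold Compl_iff) (rule x)
    show "0 = f y" if "y \<in> - closure {x. f x \<noteq> 0}" for y
      by (rule z[symmetric]) (rule ComplD[OF that])
  qed
  from frechet_derivative_at[OF this] show "frechet_derivative f (at x) v = 0" by (metis)
qed

lemma test_function_grad_inner: "test_function f \<Longrightarrow> test_function (\<lambda>x. grad f x \<bullet> v)"
  using test_function_frechet[of f v] smooth_grad_inner[of f] by (simp add: test_function_def)

lemma test_function_support:
  assumes "test_function f" obtains M where "M > 0" "\<And>x. norm x > M \<Longrightarrow> f x = 0" "\<And>x. norm x > M \<Longrightarrow> grad f x = 0"
proof -
  have "bounded ({x. f x \<noteq> 0} \<union> (\<Union>b\<in>Basis. {x. frechet_derivative f (at x) b \<noteq> 0}))"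
    using assms test_function_frechet[OF assms] by (auto simp: test_function_iff)
  then obtain M where M: "M > 0" "\<And>x. x \<in> {x. f x \<noteq> 0} \<union> (\<Union>b\<in>Basis. {x. frechet_derivative f (at x) b \<noteq> 0}) \<Longrightarrow> norm x \<le> M"
    unfolding bounded_pos by blast
  show ?thesis
  proof (rule that[OF M(1)])
    show "f x = 0" if "norm x > M" for x using M(2)[of x] that by force
    show "grad f x = 0" if "norm x > M" for x
      unfolding grad_def by (rule sum.neutral) (use M(2)[of x] that in force)
  qed
qed

lemma integrable_continuous_bounded_support:
  fixes f :: "'a::euclidean_space \<Rightarrow> 'b::{banach, second_countable_topology}"
  assumes "continuous_on UNIV f" "\<And>x. norm x > M \<Longrightarrow> f x = 0"
  shows "integrable lborel f"
proof -
  have "integrable lborel (\<lambda>x. indicator (cball 0 M) x *\<^sub>R f x)"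
    by (rule borel_integrable_compact) (use assms in \<open>auto intro: continuous_on_subset\<close>)
  moreover have "(\<lambda>x. indicator (cball 0 M) x *\<^sub>R f x) = f"
    using assms(2) by (force simp: indicator_def)
  ultimately show ?thesis by simp
qed

lemma bounded_continuous_bounded_support:
  fixes f :: "'a::euclidean_space \<Rightarrow> 'b::real_normed_vector"
  assumes "continuous_on UNIV f" "\<And>x. norm x > M \<Longrightarrow> f x = 0"
  obtains C where "C > 0" "\<And>x. norm (f x) \<le> C"
proof -
  have "compact (f ` cball 0 M)" by (rule compact_continuous_image) (use assms in \<open>auto intro: continuous_on_subset\<close>)
  then obtain C where C: "C > 0" "\<forall>y\<in>f ` cball 0 M. norm y \<le> C" using compact_imp_bounded bounded_pos by metis
  show ?thesis
  proof (rule that[OF C(1)])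
    fix x show "norm (f x) \<le> C" using C assms(2)[of x] by (cases "norm x \<le> M") auto
  qed
qed

text \<open>Smooth functions below the indicator of a box, tending to it as \<open>j\<close> grows.
  The product form permits splitting off one coordinate, on which the translation argument for
  functions with zero weak gradient relies.\<close>

definition box_bump :: "'a::euclidean_space \<Rightarrow> 'a \<Rightarrow> nat \<Rightarrow> 'a \<Rightarrow> real" where
  "box_bump l u j x = (\<Prod>b\<in>Basis. flat 0 (real j * (x \<bullet> b - l \<bullet> b)) * flat 0 (real j * (u \<bullet> b - x \<bullet> b)))"

lemma box_bump_factor_smooth: "smooth (\<lambda>x. flat 0 (c * (x \<bullet> b - s)) * flat 0 (d * (t - x \<bullet> b)))"
  by (intro smooth_mult smooth_flat smooth_diff smooth_inner smooth_const)

lemma box_bump_outside: "x \<notin> box l u \<Longrightarrow> box_bump l u j x = 0"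
proof -
  assume "x \<notin> box l u"
  then obtain b where "b \<in> Basis" "\<not> (l \<bullet> b < x \<bullet> b \<and> x \<bullet> b < u \<bullet> b)" by (auto simp: mem_box)
  then have "flat 0 (real j * (x \<bullet> b - l \<bullet> b)) * flat 0 (real j * (u \<bullet> b - x \<bullet> b)) = 0"
    by (auto simp: flat_0_props(4) mult_le_0_iff)
  then show "box_bump l u j x = 0" unfolding box_bump_def using \<open>b \<in> Basis\<close> by (auto simp: prod_zero_iff)
qed

lemma box_bump_test: "test_function (box_bump l u j)"
proof (rule test_functionI[of _ "box l u"])
  show "smooth (box_bump l u j)" unfolding box_bump_def[abs_def]
    by (intro smooth_prod box_bump_factor_smooth) simp
  show "box_bump l u j x = 0" if "x \<notin> box l u" for x by (rule box_bump_outside[OF that])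
qed (simp add: bounded_box)

lemma box_bump_bounds: "0 \<le> box_bump l u j x" "box_bump l u j x \<le> 1"
  unfolding box_bump_def by (auto intro!: prod_nonneg prod_le_1 mult_nonneg_nonneg mult_le_one simp: flat_0_props)

lemma flat_0_limit: "s > 0 \<Longrightarrow> (\<lambda>j. flat 0 (real j * s)) \<longlonglongrightarrow> 1"
proof -
  assume s: "s > 0"
  have "(\<lambda>j. exp (- (inverse (real j) * (1 / s)))) \<longlonglongrightarrow> exp (- (0 * (1 / s)))"
    by (intro tendsto_intros lim_inverse_n)
  then have "(\<lambda>j. exp (- (inverse (real j) * (1 / s)))) \<longlonglongrightarrow> 1" by simp
  moreover have "\<forall>\<^sub>F j in sequentially. exp (- (inverse (real j) * (1 / s))) = flat 0 (real j * s)"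
    using eventually_gt_at_top[of 0] by eventually_elim (use s in \<open>simp add: flat_def field_simps\<close>)
  ultimately show ?thesis by (rule Lim_transform_eventually)
qed

lemma box_bump_limit: "(\<lambda>j. box_bump l u j x) \<longlonglongrightarrow> indicator (box l u) x"
proof (cases "x \<in> box l u")
  case True
  have "(\<lambda>j. box_bump l u j x) \<longlonglongrightarrow> (\<Prod>b\<in>(Basis::'a set). 1 * 1)"
    unfolding box_bump_def
    by (intro tendsto_prod tendsto_mult flat_0_limit) (use True in \<open>auto simp: mem_box\<close>)
  then show ?thesis using True by simp
next
  case False then show ?thesis using box_bump_outside[OF False] by simp
qed

text \<open>The quotient A/(A+B) with A positive inside radius 2 and B positive outside radius 1, so
  that the denominator never vanishes. It is written with the power -1 to fit the rule
  \<open>smooth_powr\<close>.\<close>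

lemma cutoff_exists:
  obtains \<eta> :: "'a::euclidean_space \<Rightarrow> real" where "test_function \<eta>" "\<And>x. 0 \<le> \<eta> x" "\<And>x. \<eta> x \<le> 1"
    "\<And>x. norm x \<le> 1 \<Longrightarrow> \<eta> x = 1" "\<And>x. norm x \<ge> 2 \<Longrightarrow> \<eta> x = 0"
proof -
  define A where "A x = flat 0 (4 - x \<bullet> x)" for x :: 'a
  define B where "B x = flat 0 (x \<bullet> x - 1)" for x :: 'a
  define \<eta> where "\<eta> x = A x * (A x + B x) powr (-1)" for x :: 'a
  have sq: "smooth (\<lambda>x::'a. x \<bullet> x)"
  proof -
    have "(\<lambda>x::'a. x \<bullet> x) = (\<lambda>x. \<Sum>b\<in>Basis. (x \<bullet> b) * (x \<bullet> b))"
      by (auto simp: euclidean_inner[symmetric])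
    then show ?thesis by (simp add: smooth_sum smooth_mult smooth_inner)
  qed
  have AB: "0 < A x + B x" for x
    using flat_0_props(1)[of "4 - x \<bullet> x"] flat_0_props(1)[of "x \<bullet> x - 1"]
      flat_0_props(3)[of "4 - x \<bullet> x"] flat_0_props(3)[of "x \<bullet> x - 1"]
    unfolding A_def B_def by (cases "x \<bullet> x < 4") (auto intro: add_pos_nonneg add_nonneg_pos)
  have A0: "0 \<le> A x" "0 \<le> B x" for x by (auto simp: A_def B_def flat_0_props)
  have eq: "\<eta> x = A x / (A x + B x)" for x
    using AB[of x] by (simp add: \<eta>_def powr_minus divide_inverse)
  have nn: "norm x ^ 2 = x \<bullet> x" for x :: 'a by (simp add: dot_square_norm)
  have s: "smooth \<eta>" unfolding \<eta>_def[abs_def] A_def B_def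
    by (intro smooth_mult smooth_powr smooth_add smooth_flat smooth_diff smooth_const sq)
       (use AB in \<open>simp add: A_def B_def\<close>)
  have out: "\<eta> x = 0" if "norm x \<ge> 2" for x
  proof -
    have "x \<bullet> x \<ge> 4" using power_mono[OF that, of 2] nn[of x] by simp
    then have "A x = 0" by (simp add: A_def flat_0_props(4))
    then show ?thesis by (simp add: eq)
  qed
  show ?thesis
  proof (rule that[of \<eta>])
    show "test_function \<eta>"
      by (rule test_functionI[OF s, of "cball 0 2"]) (use out in auto)
    show "0 \<le> \<eta> x" "\<eta> x \<le> 1" for x using A0[of x] AB[of x] by (auto simp: eq)
    show "\<eta> x = 1" if "norm x \<le> 1" for x
    proof -
      have "x \<bullet> x \<le> 1" using power_mono[OF that, of 2] nn[of x] by simp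
      then have "B x = 0" by (simp add: B_def flat_0_props(4))
      then show ?thesis using AB[of x] by (simp add: eq)
    qed
  qed (use out in auto)
qed

subsection \<open>Hoelder's inequality and decay\<close>

text \<open>Young's inequality after division by the two norms; if one of them is zero, the product
  vanishes almost everywhere.\<close>

theorem holder:
  fixes f g :: "'a \<Rightarrow> real"
  assumes p: "1 < p" "1 < p'" "1 / p + 1 / p' = 1"
    and nn: "\<And>x. 0 \<le> f x" "\<And>x. 0 \<le> g x" and [measurable]: "f \<in> borel_measurable M" "g \<in> borel_measurable M"
    and i: "integrable M (\<lambda>x. f x powr p)" "integrable M (\<lambda>x. g x powr p')"
  shows "integrable M (\<lambda>x. f x * g x)"
    and "(LINT x|M. f x * g x) \<le> (LINT x|M. f x powr p) powr (1 / p) * (LINT x|M. g x powr p') powr (1 / p')"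
proof -
  define A B where "A = (LINT x|M. f x powr p)" and "B = (LINT x|M. g x powr p')"
  have AB: "0 \<le> A" "0 \<le> B" unfolding A_def B_def by (auto intro: Bochner_Integration.integral_nonneg)
  have young: "f x * g x \<le> f x powr p / p + g x powr p' / p'" for x
    using Youngs_inequality[OF p] nn by auto
  show int: "integrable M (\<lambda>x. f x * g x)"
    by (rule Bochner_Integration.integrable_bound[of _ "\<lambda>x. f x powr p / p + g x powr p' / p'"])
       (use i young nn p in \<open>auto intro!: AE_I2 simp: abs_of_nonneg\<close>)
  show "(LINT x|M. f x * g x) \<le> (LINT x|M. f x powr p) powr (1 / p) * (LINT x|M. g x powr p') powr (1 / p')"
    unfolding A_def[symmetric] B_def[symmetric]
  proof (cases "A = 0 \<or> B = 0")
    case True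
    have "AE x in M. f x * g x = 0"
    proof (cases "A = 0")
      case True
      then have "AE x in M. f x powr p = 0"
        using integral_nonneg_eq_0_iff_AE[OF i(1)] by (simp add: A_def)
      then show ?thesis by eventually_elim (use p in auto)
    next
      case False
      then have "AE x in M. g x powr p' = 0"
        using integral_nonneg_eq_0_iff_AE[OF i(2)] True by (simp add: B_def)
      then show ?thesis by eventually_elim (use p in auto)
    qed
    then have "(LINT x|M. f x * g x) = 0" by (rule integral_eq_zero_AE)
    then show "(LINT x|M. f x * g x) \<le> A powr (1 / p) * B powr (1 / p')" by simp
  next
    case False
    then have pos: "A > 0" "B > 0" using AB by auto
    define \<alpha> \<beta> where "\<alpha> = A powr (1 / p)" and "\<beta> = B powr (1 / p')"
    have ab: "\<alpha> > 0" "\<beta> > 0" using pos by (auto simp: \<alpha>_def \<beta>_def)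
    have ap: "\<alpha> powr p = A" "\<beta> powr p' = B" using pos p by (auto simp: \<alpha>_def \<beta>_def powr_powr)
    have "f x * g x / (\<alpha> * \<beta>) \<le> f x powr p / A / p + g x powr p' / B / p'" for x
    proof -
      have "(f x / \<alpha>) * (g x / \<beta>) \<le> (f x / \<alpha>) powr p / p + (g x / \<beta>) powr p' / p'"
        using Youngs_inequality[OF p, of "f x / \<alpha>" "g x / \<beta>"] nn ab by simp
      then show ?thesis using nn ab by (simp add: powr_divide ap)
    qed
    then have "(LINT x|M. f x * g x / (\<alpha> * \<beta>)) \<le> (LINT x|M. f x powr p / A / p + g x powr p' / B / p')"
      by (intro integral_mono) (use i int in auto)
    also have "\<dots> = A / A / p + B / B / p'" using i by (simp add: A_def B_def)
    also have "\<dots> = 1" using pos p(3) by simp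
    finally have "(LINT x|M. f x * g x) / (\<alpha> * \<beta>) \<le> 1" by simp
    then show "(LINT x|M. f x * g x) \<le> A powr (1 / p) * B powr (1 / p')"
      unfolding \<alpha>_def[symmetric] \<beta>_def[symmetric] using ab by (simp add: divide_le_eq)
  qed
qed

section \<open>Integrable powers on Euclidean space\<close>

lemma decay_half_line:
  assumes "r > 1"
  shows "(\<integral>\<^sup>+t. ennreal ((1 + t) powr (-r)) * indicator {0..} t \<partial>lborel) < \<infinity>"
proof -
  let ?F = "\<lambda>t. - ((1 + t) powr (1 - r)) / (r - 1)"
  have "(\<integral>\<^sup>+t. ennreal ((1 + t) powr (-r)) * indicator {0..} t \<partial>lborel) = ennreal (0 - ?F 0)"
  proof (rule nn_integral_FTC_atLeast)
    fix t :: real assume t: "0 \<le> t"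
    have "((\<lambda>t. (1 + t) powr (1 - r)) has_real_derivative (1 - r) * (1 + t) powr (1 - r - 1) * 1) (at t)"
      using t by (auto intro!: derivative_eq_intros)
    moreover have "- ((1 - r) * (1 + t) powr (1 - r - 1) * 1) / (r - 1) = (1 + t) powr (-r)"
      using assms by (simp add: divide_simps) (simp add: algebra_simps)
    ultimately show "(?F has_real_derivative (1 + t) powr (-r)) (at t)"
      using DERIV_cdivide[OF DERIV_minus, of "\<lambda>t. (1 + t) powr (1 - r)" "(1 - r) * (1 + t) powr (1 - r - 1) * 1" t UNIV "r - 1"]
      by (simp only:)
  next
    have "((\<lambda>t. (1 + t) powr (1 - r)) \<longlongrightarrow> 0) at_top"
      by (rule tendsto_neg_powr) (use assms in \<open>auto intro: filterlim_tendsto_add_at_top[OF tendsto_const filterlim_ident]\<close>)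
    then show "(?F \<longlongrightarrow> 0) at_top" using tendsto_divide[OF tendsto_minus tendsto_const, of _ 0 _ "r - 1"] assms by fastforce
  qed auto
  then show ?thesis by simp
qed

lemma decay_line:
  assumes "r > 1"
  shows "(\<integral>\<^sup>+t. ennreal ((1 + \<bar>t\<bar>) powr (-r)) \<partial>lborel) < \<infinity>"
proof -
  have A: "(\<integral>\<^sup>+t. ennreal ((1 + \<bar>t\<bar>) powr (-r)) * indicator {0..} t \<partial>lborel) < \<infinity>"
  proof -
    have "(\<integral>\<^sup>+t. ennreal ((1 + \<bar>t\<bar>) powr (-r)) * indicator {0..} t \<partial>lborel) = (\<integral>\<^sup>+t. ennreal ((1 + t) powr (-r)) * indicator {0..} t \<partial>lborel)"
      by (rule nn_integral_cong) (auto split: split_indicator)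
    then show ?thesis using decay_half_line[OF assms] by simp
  qed
  have B: "(\<integral>\<^sup>+t. ennreal ((1 + \<bar>t\<bar>) powr (-r)) * indicator {..0} t \<partial>lborel) = (\<integral>\<^sup>+t. ennreal ((1 + \<bar>t\<bar>) powr (-r)) * indicator {0..} t \<partial>lborel)"
  proof -
    have "(\<integral>\<^sup>+t. ennreal ((1 + \<bar>t\<bar>) powr (-r)) * indicator {..0} t \<partial>lborel)
       = (\<integral>\<^sup>+t. ennreal ((1 + \<bar>0 + (-1) * t\<bar>) powr (-r)) * indicator {..0} (0 + (-1) * t) \<partial>lborel)"
      by (subst nn_integral_real_affine[where c="-1" and t=0]) auto
    also have "\<dots> = (\<integral>\<^sup>+t. ennreal ((1 + \<bar>t\<bar>) powr (-r)) * indicator {0..} t \<partial>lborel)"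
      by (rule nn_integral_cong) (auto split: split_indicator)
    finally show ?thesis .
  qed
  have "(\<integral>\<^sup>+t. ennreal ((1 + \<bar>t\<bar>) powr (-r)) \<partial>lborel) \<le> (\<integral>\<^sup>+t. ennreal ((1 + \<bar>t\<bar>) powr (-r)) * indicator {0..} t + ennreal ((1 + \<bar>t\<bar>) powr (-r)) * indicator {..0} t \<partial>lborel)"
    by (rule nn_integral_mono) (auto split: split_indicator)
  also have "\<dots> = (\<integral>\<^sup>+t. ennreal ((1 + \<bar>t\<bar>) powr (-r)) * indicator {0..} t \<partial>lborel) + (\<integral>\<^sup>+t. ennreal ((1 + \<bar>t\<bar>) powr (-r)) * indicator {..0} t \<partial>lborel)"
    by (rule nn_integral_add) auto
  also have "\<dots> < \<infinity>" using A B by simp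
  finally show ?thesis .
qed

text \<open>Takes the place of integration in polar coordinates: the integral of a product of
  functions of one variable factors.\<close>

lemma decay_product:
  assumes "r > 1"
  shows "integrable lborel (\<lambda>x::'a::euclidean_space. \<Prod>b\<in>Basis. (1 + \<bar>x \<bullet> b\<bar>) powr (-r))"
proof -
  have "(\<integral>\<^sup>+x. ennreal (\<Prod>b\<in>Basis. (1 + \<bar>x \<bullet> b\<bar>) powr (-r)) \<partial>(lborel :: 'a measure))
     = (\<integral>\<^sup>+f. ennreal (\<Prod>b\<in>Basis. (1 + \<bar>of_coords f \<bullet> b\<bar>) powr (-r)) \<partial>LL (Basis :: 'a set))"
    by (rule nn_integral_coords) simp
  also have "\<dots> = (\<integral>\<^sup>+f. (\<Prod>b\<in>Basis. ennreal ((1 + \<bar>f b\<bar>) powr (-r))) \<partial>LL (Basis :: 'a set))"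
    by (rule nn_integral_cong) (simp add: prod_ennreal[symmetric] of_coords_inner)
  also have "\<dots> = (\<Prod>b\<in>(Basis::'a set). (\<integral>\<^sup>+t. ennreal ((1 + \<bar>t\<bar>) powr (-r)) \<partial>lborel))"
    by (rule LLp.product_nn_integral_prod) auto
  also have "\<dots> < \<infinity>"
    using decay_line[OF assms] by (simp add: power_less_top_ennreal)
  finally have "(\<integral>\<^sup>+x. ennreal (\<Prod>b\<in>Basis. (1 + \<bar>x \<bullet> b\<bar>) powr (-r)) \<partial>(lborel :: 'a measure)) < \<infinity>" .
  then show ?thesis by (simp add: integrable_iff_bounded abs_of_nonneg prod_nonneg)
qed

lemma integral_pos_of_pos:
  fixes f :: "'a::euclidean_space \<Rightarrow> real"
  assumes "integrable lborel f" "\<And>x. 0 < f x"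
  shows "0 < (LINT x|lborel. f x)"
proof -
  have "0 \<le> (LINT x|lborel. f x)" by (rule Bochner_Integration.integral_nonneg) (use assms in \<open>auto simp: less_imp_le\<close>)
  moreover have "(LINT x|lborel. f x) \<noteq> 0"
  proof
    assume "(LINT x|lborel. f x) = 0"
    then have "AE x in lborel. f x = 0"
      using integral_nonneg_eq_0_iff_AE[OF assms(1)] assms(2) by (auto simp: less_imp_le)
    then have "AE x in (lborel :: 'a measure). False"
      by eventually_elim (use assms(2) in \<open>metis less_irrefl\<close>)
    then have "emeasure (lborel :: 'a measure) UNIV = 0"
      using AE_iff_measurable[of UNIV "lborel :: 'a measure" "\<lambda>_. False"] by simp
    then show False by simp
  qed
  ultimately show ?thesis by simp
qed

lemma continuous_on_abs_powr:
  assumes "continuous_on S f" "r > 0"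
  shows "continuous_on S (\<lambda>x. \<bar>f x\<bar> powr r :: real)"
  by (rule continuous_on_powr') (use assms in \<open>auto intro!: continuous_intros\<close>)

text \<open>At 0 the difference quotient is at most |h|^(q-1) in absolute value, which tends to 0
  because \<open>q > 1\<close>.\<close>

lemma DERIV_abs_powr:
  assumes "q > 1"
  shows "((\<lambda>v. \<bar>v\<bar> powr q) has_real_derivative q * \<bar>v\<bar> powr (q - 1) * sgn v) (at v)"
proof -
  consider "v > 0" | "v < 0" | "v = 0" by linarith
  then show ?thesis
  proof cases
    case 1
    have "((\<lambda>v. v powr q) has_real_derivative q * \<bar>v\<bar> powr (q - 1) * sgn v) (at v)"
      using has_real_derivative_powr[OF 1, of q] 1 by simp
    then show ?thesis
      by (rule has_field_derivative_transform_within_open[of _ _ _ "{0<..}"]) (use 1 in auto)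
  next
    case 2
    have "((\<lambda>v. v powr q) has_real_derivative q * (-v) powr (q - 1)) (at (-v))"
      using has_real_derivative_powr[of "-v" q] 2 by simp
    from DERIV_chain2[OF this DERIV_minus[OF DERIV_ident]]
    have "((\<lambda>v. (-v) powr q) has_real_derivative q * \<bar>v\<bar> powr (q - 1) * sgn v) (at v)"
      using 2 by simp
    then show ?thesis
      by (rule has_field_derivative_transform_within_open[of _ _ _ "{..<0}"]) (use 2 in auto)
  next
    case 3
    have "((\<lambda>h. (\<bar>h\<bar> powr q) / h) \<longlongrightarrow> 0) (at 0)"
    proof (rule Lim_null_comparison)
      show "\<forall>\<^sub>F h in at 0. norm ((\<bar>h\<bar> powr q) / h) \<le> \<bar>h\<bar> powr (q - 1)"
      proof (rule eventually_at_topological[THEN iffD2], intro exI[of _ UNIV] conjI ballI impI)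
        fix h :: real assume "h \<noteq> 0"
        then show "norm ((\<bar>h\<bar> powr q) / h) \<le> \<bar>h\<bar> powr (q - 1)"
          by (simp add: powr_diff)
      qed auto
      have "continuous_on UNIV (\<lambda>h::real. \<bar>h\<bar> powr (q - 1))"
        by (rule continuous_on_abs_powr) (use assms in auto)
      then have "isCont (\<lambda>h::real. \<bar>h\<bar> powr (q - 1)) 0" by (simp add: continuous_on_eq_continuous_at)
      then show "((\<lambda>h::real. \<bar>h\<bar> powr (q - 1)) \<longlongrightarrow> 0) (at 0)" using assms by (simp add: isCont_def)
    qed
    then show ?thesis using 3 by (simp add: DERIV_def)
  qed
qed

lemma test_function_abs_powr_integrable:
  assumes "test_function f" "r > 0"
  shows "integrable lborel (\<lambda>x. \<bar>f x\<bar> powr r)"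
proof -
  obtain M where "\<And>x. norm x > M \<Longrightarrow> f x = 0" using test_function_support[OF assms(1)] by metis
  then show ?thesis
    by (intro integrable_continuous_bounded_support[of _ M] continuous_on_abs_powr smooth_continuous test_function_smooth)
       (use assms in auto)
qed

lemma test_function_grad_powr_integrable:
  assumes "test_function f" "r > 0"
  shows "integrable lborel (\<lambda>x. norm (grad f x) powr r)"
proof -
  obtain M where M: "\<And>x. norm x > M \<Longrightarrow> grad f x = 0" using test_function_support[OF assms(1)] by metis
  have "continuous_on UNIV (\<lambda>x. \<bar>norm (grad f x)\<bar> powr r)"
    by (intro continuous_on_abs_powr continuous_on_norm smooth_grad_continuous test_function_smooth assms)
  then show ?thesis
    by (intro integrable_continuous_bounded_support[of _ M]) (use M in auto)
qed

lemma AE_line_avoids: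
  fixes b b' :: "'a::euclidean_space"
  assumes "b \<in> Basis" "b' \<in> Basis" "b \<noteq> b'"
  shows "AE x in lborel. \<forall>t. (x + t *\<^sub>R b) \<bullet> b' \<noteq> 0"
  using AE_lborel_inner_neq[OF assms(2), of 0]
  by eventually_elim (use assms in \<open>auto simp: inner_add_left inner_Basis\<close>)

subsection \<open>The sharp inequality for test functions\<close>

definition rho :: "real \<Rightarrow> real ^ 'm \<Rightarrow> (real ^ 'k) \<times> (real ^ 'm) \<Rightarrow> real" where
  "rho \<mu> \<zeta> x = sqrt ((\<mu> + norm (fst x))\<^sup>2 + (norm (snd x - \<zeta>))\<^sup>2)"

text \<open>With \<open>X x = x + offset \<mu> \<zeta> x\<close> one has \<open>norm (X x) = rho \<mu> \<zeta> x\<close> off the set \<open>y = 0\<close>, where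
  \<open>sgn\<close> vanishes.\<close>

definition offset :: "real \<Rightarrow> real ^ 'm \<Rightarrow> (real ^ 'k) \<times> (real ^ 'm) \<Rightarrow> (real ^ 'k) \<times> (real ^ 'm)" where
  "offset \<mu> \<zeta> x = (\<mu> *\<^sub>R sgn (fst x), - \<zeta>)"

text \<open>The derivative of \<open>sgn y \<bullet> b\<close> in direction \<open>b\<close>, which is \<open>0\<close> at \<open>y = 0\<close> by division by zero.\<close>

definition sgn_deriv :: "(real ^ 'k) \<times> (real ^ 'm) \<Rightarrow> (real ^ 'k) \<times> (real ^ 'm) \<Rightarrow> real" where
  "sgn_deriv b x = (fst b \<bullet> fst b - (sgn (fst x) \<bullet> fst b)\<^sup>2) / norm (fst x)"

lemma rho_continuous: "continuous_on S (rho \<mu> \<zeta>)"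
  unfolding rho_def[abs_def] by (intro continuous_intros)

lemma rho_measurable [measurable]: "rho \<mu> \<zeta> \<in> borel_measurable borel"
  by (rule borel_measurable_continuous_onI) (rule rho_continuous)

lemma borel_measurable_fst [measurable]:
  "(fst :: 'a::topological_space \<times> 'b::topological_space \<Rightarrow> 'a) \<in> borel_measurable borel"
  by (intro borel_measurable_continuous_onI continuous_intros)

lemma offset_measurable [measurable]: "offset \<mu> \<zeta> \<in> borel_measurable borel"
  unfolding offset_def[abs_def] borel_prod[symmetric] by measurable

lemma sgn_deriv_measurable [measurable]: "sgn_deriv b \<in> borel_measurable borel"
  unfolding sgn_deriv_def[abs_def] borel_prod[symmetric] by measurable

lemma rho_ge:
  assumes "\<mu> > 0"
  shows "\<mu> + norm (fst x) \<le> rho \<mu> \<zeta> x" "norm (snd x - \<zeta>) \<le> rho \<mu> \<zeta> x" "\<mu> \<le> rho \<mu> \<zeta> x" "0 < rho \<mu> \<zeta> x"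
proof -
  show a: "\<mu> + norm (fst x) \<le> rho \<mu> \<zeta> x" unfolding rho_def by (rule real_le_rsqrt) simp
  show "norm (snd x - \<zeta>) \<le> rho \<mu> \<zeta> x" unfolding rho_def by (rule real_le_rsqrt) simp
  show "\<mu> \<le> rho \<mu> \<zeta> x" using a norm_ge_zero[of "fst x"] by linarith
  then show "0 < rho \<mu> \<zeta> x" using assms by linarith
qed

lemma rho_square: "(rho \<mu> \<zeta> x)\<^sup>2 = (\<mu> + norm (fst x))\<^sup>2 + (norm (snd x - \<zeta>))\<^sup>2"
  unfolding rho_def by simp

lemma norm_le_rho:
  assumes "\<mu> > 0"
  shows "norm x \<le> 2 * rho \<mu> \<zeta> x + norm \<zeta>" "rho \<mu> \<zeta> x \<le> \<mu> + 2 * norm x + norm \<zeta>"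
proof -
  have "norm x \<le> norm (fst x) + norm (snd x)" by (metis norm_Pair_le prod.collapse)
  moreover have "norm (snd x) \<le> norm (snd x - \<zeta>) + norm \<zeta>" using norm_triangle_ineq[of "snd x - \<zeta>" \<zeta>] by simp
  ultimately show "norm x \<le> 2 * rho \<mu> \<zeta> x + norm \<zeta>" using rho_ge[OF assms, where x=x and \<zeta>=\<zeta>] assms by linarith
  have "rho \<mu> \<zeta> x \<le> (\<mu> + norm (fst x)) + norm (snd x - \<zeta>)"
    unfolding rho_def by (rule sqrt_sum_squares_le_sum) (use assms in auto)
  moreover have "norm (snd x - \<zeta>) \<le> norm (snd x) + norm \<zeta>" by (rule norm_triangle_ineq4)
  ultimately show "rho \<mu> \<zeta> x \<le> \<mu> + 2 * norm x + norm \<zeta>"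
    using norm_fst_le[of "fst x" "snd x"] norm_snd_le[of "snd x" "fst x"] unfolding prod.collapse by linarith
qed

text \<open>The decay is spread evenly over the N coordinates: each 1 + |x \<bullet> b| is at most K
  \<rho>, where \<rho> \<ge> \<mu> absorbs the constant 1 + |\<zeta>|, and receives the exponent s/N
  > 1.\<close>

lemma rho_powr_integrable:
  fixes \<zeta> :: "real ^ 'm"
  assumes \<mu>: "\<mu> > 0" and s: "s > real (CARD('k) + CARD('m))"
  shows "integrable lborel (\<lambda>x :: (real ^ 'k) \<times> (real ^ 'm). rho \<mu> \<zeta> x powr (-s))"
proof -
  define N where "N = real (CARD('k) + CARD('m))"
  have N: "N > 0" by (simp add: N_def add_pos_pos)
  define K where "K = 2 + (1 + norm \<zeta>) / \<mu>"
  have K: "K > 0" unfolding K_def using \<mu> by (intro add_pos_nonneg) auto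
  have cb: "card (Basis :: ((real ^ 'k) \<times> (real ^ 'm)) set) = CARD('k) + CARD('m)" by simp
  have bd: "1 + \<bar>x \<bullet> b\<bar> \<le> K * rho \<mu> \<zeta> x" if "b \<in> Basis" for x b :: "(real ^ 'k) \<times> (real ^ 'm)"
  proof -
    have "\<bar>x \<bullet> b\<bar> \<le> norm x" using Basis_le_norm[OF that] .
    then have "1 + \<bar>x \<bullet> b\<bar> \<le> 2 * rho \<mu> \<zeta> x + (1 + norm \<zeta>)" using norm_le_rho(1)[OF \<mu>, of x \<zeta>] by linarith
    also have "1 + norm \<zeta> \<le> (1 + norm \<zeta>) / \<mu> * rho \<mu> \<zeta> x"
    proof -
      have "(1 + norm \<zeta>) / \<mu> * \<mu> \<le> (1 + norm \<zeta>) / \<mu> * rho \<mu> \<zeta> x"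
        by (rule mult_left_mono[OF rho_ge(3)[OF \<mu>]]) (use \<mu> in auto)
      then show ?thesis using \<mu> by simp
    qed
    finally show ?thesis by (simp add: K_def algebra_simps)
  qed
  have pw: "rho \<mu> \<zeta> x powr (-s) \<le> K powr s * (\<Prod>b\<in>Basis. (1 + \<bar>x \<bullet> b\<bar>) powr (-(s / N)))" for x :: "(real ^ 'k) \<times> (real ^ 'm)"
  proof -
    have r: "0 < rho \<mu> \<zeta> x" by (rule rho_ge(4)[OF \<mu>])
    have "(K * rho \<mu> \<zeta> x) powr (-s) = (\<Prod>b\<in>(Basis :: ((real ^ 'k) \<times> (real ^ 'm)) set). (K * rho \<mu> \<zeta> x) powr (-(s / N)))"
      unfolding prod_constant cb using K r N by (simp add: powr_realpow[symmetric] powr_powr N_def)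
    also have "\<dots> \<le> (\<Prod>b\<in>Basis. (1 + \<bar>x \<bullet> b\<bar>) powr (-(s / N)))"
    proof (rule prod_mono, intro conjI)
      fix b :: "(real ^ 'k) \<times> (real ^ 'm)" assume b: "b \<in> Basis"
      show "(K * rho \<mu> \<zeta> x) powr (-(s / N)) \<le> (1 + \<bar>x \<bullet> b\<bar>) powr (-(s / N))"
        by (rule powr_mono2') (use bd[OF b, of x] s N in \<open>auto simp: N_def\<close>)
    qed simp
    finally have "(K * rho \<mu> \<zeta> x) powr (-s) \<le> (\<Prod>b\<in>Basis. (1 + \<bar>x \<bullet> b\<bar>) powr (-(s / N)))" .
    then have "K powr s * (K * rho \<mu> \<zeta> x) powr (-s) \<le> K powr s * (\<Prod>b\<in>Basis. (1 + \<bar>x \<bullet> b\<bar>) powr (-(s / N)))"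
      by (rule mult_left_mono) simp
    moreover have "K powr s * (K * rho \<mu> \<zeta> x) powr (-s) = rho \<mu> \<zeta> x powr (-s)"
      using K r by (simp add: powr_mult powr_minus field_simps)
    ultimately show ?thesis by simp
  qed
  have "integrable lborel (\<lambda>x :: (real ^ 'k) \<times> (real ^ 'm). K powr s * (\<Prod>b\<in>Basis. (1 + \<bar>x \<bullet> b\<bar>) powr (-(s / N))))"
    by (rule integrable_mult_right) (rule decay_product, use s N in \<open>simp add: N_def\<close>)
  then show ?thesis
    by (rule Bochner_Integration.integrable_bound) (use pw in \<open>auto intro!: AE_I2 simp: abs_of_nonneg prod_nonneg\<close>)
qed

text \<open>The shift is taken at \<open>x\<close> but added to an independent point
  \<open>y\<close>. Its first block has length at most \<mu> in whatever direction, and its second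
  block is constant. With y = T x this is the pointwise bound of the transport estimate.\<close>

lemma norm_add_offset_le:
  assumes "\<mu> > 0" shows "norm (y + offset \<mu> \<zeta> x) \<le> rho \<mu> \<zeta> y"
proof -
  have "norm (fst y + \<mu> *\<^sub>R sgn (fst x)) \<le> norm (fst y) + norm (\<mu> *\<^sub>R sgn (fst x))" by (rule norm_triangle_ineq)
  also have "norm (\<mu> *\<^sub>R sgn (fst x)) \<le> \<mu>" using assms by (simp add: norm_sgn)
  finally have "(norm (fst y + \<mu> *\<^sub>R sgn (fst x)))\<^sup>2 \<le> (\<mu> + norm (fst y))\<^sup>2"
    by (intro power_mono) (auto simp: add.commute)
  then show ?thesis unfolding rho_def norm_prod_def offset_def by simp
qed

text \<open>The second derivative of the norm in direction \<open>c\<close>: with v = y + t c, it is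
  the squared length of the part of \<open>c\<close> orthogonal to v, divided by |v|.\<close>

lemma sgn_line_deriv:
  fixes y c :: "'a::euclidean_space"
  assumes "y + t *\<^sub>R c \<noteq> 0"
  shows "((\<lambda>s. sgn (y + s *\<^sub>R c) \<bullet> c) has_real_derivative (c \<bullet> c - (sgn (y + t *\<^sub>R c) \<bullet> c)\<^sup>2) / norm (y + t *\<^sub>R c)) (at t)"
proof -
  let ?v = "y + t *\<^sub>R c"
  have n: "norm ?v \<noteq> 0" using assms by simp
  have d: "((\<lambda>s. y + s *\<^sub>R c) has_derivative (\<lambda>h. h *\<^sub>R c)) (at t)" by (auto intro!: derivative_eq_intros)
  have "((\<lambda>s. norm (y + s *\<^sub>R c)) has_derivative (\<lambda>h. (h *\<^sub>R c) \<bullet> sgn ?v)) (at t)"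
    by (rule has_derivative_compose[OF d has_derivative_norm[OF assms]])
  then have dn: "((\<lambda>s. norm (y + s *\<^sub>R c)) has_real_derivative (c \<bullet> sgn ?v)) (at t)"
    by (simp add: has_field_derivative_def mult.commute[of _ "c \<bullet> sgn ?v"])
  have di: "((\<lambda>s. (y + s *\<^sub>R c) \<bullet> c) has_real_derivative (c \<bullet> c)) (at t)"
    by (auto intro!: derivative_eq_intros simp: inner_add_left has_field_derivative_def)
  have "((\<lambda>s. ((y + s *\<^sub>R c) \<bullet> c) / norm (y + s *\<^sub>R c)) has_real_derivative
     ((c \<bullet> c) * norm ?v - (?v \<bullet> c) * (c \<bullet> sgn ?v)) / (norm ?v * norm ?v)) (at t)"
    by (rule DERIV_divide[OF di dn n])
  moreover have "?v \<bullet> c = norm ?v * (sgn ?v \<bullet> c)" using n by (simp add: sgn_div_norm)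
  moreover have q: "(A * m - (m * B) * B) / (m * m) = (A - B\<^sup>2) / m" if "m \<noteq> 0" for A B m :: real
    using that by (simp add: power2_eq_square divide_simps) (simp add: algebra_simps)
  ultimately have "((\<lambda>s. ((y + s *\<^sub>R c) \<bullet> c) / norm (y + s *\<^sub>R c)) has_real_derivative
     (c \<bullet> c - (sgn ?v \<bullet> c)\<^sup>2) / norm ?v) (at t)"
    by (simp only: inner_commute[of c "sgn ?v"] q[OF n])
  moreover have "(\<lambda>s. sgn (y + s *\<^sub>R c) \<bullet> c) = (\<lambda>s. ((y + s *\<^sub>R c) \<bullet> c) / norm (y + s *\<^sub>R c))"
    by (simp add: sgn_div_norm divide_inverse mult.commute)
  ultimately show ?thesis by simp
qed

lemma offset_line_deriv:
  assumes "fst (x + t *\<^sub>R b) \<noteq> 0"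
  shows "((\<lambda>s. offset \<mu> \<zeta> (x + s *\<^sub>R b) \<bullet> b) has_real_derivative \<mu> * sgn_deriv b (x + t *\<^sub>R b)) (at t)"
proof -
  have e: "(\<lambda>s. offset \<mu> \<zeta> (x + s *\<^sub>R b) \<bullet> b) = (\<lambda>s. \<mu> * (sgn (fst x + s *\<^sub>R fst b) \<bullet> fst b) - \<zeta> \<bullet> snd b)"
    by (auto simp: offset_def inner_prod_def)
  have "((\<lambda>s. sgn (fst x + s *\<^sub>R fst b) \<bullet> fst b) has_real_derivative sgn_deriv b (x + t *\<^sub>R b)) (at t)"
    using sgn_line_deriv[of "fst x" t "fst b"] assms by (simp add: sgn_deriv_def)
  from DERIV_diff[OF DERIV_cmult[OF this, of \<mu>] DERIV_const[of "\<zeta> \<bullet> snd b"]] show ?thesis unfolding e by simp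
qed

text \<open>Convexity of the norm. The sign is what admits the shift to
  \<open>parts_along\<close>.\<close>

lemma sgn_deriv_nonneg: "0 \<le> sgn_deriv b x"
proof -
  have "(sgn (fst x) \<bullet> fst b)\<^sup>2 \<le> (sgn (fst x) \<bullet> sgn (fst x)) * (fst b \<bullet> fst b)" by (rule Cauchy_Schwarz_ineq)
  also have "\<dots> \<le> 1 * (fst b \<bullet> fst b)"
    by (rule mult_right_mono) (auto simp: dot_square_norm norm_sgn power_le_one)
  finally show ?thesis unfolding sgn_deriv_def by simp
qed

text \<open>The divergence of y/|y|, source of the Hardy weight: the projection orthogonal to y has
  trace k - 1, and the z directions contribute nothing. On y = 0 both sides are 0 by division by
  zero.\<close>

lemma sum_sgn_deriv:
  fixes x :: "(real ^ 'k) \<times> (real ^ 'm)"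
  shows "(\<Sum>b\<in>Basis. sgn_deriv b x) = (real CARD('k) - 1) / norm (fst x)"
proof (cases "fst x = 0")
  case True then show ?thesis by (simp add: sgn_deriv_def)
next
  case False
  have "(\<Sum>b\<in>Basis. sgn_deriv b x) = (\<Sum>i\<in>(Basis :: (real ^ 'k) set). sgn_deriv (i, 0 :: real ^ 'm) x) + (\<Sum>j\<in>(Basis :: (real ^ 'm) set). sgn_deriv (0 :: real ^ 'k, j) x)"
  proof -
    have "(\<lambda>i::real ^ 'k. (i, 0::real ^ 'm)) ` Basis \<inter> (\<lambda>j. (0, j)) ` Basis = {}"
      using nonzero_Basis by fastforce
    then show ?thesis unfolding Basis_prod_def
      by (subst sum.union_disjoint) (auto simp: sum.reindex inj_on_def)
  qed
  also have "(\<Sum>j\<in>(Basis :: (real ^ 'm) set). sgn_deriv (0 :: real ^ 'k, j) x) = 0" by (simp add: sgn_deriv_def)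
  also have "(\<Sum>i\<in>(Basis :: (real ^ 'k) set). sgn_deriv (i, 0 :: real ^ 'm) x)
     = ((\<Sum>i\<in>(Basis :: (real ^ 'k) set). i \<bullet> i) - (\<Sum>i\<in>Basis. (sgn (fst x) \<bullet> i)\<^sup>2)) / norm (fst x)"
    unfolding sgn_deriv_def by (simp add: sum_divide_distrib[symmetric] sum_subtractf)
  also have "(\<Sum>i\<in>(Basis :: (real ^ 'k) set). i \<bullet> i) = real CARD('k)" by simp
  also have "(\<Sum>i\<in>Basis. (sgn (fst x) \<bullet> i)\<^sup>2) = (norm (sgn (fst x)))\<^sup>2"
    by (simp add: norm_eq_sqrt_inner euclidean_inner[of "sgn (fst x)" "sgn (fst x)"] power2_eq_square sum_nonneg)
  also have "\<dots> = 1" using False by (simp add: norm_sgn)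
  finally show ?thesis by simp
qed

text \<open>As k \<ge> 2, some coordinate of y differs from \<open>b\<close>. It is constant along
  the line and nonzero for almost every starting point, so the set y = 0, where \<open>sgn\<close>
  is singular, is missed by almost every line.\<close>

lemma AE_line_fst_nonzero:
  fixes b :: "(real ^ 'k) \<times> (real ^ 'm)"
  assumes b: "b \<in> Basis" and k: "CARD('k) \<ge> 2"
  shows "AE x in lborel. \<forall>t. fst (x + t *\<^sub>R b) \<noteq> 0"
proof -
  have "\<exists>i\<in>(Basis :: (real ^ 'k) set). (i, 0) \<noteq> b"
  proof (rule ccontr)
    assume "\<not> ?thesis"
    then have "Basis \<subseteq> {fst b}" by force
    then have "card (Basis :: (real ^ 'k) set) \<le> 1" using card_mono[of "{fst b}" Basis] by simp
    then show False using k by simp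
  qed
  then obtain i :: "real ^ 'k" where i: "i \<in> Basis" "(i, 0) \<noteq> b" by blast
  have "(i, 0 :: real ^ 'm) \<in> Basis" using i by (auto simp: Basis_prod_def)
  from AE_line_avoids[OF b this i(2)[symmetric]] show ?thesis
    by eventually_elim (auto simp: inner_prod_def, metis inner_zero_left)
qed

text \<open>\<open>ps * (1 - 1 / N) = q\<close> matches the geometric mean with the power of
  |\<phi>| that is integrated by parts, and \<open>(q - 1) * (p / (p - 1)) = ps\<close> leads back
  to the source density in Hoelder's inequality. The two identities for
  \<open>N * p / (p - 1)\<close> show that both terms produce the same power of \<rho>.\<close>

lemma exponent_identities:
  fixes N p :: real
  assumes "1 < p" "p < N"
  defines "q \<equiv> p * (N - 1) / (N - p)" and "ps \<equiv> N * p / (N - p)"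
  shows "q > 1" "ps > 0" "ps * (1 - 1 / N) = q" "(q - 1) * (p / (p - 1)) = ps"
    "N * p / (p - 1) * (1 - 1 / N) = (N - 1) * p / (p - 1)"
    "N * p / (p - 1) - p / (p - 1) = (N - 1) * p / (p - 1)"
    "1 / p + 1 / (p / (p - 1)) = 1" "p / (p - 1) > 1"
proof -
  have "p * 1 < p * N" using assms by (intro mult_strict_left_mono) auto
  then have "N - p < p * (N - 1)" using mult_strict_right_mono[of 1 p N] assms by (simp add: algebra_simps)
  then show "q > 1" unfolding q_def using assms by (simp add: less_divide_eq)
  show "ps > 0" unfolding ps_def using assms by simp
  show "ps * (1 - 1 / N) = q" unfolding q_def ps_def using assms by (simp add: field_simps)
  have "q - 1 = N * (p - 1) / (N - p)" unfolding q_def using assms by (simp add: field_simps)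
  then show "(q - 1) * (p / (p - 1)) = ps" unfolding ps_def using assms by simp
  show "N * p / (p - 1) * (1 - 1 / N) = (N - 1) * p / (p - 1)" using assms by (simp add: field_simps)
  show "N * p / (p - 1) - p / (p - 1) = (N - 1) * p / (p - 1)"
    by (simp add: diff_divide_distrib[symmetric] algebra_simps)
  show "1 / p + 1 / (p / (p - 1)) = 1" using assms by (simp add: add_divide_distrib[symmetric])
  show "p / (p - 1) > 1" using assms by (simp add: less_divide_eq)
qed

text \<open>Let F = v^ps and let P be the product of the entries. From F = g P one gets F g^(-1/N) =
  F^(1-1/N) P^(1/N); the first factor is v^q, and the arithmetic-geometric mean inequality bounds N
  P^(1/N) by the trace.\<close>

lemma transported_density_le:
  fixes D :: "'a::euclidean_space \<Rightarrow> real"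
  assumes N: "N = real DIM('a)" and g: "0 < g" and v: "0 \<le> v" and D: "\<And>b. b \<in> Basis \<Longrightarrow> 0 \<le> D b"
    and eq: "v > 0 \<Longrightarrow> v powr ps = g * (\<Prod>b\<in>Basis. D b)" and ps: "ps * (1 - 1 / N) = q"
  shows "N * (v powr ps * g powr (- (1 / N))) \<le> v powr q * (\<Sum>b\<in>Basis. D b)"
proof (cases "v = 0")
  case False
  then have v0: "v > 0" using v by simp
  have N0: "N > 0" using N by simp
  define F P where "F = v powr ps" and "P = (\<Prod>b\<in>Basis. D b)"
  have F: "F = g * P" "F > 0"
    unfolding F_def P_def using v0 by (rule eq, simp)
  have P0: "P \<ge> 0" unfolding P_def using D by (intro prod_nonneg) auto
  have "P powr (1 / N) \<le> (\<Sum>b\<in>Basis. D b / N)"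
    using arith_geom_mean[of "Basis :: 'a set" D] D unfolding P_def N by simp
  then have am: "N * P powr (1 / N) \<le> (\<Sum>b\<in>Basis. D b)"
    using N0 by (simp add: sum_divide_distrib[symmetric] field_simps)
  have "F * g powr (- (1 / N)) = F powr (1 - 1 / N) * (F powr (1 / N) * g powr (- (1 / N)))"
    using F(2) by (simp add: powr_add[symmetric] mult.assoc[symmetric])
  also have "F powr (1 / N) * g powr (- (1 / N)) = P powr (1 / N)"
    unfolding F(1) using g P0 by (simp add: powr_mult powr_minus field_simps)
  also have "F powr (1 - 1 / N) = v powr q" unfolding F_def powr_powr ps ..
  finally have "N * (F * g powr (- (1 / N))) = v powr q * (N * P powr (1 / N))" by simp
  also have "\<dots> \<le> v powr q * (\<Sum>b\<in>Basis. D b)" by (rule mult_left_mono[OF am]) simp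
  finally show ?thesis unfolding F_def .
qed simp

lemma eventually_outside_ball:
  fixes x b :: "'a::euclidean_space"
  assumes "b \<in> Basis"
  shows "eventually (\<lambda>t. norm (x + t *\<^sub>R b) > M) at_top" "eventually (\<lambda>t. norm (x + t *\<^sub>R b) > M) at_bot"
proof -
  have *: "norm (x + t *\<^sub>R b) > M" if "\<bar>t\<bar> > M + norm x" for t
  proof -
    have "norm (t *\<^sub>R b) \<le> norm (x + t *\<^sub>R b) + norm x"
      using norm_triangle_ineq4[of "x + t *\<^sub>R b" x] by simp
    then show ?thesis using that assms by simp
  qed
  show "eventually (\<lambda>t. norm (x + t *\<^sub>R b) > M) at_top"
    using eventually_gt_at_top[of "\<bar>M + norm x\<bar>"] by eventually_elim (rule *, simp)
  show "eventually (\<lambda>t. norm (x + t *\<^sub>R b) > M) at_bot"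
    using eventually_gt_at_bot[of "- \<bar>M + norm x\<bar>"] by eventually_elim (rule *, simp)
qed

text \<open>The image of the transport is bounded because the target is confined to a cube, and this
  makes all products with the gradient of \<phi> integrable. \<open>J\<close> normalises the target;
  \<open>I\<close> occurs both in the volume term and in the Hoelder factor.\<close>

theorem hsm_truncated:
  fixes \<phi> :: "(real ^ 'k) \<times> (real ^ 'm) \<Rightarrow> real" and \<zeta> :: "real ^ 'm"
  assumes \<mu>: "\<mu> > 0" and k: "CARD('k) \<ge> 2" and p: "1 < p" "p < N" and N: "N = real (CARD('k) + CARD('m))"
    and \<phi>: "test_function \<phi>" and R: "R > 0"
  defines "q \<equiv> p * (N - 1) / (N - p)" and "ps \<equiv> N * p / (N - p)" and "p' \<equiv> p / (p - 1)" and "s \<equiv> (N - 1) * p / (p - 1)"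
  defines "J \<equiv> (LINT x|lborel. rho \<mu> \<zeta> (x :: (real ^ 'k) \<times> (real ^ 'm)) powr (- (N * p / (p - 1))) * indicator (cube R) x)"
    and "I \<equiv> (LINT x|lborel. rho \<mu> \<zeta> (x :: (real ^ 'k) \<times> (real ^ 'm)) powr (- s) * indicator (cube R) x)"
    and "\<Phi> \<equiv> (LINT x|lborel. \<bar>\<phi> x\<bar> powr ps)"
  assumes J: "J > 0" and \<Phi>: "\<Phi> > 0"
  shows "integrable lborel (\<lambda>x. \<bar>\<phi> x\<bar> powr q / norm (fst x))"
    and "N * ((\<Phi> / J) powr (1 - 1 / N) * I) + \<mu> * (real CARD('k) - 1) * (LINT x|lborel. \<bar>\<phi> x\<bar> powr q / norm (fst x))
      \<le> q * (LINT x|lborel. norm (grad \<phi> x) powr p) powr (1 / p) * (\<Phi> / J * I) powr (1 / p')"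
proof -
  note ex = exponent_identities[OF p, folded q_def ps_def p'_def s_def]
  have N0: "N > 0" using p by simp
  \<comment> \<open>Gives the truncated target the mass \<Phi> of the source.\<close>
  define \<kappa> where "\<kappa> = \<Phi> / J"
  have \<kappa>: "\<kappa> > 0" unfolding \<kappa>_def using J \<Phi> by simp
  let ?e = "N * p / (p - 1)"
  let ?r = "rho \<mu> \<zeta> :: (real ^ 'k) \<times> (real ^ 'm) \<Rightarrow> real"
  define F where "F x = \<bar>\<phi> x\<bar> powr ps" for x
  define G where "G x = \<kappa> * ?r x powr (- ?e)" for x
  have r0: "0 < ?r x" "\<mu> \<le> ?r x" for x using rho_ge[OF \<mu>, where x=x and \<zeta>=\<zeta>] by auto
  have sm: "smooth \<phi>" using \<phi> by (simp add: test_function_def)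
  have phc: "continuous_on UNIV \<phi>" using sm by (rule smooth_continuous)
  have [measurable]: "\<phi> \<in> borel_measurable borel" using phc by (rule borel_measurable_continuous_onI)
  have [measurable]: "grad \<phi> \<in> borel_measurable borel"
    using smooth_grad_continuous[OF sm] by (rule borel_measurable_continuous_onI)
  obtain M where M: "M > 0" "\<And>x. norm x > M \<Longrightarrow> \<phi> x = 0" "\<And>x. norm x > M \<Longrightarrow> grad \<phi> x = 0"
    using test_function_support[OF \<phi>] by metis
  have Fi: "integrable lborel F" unfolding F_def by (rule test_function_abs_powr_integrable[OF \<phi> ex(2)])
  have Fc: "continuous_on UNIV F" unfolding F_def by (rule continuous_on_abs_powr[OF phc ex(2)])
  have Gc: "continuous_on UNIV G" unfolding G_def
    by (intro continuous_intros rho_continuous) (use r0 in \<open>auto simp: order_less_imp_not_eq2\<close>)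
  have [measurable]: "F \<in> borel_measurable borel" "G \<in> borel_measurable borel"
    using Fc Gc by (auto intro: borel_measurable_continuous_onI)
  have G0: "0 < G x" for x unfolding G_def using \<kappa> r0(1)[of x] by simp
  have Gle: "G x \<le> \<kappa> * \<mu> powr (- ?e)" for x unfolding G_def
    by (intro mult_left_mono powr_mono2') (use r0 \<kappa> \<mu> p N0 in auto)
  obtain CF where CF: "\<And>x. F x \<le> CF"
  proof -
    obtain C where "\<And>x. norm (F x) \<le> C"
      by (rule bounded_continuous_bounded_support[OF Fc, of M]) (use M(2) in \<open>auto simp: F_def\<close>)
    then show ?thesis using that[of C] by (metis abs_le_D1 real_norm_def)
  qed
  have Fsupp: "F x = 0" if "b \<in> Basis" "\<bar>x \<bullet> b\<bar> > M" for x b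
    using M(2)[of x] Basis_le_norm[OF that(1), of x] that(2) by (auto simp: F_def)
  have ri: "integrable lborel (\<lambda>x. ?r x powr (-e))" if "e > N" for e
    using rho_powr_integrable[OF \<mu>, of e \<zeta>] that N by simp
  have eN: "?e > N" "s > N"
  proof -
    have "N * (p - 1) < N * p" using N0 by simp
    then show "?e > N" using p by (simp add: less_divide_eq)
    have "N * (p - 1) < (N - 1) * p" using p by (simp add: algebra_simps)
    then show "s > N" using p by (simp add: s_def less_divide_eq)
  qed
  have ri_cube: "integrable lborel (\<lambda>x. ?r x powr (-e) * indicator (cube R) x)" if "e > N" for e
    using integrable_mult_indicator[OF _ ri[OF that], of "cube R"] by (simp add: mult.commute)
  have mass: "(\<integral>\<^sup>+x. ennreal (F x) \<partial>lborel) = (\<integral>\<^sup>+x. ennreal (G x) * indicator (cube R) x \<partial>lborel)"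
  proof -
    have "(\<integral>\<^sup>+x. ennreal (G x) * indicator (cube R) x \<partial>lborel) = (\<integral>\<^sup>+x. ennreal (\<kappa> * (?r x powr (- ?e) * indicator (cube R) x)) \<partial>lborel)"
      by (rule nn_integral_cong) (auto simp: G_def split: split_indicator)
    also have "\<dots> = ennreal (LINT x|lborel. \<kappa> * (?r x powr (- ?e) * indicator (cube R) x))"
      by (rule nn_integral_eq_integral) (use ri_cube[OF eN(1)] \<kappa> in auto)
    also have "(LINT x|lborel. \<kappa> * (?r x powr (- ?e) * indicator (cube R) x)) = \<kappa> * J" unfolding J_def by simp
    also have "\<dots> = \<Phi>" unfolding \<kappa>_def using J by simp
    also have "ennreal \<Phi> = (\<integral>\<^sup>+x. ennreal (F x) \<partial>lborel)"
    proof -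
      have "\<Phi> = (LINT x|lborel. F x)" by (simp add: \<Phi>_def F_def)
      then show ?thesis using nn_integral_eq_integral[OF Fi] by (simp add: F_def[abs_def])
    qed
    finally show ?thesis by simp
  qed
  obtain T D where Tm[measurable]: "T \<in> borel_measurable borel" and Tc: "\<And>x. T x \<in> cube R"
    and push: "\<And>h. h \<in> borel_measurable borel \<Longrightarrow> (\<integral>\<^sup>+x. ennreal (F x) * h (T x) \<partial>lborel)
           = (\<integral>\<^sup>+y. ennreal (G y) * h y * indicator (cube R) y \<partial>lborel)"
    and Dm: "\<And>b. b \<in> Basis \<Longrightarrow> D b \<in> borel_measurable borel" and D0: "\<And>b x. b \<in> Basis \<Longrightarrow> 0 \<le> D b x"
    and det: "\<And>x. F x > 0 \<Longrightarrow> F x = G (T x) * (\<Prod>b\<in>Basis. D b x)"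
    and Td: "\<And>x b t. b \<in> Basis \<Longrightarrow> \<exists>t. F (x + t *\<^sub>R b) > 0 \<Longrightarrow>
          ((\<lambda>s. T (x + s *\<^sub>R b) \<bullet> b) has_real_derivative D b (x + t *\<^sub>R b)) (at t)"
  proof (rule knothe_euclidean[OF R Fc _ CF Fsupp Gc G0 Gle mass])
  qed (auto simp: F_def)
  define V where "V x = T x + offset \<mu> \<zeta> x" for x
  have [measurable]: "V \<in> borel_measurable borel" unfolding V_def by measurable
  have Vr: "norm (V x) \<le> ?r (T x)" for x unfolding V_def by (rule norm_add_offset_le[OF \<mu>])
  \<comment> \<open>The transport formula for the test function G^(-1/N): the volume term becomes an
    integral over the target alone, in which the map no longer occurs.\<close>
  have vol: "(\<integral>\<^sup>+x. ennreal (F x * G (T x) powr (- (1 / N))) \<partial>lborel) = ennreal (\<kappa> powr (1 - 1 / N) * I)"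
  proof -
    have "(\<integral>\<^sup>+x. ennreal (F x * G (T x) powr (- (1 / N))) \<partial>lborel) = (\<integral>\<^sup>+x. ennreal (F x) * ennreal (G (T x) powr (- (1 / N))) \<partial>lborel)"
      by (rule nn_integral_cong) (simp add: ennreal_mult F_def)
    also have "\<dots> = (\<integral>\<^sup>+y. ennreal (G y) * ennreal (G y powr (- (1 / N))) * indicator (cube R) y \<partial>lborel)"
      by (rule push) measurable
    also have "\<dots> = (\<integral>\<^sup>+y. ennreal (\<kappa> powr (1 - 1 / N) * (?r y powr (- s) * indicator (cube R) y)) \<partial>lborel)"
    proof (rule nn_integral_cong)
      fix y
      have "G y * G y powr (- (1 / N)) = G y powr (1 - 1 / N)"
        using G0[of y] powr_add[of "G y" 1 "- (1 / N)"] by simp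
      also have "\<dots> = \<kappa> powr (1 - 1 / N) * ?r y powr (- s)"
      proof -
        have "- ?e * (1 - 1 / N) = - s" using ex(5) by simp
        then show ?thesis unfolding G_def using \<kappa> by (simp only: powr_mult powr_powr)
      qed
      finally show "ennreal (G y) * ennreal (G y powr (- (1 / N))) * indicator (cube R) y = ennreal (\<kappa> powr (1 - 1 / N) * (?r y powr (- s) * indicator (cube R) y))"
        using G0[of y] by (auto simp: ennreal_mult[symmetric] less_imp_le split: split_indicator)
    qed
    also have "\<dots> = ennreal (LINT y|lborel. \<kappa> powr (1 - 1 / N) * (?r y powr (- s) * indicator (cube R) y))"
      by (rule nn_integral_eq_integral) (use ri_cube[OF eN(2)] in auto)
    also have "\<dots> = ennreal (\<kappa> powr (1 - 1 / N) * I)" unfolding I_def by simp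
    finally show ?thesis .
  qed
  define w where "w x = \<bar>\<phi> x\<bar> powr q" for x
  define w' where "w' b x = q * \<bar>\<phi> x\<bar> powr (q - 1) * sgn (\<phi> x) * (grad \<phi> x \<bullet> b)" for b x
  define S' where "S' b x = D b x + \<mu> * sgn_deriv b x" for b x
  have q1: "q > 1" by (rule ex(1))
  have wm[measurable]: "w \<in> borel_measurable borel" "\<And>b. w' b \<in> borel_measurable borel"
    unfolding w_def[abs_def] w'_def[abs_def] by measurable
  have gi: "integrable lborel (\<lambda>x. \<bar>\<phi> x\<bar> powr (q - 1) * norm (grad \<phi> x))"
    by (rule integrable_continuous_bounded_support[of _ M])
       (use M q1 in \<open>auto intro!: continuous_intros continuous_on_abs_powr phc smooth_grad_continuous[OF sm]\<close>)
  obtain CV where CV: "\<And>x. norm (V x) \<le> CV"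
  proof -
    have "compact (cube R :: ((real ^ 'k) \<times> (real ^ 'm)) set)"
      unfolding compact_eq_bounded_closed by (intro conjI bounded_cube cube_closed)
    then have "compact (?r ` cube R)" by (rule compact_continuous_image[OF rho_continuous])
    then obtain C where "\<forall>v\<in>?r ` cube R. norm v \<le> C" using compact_imp_bounded bounded_iff by metis
    then have "norm (V x) \<le> C" for x using Vr[of x] Tc[of x] r0(1)[of "T x"] by force
    then show ?thesis using that by blast
  qed
  have w'V: "\<bar>w' b x * (V x \<bullet> b)\<bar> \<le> q * CV * (\<bar>\<phi> x\<bar> powr (q - 1) * norm (grad \<phi> x))" if b: "b \<in> Basis" for b x
  proof -
    have a: "\<bar>w' b x\<bar> \<le> q * (\<bar>\<phi> x\<bar> powr (q - 1) * norm (grad \<phi> x))"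
    proof -
      have "\<bar>w' b x\<bar> = q * (\<bar>\<phi> x\<bar> powr (q - 1) * (\<bar>sgn (\<phi> x)\<bar> * \<bar>grad \<phi> x \<bullet> b\<bar>))"
        unfolding w'_def using q1 by (simp add: abs_mult mult.assoc)
      also have "\<dots> \<le> q * (\<bar>\<phi> x\<bar> powr (q - 1) * (1 * norm (grad \<phi> x)))"
        by (intro mult_left_mono mult_mono Basis_le_norm[OF b]) (use q1 in \<open>auto simp: abs_sgn_eq\<close>)
      finally show ?thesis by simp
    qed
    have "\<bar>w' b x * (V x \<bullet> b)\<bar> \<le> (q * (\<bar>\<phi> x\<bar> powr (q - 1) * norm (grad \<phi> x))) * CV"
      unfolding abs_mult by (rule mult_mono[OF a order_trans[OF Basis_le_norm[OF b] CV]]) (use q1 in auto)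
    then show ?thesis by (simp add: mult_ac)
  qed
  have w'i: "integrable lborel (\<lambda>x. w' b x * (V x \<bullet> b))" if b: "b \<in> Basis" for b
    by (rule Bochner_Integration.integrable_bound[OF integrable_mult_right[OF gi, of "q * CV"]])
       (use w'V[OF b] in \<open>auto intro!: AE_I2 order_trans[OF _ abs_ge_self]\<close>)
  have S'm: "S' b \<in> borel_measurable borel" if "b \<in> Basis" for b
    unfolding S'_def[abs_def] using Dm[OF that] by measurable
  have S'0: "0 \<le> S' b x" if "b \<in> Basis" for b x
    unfolding S'_def by (intro add_nonneg_nonneg mult_nonneg_nonneg D0[OF that] sgn_deriv_nonneg less_imp_le[OF \<mu>])
  have parts: "integrable lborel (\<lambda>x. w x * S' b x)" "(LINT x|lborel. w x * S' b x) = - (LINT x|lborel. w' b x * (V x \<bullet> b))"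
    if b: "b \<in> Basis" for b
  proof -
    \<comment> \<open>\<open>w\<close> and \<open>F\<close> are positive at the same points, so
      either \<open>w\<close> vanishes on the whole line or the transport is differentiable along
      all of it. The limits are trivial since \<phi> has bounded support.\<close>
    have ae: "AE x in lborel. (\<forall>t. ((\<lambda>s. w (x + s *\<^sub>R b)) has_real_derivative w' b (x + t *\<^sub>R b)) (at t)) \<and>
      ((\<forall>t. w (x + t *\<^sub>R b) = 0) \<or>
       (\<forall>t. ((\<lambda>s. V (x + s *\<^sub>R b) \<bullet> b) has_real_derivative S' b (x + t *\<^sub>R b)) (at t)) \<and>
       ((\<lambda>t. w (x + t *\<^sub>R b) * (V (x + t *\<^sub>R b) \<bullet> b)) \<longlongrightarrow> 0) at_top \<and>
       ((\<lambda>t. w (x + t *\<^sub>R b) * (V (x + t *\<^sub>R b) \<bullet> b)) \<longlongrightarrow> 0) at_bot)"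
      using AE_line_fst_nonzero[OF b k]
    proof eventually_elim
      case (elim x)
      have "((\<lambda>s. w (x + s *\<^sub>R b)) has_real_derivative w' b (x + t *\<^sub>R b)) (at t)" for t
        unfolding w_def w'_def
        by (rule DERIV_chain2[OF DERIV_abs_powr[OF q1] smooth_line[OF sm]])
      moreover have "((\<lambda>s. V (x + s *\<^sub>R b) \<bullet> b) has_real_derivative S' b (x + t *\<^sub>R b)) (at t)"
        if "w (x + t0 *\<^sub>R b) \<noteq> 0" for t t0
      proof -
        have "F (x + t0 *\<^sub>R b) > 0" using that by (simp add: w_def F_def)
        then have "((\<lambda>s. T (x + s *\<^sub>R b) \<bullet> b) has_real_derivative D b (x + t *\<^sub>R b)) (at t)" using Td[OF b] by blast
        from DERIV_add[OF this offset_line_deriv[of x t b \<mu> \<zeta>]] show ?thesis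
          unfolding V_def S'_def inner_add_left using elim by simp
      qed
      moreover have "((\<lambda>t. w (x + t *\<^sub>R b) * (V (x + t *\<^sub>R b) \<bullet> b)) \<longlongrightarrow> 0) at_top"
        by (rule tendsto_eventually, rule eventually_mono[OF eventually_outside_ball(1)[OF b, of M x]]) (use M(2) in \<open>auto simp: w_def\<close>)
      moreover have "((\<lambda>t. w (x + t *\<^sub>R b) * (V (x + t *\<^sub>R b) \<bullet> b)) \<longlongrightarrow> 0) at_bot"
        by (rule tendsto_eventually, rule eventually_mono[OF eventually_outside_ball(2)[OF b, of M x]]) (use M(2) in \<open>auto simp: w_def\<close>)
      ultimately show ?case by blast
    qed
    have w0: "0 \<le> w x" for x by (simp add: w_def)
    show "integrable lborel (\<lambda>x. w x * S' b x)" by (rule parts_along(1)[OF b w'i[OF b] w0 S'0[OF b] wm(1) S'm[OF b] ae])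
    show "(LINT x|lborel. w x * S' b x) = - (LINT x|lborel. w' b x * (V x \<bullet> b))"
      by (rule parts_along(2)[OF b w'i[OF b] w0 S'0[OF b] wm(1) S'm[OF b] ae])
  qed
  \<comment> \<open>So far only the sum of the two nonnegative terms is known to be integrable; each
    of them is dominated by it. The Hardy integrand of \<phi> gets its integrability from
    here.\<close>
  have wE: "integrable lborel (\<lambda>x. w x * sgn_deriv b x)" "integrable lborel (\<lambda>x. w x * D b x)" if b: "b \<in> Basis" for b
  proof -
    have "0 \<le> w x * sgn_deriv b x" "0 \<le> w x * D b x" for x
      unfolding w_def by (intro mult_nonneg_nonneg D0[OF b] sgn_deriv_nonneg powr_ge_zero)+
    moreover have "w x * S' b x = w x * D b x + \<mu> * (w x * sgn_deriv b x)" for x unfolding S'_def by (simp add: algebra_simps)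
    ultimately have le: "\<mu> * (w x * sgn_deriv b x) \<le> w x * S' b x" "w x * D b x \<le> w x * S' b x" "0 \<le> w x * sgn_deriv b x" "0 \<le> w x * D b x" for x
      using \<mu> by auto
    have "integrable lborel (\<lambda>x. \<mu> * (w x * sgn_deriv b x))"
      by (rule Bochner_Integration.integrable_bound[OF parts(1)[OF b]])
         (use le \<mu> in \<open>auto intro!: AE_I2 order_trans[OF _ abs_ge_self] simp: abs_of_nonneg\<close>)
    then show "integrable lborel (\<lambda>x. w x * sgn_deriv b x)" using \<mu> by simp
    show "integrable lborel (\<lambda>x. w x * D b x)"
      by (rule Bochner_Integration.integrable_bound[OF parts(1)[OF b]])
         (use le Dm[OF b] in \<open>auto intro!: AE_I2 order_trans[OF _ abs_ge_self] simp: abs_of_nonneg\<close>)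
  qed
  have wEsum: "(\<Sum>b\<in>Basis. w x * sgn_deriv b x) = (real CARD('k) - 1) * (w x / norm (fst x))" for x
    by (simp add: sum_distrib_left[symmetric] sum_sgn_deriv mult.commute)
  have "integrable lborel (\<lambda>x. \<Sum>b\<in>Basis. w x * sgn_deriv b x)" using wE(1) by simp
  then have "integrable lborel (\<lambda>x. (real CARD('k) - 1) * (w x / norm (fst x)))" unfolding wEsum .
  then have "integrable lborel (\<lambda>x. 1 / (real CARD('k) - 1) * ((real CARD('k) - 1) * (w x / norm (fst x))))"
    by (rule integrable_mult_right)
  moreover have "1 / (real CARD('k) - 1) * ((real CARD('k) - 1) * v) = v" for v using k by simp
  ultimately have wy: "integrable lborel (\<lambda>x. w x / norm (fst x))" by simp
  then show "integrable lborel (\<lambda>x. \<bar>\<phi> x\<bar> powr q / norm (fst x))" unfolding w_def .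
  have div: "(LINT x|lborel. (\<Sum>b\<in>Basis. w x * D b x)) + \<mu> * (real CARD('k) - 1) * (LINT x|lborel. w x / norm (fst x))
      = (LINT x|lborel. - (\<Sum>b\<in>Basis. w' b x * (V x \<bullet> b)))"
  proof -
    have "(LINT x|lborel. - (\<Sum>b\<in>Basis. w' b x * (V x \<bullet> b))) = (\<Sum>b\<in>Basis. - (LINT x|lborel. w' b x * (V x \<bullet> b)))"
      using w'i by (simp add: sum_negf)
    also have "\<dots> = (\<Sum>b\<in>Basis. (LINT x|lborel. w x * S' b x))" using parts(2) by simp
    also have "\<dots> = (\<Sum>b\<in>Basis. (LINT x|lborel. w x * D b x) + \<mu> * (LINT x|lborel. w x * sgn_deriv b x))"
    proof (rule sum.cong[OF refl])
      fix b :: "(real ^ 'k) \<times> (real ^ 'm)" assume b: "b \<in> Basis"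
      have "(LINT x|lborel. w x * S' b x) = (LINT x|lborel. w x * D b x + \<mu> * (w x * sgn_deriv b x))"
        unfolding S'_def by (simp add: algebra_simps)
      then show "(LINT x|lborel. w x * S' b x) = (LINT x|lborel. w x * D b x) + \<mu> * (LINT x|lborel. w x * sgn_deriv b x)"
        using wE[OF b] by simp
    qed
    also have "\<dots> = (LINT x|lborel. (\<Sum>b\<in>Basis. w x * D b x)) + \<mu> * (LINT x|lborel. (\<Sum>b\<in>Basis. w x * sgn_deriv b x))"
      using wE by (simp add: sum.distrib sum_distrib_left)
    also have "(LINT x|lborel. (\<Sum>b\<in>Basis. w x * sgn_deriv b x)) = (real CARD('k) - 1) * (LINT x|lborel. w x / norm (fst x))"
      unfolding wEsum by (rule integral_mult_right_zero)
    finally show ?thesis by simp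
  qed
  have volume: "N * (\<kappa> powr (1 - 1 / N) * I) \<le> (LINT x|lborel. (\<Sum>b\<in>Basis. w x * D b x))"
  proof -
    have I0: "0 \<le> I" unfolding I_def by (rule Bochner_Integration.integral_nonneg) auto
    have dim: "N = real DIM((real ^ 'k) \<times> (real ^ 'm))" using N by simp
    have pt: "N * (F x * G (T x) powr (- (1 / N))) \<le> (\<Sum>b\<in>Basis. w x * D b x)" for x
    proof -
      have "\<bar>\<phi> x\<bar> powr ps = G (T x) * (\<Prod>b\<in>Basis. D b x)" if "\<bar>\<phi> x\<bar> > 0"
        using det[of x] that by (simp add: F_def)
      from transported_density_le[OF dim G0[of "T x"] abs_ge_zero D0 this ex(3)]
      show ?thesis unfolding F_def w_def by (simp add: sum_distrib_left)
    qed
    have "ennreal (N * (\<kappa> powr (1 - 1 / N) * I)) = ennreal N * (\<integral>\<^sup>+x. ennreal (F x * G (T x) powr (- (1 / N))) \<partial>lborel)"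
      unfolding vol using N0 I0 by (simp add: ennreal_mult)
    also have "\<dots> = (\<integral>\<^sup>+x. ennreal N * ennreal (F x * G (T x) powr (- (1 / N))) \<partial>lborel)"
      by (rule nn_integral_cmult[symmetric]) simp
    also have "\<dots> \<le> (\<integral>\<^sup>+x. ennreal (\<Sum>b\<in>Basis. w x * D b x) \<partial>lborel)"
      by (rule nn_integral_mono) (use pt N0 in \<open>auto simp: ennreal_mult'[symmetric] intro!: ennreal_leI\<close>)
    also have "\<dots> = ennreal (LINT x|lborel. (\<Sum>b\<in>Basis. w x * D b x))"
      by (rule nn_integral_eq_integral) (use wE(2) D0 in \<open>auto intro!: AE_I2 sum_nonneg mult_nonneg_nonneg simp: w_def\<close>)
    finally show ?thesis
      by (subst (asm) ennreal_le_iff)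
         (use D0 in \<open>auto intro!: Bochner_Integration.integral_nonneg sum_nonneg mult_nonneg_nonneg simp: w_def\<close>)
  qed
  \<comment> \<open>The partner of the gradient in Hoelder's inequality. Its power p' is at most the
    source density times the same power of \<rho> at the image point, and the transport evaluates
    that integral exactly.\<close>
  define Q where "Q x = \<bar>\<phi> x\<bar> powr (q - 1) * norm (V x)" for x
  have Q0: "0 \<le> Q x" for x unfolding Q_def by simp
  have Qm[measurable]: "Q \<in> borel_measurable borel" unfolding Q_def[abs_def] by measurable
  have Qle: "Q x powr p' \<le> F x * ?r (T x) powr p'" for x
  proof -
    have "Q x powr p' = \<bar>\<phi> x\<bar> powr ps * norm (V x) powr p'"
      unfolding Q_def by (simp add: powr_mult powr_powr ex(4))
    also have "\<dots> \<le> F x * ?r (T x) powr p'"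
      unfolding F_def by (intro mult_left_mono powr_mono2 Vr) (use ex(8) in auto)
    finally show ?thesis .
  qed
  have rT: "(\<integral>\<^sup>+x. ennreal (F x * ?r (T x) powr p') \<partial>lborel) = ennreal (\<kappa> * I)"
  proof -
    have "(\<integral>\<^sup>+x. ennreal (F x * ?r (T x) powr p') \<partial>lborel) = (\<integral>\<^sup>+x. ennreal (F x) * ennreal (?r (T x) powr p') \<partial>lborel)"
      by (rule nn_integral_cong) (simp add: ennreal_mult F_def)
    also have "\<dots> = (\<integral>\<^sup>+y. ennreal (G y) * ennreal (?r y powr p') * indicator (cube R) y \<partial>lborel)"
      by (rule push) measurable
    also have "\<dots> = (\<integral>\<^sup>+y. ennreal (\<kappa> * (?r y powr (- s) * indicator (cube R) y)) \<partial>lborel)"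
    proof (rule nn_integral_cong)
      fix y
      have "G y * ?r y powr p' = \<kappa> * ?r y powr (- ?e + p')"
        unfolding G_def by (simp only: powr_add mult.assoc)
      also have "- ?e + p' = - s" using ex(6) by simp
      finally show "ennreal (G y) * ennreal (?r y powr p') * indicator (cube R) y = ennreal (\<kappa> * (?r y powr (- s) * indicator (cube R) y))"
        using G0[of y] by (auto simp: ennreal_mult[symmetric] less_imp_le split: split_indicator)
    qed
    also have "\<dots> = ennreal (LINT y|lborel. \<kappa> * (?r y powr (- s) * indicator (cube R) y))"
      by (rule nn_integral_eq_integral) (use ri_cube[OF eN(2)] \<kappa> in auto)
    also have "\<dots> = ennreal (\<kappa> * I)" unfolding I_def by simp
    finally show ?thesis .
  qed
  have rTb: "has_bochner_integral lborel (\<lambda>x. F x * ?r (T x) powr p') (\<kappa> * I)"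
  proof (rule has_bochner_integral_nn_integral[OF _ _ _ rT])
    show "0 \<le> \<kappa> * I" unfolding I_def by (intro mult_nonneg_nonneg Bochner_Integration.integral_nonneg) (use \<kappa> in auto)
  qed (auto simp: F_def)
  then have rTi: "integrable lborel (\<lambda>x. F x * ?r (T x) powr p')" and rTv: "(LINT x|lborel. F x * ?r (T x) powr p') = \<kappa> * I"
    by (auto simp: has_bochner_integral_iff)
  have Qi: "integrable lborel (\<lambda>x. Q x powr p')"
    by (rule Bochner_Integration.integrable_bound[OF rTi])
       (use Qle in \<open>auto intro!: AE_I2 order_trans[OF _ abs_ge_self]\<close>)
  have "(LINT x|lborel. Q x powr p') \<le> \<kappa> * I"
    unfolding rTv[symmetric] by (rule integral_mono[OF Qi rTi Qle])
  then have QI: "(LINT x|lborel. Q x powr p') powr (1 / p') \<le> (\<kappa> * I) powr (1 / p')"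
    by (intro powr_mono2) (use ex(8) in \<open>auto intro: Bochner_Integration.integral_nonneg\<close>)
  have gp: "integrable lborel (\<lambda>x. norm (grad \<phi> x) powr p)"
    by (rule test_function_grad_powr_integrable[OF \<phi>]) (use p in simp)
  note hol = holder[OF p(1) ex(8) ex(7)[folded p'_def], of "\<lambda>x. norm (grad \<phi> x)" Q lborel, OF norm_ge_zero Q0 _ _ gp Qi]
  have pt: "- (\<Sum>b\<in>Basis. w' b x * (V x \<bullet> b)) \<le> q * (norm (grad \<phi> x) * Q x)" for x
  proof -
    have "(\<Sum>b\<in>Basis. w' b x * (V x \<bullet> b)) = q * \<bar>\<phi> x\<bar> powr (q - 1) * sgn (\<phi> x) * (grad \<phi> x \<bullet> V x)"
      unfolding w'_def euclidean_inner[of "grad \<phi> x" "V x"] by (simp add: sum_distrib_left mult_ac)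
    then have "- (\<Sum>b\<in>Basis. w' b x * (V x \<bullet> b)) \<le> \<bar>q * \<bar>\<phi> x\<bar> powr (q - 1) * sgn (\<phi> x) * (grad \<phi> x \<bullet> V x)\<bar>" by linarith
    also have "\<dots> = (q * \<bar>\<phi> x\<bar> powr (q - 1)) * (\<bar>sgn (\<phi> x)\<bar> * \<bar>grad \<phi> x \<bullet> V x\<bar>)"
      using q1 by (simp add: abs_mult mult.assoc)
    also have "\<dots> \<le> (q * \<bar>\<phi> x\<bar> powr (q - 1)) * (1 * (norm (grad \<phi> x) * norm (V x)))"
      by (intro mult_left_mono mult_mono Cauchy_Schwarz_ineq2) (use q1 in \<open>auto simp: abs_sgn_eq\<close>)
    finally show ?thesis by (simp add: Q_def mult_ac)
  qed
  have "(LINT x|lborel. - (\<Sum>b\<in>Basis. w' b x * (V x \<bullet> b))) \<le> (LINT x|lborel. q * (norm (grad \<phi> x) * Q x))"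
    by (rule integral_mono) (use pt w'i hol(1) in auto)
  also have "\<dots> \<le> q * ((LINT x|lborel. norm (grad \<phi> x) powr p) powr (1 / p) * (LINT x|lborel. Q x powr p') powr (1 / p'))"
    using hol(2) q1 by simp
  also have "\<dots> \<le> q * ((LINT x|lborel. norm (grad \<phi> x) powr p) powr (1 / p) * (\<kappa> * I) powr (1 / p'))"
    by (intro mult_left_mono QI) (use q1 in auto)
  finally have "(LINT x|lborel. - (\<Sum>b\<in>Basis. w' b x * (V x \<bullet> b))) \<le> q * (LINT x|lborel. norm (grad \<phi> x) powr p) powr (1 / p) * (\<kappa> * I) powr (1 / p')"
    by simp
  then show "N * ((\<Phi> / J) powr (1 - 1 / N) * I) + \<mu> * (real CARD('k) - 1) * (LINT x|lborel. \<bar>\<phi> x\<bar> powr q / norm (fst x))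
      \<le> q * (LINT x|lborel. norm (grad \<phi> x) powr p) powr (1 / p) * (\<Phi> / J * I) powr (1 / p')"
    using div volume unfolding \<kappa>_def[symmetric] w_def[symmetric] by linarith
qed

text \<open>As a function of \<open>t\<close> the left side is largest at t = \<sigma>, with value
  \<sigma>^q; this is Young's inequality for the exponents q and q/(q-1).\<close>

lemma young_optimize:
  fixes q \<sigma> t :: real
  assumes "q > 1" "\<sigma> \<ge> 0" "t \<ge> 0"
  shows "q * \<sigma> * t powr (q - 1) - (q - 1) * t powr q \<le> \<sigma> powr q"
proof -
  have e: "1 / q + 1 / (q / (q - 1)) = 1" "1 < q / (q - 1)" using assms by (auto simp: field_simps)
  have "\<sigma> * t powr (q - 1) \<le> \<sigma> powr q / q + (t powr (q - 1)) powr (q / (q - 1)) / (q / (q - 1))"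
    by (rule Youngs_inequality) (use assms e in auto)
  also have "(t powr (q - 1)) powr (q / (q - 1)) = t powr q" using assms by (simp add: powr_powr)
  finally have "q * (\<sigma> * t powr (q - 1)) \<le> q * (\<sigma> powr q / q + t powr q / (q / (q - 1)))"
    using assms by (intro mult_left_mono) auto
  also have "\<dots> = \<sigma> powr q + (q - 1) * t powr q" using assms by (simp add: field_simps)
  finally show ?thesis by (simp add: mult.assoc)
qed

section \<open>Removing the cube and optimising the norm parameter\<close>

lemma cube_limit:
  fixes f :: "'a::euclidean_space \<Rightarrow> real"
  assumes "integrable lborel f"
  shows "(\<lambda>n. LINT x|lborel. f x * indicator (cube (real n)) x) \<longlonglongrightarrow> (LINT x|lborel. f x)"
proof (rule integral_dominated_convergence[where w="\<lambda>x. \<bar>f x\<bar>"])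
  show "AE x in lborel. (\<lambda>n. f x * indicator (cube (real n)) x) \<longlonglongrightarrow> f x"
  proof (rule AE_I2)
    fix x :: 'a
    obtain n0 :: nat where n0: "norm x \<le> real n0" using real_arch_simple by blast
    have "\<forall>n\<ge>n0. f x * indicator (cube (real n)) x = f x"
    proof (intro allI impI)
      fix n assume "n \<ge> n0"
      then have "x \<in> cube (real n)" unfolding cube_def
        using n0 Basis_le_norm[of _ x] by (auto simp: abs_le_iff) (smt (verit) of_nat_mono)+
      then show "f x * indicator (cube (real n)) x = f x" by simp
    qed
    then show "(\<lambda>n. f x * indicator (cube (real n)) x) \<longlonglongrightarrow> f x"
      by (intro tendsto_eventually) (unfold eventually_sequentially, blast)
  qed
  show "\<And>n. AE x in lborel. norm (f x * indicator (cube (real n)) x) \<le> \<bar>f x\<bar>"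
    by (auto split: split_indicator)
qed (use assms in auto)

text \<open>The parameter \<open>ky\<close> only fixes the type \<open>'k\<close>. Below, \<open>q\<close> and \<open>ps\<close> are the Hardy-Sobolev and the Sobolev
  exponent, \<open>p'\<close> is conjugate to \<open>p\<close>, the extremal is a multiple of \<open>r\<^bsup>-a\<^esup>\<close>, and \<open>s = a q\<close>.\<close>

locale hsm_setup =
  fixes \<mu> p N :: real and \<zeta> :: "real ^ 'm" and ky :: "'k::finite itself"
  assumes \<mu>: "\<mu> > 0" and k2: "CARD('k) \<ge> 2" and p1: "1 < p" and pN: "p < N"
    and N: "N = real (CARD('k) + CARD('m))"
begin

definition "a = (N - p) / (p - 1)"
definition "q = p * (N - 1) / (N - p)"
definition "ps = N * p / (N - p)"
definition "p' = p / (p - 1)"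
definition "s = (N - 1) * p / (p - 1)"

abbreviation r :: "(real ^ 'k) \<times> (real ^ 'm) \<Rightarrow> real" where "r \<equiv> rho \<mu> \<zeta>"

definition "I = (LINT x|lborel. r x powr (- s))"
definition "J = (LINT x|lborel. r x powr (- (N * p / (p - 1))))"

lemmas ex = exponent_identities[OF p1 pN, folded q_def ps_def p'_def s_def]

text \<open>\<open>a * q = s\<close> and \<open>(a + 1) * p = s\<close> say that the Hardy numerator
  and the p-th power of the gradient of r^(-a) are both multiples of r^(-s), and
  \<open>a * ps = N * p / (p - 1)\<close> identifies the ps-th power of r^(-a) with the integrand of
  \<open>J\<close>. \<open>s = N + a\<close> yields the constant in the equality case, and
  \<open>(q - 1) * a = N\<close> the form required by \<open>young_optimize\<close>.\<close>

lemma exponents: "N > 0" "a > 0" "(q - 1) * a = N" "a * (q - 1) = N" "s = N + a" "a * q = s" "a * ps = N * p / (p - 1)" "(a + 1) * p = s"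
  "N * p / (p - 1) > N" "s > N" "s > 0" "ps > 1" "q > 1" "p' > 1" "ps / p' = q - 1"
proof -
  show N0: "N > 0" using p1 pN by simp
  show a0: "a > 0" using p1 pN by (simp add: a_def)
  have nz: "p - 1 \<noteq> 0" "N - p \<noteq> 0" using p1 pN by auto
  have q1: "q - 1 = N * (p - 1) / (N - p)" unfolding q_def using nz by (simp add: field_simps)
  show "(q - 1) * a = N" unfolding q1 a_def using nz by simp
  then show "a * (q - 1) = N" by (simp add: mult.commute)
  show sN: "s = N + a" unfolding s_def a_def using nz by (simp add: field_simps)
  show "a * q = s" using \<open>(q - 1) * a = N\<close> sN by (simp add: algebra_simps)
  show "a * ps = N * p / (p - 1)" unfolding a_def ps_def using nz by simp
  have "a + 1 = (N - 1) / (p - 1)" unfolding a_def using nz by (simp add: field_simps)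
  then show "(a + 1) * p = s" unfolding s_def by simp
  have "N * (p - 1) < N * p" using N0 by simp
  then show "N * p / (p - 1) > N" using p1 by (simp add: less_divide_eq)
  show "s > N" "s > 0" using sN a0 N0 by auto
  have "N * p > N - p" using p1 pN by (smt (verit) mult_le_cancel_left1)
  then show "ps > 1" unfolding ps_def using pN by (simp add: less_divide_eq)
  show "q > 1" "p' > 1" using ex by auto
  then show "ps / p' = q - 1" using ex(4) by (simp add: field_simps)
qed

lemma r_pos: "0 < r x" using rho_ge(4)[OF \<mu>] .

lemma r_powr_integrable: "e > N \<Longrightarrow> integrable lborel (\<lambda>x. r x powr (- e))"
  using rho_powr_integrable[OF \<mu>, of e \<zeta>] N by simp

lemma IJ_pos: "I > 0" "J > 0"
proof -
  have r: "0 < r x powr e" for x e using r_pos[of x] by simp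
  show "I > 0" unfolding I_def by (rule integral_pos_of_pos[OF r_powr_integrable[OF exponents(10)] r])
  show "J > 0" unfolding J_def by (rule integral_pos_of_pos[OF r_powr_integrable[OF exponents(9)] r])
qed

definition "energy \<phi> = (LINT x|lborel. norm (grad \<phi> x) powr p) powr (1 / p)"

text \<open>The limit of the truncated inequalities. \<open>t\<close> is the norm of \<phi> in L^ps
  relative to that of r^(-a), the free parameter left to be optimised.\<close>

lemma hsm_parametric:
  fixes \<phi> :: "(real ^ 'k) \<times> (real ^ 'm) \<Rightarrow> real"
  assumes \<phi>: "test_function \<phi>" and pos: "(LINT x|lborel. \<bar>\<phi> x\<bar> powr ps) > 0"
  defines "t \<equiv> ((LINT x|lborel. \<bar>\<phi> x\<bar> powr ps) / J) powr (1 / ps)"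
  shows "integrable lborel (\<lambda>x. \<bar>\<phi> x\<bar> powr q / norm (fst x))"
    and "N * t powr q * I + \<mu> * (real CARD('k) - 1) * (LINT x|lborel. \<bar>\<phi> x\<bar> powr q / norm (fst x))
      \<le> q * energy \<phi> * t powr (q - 1) * I powr (1 / p')"
proof -
  let ?J = "\<lambda>n. (LINT x|lborel. r x powr (- (N * p / (p - 1))) * indicator (cube (real n)) x)"
  let ?I = "\<lambda>n. (LINT x|lborel. r x powr (- s) * indicator (cube (real n)) x)"
  define \<Phi> where "\<Phi> = (LINT x|lborel. \<bar>\<phi> x\<bar> powr ps)"
  let ?W = "LINT x|lborel. \<bar>\<phi> x\<bar> powr q / norm (fst x)"
  have Jl: "?J \<longlonglongrightarrow> J" unfolding J_def by (rule cube_limit[OF r_powr_integrable[OF exponents(9)]])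
  have Il: "?I \<longlonglongrightarrow> I" unfolding I_def by (rule cube_limit[OF r_powr_integrable[OF exponents(10)]])
  \<comment> \<open>A degenerate cube carries no mass, so the truncated inequality is only available
    eventually.\<close>
  have ev: "\<forall>\<^sub>F n in sequentially. ?J n > 0 \<and> real n > 0"
    using order_tendstoD(1)[OF Jl IJ_pos(2)] eventually_gt_at_top[of 0] by eventually_elim auto
  note tr = hsm_truncated[OF \<mu> k2 p1 pN N \<phi>, folded q_def ps_def p'_def s_def, where \<zeta>=\<zeta>]
  obtain n where n: "?J n > 0" "real n > 0" using eventually_happens[OF ev] by auto
  show "integrable lborel (\<lambda>x. \<bar>\<phi> x\<bar> powr q / norm (fst x))" by (rule tr(1)[OF n(2,1) pos])
  have ineq: "\<forall>\<^sub>F n in sequentially. N * ((\<Phi> / ?J n) powr (1 - 1 / N) * ?I n) + \<mu> * (real CARD('k) - 1) * ?W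
      \<le> q * energy \<phi> * (\<Phi> / ?J n * ?I n) powr (1 / p')"
    using ev by eventually_elim (use tr(2) pos in \<open>simp add: energy_def \<Phi>_def\<close>)
  have \<Phi>0: "\<Phi> > 0" using pos by (simp add: \<Phi>_def)
  have JI: "\<Phi> / J > 0" "\<Phi> / J * I > 0" using \<Phi>0 IJ_pos by auto
  have lim1: "(\<lambda>n. N * ((\<Phi> / ?J n) powr (1 - 1 / N) * ?I n) + \<mu> * (real CARD('k) - 1) * ?W) \<longlonglongrightarrow>
      N * ((\<Phi> / J) powr (1 - 1 / N) * I) + \<mu> * (real CARD('k) - 1) * ?W"
    by (intro tendsto_intros Jl Il) (use IJ_pos JI in auto)
  have lim2: "(\<lambda>n. q * energy \<phi> * (\<Phi> / ?J n * ?I n) powr (1 / p')) \<longlonglongrightarrow> q * energy \<phi> * (\<Phi> / J * I) powr (1 / p')"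
    by (intro tendsto_intros Jl Il) (use IJ_pos JI in auto)
  have le: "N * ((\<Phi> / J) powr (1 - 1 / N) * I) + \<mu> * (real CARD('k) - 1) * ?W \<le> q * energy \<phi> * (\<Phi> / J * I) powr (1 / p')"
    by (rule tendsto_le[OF _ lim2 lim1 ineq]) simp
  have t: "t = (\<Phi> / J) powr (1 / ps)" unfolding t_def \<Phi>_def ..
  have t1: "(\<Phi> / J) powr (1 - 1 / N) = t powr q"
  proof -
    have "1 / ps * q = 1 - 1 / N" by (subst ex(3)[symmetric]) (use ex(2) in simp)
    then show ?thesis unfolding t powr_powr by (simp only:)
  qed
  have "(\<Phi> / J) = t powr ps" 
  proof -
    have "1 / ps * ps = 1" using ex(2) by simp
    then show ?thesis unfolding t powr_powr using powr_one[OF less_imp_le[OF JI(1)]] by (simp only:)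
  qed
  then have t2: "(\<Phi> / J * I) powr (1 / p') = t powr (q - 1) * I powr (1 / p')"
    using IJ_pos exponents(15) by (simp add: powr_mult powr_powr)
  show "N * t powr q * I + \<mu> * (real CARD('k) - 1) * ?W \<le> q * energy \<phi> * t powr (q - 1) * I powr (1 / p')"
    using le unfolding t1 t2 by (simp add: mult.assoc)
qed

text \<open>The result of solving \<open>N * I * t \<le> q * energy \<phi> * I powr (1 / p')\<close>
  for the norm of \<phi>. It makes no claim to be optimal; its purpose is the closure
  argument.\<close>

definition "sobolev_constant = q * I powr (1 / p') / (N * I) * J powr (1 / ps)"

theorem sobolev_test:
  fixes \<phi> :: "(real ^ 'k) \<times> (real ^ 'm) \<Rightarrow> real"
  assumes \<phi>: "test_function \<phi>"
  shows "(LINT x|lborel. \<bar>\<phi> x\<bar> powr ps) powr (1 / ps) \<le> sobolev_constant * energy \<phi>"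
proof -
  define \<Phi> where "\<Phi> = (LINT x|lborel. \<bar>\<phi> x\<bar> powr ps)"
  have sc: "sobolev_constant \<ge> 0" unfolding sobolev_constant_def using exponents(1,2,13) IJ_pos by simp
  have en: "energy \<phi> \<ge> 0" by (simp add: energy_def)
  have \<Phi>0: "\<Phi> \<ge> 0" unfolding \<Phi>_def by (rule Bochner_Integration.integral_nonneg) simp
  show ?thesis
  proof (cases "\<Phi> = 0")
    case True then show ?thesis using sc en unfolding \<Phi>_def[symmetric] by simp
  next
    case False
    then have pos: "\<Phi> > 0" using \<Phi>0 by simp
    define t where "t = (\<Phi> / J) powr (1 / ps)"
    have t0: "t > 0" unfolding t_def using pos IJ_pos by simp
    have W: "0 \<le> (LINT x|lborel. \<bar>\<phi> x\<bar> powr q / norm (fst x))" by (rule Bochner_Integration.integral_nonneg) simp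
    have "0 \<le> \<mu> * (real CARD('k) - 1) * (LINT x|lborel. \<bar>\<phi> x\<bar> powr q / norm (fst x))"
      using \<mu> k2 W by (intro mult_nonneg_nonneg) auto
    then have "N * t powr q * I \<le> q * energy \<phi> * t powr (q - 1) * I powr (1 / p')"
      using hsm_parametric(2)[OF \<phi>] pos unfolding \<Phi>_def t_def by fastforce
    moreover have "t powr q = t * t powr (q - 1)" using t0 powr_add[of t 1 "q - 1"] by simp
    ultimately have "(N * I * t) * t powr (q - 1) \<le> (q * energy \<phi> * I powr (1 / p')) * t powr (q - 1)"
      by (simp add: mult_ac)
    then have le: "N * I * t \<le> q * energy \<phi> * I powr (1 / p')" using t0 by simp
    have "\<Phi> powr (1 / ps) = t * J powr (1 / ps)"
      unfolding t_def using pos IJ_pos by (simp add: powr_divide)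
    also have "t = (N * I * t) / (N * I)" using exponents(1,2,13) IJ_pos by simp
    also have "\<dots> * J powr (1 / ps) \<le> (q * energy \<phi> * I powr (1 / p')) / (N * I) * J powr (1 / ps)"
      by (intro mult_right_mono divide_right_mono le) (use exponents(1,2) IJ_pos in auto)
    also have "\<dots> = sobolev_constant * energy \<phi>" by (simp add: sobolev_constant_def)
    finally show ?thesis unfolding \<Phi>_def .
  qed
qed

text \<open>Measured in units of \<open>a * I powr (1 / p)\<close>, the gradient norm of r^(-a), the
  energy becomes \<sigma>, and the right side of the parametric inequality minus its volume term
  becomes a I (q \<sigma> t^(q-1) - (q-1) t^q). Maximising removes \<open>t\<close>. A test function
  that vanishes almost everywhere has no mass to transport and is treated apart.\<close>

theorem hsm_test:
  fixes \<phi> :: "(real ^ 'k) \<times> (real ^ 'm) \<Rightarrow> real"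
  assumes \<phi>: "test_function \<phi>"
  shows "integrable lborel (\<lambda>x. \<bar>\<phi> x\<bar> powr q / norm (fst x))"
    and "\<mu> * (real CARD('k) - 1) * (LINT x|lborel. \<bar>\<phi> x\<bar> powr q / norm (fst x))
      \<le> a * I * (energy \<phi> / (a * I powr (1 / p))) powr q"
proof -
  define \<Phi> where "\<Phi> = (LINT x|lborel. \<bar>\<phi> x\<bar> powr ps)"
  have \<Phi>0: "\<Phi> \<ge> 0" unfolding \<Phi>_def by (rule Bochner_Integration.integral_nonneg) simp
  have [measurable]: "\<phi> \<in> borel_measurable borel"
    by (rule borel_measurable_continuous_onI) (use \<phi> in \<open>simp add: smooth_continuous test_function_def\<close>)
  have "integrable lborel (\<lambda>x. \<bar>\<phi> x\<bar> powr q / norm (fst x)) \<and> \<mu> * (real CARD('k) - 1) * (LINT x|lborel. \<bar>\<phi> x\<bar> powr q / norm (fst x))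
      \<le> a * I * (energy \<phi> / (a * I powr (1 / p))) powr q"
  proof (cases "\<Phi> = 0")
    case True
    then have "AE x in lborel. \<bar>\<phi> x\<bar> powr ps = 0"
      using integral_nonneg_eq_0_iff_AE[OF test_function_abs_powr_integrable[OF \<phi>, of ps]] ex(2) by (simp add: \<Phi>_def)
    then have ae: "AE x in lborel. \<bar>\<phi> x\<bar> powr q / norm (fst x) = 0" by eventually_elim auto
    have m: "(\<lambda>x. \<bar>\<phi> x\<bar> powr q / norm (fst x)) \<in> borel_measurable lborel"
      by measurable
    have "integrable lborel (\<lambda>x. \<bar>\<phi> x\<bar> powr q / norm (fst x))"
      using integrable_cong_AE[OF m _ ae] by simp
    moreover have "(LINT x|lborel. \<bar>\<phi> x\<bar> powr q / norm (fst x)) = 0" by (rule integral_eq_zero_AE[OF ae])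
    ultimately show ?thesis using exponents(1,2,13) IJ_pos by simp
  next
    case False
    then have "\<Phi> > 0" using \<Phi>0 by simp
    then have pos: "(LINT x|lborel. \<bar>\<phi> x\<bar> powr ps) > 0" unfolding \<Phi>_def .
    define t where "t = (\<Phi> / J) powr (1 / ps)"
    define \<sigma> where "\<sigma> = energy \<phi> / (a * I powr (1 / p))"
    have \<sigma>0: "\<sigma> \<ge> 0" unfolding \<sigma>_def energy_def using exponents(1,2) by simp
    have "energy \<phi> = \<sigma> * (a * I powr (1 / p))" unfolding \<sigma>_def using exponents(1,2,13) IJ_pos by simp
    moreover have "I powr (1 / p) * I powr (1 / p') = I" using IJ_pos ex(7) by (simp add: powr_add[symmetric])
    ultimately have e1: "q * energy \<phi> * t powr (q - 1) * I powr (1 / p') = a * I * (q * \<sigma> * t powr (q - 1))"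
      by (simp add: mult_ac)
    have e2: "N * t powr q * I = a * I * ((q - 1) * t powr q)" 
    proof -
      have "N * t powr q * I = ((q - 1) * a) * t powr q * I" by (simp only: exponents(3))
      then show ?thesis by (simp only: mult_ac)
    qed
    have "\<mu> * (real CARD('k) - 1) * (LINT x|lborel. \<bar>\<phi> x\<bar> powr q / norm (fst x))
      \<le> a * I * (q * \<sigma> * t powr (q - 1)) - a * I * ((q - 1) * t powr q)"
      using hsm_parametric(2)[OF \<phi> pos] unfolding \<Phi>_def[symmetric] t_def[symmetric] e1 e2 by linarith
    also have "\<dots> = a * I * (q * \<sigma> * t powr (q - 1) - (q - 1) * t powr q)" by (simp add: right_diff_distrib)
    also have "\<dots> \<le> a * I * \<sigma> powr q"
      by (intro mult_left_mono young_optimize) (use exponents(1,2,13) IJ_pos \<sigma>0 in \<open>auto simp: t_def\<close>)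
    finally show ?thesis using hsm_parametric(1)[OF \<phi> pos] unfolding \<sigma>_def by blast
  qed
  then show "integrable lborel (\<lambda>x. \<bar>\<phi> x\<bar> powr q / norm (fst x))"
    and "\<mu> * (real CARD('k) - 1) * (LINT x|lborel. \<bar>\<phi> x\<bar> powr q / norm (fst x))
      \<le> a * I * (energy \<phi> / (a * I powr (1 / p))) powr q" by auto
qed

end

subsection \<open>Weak gradients\<close>

text \<open>Hoelder's inequality against the weight (f + g)^(p-1), whose p'-th power is (f + g)^p; a
  bound through the maximum of f and g first makes this integrable.\<close>

theorem minkowski:
  fixes f g :: "'a \<Rightarrow> real"
  assumes p: "1 < p" and nn: "\<And>x. 0 \<le> f x" "\<And>x. 0 \<le> g x"
    and m[measurable]: "f \<in> borel_measurable M" "g \<in> borel_measurable M"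
    and i: "integrable M (\<lambda>x. f x powr p)" "integrable M (\<lambda>x. g x powr p)"
  shows "integrable M (\<lambda>x. (f x + g x) powr p)"
    and "(LINT x|M. (f x + g x) powr p) powr (1 / p) \<le> (LINT x|M. f x powr p) powr (1 / p) + (LINT x|M. g x powr p) powr (1 / p)"
proof -
  define p' where "p' = p / (p - 1)"
  have p': "1 < p'" "1 / p + 1 / p' = 1" "(p - 1) * p' = p" using p by (auto simp: p'_def field_simps)
  let ?h = "\<lambda>x. f x + g x"
  have bd: "?h x powr p \<le> 2 powr p * (f x powr p + g x powr p)" for x
  proof -
    have "?h x \<le> 2 * max (f x) (g x)" by simp
    then have "?h x powr p \<le> (2 * max (f x) (g x)) powr p" using nn[of x] p by (intro powr_mono2) auto
    also have "\<dots> = 2 powr p * max (f x) (g x) powr p" using nn by (simp add: powr_mult)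
    also have "max (f x) (g x) powr p \<le> f x powr p + g x powr p" by (simp add: max_def)
    finally show ?thesis by simp
  qed
  show hi: "integrable M (\<lambda>x. ?h x powr p)"
    by (rule Bochner_Integration.integrable_bound[of _ "\<lambda>x. 2 powr p * (f x powr p + g x powr p)"])
       (use i bd in \<open>auto intro!: AE_I2\<close>)
  let ?w = "\<lambda>x. ?h x powr (p - 1)"
  have wi: "integrable M (\<lambda>x. ?w x powr p')" using hi by (simp add: powr_powr p')
  have w0: "0 \<le> ?w x" for x by simp
  have wm: "?w \<in> borel_measurable M" by measurable
  define H where "H = (LINT x|M. ?h x powr p)"
  define A B where "A = (LINT x|M. f x powr p) powr (1 / p)" and "B = (LINT x|M. g x powr p) powr (1 / p)"
  have H0: "0 \<le> H" unfolding H_def by (rule Bochner_Integration.integral_nonneg) simp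
  have AB: "0 \<le> A" "0 \<le> B" by (auto simp: A_def B_def)
  note h1 = holder[OF p p'(1,2) nn(1) w0 m(1) wm i(1) wi] and h2 = holder[OF p p'(1,2) nn(2) w0 m(2) wm i(2) wi]
  have Hw: "(LINT x|M. ?w x powr p') = H" by (simp add: powr_powr p' H_def)
  have "H = (LINT x|M. f x * ?w x + g x * ?w x)"
    unfolding H_def
  proof (rule Bochner_Integration.integral_cong[OF refl])
    fix x show "?h x powr p = f x * ?w x + g x * ?w x"
    proof (cases "?h x = 0")
      case True then show ?thesis using nn[of x] by (simp add: add_nonneg_eq_0_iff)
    next
      case False
      then have "?h x > 0" using nn[of x] by (simp add: less_le)
      then have "?h x powr p = ?h x * ?w x" using powr_add[of "?h x" 1 "p - 1"] by simp
      then show ?thesis by (simp add: distrib_right)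
    qed
  qed
  also have "\<dots> = (LINT x|M. f x * ?w x) + (LINT x|M. g x * ?w x)" using h1(1) h2(1) by simp
  also have "\<dots> \<le> A * H powr (1 / p') + B * H powr (1 / p')"
    unfolding A_def B_def Hw[symmetric] by (intro add_mono h1(2) h2(2))
  finally have le: "H \<le> (A + B) * H powr (1 / p')" by (simp add: distrib_right)
  show "H powr (1 / p) \<le> A + B"
  proof (cases "H = 0")
    case False
    then have "H > 0" using H0 by simp
    moreover from this have "H = H powr (1 / p) * H powr (1 / p')" using p'(2) by (simp add: powr_add[symmetric])
    ultimately have "H powr (1 / p) * H powr (1 / p') \<le> (A + B) * H powr (1 / p')" using le by linarith
    then show ?thesis using \<open>H > 0\<close> by simp
  qed (use AB in simp)
qed

section \<open>Local integrability and testing with box bumps\<close>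

lemma locally_integrable_measurable:
  fixes f :: "'a::euclidean_space \<Rightarrow> 'b::euclidean_space"
  assumes "locally_integrable f" shows "f \<in> borel_measurable borel"
proof (rule borel_measurable_LIMSEQ_metric)
  fix n :: nat
  have "set_integrable lborel (cball 0 (real n)) f" using assms by (simp add: locally_integrable_def)
  then show "(\<lambda>x. indicator (cball 0 (real n)) x *\<^sub>R f x) \<in> borel_measurable borel"
    unfolding set_integrable_def by (auto dest: borel_measurable_integrable)
next
  fix x :: 'a
  obtain n0 :: nat where n0: "norm x \<le> real n0" using real_arch_simple by blast
  have "\<forall>n\<ge>n0. indicator (cball 0 (real n)) x *\<^sub>R f x = f x"
  proof (intro allI impI)
    fix n assume "n0 \<le> n"
    then have "real n0 \<le> real n" by simp
    then show "indicator (cball 0 (real n)) x *\<^sub>R f x = f x" using n0 by (simp add: indicator_def)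
  qed
  then show "(\<lambda>n. indicator (cball 0 (real n)) x *\<^sub>R f x) \<longlonglongrightarrow> f x"
    by (intro tendsto_eventually) (unfold eventually_sequentially, blast)
qed

lemma bounded_locally_integrable:
  fixes f :: "'a::euclidean_space \<Rightarrow> 'b::euclidean_space"
  assumes [measurable]: "f \<in> borel_measurable borel" and "\<And>x. norm (f x) \<le> C"
  shows "locally_integrable f"
  unfolding locally_integrable_def set_integrable_def
proof (intro allI impI)
  fix K :: "'a set" assume K: "compact K"
  then have [measurable]: "K \<in> sets borel" by (simp add: compact_imp_closed)
  have "integrable lborel (\<lambda>x. C * indicator K x :: real)"
    by (intro integrable_mult_right integrable_real_indicator) (use K emeasure_compact_finite in auto)
  then show "integrable lborel (\<lambda>x. indicator K x *\<^sub>R f x)"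
    by (rule Bochner_Integration.integrable_bound)
       (use assms(2) in \<open>auto split: split_indicator intro!: AE_I2 order_trans[OF _ abs_ge_self]\<close>)
qed

lemma integrable_test_mult:
  fixes f :: "'a::euclidean_space \<Rightarrow> 'b::euclidean_space"
  assumes f: "locally_integrable f" and c: "continuous_on UNIV \<theta>" and s: "\<And>x. norm x > M \<Longrightarrow> \<theta> x = (0::real)"
  shows "integrable lborel (\<lambda>x. \<theta> x *\<^sub>R f x)"
proof -
  obtain C where C: "C > 0" "\<And>x. norm (\<theta> x) \<le> C" using bounded_continuous_bounded_support[OF c s] by metis
  have [measurable]: "f \<in> borel_measurable borel" by (rule locally_integrable_measurable[OF f])
  have [measurable]: "\<theta> \<in> borel_measurable borel" by (rule borel_measurable_continuous_onI[OF c])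
  have "set_integrable lborel (cball 0 M) f" using f by (simp add: locally_integrable_def)
  then have "integrable lborel (\<lambda>x. C *\<^sub>R (indicator (cball 0 M) x *\<^sub>R f x))"
    unfolding set_integrable_def by (rule integrable_scaleR_right)
  then show ?thesis
  proof (rule Bochner_Integration.integrable_bound)
    show "AE x in lborel. norm (\<theta> x *\<^sub>R f x) \<le> norm (C *\<^sub>R (indicator (cball 0 M) x *\<^sub>R f x))"
    proof (rule AE_I2)
      fix x show "norm (\<theta> x *\<^sub>R f x) \<le> norm (C *\<^sub>R (indicator (cball 0 M) x *\<^sub>R f x))"
        using C s[of x] by (cases "norm x \<le> M") (auto intro!: mult_right_mono simp: indicator_def)
    qed
  qed simp
qed

lemma locally_integrable_inner:
  fixes f :: "'a::euclidean_space \<Rightarrow> 'b::euclidean_space"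
  assumes "locally_integrable f" shows "locally_integrable (\<lambda>x. f x \<bullet> b)"
  unfolding locally_integrable_def set_integrable_def
proof (intro allI impI)
  fix K :: "'a set" assume "compact K"
  then have "integrable lborel (\<lambda>x. indicator K x *\<^sub>R f x)"
    using assms by (simp add: locally_integrable_def set_integrable_def)
  from integrable_inner_left[OF this, of b] show "integrable lborel (\<lambda>x. indicator K x *\<^sub>R (f x \<bullet> b))" by simp
qed

lemma locally_integrable_diff:
  "locally_integrable f \<Longrightarrow> locally_integrable g \<Longrightarrow> locally_integrable (\<lambda>x. f x - g x)"
  unfolding locally_integrable_def by (auto intro: set_integral_diff(1))

text \<open>The bumps tend to indicators of boxes, and boxes are an intersection-stable generator of
  the Borel sets. As \<open>h\<close> is only locally integrable, it is first restricted to one box;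
  countably many boxes exhaust the space at the end.\<close>

lemma AE_zero_of_box_bumps:
  fixes h :: "'a::euclidean_space \<Rightarrow> real"
  assumes h: "locally_integrable h" and z: "\<And>l u j. (LINT x|lborel. box_bump l u j x * h x) = 0"
  shows "AE x in lborel. h x = 0"
proof -
  have [measurable]: "h \<in> borel_measurable borel" by (rule locally_integrable_measurable[OF h])
  have hb: "integrable lborel (\<lambda>x. indicator (box l u) x * h x)" for l u
  proof -
    have "set_integrable lborel (cbox l u) h" using h by (simp add: locally_integrable_def)
    then have "set_integrable lborel (box l u) h" by (rule set_integrable_subset) (auto simp: box_subset_cbox)
    then show ?thesis by (simp add: set_integrable_def)
  qed
  have box0: "(LINT x|lborel. indicator (box l u) x * h x) = 0" for l u
  proof -
    have "(\<lambda>j. LINT x|lborel. box_bump l u j x * h x) \<longlonglongrightarrow> (LINT x|lborel. indicator (box l u) x * h x)"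
    proof (rule integral_dominated_convergence[where w="\<lambda>x. \<bar>indicator (box l u) x * h x\<bar>"])
      show "AE x in lborel. (\<lambda>j. box_bump l u j x * h x) \<longlonglongrightarrow> indicator (box l u) x * h x"
        by (intro AE_I2 tendsto_mult box_bump_limit tendsto_const)
      show "AE x in lborel. norm (box_bump l u j x * h x) \<le> \<bar>indicator (box l u) x * h x\<bar>" for j
      proof (rule AE_I2)
        fix x show "norm (box_bump l u j x * h x) \<le> \<bar>indicator (box l u) x * h x\<bar>"
          using box_bump_bounds[of l u j x] box_bump_outside[of x l u j]
          by (cases "x \<in> box l u") (auto simp: abs_mult intro!: mult_left_le_one_le)
      qed
      have "box_bump l u j \<in> borel_measurable borel" for j
        by (intro borel_measurable_continuous_onI smooth_continuous test_function_smooth box_bump_test)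
      then show "(\<lambda>x. box_bump l u j x * h x) \<in> borel_measurable lborel" for j by simp
    qed (use hb in auto)
    then show ?thesis unfolding z using LIMSEQ_unique tendsto_const by blast
  qed
  have B: "AE x in lborel. indicator (box l u) x * h x = 0" for l u :: 'a
  proof (rule sigma_finite_measure.density_zero[OF lborel.sigma_finite_measure_axioms hb])
    let ?h = "\<lambda>x. indicator (box l u) x * h x"
    fix A :: "'a set" assume "A \<in> sets lborel"
    then have "A \<in> sigma_sets UNIV (range (\<lambda>(a, b). box a b))"
      by (simp add: borel_eq_box)
    have st: "Int_stable (range (\<lambda>(a, b). box a b) :: 'a set set)" by (auto simp: Int_stable_def box_Int_box)
    have pw: "(range (\<lambda>(a, b). box a b) :: 'a set set) \<subseteq> Pow UNIV" by simp
    from st pw \<open>A \<in> sigma_sets UNIV _\<close> have "(LINT x|lborel. indicator A x * ?h x) = 0"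
    proof (induction A rule: sigma_sets_induct_disjoint)
      case (basic A)
      then obtain c d where A: "A = box c d" by auto
      have "\<exists>e f. box c d \<inter> box l u = box e f" using box_Int_box[of c d l u] by blast
      then obtain e f where ef: "box c d \<inter> box l u = box e f" by blast
      have "(\<lambda>x. indicator A x * ?h x) = (\<lambda>x. indicator (box e f) x * h x)"
        unfolding A ef[symmetric] by (simp add: indicator_inter_arith mult.assoc)
      then show ?case by (simp only: box0)
    next
      case empty then show ?case by simp
    next
      case (compl A)
      have [measurable]: "A \<in> sets borel" using compl(1) by (simp add: borel_eq_box)
      have "(LINT x|lborel. indicator (UNIV - A) x * ?h x) = (LINT x|lborel. ?h x - indicator A x * ?h x)"
        by (rule Bochner_Integration.integral_cong) (auto split: split_indicator)
      also have "\<dots> = (LINT x|lborel. ?h x) - (LINT x|lborel. indicator A x * ?h x)"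
        by (rule Bochner_Integration.integral_diff[OF hb]) (use integrable_mult_indicator[OF _ hb, of A] in simp)
      finally show ?case using compl box0 by simp
    next
      case (union A)
      have Am[measurable]: "A i \<in> sets borel" for i using union(2) by (auto simp: borel_eq_box)
      have "(LINT x:(\<Union>i. A i)|lborel. ?h x) = (\<Sum>i. (LINT x:(A i)|lborel. ?h x))"
      proof (rule lebesgue_integral_countable_add)
        show "A i \<inter> A j = {}" if "i \<noteq> j" for i j using union(1) that by (auto simp: disjoint_family_on_def)
        show "set_integrable lborel (\<Union>i. A i) ?h"
          unfolding set_integrable_def by (rule integrable_mult_indicator[OF _ hb]) simp
      qed simp
      then show ?case using union(3) by (simp add: set_lebesgue_integral_def)
    qed
    then show "(LINT x:A|lborel. ?h x) = 0" by (simp add: set_lebesgue_integral_def)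
  qed
  have "AE x in lborel. \<forall>n::nat. indicator (box (- real n *\<^sub>R One) (real n *\<^sub>R One)) x * h x = 0"
    unfolding AE_all_countable using B by blast
  then show ?thesis
  proof eventually_elim
    case (elim x)
    obtain n :: nat where n: "norm x < real n" using reals_Archimedean2 by blast
    then have "x \<in> box (- real n *\<^sub>R One) (real n *\<^sub>R One)"
      using Basis_le_norm[of _ x] by (auto simp: mem_box) (smt (verit))+
    then show ?case using elim[rule_format, of n] by simp
  qed
qed

lemma test_grad_facts:
  assumes "test_function \<phi>"
  obtains M where "continuous_on UNIV \<phi>" "continuous_on UNIV (grad \<phi>)" "\<And>x. norm x > M \<Longrightarrow> \<phi> x = 0" "\<And>x. norm x > M \<Longrightarrow> grad \<phi> x = 0"
proof -
  obtain M where M: "\<And>x. norm x > M \<Longrightarrow> \<phi> x = 0" "\<And>x. norm x > M \<Longrightarrow> grad \<phi> x = 0"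
    using test_function_support[OF assms] by metis
  have s: "smooth \<phi>" by (rule test_function_smooth[OF assms])
  show ?thesis by (rule that[OF smooth_continuous[OF s] smooth_grad_continuous[OF s] M])
qed

text \<open>The vector identity by components, so that later arguments deal with scalar integrals in
  one basis direction; local integrability lets the inner product pass under the integrals.\<close>

lemma has_weak_gradient_iff:
  "has_weak_gradient u g \<longleftrightarrow> locally_integrable u \<and> locally_integrable g \<and>
     (\<forall>\<phi> b. test_function \<phi> \<longrightarrow> b \<in> Basis \<longrightarrow> (LINT x|lborel. u x * (grad \<phi> x \<bullet> b)) = - (LINT x|lborel. \<phi> x * (g x \<bullet> b)))"
proof -
  have "(LINT x|lborel. u x *\<^sub>R grad \<phi> x) = - (LINT x|lborel. \<phi> x *\<^sub>R g x) \<longleftrightarrow>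
      (\<forall>b\<in>Basis. (LINT x|lborel. u x * (grad \<phi> x \<bullet> b)) = - (LINT x|lborel. \<phi> x * (g x \<bullet> b)))"
    if l: "locally_integrable u" "locally_integrable g" and \<phi>: "test_function \<phi>" for \<phi>
  proof -
    obtain M where M: "continuous_on UNIV \<phi>" "continuous_on UNIV (grad \<phi>)" "\<And>x. norm x > M \<Longrightarrow> \<phi> x = 0" "\<And>x. norm x > M \<Longrightarrow> grad \<phi> x = 0"
      using test_grad_facts[OF \<phi>] by metis
    have i1: "integrable lborel (\<lambda>x. \<phi> x *\<^sub>R g x)" by (rule integrable_test_mult[OF l(2) M(1,3)])
    have i2: "integrable lborel (\<lambda>x. u x *\<^sub>R grad \<phi> x)"
    proof -
      have "integrable lborel (\<lambda>x. norm (grad \<phi> x) *\<^sub>R u x)"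
        by (rule integrable_test_mult[OF l(1)]) (use M in \<open>auto intro: continuous_on_norm\<close>)
      then show ?thesis
        by (rule Bochner_Integration.integrable_bound)
           (use locally_integrable_measurable[OF l(1)] borel_measurable_continuous_onI[OF M(2)] in \<open>auto simp: abs_mult mult.commute\<close>)
    qed
    have e1: "(LINT x|lborel. \<phi> x *\<^sub>R g x) \<bullet> b = (LINT x|lborel. \<phi> x * (g x \<bullet> b))" for b
      using integral_inner_left[OF i1, of b] by simp
    have e2: "(LINT x|lborel. u x *\<^sub>R grad \<phi> x) \<bullet> b = (LINT x|lborel. u x * (grad \<phi> x \<bullet> b))" for b
      using integral_inner_left[OF i2, of b] by simp
    show ?thesis
      unfolding euclidean_eq_iff[of "LINT x|lborel. u x *\<^sub>R grad \<phi> x"] inner_minus_left e1 e2 ..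
  qed
  then show ?thesis unfolding has_weak_gradient_def by blast
qed

lemma has_weak_gradient_unique:
  fixes u :: "'a::euclidean_space \<Rightarrow> real"
  assumes g: "has_weak_gradient u g" and h: "has_weak_gradient u h"
  shows "AE x in lborel. g x = h x"
proof -
  have "AE x in lborel. (g x - h x) \<bullet> b = 0" if b: "b \<in> Basis" for b
  proof (rule AE_zero_of_box_bumps)
    show "locally_integrable (\<lambda>x. (g x - h x) \<bullet> b)"
      using g h by (intro locally_integrable_inner locally_integrable_diff) (auto simp: has_weak_gradient_def)
    fix l r :: 'a and j
    note \<phi> = box_bump_test[of l r j]
    obtain M where M: "continuous_on UNIV (box_bump l r j)" "\<And>x. norm x > M \<Longrightarrow> box_bump l r j x = 0"
      using test_grad_facts[OF \<phi>] by metis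
    have "integrable lborel (\<lambda>x. box_bump l r j x *\<^sub>R (g x \<bullet> b))" "integrable lborel (\<lambda>x. box_bump l r j x *\<^sub>R (h x \<bullet> b))"
      using g h by (auto intro!: integrable_test_mult[OF _ M] locally_integrable_inner simp: has_weak_gradient_def simp del: real_scaleR_def)
    then have "(LINT x|lborel. box_bump l r j x * ((g x - h x) \<bullet> b)) = (LINT x|lborel. box_bump l r j x * (g x \<bullet> b)) - (LINT x|lborel. box_bump l r j x * (h x \<bullet> b))"
      by (simp add: inner_diff_left right_diff_distrib)
    moreover have "- (LINT x|lborel. box_bump l r j x * (g x \<bullet> b)) = - (LINT x|lborel. box_bump l r j x * (h x \<bullet> b))"
      using g h \<phi> b unfolding has_weak_gradient_iff by metis
    ultimately show "(LINT x|lborel. box_bump l r j x * ((g x - h x) \<bullet> b)) = 0" by simp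
  qed
  then have "AE x in lborel. \<forall>b\<in>Basis. (g x - h x) \<bullet> b = 0" by (intro AE_finite_allI) auto
  then show ?thesis by eventually_elim (subst euclidean_eq_iff, simp add: inner_diff_left)
qed

lemma weak_gradient_AE:
  assumes "has_weak_gradient u g"
  shows "has_weak_gradient u (weak_gradient u)" "AE x in lborel. weak_gradient u x = g x"
proof -
  show "has_weak_gradient u (weak_gradient u)"
    unfolding weak_gradient_def by (rule someI[of "has_weak_gradient u", OF assms])
  then show "AE x in lborel. weak_gradient u x = g x" using assms by (rule has_weak_gradient_unique)
qed

lemma has_weak_gradient_measurable:
  "has_weak_gradient u g \<Longrightarrow> u \<in> borel_measurable borel" "has_weak_gradient u g \<Longrightarrow> g \<in> borel_measurable borel"
  by (auto simp: has_weak_gradient_def intro: locally_integrable_measurable)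

text \<open>Removes the arbitrary choice inside \<open>weak_gradient\<close>: any explicit weak
  gradient computes the norm and decides membership in L^p.\<close>

lemma gradient_norm_eq:
  assumes "has_weak_gradient u g"
  shows "gradient_norm p u = (LINT x|lborel. norm (g x) powr p) powr (1 / p)"
    "in_Lp p (weak_gradient u) \<longleftrightarrow> integrable lborel (\<lambda>x. norm (g x) powr p)"
proof -
  note w = weak_gradient_AE[OF assms]
  have [measurable]: "g \<in> borel_measurable borel" "weak_gradient u \<in> borel_measurable borel"
    using has_weak_gradient_measurable assms w(1) by blast+
  have ae: "AE x in lborel. norm (weak_gradient u x) powr p = norm (g x) powr p"
    using w(2) by eventually_elim simp
  show "gradient_norm p u = (LINT x|lborel. norm (g x) powr p) powr (1 / p)"
    unfolding gradient_norm_def by (subst integral_cong_AE[OF _ _ ae]) auto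
  show "in_Lp p (weak_gradient u) \<longleftrightarrow> integrable lborel (\<lambda>x. norm (g x) powr p)"
    unfolding in_Lp_def using integrable_cong_AE[OF _ _ ae] by simp
qed

lemma has_weak_gradient_diff:
  fixes u :: "'a::euclidean_space \<Rightarrow> real"
  assumes "has_weak_gradient u g" "has_weak_gradient v h"
  shows "has_weak_gradient (\<lambda>x. u x - v x) (\<lambda>x. g x - h x)"
  unfolding has_weak_gradient_iff
proof (intro conjI allI impI)
  have l: "locally_integrable u" "locally_integrable g" "locally_integrable v" "locally_integrable h"
    using assms by (auto simp: has_weak_gradient_def)
  show "locally_integrable (\<lambda>x. u x - v x)" "locally_integrable (\<lambda>x. g x - h x)"
    using l by (auto intro: locally_integrable_diff)
  fix \<phi> :: "'a \<Rightarrow> real" and b assume \<phi>: "test_function \<phi>" and b: "b \<in> (Basis :: 'a set)"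
  obtain M where M: "continuous_on UNIV \<phi>" "continuous_on UNIV (grad \<phi>)" "\<And>x. norm x > M \<Longrightarrow> \<phi> x = 0" "\<And>x. norm x > M \<Longrightarrow> grad \<phi> x = 0"
    using test_grad_facts[OF \<phi>] by metis
  have i1: "integrable lborel (\<lambda>x. \<phi> x * (g x \<bullet> b))" "integrable lborel (\<lambda>x. \<phi> x * (h x \<bullet> b))"
    using integrable_test_mult[OF locally_integrable_inner M(1,3)] l by simp_all
  have gc: "continuous_on UNIV (\<lambda>x. grad \<phi> x \<bullet> b)" "\<And>x. norm x > M \<Longrightarrow> grad \<phi> x \<bullet> b = 0"
    using M by (auto intro!: continuous_intros)
  have i2: "integrable lborel (\<lambda>x. u x * (grad \<phi> x \<bullet> b))" "integrable lborel (\<lambda>x. v x * (grad \<phi> x \<bullet> b))"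
    using integrable_test_mult[OF l(1) gc] integrable_test_mult[OF l(3) gc] by (simp_all add: mult.commute)
  have "(LINT x|lborel. u x * (grad \<phi> x \<bullet> b)) = - (LINT x|lborel. \<phi> x * (g x \<bullet> b))" "(LINT x|lborel. v x * (grad \<phi> x \<bullet> b)) = - (LINT x|lborel. \<phi> x * (h x \<bullet> b))"
    using assms \<phi> b unfolding has_weak_gradient_iff by blast+
  then show "(LINT x|lborel. (u x - v x) * (grad \<phi> x \<bullet> b)) = - (LINT x|lborel. \<phi> x * ((g x - h x) \<bullet> b))"
    using i1 i2 by (simp add: inner_diff_left left_diff_distrib right_diff_distrib)
qed

text \<open>A derivative along almost every line in each basis direction suffices: times a test
  function, \<open>u\<close> vanishes at both ends of the line, so the derivative of the product
  integrates to zero. This covers a singular set, such as y = 0, that almost every line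
  misses.\<close>

lemma has_weak_gradientI_lines:
  fixes u :: "'a::euclidean_space \<Rightarrow> real" and g :: "'a \<Rightarrow> 'a"
  assumes [measurable]: "u \<in> borel_measurable borel" "g \<in> borel_measurable borel"
    and bd: "\<And>x. norm (u x) \<le> Cu" "\<And>x. norm (g x) \<le> Cg"
    and ae: "\<And>b. b \<in> Basis \<Longrightarrow> AE x in lborel. \<forall>t. ((\<lambda>s. u (x + s *\<^sub>R b)) has_real_derivative (g (x + t *\<^sub>R b) \<bullet> b)) (at t)"
  shows "has_weak_gradient u g"
  unfolding has_weak_gradient_iff
proof (intro conjI allI impI)
  show l: "locally_integrable u" "locally_integrable g" by (rule bounded_locally_integrable[OF assms(1) bd(1)], rule bounded_locally_integrable[OF assms(2) bd(2)])
  fix \<phi> :: "'a \<Rightarrow> real" and b assume \<phi>: "test_function \<phi>" and b: "b \<in> (Basis :: 'a set)"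
  obtain M where M: "continuous_on UNIV \<phi>" "continuous_on UNIV (grad \<phi>)" "\<And>x. norm x > M \<Longrightarrow> \<phi> x = 0" "\<And>x. norm x > M \<Longrightarrow> grad \<phi> x = 0"
    using test_grad_facts[OF \<phi>] by metis
  have i1: "integrable lborel (\<lambda>x. \<phi> x * (g x \<bullet> b))"
    using integrable_test_mult[OF locally_integrable_inner M(1,3)] l by simp
  have gc: "continuous_on UNIV (\<lambda>x. grad \<phi> x \<bullet> b)" "\<And>x. norm x > M \<Longrightarrow> grad \<phi> x \<bullet> b = 0"
    using M by (auto intro!: continuous_intros)
  have i2: "integrable lborel (\<lambda>x. u x * (grad \<phi> x \<bullet> b))"
    using integrable_test_mult[OF l(1) gc] by (simp add: mult.commute)
  have "(LINT x|lborel. u x * (grad \<phi> x \<bullet> b) + \<phi> x * (g x \<bullet> b)) = 0"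
  proof (rule integral_deriv_along_zero[OF b, of _ "\<lambda>x. u x * \<phi> x"])
    show "integrable lborel (\<lambda>x. u x * (grad \<phi> x \<bullet> b) + \<phi> x * (g x \<bullet> b))" using i1 i2 by simp
    show "AE x in lborel. (\<forall>t. ((\<lambda>s. u (x + s *\<^sub>R b) * \<phi> (x + s *\<^sub>R b)) has_real_derivative u (x + t *\<^sub>R b) * (grad \<phi> (x + t *\<^sub>R b) \<bullet> b) + \<phi> (x + t *\<^sub>R b) * (g (x + t *\<^sub>R b) \<bullet> b)) (at t)) \<and>
      ((\<lambda>t. u (x + t *\<^sub>R b) * \<phi> (x + t *\<^sub>R b)) \<longlongrightarrow> 0) at_top \<and> ((\<lambda>t. u (x + t *\<^sub>R b) * \<phi> (x + t *\<^sub>R b)) \<longlongrightarrow> 0) at_bot"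
      using ae[OF b]
    proof eventually_elim
      case (elim x)
      have "((\<lambda>s. u (x + s *\<^sub>R b) * \<phi> (x + s *\<^sub>R b)) has_real_derivative u (x + t *\<^sub>R b) * (grad \<phi> (x + t *\<^sub>R b) \<bullet> b) + \<phi> (x + t *\<^sub>R b) * (g (x + t *\<^sub>R b) \<bullet> b)) (at t)" for t
        using DERIV_mult[OF elim[rule_format, of t] smooth_line[OF test_function_smooth[OF \<phi>], of x b t]]
        by (simp add: mult_ac add.commute)
      moreover have "((\<lambda>t. u (x + t *\<^sub>R b) * \<phi> (x + t *\<^sub>R b)) \<longlongrightarrow> 0) at_top"
        by (rule tendsto_eventually, rule eventually_mono[OF eventually_outside_ball(1)[OF b, of M x]]) (use M(3) in simp)
      moreover have "((\<lambda>t. u (x + t *\<^sub>R b) * \<phi> (x + t *\<^sub>R b)) \<longlongrightarrow> 0) at_bot"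
        by (rule tendsto_eventually, rule eventually_mono[OF eventually_outside_ball(2)[OF b, of M x]]) (use M(3) in simp)
      ultimately show ?case by blast
    qed
  qed
  then show "(LINT x|lborel. u x * (grad \<phi> x \<bullet> b)) = - (LINT x|lborel. \<phi> x * (g x \<bullet> b))"
    using i1 i2 by simp
qed

lemma test_function_weak_gradient:
  assumes "test_function \<phi>" shows "has_weak_gradient \<phi> (grad \<phi>)"
proof -
  obtain M where M: "continuous_on UNIV \<phi>" "continuous_on UNIV (grad \<phi>)" "\<And>x. norm x > M \<Longrightarrow> \<phi> x = 0" "\<And>x. norm x > M \<Longrightarrow> grad \<phi> x = 0"
    using test_grad_facts[OF assms] by metis
  obtain C1 where "\<And>x. norm (\<phi> x) \<le> C1" using bounded_continuous_bounded_support[OF M(1,3)] by metis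
  moreover obtain C2 where "\<And>x. norm (grad \<phi> x) \<le> C2" using bounded_continuous_bounded_support[OF M(2,4)] by metis
  ultimately show ?thesis
    by (intro has_weak_gradientI_lines AE_I2 allI smooth_line test_function_smooth assms)
       (use M in \<open>auto intro: borel_measurable_continuous_onI\<close>)
qed

section \<open>Limits of test functions in Lebesgue spaces\<close>

lemma holder_abs:
  fixes f g :: "'a \<Rightarrow> real"
  assumes p: "1 < p" "1 < p'" "1 / p + 1 / p' = 1" and [measurable]: "f \<in> borel_measurable M" "g \<in> borel_measurable M"
    and i: "integrable M (\<lambda>x. \<bar>f x\<bar> powr p)" "integrable M (\<lambda>x. \<bar>g x\<bar> powr p')"
  shows "integrable M (\<lambda>x. f x * g x)"
    and "\<bar>LINT x|M. f x * g x\<bar> \<le> (LINT x|M. \<bar>f x\<bar> powr p) powr (1 / p) * (LINT x|M. \<bar>g x\<bar> powr p') powr (1 / p')"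
proof -
  note h = holder[OF p, of "\<lambda>x. \<bar>f x\<bar>" "\<lambda>x. \<bar>g x\<bar>" M, OF abs_ge_zero abs_ge_zero _ _ i]
  show "integrable M (\<lambda>x. f x * g x)"
    by (rule Bochner_Integration.integrable_bound[OF h(1)]) (auto simp: abs_mult)
  have "\<bar>LINT x|M. f x * g x\<bar> \<le> (LINT x|M. \<bar>f x * g x\<bar>)" by (rule integral_abs_bound)
  also have "\<dots> = (LINT x|M. \<bar>f x\<bar> * \<bar>g x\<bar>)" by (simp add: abs_mult)
  also have "\<dots> \<le> (LINT x|M. \<bar>f x\<bar> powr p) powr (1 / p) * (LINT x|M. \<bar>g x\<bar> powr p') powr (1 / p')"
    by (rule h(2)) auto
  finally show "\<bar>LINT x|M. f x * g x\<bar> \<le> (LINT x|M. \<bar>f x\<bar> powr p) powr (1 / p) * (LINT x|M. \<bar>g x\<bar> powr p') powr (1 / p')" .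
qed

lemma fatou_bound:
  fixes f :: "nat \<Rightarrow> 'a \<Rightarrow> real"
  assumes m[measurable]: "\<And>i. f i \<in> borel_measurable M" "g \<in> borel_measurable M" and nn: "\<And>i x. 0 \<le> f i x" "\<And>x. 0 \<le> g x"
    and i: "\<And>i. integrable M (f i)" and le: "\<And>i. (LINT x|M. f i x) \<le> c i" and lim: "c \<longlonglongrightarrow> C"
    and ae: "AE x in M. (\<lambda>i. f i x) \<longlonglongrightarrow> g x"
  shows "integrable M g" "(LINT x|M. g x) \<le> C"
proof -
  have C0: "0 \<le> C"
  proof (rule LIMSEQ_le_const[OF lim], intro exI allI impI)
    fix n
    have "0 \<le> (LINT x|M. f n x)" by (rule Bochner_Integration.integral_nonneg) (rule nn)
    then show "0 \<le> c n" using le[of n] by linarith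
  qed
  have "(\<integral>\<^sup>+x. ennreal (g x) \<partial>M) = (\<integral>\<^sup>+x. liminf (\<lambda>i. ennreal (f i x)) \<partial>M)"
  proof (rule nn_integral_cong_AE, use ae in eventually_elim)
    case (elim x)
    have "(\<lambda>i. ennreal (f i x)) \<longlonglongrightarrow> ennreal (g x)" by (rule tendsto_ennrealI[OF elim])
    then show ?case using lim_imp_Liminf[OF sequentially_bot] by metis
  qed
  also have "\<dots> \<le> liminf (\<lambda>i. \<integral>\<^sup>+x. ennreal (f i x) \<partial>M)" by (rule nn_integral_liminf) simp
  also have "\<dots> \<le> liminf (\<lambda>i. ennreal (c i))"
  proof (rule Liminf_mono, rule always_eventually, rule allI)
    fix j show "(\<integral>\<^sup>+x. ennreal (f j x) \<partial>M) \<le> ennreal (c j)"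
      using nn_integral_eq_integral[OF i[of j]] nn le[of j] by (simp add: ennreal_leI)
  qed
  also have "liminf (\<lambda>i. ennreal (c i)) = ennreal C"
    by (rule lim_imp_Liminf[OF sequentially_bot tendsto_ennrealI[OF lim]])
  finally have le: "(\<integral>\<^sup>+x. ennreal (g x) \<partial>M) \<le> ennreal C" .
  have "(\<integral>\<^sup>+x. ennreal (norm (g x)) \<partial>M) < \<infinity>"
    using le nn(2) by (simp add: le_less_trans[OF _ ennreal_less_top])
  then show gi: "integrable M g" by (simp add: integrable_iff_bounded)
  show "(LINT x|M. g x) \<le> C"
    using le C0 nn(2) by (simp add: nn_integral_eq_integral[OF gi])
qed

text \<open>Where \<open>\<bar>d\<^sub>j\<bar> > 2\<^sup>-\<^sup>j\<close> one has \<open>\<bar>d\<^sub>j\<bar> \<le> 2\<^bsup>j(r-1)\<^esup> \<bar>d\<^sub>j\<bar>\<^sup>r\<close>, so no Hoelder inequality on balls is needed.\<close>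

lemma AE_summable_of_fast_decay:
  fixes d :: "nat \<Rightarrow> 'a \<Rightarrow> real"
  assumes m[measurable]: "\<And>j. d j \<in> borel_measurable M" and r: "r > 1" and K: "K \<ge> 0"
    and i: "\<And>j. integrable M (\<lambda>x. \<bar>d j x\<bar> powr r)" and le: "\<And>j. (LINT x|M. \<bar>d j x\<bar> powr r) \<le> K * (1 / 4 ^ j) powr r"
  shows "AE x in M. summable (\<lambda>j. \<bar>d j x\<bar>)"
proof -
  define F where "F j x = (2 ^ j) powr (r - 1) * \<bar>d j x\<bar> powr r" for j x
  have F0: "0 \<le> F j x" for j x by (simp add: F_def)
  have pt: "\<bar>d j x\<bar> \<le> (1 / 2) ^ j + F j x" for j x
  proof (cases "\<bar>d j x\<bar> \<le> (1 / 2) ^ j")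
    case True then show ?thesis using F0[of j x] by linarith
  next
    case False
    then have big: "(1 / 2) ^ j < \<bar>d j x\<bar>" by simp
    have "1 < 2 ^ j * \<bar>d j x\<bar>" using big by (simp add: power_one_over field_simps)
    then have "1 \<le> (2 ^ j * \<bar>d j x\<bar>) powr (r - 1)" using r by (intro ge_one_powr_ge_zero) auto
    then have "\<bar>d j x\<bar> \<le> \<bar>d j x\<bar> * (2 ^ j * \<bar>d j x\<bar>) powr (r - 1)" by (simp add: mult_le_cancel_left1)
    also have "\<dots> = F j x"
    proof -
      have pos: "\<bar>d j x\<bar> > 0" using big by (metis less_trans zero_less_power half_gt_zero zero_less_one)
      have "\<bar>d j x\<bar> powr r = \<bar>d j x\<bar> * \<bar>d j x\<bar> powr (r - 1)" using pos powr_add[of "\<bar>d j x\<bar>" 1 "r - 1"] by simp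
      then show ?thesis by (simp add: F_def powr_mult)
    qed
    finally show ?thesis by (simp add: add_increasing)
  qed
  have Fi: "integrable M (F j)" for j unfolding F_def[abs_def] by (rule integrable_mult_right[OF i])
  \<comment> \<open>2^(j(r-1)) times 4^(-jr) is (2^j/4^j)^(r-1) 4^(-j), hence at most 2^(-j); the
    rate 4^(-j) was chosen to leave such a summable bound.\<close>
  have FL: "(LINT x|M. F j x) \<le> K * (1 / 2) ^ j" for j
  proof -
    have "(LINT x|M. F j x) = (2 ^ j) powr (r - 1) * (LINT x|M. \<bar>d j x\<bar> powr r)"
      unfolding F_def by (rule integral_mult_right_zero)
    also have "\<dots> \<le> (2 ^ j) powr (r - 1) * (K * (1 / 4 ^ j) powr r)" by (rule mult_left_mono[OF le]) simp
    also have "(1 / 4 ^ j) powr r \<le> (1 / 4 ^ j :: real) powr (r - 1) * (1 / 4 ^ j)"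
      using powr_add[of "1 / 4 ^ j :: real" "r - 1" 1] by simp
    also have "(2 ^ j) powr (r - 1) * (K * ((1 / 4 ^ j) powr (r - 1) * (1 / 4 ^ j))) = K * ((2 ^ j * (1 / 4 ^ j)) powr (r - 1) * (1 / 4 ^ j))"
    proof -
      have e: "(2 ^ j * (1 / 4 ^ j) :: real) powr (r - 1) = (2 ^ j) powr (r - 1) * (1 / 4 ^ j) powr (r - 1)"
        by (rule powr_mult)
      show ?thesis by (simp only: e mult_ac)
    qed
    also have "\<dots> \<le> K * (1 * (1 / 2) ^ j)"
    proof (intro mult_left_mono mult_mono K)
      have "(2 ^ j * (1 / 4 ^ j) :: real) = (1 / 2) ^ j" by (simp add: power_one_over power_mult_distrib[symmetric] field_simps)
      then show "(2 ^ j * (1 / 4 ^ j) :: real) powr (r - 1) \<le> 1"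
        using r by (intro powr_le1) (auto simp: power_le_one)
      have "(2::real) ^ j \<le> 4 ^ j" by (intro power_mono) auto
      then show "1 / 4 ^ j \<le> (1 / 2 :: real) ^ j" by (simp add: power_one_over frac_le)
    qed auto
    finally show ?thesis using K by (simp add: mult_left_mono)
  qed
  have sK: "summable (\<lambda>j. K * (1 / 2 :: real) ^ j)" by (intro summable_mult summable_geometric) simp
  have "(\<integral>\<^sup>+x. (\<Sum>j. ennreal (F j x)) \<partial>M) = (\<Sum>j. \<integral>\<^sup>+x. ennreal (F j x) \<partial>M)"
    by (rule nn_integral_suminf) (simp add: F_def)
  also have "\<dots> \<le> (\<Sum>j. ennreal (K * (1 / 2) ^ j))"
  proof (rule suminf_le)
    fix j show "(\<integral>\<^sup>+x. ennreal (F j x) \<partial>M) \<le> ennreal (K * (1 / 2) ^ j)"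
      using nn_integral_eq_integral[OF Fi[of j]] F0 FL[of j] by (simp add: ennreal_leI)
  qed auto
  also have "\<dots> = ennreal (\<Sum>j. K * (1 / 2) ^ j)" by (rule suminf_ennreal2[OF _ sK]) (use K in simp)
  finally have "(\<integral>\<^sup>+x. (\<Sum>j. ennreal (F j x)) \<partial>M) \<noteq> \<infinity>"
    using ennreal_less_top le_less_trans by (metis infinity_ennreal_def less_irrefl)
  then have "AE x in M. (\<Sum>j. ennreal (F j x)) \<noteq> \<infinity>"
    by (intro nn_integral_PInf_AE) (auto simp: F_def)
  then show ?thesis
  proof eventually_elim
    case (elim x)
    have "summable (\<lambda>j. F j x)" by (rule summable_suminf_not_top) (use F0 elim in auto)
    then have "summable (\<lambda>j. (1 / 2) ^ j + F j x)" by (intro summable_add summable_geometric) simp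
    then show ?case by (rule summable_comparison_test'[where N=0]) (use pt in auto)
  qed
qed

lemma powr_integrable_locally_integrable:
  fixes h :: "'a::euclidean_space \<Rightarrow> real"
  assumes [measurable]: "h \<in> borel_measurable borel" and r: "r > 1" and i: "integrable lborel (\<lambda>x. \<bar>h x\<bar> powr r)"
  shows "locally_integrable h"
  unfolding locally_integrable_def set_integrable_def
proof (intro allI impI)
  fix K :: "'a set" assume K: "compact K"
  then have [measurable]: "K \<in> sets borel" by (simp add: compact_imp_closed)
  have "integrable lborel (\<lambda>x. indicator K x + \<bar>h x\<bar> powr r)"
    by (intro Bochner_Integration.integrable_add i integrable_real_indicator) (use K emeasure_compact_finite in auto)
  then show "integrable lborel (\<lambda>x. indicator K x *\<^sub>R h x)"
  proof (rule Bochner_Integration.integrable_bound)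
    show "AE x in lborel. norm (indicator K x *\<^sub>R h x) \<le> norm (indicator K x + \<bar>h x\<bar> powr r)"
    proof (rule AE_I2)
      fix x
      have "\<bar>h x\<bar> \<le> 1 + \<bar>h x\<bar> powr r"
      proof (cases "\<bar>h x\<bar> \<le> 1")
        case True then show ?thesis by (simp add: add_increasing2)
      next
        case False
        then have "\<bar>h x\<bar> powr 1 \<le> \<bar>h x\<bar> powr r" using r by (intro powr_mono) auto
        then show ?thesis by simp
      qed
      then show "norm (indicator K x *\<^sub>R h x) \<le> norm (indicator K x + \<bar>h x\<bar> powr r)"
        by (auto split: split_indicator)
    qed
  qed simp
qed

text \<open>A test function and its translates differ by a derivative of a test function; letting the
  translate move to infinity shows that the integral of \<open>h\<close> against a box bump vanishes.\<close>

theorem zero_gradient_AE_zero: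
  fixes h :: "'a::euclidean_space \<Rightarrow> real"
  assumes hm[measurable]: "h \<in> borel_measurable borel" and r: "r > 1" and hi: "integrable lborel (\<lambda>x. \<bar>h x\<bar> powr r)"
    and zero: "\<And>\<phi> b. test_function \<phi> \<Longrightarrow> b \<in> Basis \<Longrightarrow> (LINT x|lborel. h x * (grad \<phi> x \<bullet> b)) = 0"
  shows "AE x in lborel. h x = 0"
proof (rule AE_zero_of_box_bumps)
  show hl: "locally_integrable h" by (rule powr_integrable_locally_integrable[OF hm r hi])
  fix l u :: 'a and j
  obtain c :: 'a where c: "c \<in> Basis" using nonempty_Basis by blast
  define \<beta> where "\<beta> t = flat 0 (real j * (t - l \<bullet> c)) * flat 0 (real j * (u \<bullet> c - t))" for t
  define rest where "rest x = (\<Prod>b\<in>Basis - {c}. flat 0 (real j * (x \<bullet> b - l \<bullet> b)) * flat 0 (real j * (u \<bullet> b - x \<bullet> b)))" for x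
  define M where "M = \<bar>l \<bullet> c\<bar> + \<bar>u \<bullet> c\<bar>"
  let ?\<theta> = "box_bump l u j"
  have \<theta>: "?\<theta> x = \<beta> (x \<bullet> c) * rest x" for x
    unfolding box_bump_def \<beta>_def rest_def using c by (simp add: prod.remove)
  have fc: "continuous_on UNIV (flat 0)"
    by (intro continuous_at_imp_continuous_on ballI DERIV_isCont[OF flat_deriv])
  have \<beta>1: "continuous_on UNIV \<beta>" unfolding \<beta>_def
    by (intro continuous_on_mult continuous_on_compose2[OF fc] continuous_intros) auto
  have \<beta>2: "0 \<le> \<beta> t" for t by (simp add: \<beta>_def flat_0_props)
  have \<beta>3: "\<beta> t = 0" if "\<bar>t\<bar> > M" for t
  proof -
    have "t \<le> l \<bullet> c \<or> u \<bullet> c \<le> t" using that by (auto simp: M_def)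
    then have "real j * (t - l \<bullet> c) \<le> 0 \<or> real j * (u \<bullet> c - t) \<le> 0" by (auto simp: mult_nonneg_nonpos)
    then show ?thesis by (auto simp: \<beta>_def flat_0_props(4)[THEN iffD2])
  qed
  note cumd = cum_deriv[where M=M, OF \<beta>1 \<beta>2 \<beta>3]
  have rest_shift: "rest (x + s *\<^sub>R c) = rest x" for x s
    unfolding rest_def by (rule prod.cong[OF refl]) (use c in \<open>auto simp: inner_add_left inner_Basis\<close>)
  have rest_s: "smooth rest" unfolding rest_def[abs_def] by (intro smooth_prod box_bump_factor_smooth) simp
  have cum_s: "smooth (\<lambda>x. cum \<beta> (x \<bullet> c + e))" for e
  proof (rule smoothI_deriv)
    show "((\<lambda>x. cum \<beta> (x \<bullet> c + e)) has_derivative (\<lambda>v. \<beta> (x \<bullet> c + e) * (v \<bullet> c))) (at x)" for x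
      by (rule has_derivative_compose[where f="\<lambda>x. x \<bullet> c + e" and g="cum \<beta>" and g'="\<lambda>h. \<beta> (x \<bullet> c + e) * h"])
         (use cumd in \<open>auto intro!: derivative_eq_intros simp: has_field_derivative_def\<close>)
    have e1: "\<beta> (x \<bullet> c + e) = flat 0 (real j * (x \<bullet> c - (l \<bullet> c - e))) * flat 0 (real j * ((u \<bullet> c - e) - x \<bullet> c))" for x
      by (simp add: \<beta>_def algebra_simps)
    show "smooth (\<lambda>x. \<beta> (x \<bullet> c + e) * (v \<bullet> c))" for v
      unfolding e1 by (rule smooth_mult[OF box_bump_factor_smooth smooth_const])
  qed
  \<comment> \<open>Its derivative in direction \<open>c\<close> is the translated bump minus the
    bump, since \<open>cum \<beta>\<close> has the derivative \<open>\<beta>\<close>. Far out in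
    direction \<open>c\<close> the two cumulative terms coincide, which keeps the support
    bounded.\<close>
  define \<psi> where "\<psi> n x = (cum \<beta> (x \<bullet> c + real n) - cum \<beta> (x \<bullet> c + 0)) * rest x" for n x
  have \<psi>s: "smooth (\<psi> n)" for n unfolding \<psi>_def[abs_def] by (intro smooth_mult smooth_diff cum_s rest_s)
  have \<psi>t: "test_function (\<psi> n)" for n
  proof (rule test_functionI[OF \<psi>s bounded_cube[of "norm l + norm u + M + real n"]])
    fix x :: 'a assume "x \<notin> cube (norm l + norm u + M + real n)"
    then obtain b where b: "b \<in> Basis" "\<bar>x \<bullet> b\<bar> > norm l + norm u + M + real n"
      unfolding cube_def by (auto simp: abs_le_iff)
    have M0: "M \<ge> 0" by (simp add: M_def)
    show "\<psi> n x = 0"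
    proof (cases "b = c")
      case True
      then have "x \<bullet> c > M \<or> x \<bullet> c + real n < - M"
        using b(2) norm_ge_zero[of l] norm_ge_zero[of u] of_nat_0_le_iff[of n] by (smt (verit))
      then consider "x \<bullet> c > M" | "x \<bullet> c + real n < - M" by blast
      then show ?thesis
      proof cases
        case 1 then show ?thesis
          using cum_hi[where M=M and s="x \<bullet> c", OF \<beta>1 \<beta>2 \<beta>3] cum_hi[where M=M and s="x \<bullet> c + real n", OF \<beta>1 \<beta>2 \<beta>3] by (simp add: \<psi>_def)
      next
        case 2 then show ?thesis
          using cum_lo[where M=M and s="x \<bullet> c", OF \<beta>1 \<beta>2 \<beta>3] cum_lo[where M=M and s="x \<bullet> c + real n", OF \<beta>1 \<beta>2 \<beta>3] by (simp add: \<psi>_def)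
      qed
    next
      case False
      have "x \<bullet> b \<le> l \<bullet> b \<or> u \<bullet> b \<le> x \<bullet> b"
        using b(2) Basis_le_norm[OF b(1), of l] Basis_le_norm[OF b(1), of u] M0 by linarith
      then have "real j * (x \<bullet> b - l \<bullet> b) \<le> 0 \<or> real j * (u \<bullet> b - x \<bullet> b) \<le> 0" by (auto simp: mult_nonneg_nonpos)
      then have "flat 0 (real j * (x \<bullet> b - l \<bullet> b)) * flat 0 (real j * (u \<bullet> b - x \<bullet> b)) = 0" by (auto simp: flat_0_props(4)[THEN iffD2])
      then have "rest x = 0" unfolding rest_def using b(1) False by (intro prod_zero) auto
      then show ?thesis by (simp add: \<psi>_def)
    qed
  qed
  have cc: "c \<bullet> c = 1" using c by simp
  have grad: "grad (\<psi> n) x \<bullet> c = ?\<theta> (x + real n *\<^sub>R c) - ?\<theta> x" for n x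
  proof -
    have "((\<lambda>s. \<psi> n (x + s *\<^sub>R c)) has_real_derivative (grad (\<psi> n) (x + 0 *\<^sub>R c) \<bullet> c)) (at 0)"
      by (rule smooth_line[OF \<psi>s])
    moreover have "((\<lambda>s. \<psi> n (x + s *\<^sub>R c)) has_real_derivative (\<beta> (x \<bullet> c + real n) - \<beta> (x \<bullet> c)) * rest x) (at 0)"
    proof -
      have "((\<lambda>s. cum \<beta> (x \<bullet> c + s + e)) has_real_derivative \<beta> (x \<bullet> c + 0 + e) * 1) (at 0)" for e
        by (rule DERIV_chain2[OF cumd]) (auto intro!: derivative_eq_intros)
      from DERIV_cmult_right[OF DERIV_diff[OF this[of "real n"] this[of 0]], of "rest x"]
      show ?thesis by (simp add: \<psi>_def inner_add_left cc rest_shift)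
    qed
    ultimately have "grad (\<psi> n) x \<bullet> c = (\<beta> (x \<bullet> c + real n) - \<beta> (x \<bullet> c)) * rest x"
      using DERIV_unique by fastforce
    then show ?thesis unfolding \<theta> rest_shift by (simp add: inner_add_left cc left_diff_distrib)
  qed
  have \<theta>c: "continuous_on UNIV ?\<theta>" by (intro smooth_continuous test_function_smooth box_bump_test)
  have [measurable]: "?\<theta> \<in> borel_measurable borel" by (rule borel_measurable_continuous_onI[OF \<theta>c])
  obtain M1 where M1: "\<And>x. norm x > M1 \<Longrightarrow> ?\<theta> x = 0" using test_function_support[OF box_bump_test] by metis
  have i\<theta>: "integrable lborel (\<lambda>x. h x * ?\<theta> x)"
    using integrable_test_mult[OF hl \<theta>c M1] by (simp add: mult.commute)
  \<comment> \<open>The indicator of the translated box, to be used twice: in (|h| B) B Hoelder's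
    inequality gives a first factor that vanishes as the box moves away and a second one of constant
    volume \<open>V\<close>.\<close>
  define B where "B n x = (indicator (box l u) (x + real n *\<^sub>R c) :: real)" for n x
  have Bm[measurable]: "B n \<in> borel_measurable borel" for n unfolding B_def[abs_def] by measurable
  define r' where "r' = r / (r - 1)"
  have r': "1 < r'" "1 / r + 1 / r' = 1" using r by (auto simp: r'_def field_simps)
  define V where "V = (LINT x|lborel. (indicator (box l u) x :: real))"
  have BV: "integrable lborel (B n)" "(LINT x|lborel. B n x) = V" for n
  proof -
    have bi: "integrable lborel (indicator (box l u) :: 'a \<Rightarrow> real)"
      by (rule integrable_real_indicator) (auto simp: emeasure_lborel_box_eq)
    have "(\<integral>\<^sup>+x. ennreal (B n x) \<partial>lborel) = (\<integral>\<^sup>+x. ennreal (indicator (box l u) x) \<partial>lborel)"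
      unfolding B_def by (rule nn_integral_translate) simp
    also have "\<dots> = ennreal V" unfolding V_def by (rule nn_integral_eq_integral[OF bi]) simp
    finally have "has_bochner_integral lborel (B n) V"
      by (intro has_bochner_integral_nn_integral) (auto simp: B_def V_def intro: Bochner_Integration.integral_nonneg)
    then show "integrable lborel (B n)" "(LINT x|lborel. B n x) = V" by (auto simp: has_bochner_integral_iff)
  qed
  have B01: "B n x = 0 \<or> B n x = 1" for n x by (auto simp: B_def indicator_def)
  have hBle: "\<bar>\<bar>h x\<bar> * B n x\<bar> powr r \<le> \<bar>h x\<bar> powr r" for n x
    using B01[of n x] by (elim disjE) simp_all
  have hBi: "integrable lborel (\<lambda>x. \<bar>\<bar>h x\<bar> * B n x\<bar> powr r)" for n
    by (rule Bochner_Integration.integrable_bound[OF hi]) (use hBle in \<open>simp_all\<close>)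
  have hB: "(\<lambda>n. LINT x|lborel. \<bar>\<bar>h x\<bar> * B n x\<bar> powr r) \<longlonglongrightarrow> (LINT x|(lborel :: 'a measure). (0 :: real))"
  proof (rule integral_dominated_convergence[where w="\<lambda>x. \<bar>h x\<bar> powr r"])
    show "AE x in lborel. (\<lambda>n. \<bar>\<bar>h x\<bar> * B n x\<bar> powr r) \<longlonglongrightarrow> 0"
    proof (rule AE_I2)
      fix x
      obtain n0 :: nat where n0: "u \<bullet> c - x \<bullet> c \<le> real n0" using real_arch_simple by blast
      have "\<forall>n\<ge>n0. \<bar>\<bar>h x\<bar> * B n x\<bar> powr r = 0"
      proof (intro allI impI)
        fix n assume "n0 \<le> n"
        then have "u \<bullet> c \<le> (x + real n *\<^sub>R c) \<bullet> c" using n0 of_nat_mono[of n0 n] by (simp add: inner_add_left cc)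
        then have "x + real n *\<^sub>R c \<notin> box l u" using c by (auto simp: mem_box not_less intro!: bexI[of _ c])
        then show "\<bar>\<bar>h x\<bar> * B n x\<bar> powr r = 0" by (simp add: B_def)
      qed
      then show "(\<lambda>n. \<bar>\<bar>h x\<bar> * B n x\<bar> powr r) \<longlonglongrightarrow> 0"
        by (intro tendsto_eventually) (unfold eventually_sequentially, blast)
    qed
    show "AE x in lborel. norm (\<bar>\<bar>h x\<bar> * B n x\<bar> powr r) \<le> \<bar>h x\<bar> powr r" for n
      by (rule AE_I2) (use hBle in simp)
  qed (use hi in auto)
  have bound: "\<bar>LINT x|lborel. ?\<theta> x * h x\<bar> \<le> (LINT x|lborel. \<bar>\<bar>h x\<bar> * B n x\<bar> powr r) powr (1 / r) * V powr (1 / r')" for n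
  proof -
    have \<theta>n: "continuous_on UNIV (\<lambda>x. ?\<theta> (x + real n *\<^sub>R c))"
      by (rule continuous_on_compose2[OF \<theta>c]) (auto intro!: continuous_intros)
    have "?\<theta> (x + real n *\<^sub>R c) = 0" if "norm x > M1 + real n" for x
    proof -
      have "norm x \<le> norm (x + real n *\<^sub>R c) + norm (real n *\<^sub>R c)" using norm_triangle_ineq4[of "x + real n *\<^sub>R c" "real n *\<^sub>R c"] by simp
      then show ?thesis using that c by (intro M1) simp
    qed
    then have i\<theta>n: "integrable lborel (\<lambda>x. h x * ?\<theta> (x + real n *\<^sub>R c))"
      using integrable_test_mult[OF hl \<theta>n, of "M1 + real n"] by (simp add: mult.commute)
    have "0 = (LINT x|lborel. h x * ?\<theta> (x + real n *\<^sub>R c) - h x * ?\<theta> x)"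
      using zero[OF \<psi>t c, of n] by (simp add: grad right_diff_distrib)
    then have "(LINT x|lborel. h x * ?\<theta> x) = (LINT x|lborel. h x * ?\<theta> (x + real n *\<^sub>R c))"
      using i\<theta> i\<theta>n by simp
    then have eq: "(LINT x|lborel. ?\<theta> x * h x) = (LINT x|lborel. h x * ?\<theta> (x + real n *\<^sub>R c))"
      by (simp add: mult.commute)
    have Br: "(\<lambda>x. \<bar>B n x\<bar> powr r') = B n"
    proof
      fix x show "\<bar>B n x\<bar> powr r' = B n x" using B01[of n x] r'(1) by (elim disjE) simp_all
    qed
    have Bi: "integrable lborel (\<lambda>x. \<bar>B n x\<bar> powr r')" unfolding Br by (rule BV)
    have "\<bar>LINT x|lborel. h x * ?\<theta> (x + real n *\<^sub>R c)\<bar> \<le> (LINT x|lborel. \<bar>h x * ?\<theta> (x + real n *\<^sub>R c)\<bar>)"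
      by (rule integral_abs_bound)
    also have "\<dots> \<le> (LINT x|lborel. (\<bar>h x\<bar> * B n x) * B n x)"
    proof (rule integral_mono)
      show "integrable lborel (\<lambda>x. (\<bar>h x\<bar> * B n x) * B n x)"
        by (rule holder_abs(1)[OF r r' _ _ hBi Bi]) auto
      show "\<bar>h x * ?\<theta> (x + real n *\<^sub>R c)\<bar> \<le> (\<bar>h x\<bar> * B n x) * B n x" for x
      proof (cases "x + real n *\<^sub>R c \<in> box l u")
        case True
        then show ?thesis using box_bump_bounds[of l u j "x + real n *\<^sub>R c"] by (simp add: B_def abs_mult mult_left_le)
      next
        case False then show ?thesis using box_bump_outside[OF False] by (simp add: B_def)
      qed
    qed (use i\<theta>n in simp)
    also have "\<dots> \<le> \<bar>LINT x|lborel. (\<bar>h x\<bar> * B n x) * B n x\<bar>" by simp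
    also have "\<dots> \<le> (LINT x|lborel. \<bar>\<bar>h x\<bar> * B n x\<bar> powr r) powr (1 / r) * (LINT x|lborel. \<bar>B n x\<bar> powr r') powr (1 / r')"
      by (rule holder_abs(2)[OF r r' _ _ hBi Bi]) auto
    also have "(LINT x|lborel. \<bar>B n x\<bar> powr r') = V" unfolding Br by (rule BV)
    finally show ?thesis unfolding eq .
  qed
  have "(\<lambda>n. (LINT x|lborel. \<bar>\<bar>h x\<bar> * B n x\<bar> powr r) powr (1 / r) * V powr (1 / r')) \<longlonglongrightarrow> 0 powr (1 / r) * V powr (1 / r')"
  proof (intro tendsto_mult tendsto_const tendsto_powr2)
    show "(\<lambda>n. LINT x|lborel. \<bar>\<bar>h x\<bar> * B n x\<bar> powr r) \<longlonglongrightarrow> 0" using hB by simp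
    show "\<forall>\<^sub>F n in sequentially. 0 \<le> (LINT x|lborel. \<bar>\<bar>h x\<bar> * B n x\<bar> powr r)"
      by (intro always_eventually allI Bochner_Integration.integral_nonneg) simp
  qed (use r in auto)
  then have "\<bar>LINT x|lborel. ?\<theta> x * h x\<bar> \<le> 0 powr (1 / r) * V powr (1 / r')"
    by (rule LIMSEQ_le_const) (use bound in auto)
  then show "(LINT x|lborel. ?\<theta> x * h x) = 0" using r by simp
qed

subsection \<open>Passage to the closure\<close>

context hsm_setup
begin

lemma sobolev_conjugate_eq: "sobolev_conjugate (real DIM((real ^ 'k) \<times> (real ^ 'm))) p = ps"
proof -
  have "real DIM((real ^ 'k) \<times> (real ^ 'm)) = N" using N by simp
  then show ?thesis unfolding sobolev_conjugate_def ps_def by (simp only:)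
qed

lemma hsm_exponent_eq: "hsm_exponent (real DIM((real ^ 'k) \<times> (real ^ 'm))) p = q"
proof -
  have "real DIM((real ^ 'k) \<times> (real ^ 'm)) = N" using N by simp
  then show ?thesis unfolding hsm_exponent_def q_def by (simp only:)
qed

text \<open>A gradient approximation of \<open>v\<close> by test functions is also an approximation almost everywhere:
  by the Sobolev inequality it converges in \<open>L\<^bsup>ps\<^esup>\<close> to some \<open>w\<close>, and \<open>v - w\<close> has weak gradient zero.\<close>

lemma AE_limit_of_gradient_approximation:
  fixes v :: "(real ^ 'k) \<times> (real ^ 'm) \<Rightarrow> real"
  assumes v: "integrable lborel (\<lambda>x. \<bar>v x\<bar> powr ps)" and g: "has_weak_gradient v g"
    and gi: "integrable lborel (\<lambda>x. norm (g x) powr p)"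
    and \<phi>: "\<And>j. test_function (\<phi> j)"
    and close: "\<And>j. (LINT x|lborel. norm (g x - grad (\<phi> j) x) powr p) powr (1 / p) \<le> 1 / 4 ^ j"
  shows "AE x in lborel. (\<lambda>j. \<phi> j x) \<longlonglongrightarrow> v x"
proof -
  let ?C = sobolev_constant
  have C0: "0 \<le> ?C" unfolding sobolev_constant_def using exponents(1,13) IJ_pos by simp
  have ps1: "ps > 1" by (rule exponents(12))
  have [measurable]: "v \<in> borel_measurable borel" "g \<in> borel_measurable borel"
    using has_weak_gradient_measurable g by blast+
  have sm: "smooth (\<phi> j)" for j using \<phi> by (simp add: test_function_def)
  have pc: "continuous_on UNIV (\<phi> j)" for j by (rule smooth_continuous[OF sm])
  have gc: "continuous_on UNIV (grad (\<phi> j))" for j by (rule smooth_grad_continuous[OF sm])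
  have pm[measurable]: "\<phi> j \<in> borel_measurable borel" for j using pc by (rule borel_measurable_continuous_onI)
  have gm[measurable]: "grad (\<phi> j) \<in> borel_measurable borel" for j using gc by (rule borel_measurable_continuous_onI)
  have gpi: "integrable lborel (\<lambda>x. norm (grad (\<phi> j) x) powr p)" for j
    by (rule test_function_grad_powr_integrable[OF \<phi>]) (use p1 in simp)
  define e where "e j x = norm (g x - grad (\<phi> j) x)" for j x
  have em[measurable]: "e j \<in> borel_measurable borel" for j unfolding e_def[abs_def] by measurable
  have e0: "0 \<le> e j x" for j x by (simp add: e_def)
  have ei: "integrable lborel (\<lambda>x. e j x powr p)" for j
  proof (rule Bochner_Integration.integrable_bound[OF minkowski(1)[OF p1, of "\<lambda>x. norm (g x)" "\<lambda>x. norm (grad (\<phi> j) x)" lborel, OF norm_ge_zero norm_ge_zero _ _ gi gpi]])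
    show "AE x in lborel. norm (e j x powr p) \<le> norm ((norm (g x) + norm (grad (\<phi> j) x)) powr p)"
      by (rule AE_I2) (use p1 norm_triangle_ineq4 in \<open>auto simp: e_def intro!: powr_mono2\<close>)
  qed auto
  have eL: "(LINT x|lborel. e j x powr p) powr (1 / p) \<le> 1 / 4 ^ j" for j unfolding e_def by (rule close)
  have diff_energy: "energy (\<lambda>x. \<phi> i x - \<phi> j x) \<le> 1 / 4 ^ i + 1 / 4 ^ j" for i j
  proof -
    have gd: "grad (\<lambda>x. \<phi> i x - \<phi> j x) x = grad (\<phi> i) x - grad (\<phi> j) x" for x
    proof (rule euclidean_eqI)
      fix b :: "(real ^ 'k) \<times> (real ^ 'm)"
      show "grad (\<lambda>x. \<phi> i x - \<phi> j x) x \<bullet> b = (grad (\<phi> i) x - grad (\<phi> j) x) \<bullet> b"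
        using grad_inner[OF has_derivative_diff[OF smooth_has_derivative[OF sm[of i]] smooth_has_derivative[OF sm[of j]]], of x b]
        by (simp add: inner_diff_left smooth_grad_inner[OF sm])
    qed
    note mk = minkowski[OF p1, of "e i" "e j" lborel, OF e0 e0 _ _ ei ei]
    have "(LINT x|lborel. norm (grad (\<lambda>x. \<phi> i x - \<phi> j x) x) powr p) \<le> (LINT x|lborel. (e i x + e j x) powr p)"
    proof (rule integral_mono)
      show "integrable lborel (\<lambda>x. norm (grad (\<lambda>x. \<phi> i x - \<phi> j x) x) powr p)"
        by (rule test_function_grad_powr_integrable[OF test_function_diff[OF \<phi> \<phi>]]) (use p1 in simp)
      show "integrable lborel (\<lambda>x. (e i x + e j x) powr p)" by (rule mk(1)) auto
      show "norm (grad (\<lambda>x. \<phi> i x - \<phi> j x) x) powr p \<le> (e i x + e j x) powr p" for x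
        unfolding gd e_def
        by (intro powr_mono2) (use p1 norm_triangle_ineq4[of "g x - grad (\<phi> j) x" "g x - grad (\<phi> i) x"] in \<open>auto simp: add.commute\<close>)
    qed
    then have "energy (\<lambda>x. \<phi> i x - \<phi> j x) \<le> (LINT x|lborel. (e i x + e j x) powr p) powr (1 / p)"
      unfolding energy_def by (intro powr_mono2) (use p1 in \<open>auto intro: Bochner_Integration.integral_nonneg\<close>)
    also have "\<dots> \<le> (LINT x|lborel. e i x powr p) powr (1 / p) + (LINT x|lborel. e j x powr p) powr (1 / p)"
      by (rule mk(2)) auto
    finally show ?thesis using eL[of i] eL[of j] by linarith
  qed
  have diff_ps: "(LINT x|lborel. \<bar>\<phi> i x - \<phi> j x\<bar> powr ps) \<le> (?C * (1 / 4 ^ i + 1 / 4 ^ j)) powr ps" for i j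
  proof -
    have nn: "0 \<le> (LINT x|lborel. \<bar>\<phi> i x - \<phi> j x\<bar> powr ps)" by (rule Bochner_Integration.integral_nonneg) simp
    have "(LINT x|lborel. \<bar>\<phi> i x - \<phi> j x\<bar> powr ps) powr (1 / ps) \<le> ?C * energy (\<lambda>x. \<phi> i x - \<phi> j x)"
      by (rule sobolev_test[OF test_function_diff[OF \<phi> \<phi>]])
    also have "\<dots> \<le> ?C * (1 / 4 ^ i + 1 / 4 ^ j)" by (rule mult_left_mono[OF diff_energy C0])
    finally have "((LINT x|lborel. \<bar>\<phi> i x - \<phi> j x\<bar> powr ps) powr (1 / ps)) powr ps \<le> (?C * (1 / 4 ^ i + 1 / 4 ^ j)) powr ps"
      by (intro powr_mono2) (use ps1 in auto)
    then show ?thesis using nn ps1 by (simp add: powr_powr)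
  qed
  have dpi: "integrable lborel (\<lambda>x. \<bar>\<phi> i x - \<phi> j x\<bar> powr ps)" for i j
    by (rule test_function_abs_powr_integrable[OF test_function_diff[OF \<phi> \<phi>]]) (use ps1 in simp)
  \<comment> \<open>The rate 4^(-j) makes the increments summable almost everywhere, so the full
    sequence converges and no subsequence has to be chosen.\<close>
  have "AE x in lborel. summable (\<lambda>j. \<bar>\<phi> (Suc j) x - \<phi> j x\<bar>)"
  proof (rule AE_summable_of_fast_decay[OF _ ps1, where K="(2 * ?C) powr ps"])
    show "(LINT x|lborel. \<bar>\<phi> (Suc j) x - \<phi> j x\<bar> powr ps) \<le> (2 * ?C) powr ps * (1 / 4 ^ j) powr ps" for j
    proof -
      have "?C * (1 / 4 ^ Suc j + 1 / 4 ^ j) \<le> 2 * ?C * (1 / 4 ^ j)"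
        using C0 by (simp add: field_simps)
      then have "(?C * (1 / 4 ^ Suc j + 1 / 4 ^ j)) powr ps \<le> (2 * ?C * (1 / 4 ^ j)) powr ps"
        by (intro powr_mono2) (use ps1 C0 in auto)
      also have "\<dots> = (2 * ?C) powr ps * (1 / 4 ^ j) powr ps" by (rule powr_mult)
      finally show ?thesis using diff_ps[of "Suc j" j] by linarith
    qed
  qed (use dpi in auto)
  then have conv: "AE x in lborel. (\<lambda>j. \<phi> j x) \<longlonglongrightarrow> lim (\<lambda>j. \<phi> j x)"
  proof eventually_elim
    case (elim x)
    then have "summable (\<lambda>j. \<phi> (Suc j) x - \<phi> j x)" by (rule summable_rabs_cancel)
    then have "convergent (\<lambda>n. \<Sum>j<n. \<phi> (Suc j) x - \<phi> j x)" by (simp add: summable_iff_convergent)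
    moreover have "(\<Sum>j<n. \<phi> (Suc j) x - \<phi> j x) = \<phi> n x - \<phi> 0 x" for n
      by (rule sum_lessThan_telescope)
    ultimately have "convergent (\<lambda>n. \<phi> n x - \<phi> 0 x)" by simp
    from convergent_add[OF this convergent_const[of "\<phi> 0 x"]] show ?case by (simp add: convergent_LIMSEQ_iff)
  qed
  \<comment> \<open>\<open>lim\<close> has some value on the null set of divergence too, and
    \<open>w\<close> is measurable on the whole space.\<close>
  define w where "w x = lim (\<lambda>j. \<phi> j x)" for x
  have wm[measurable]: "w \<in> borel_measurable borel" unfolding w_def[abs_def] by measurable
  have wc: "AE x in lborel. (\<lambda>j. \<phi> j x) \<longlonglongrightarrow> w x" using conv unfolding w_def .
  have fat: "integrable lborel (\<lambda>x. \<bar>w x - \<phi> j x\<bar> powr ps)" "(LINT x|lborel. \<bar>w x - \<phi> j x\<bar> powr ps) \<le> (?C * (1 / 4 ^ j)) powr ps" for j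
  proof -
    have lim: "(\<lambda>i. (?C * (1 / 4 ^ i + 1 / 4 ^ j)) powr ps) \<longlonglongrightarrow> (?C * (1 / 4 ^ j)) powr ps"
    proof (rule tendsto_powr2)
      have "(\<lambda>i. (1 / 4) ^ i :: real) \<longlonglongrightarrow> 0" by (rule LIMSEQ_realpow_zero) auto
      then have "(\<lambda>i. 1 / 4 ^ i :: real) \<longlonglongrightarrow> 0" by (simp add: power_one_over)
      then have "(\<lambda>i. ?C * (1 / 4 ^ i + 1 / 4 ^ j)) \<longlonglongrightarrow> ?C * (0 + 1 / 4 ^ j)" by (intro tendsto_intros)
      then show "(\<lambda>i. ?C * (1 / 4 ^ i + 1 / 4 ^ j)) \<longlonglongrightarrow> ?C * (1 / 4 ^ j)" by simp
      show "\<forall>\<^sub>F i in sequentially. 0 \<le> ?C * (1 / 4 ^ i + 1 / 4 ^ j)"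
        by (intro always_eventually allI mult_nonneg_nonneg C0) simp
    qed (use ps1 in auto)
    have ae: "AE x in lborel. (\<lambda>i. \<bar>\<phi> i x - \<phi> j x\<bar> powr ps) \<longlonglongrightarrow> \<bar>w x - \<phi> j x\<bar> powr ps"
      using wc
    proof eventually_elim
      case (elim x)
      show ?case by (intro tendsto_powr2 tendsto_rabs tendsto_diff elim tendsto_const) (use ps1 in auto)
    qed
    note F = fatou_bound[OF _ _ _ _ dpi diff_ps lim ae]
    show "integrable lborel (\<lambda>x. \<bar>w x - \<phi> j x\<bar> powr ps)" by (rule F(1)) auto
    show "(LINT x|lborel. \<bar>w x - \<phi> j x\<bar> powr ps) \<le> (?C * (1 / 4 ^ j)) powr ps" by (rule F(2)) auto
  qed
  have wi: "integrable lborel (\<lambda>x. \<bar>w x\<bar> powr ps)"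
  proof (rule Bochner_Integration.integrable_bound[OF minkowski(1)[OF ps1, of "\<lambda>x. \<bar>w x - \<phi> 0 x\<bar>" "\<lambda>x. \<bar>\<phi> 0 x\<bar>" lborel]])
    show "integrable lborel (\<lambda>x. \<bar>\<phi> 0 x\<bar> powr ps)" by (rule test_function_abs_powr_integrable[OF \<phi>]) (use ps1 in simp)
    show "AE x in lborel. norm (\<bar>w x\<bar> powr ps) \<le> norm ((\<bar>w x - \<phi> 0 x\<bar> + \<bar>\<phi> 0 x\<bar>) powr ps)"
      by (rule AE_I2) (use ps1 in \<open>auto intro!: powr_mono2\<close>)
  qed (use fat in auto)
  define h where "h x = v x - w x" for x
  have hm[measurable]: "h \<in> borel_measurable borel" unfolding h_def[abs_def] by measurable
  have hi: "integrable lborel (\<lambda>x. \<bar>h x\<bar> powr ps)"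
  proof (rule Bochner_Integration.integrable_bound[OF minkowski(1)[OF ps1, of "\<lambda>x. \<bar>v x\<bar>" "\<lambda>x. \<bar>w x\<bar>" lborel]])
    show "AE x in lborel. norm (\<bar>h x\<bar> powr ps) \<le> norm ((\<bar>v x\<bar> + \<bar>w x\<bar>) powr ps)"
      by (rule AE_I2) (use ps1 in \<open>auto intro!: powr_mono2 simp: h_def\<close>)
  qed (use wi v in auto)
  have "AE x in lborel. h x = 0"
  proof (rule zero_gradient_AE_zero[OF hm ps1 hi])
    fix \<theta> :: "(real ^ 'k) \<times> (real ^ 'm) \<Rightarrow> real" and b :: "(real ^ 'k) \<times> (real ^ 'm)"
    assume \<theta>: "test_function \<theta>" and b: "b \<in> Basis"
    define D where "D x = grad \<theta> x \<bullet> b" for x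
    have Dt: "test_function D" unfolding D_def by (rule test_function_grad_inner[OF \<theta>])
    obtain M where M: "continuous_on UNIV \<theta>" "\<And>x. norm x > M \<Longrightarrow> \<theta> x = 0" using test_grad_facts[OF \<theta>] by metis
    obtain M' where M': "continuous_on UNIV D" "\<And>x. norm x > M' \<Longrightarrow> D x = 0" using test_grad_facts[OF Dt] by metis
    have [measurable]: "\<theta> \<in> borel_measurable borel" "D \<in> borel_measurable borel" using M(1) M'(1) by (auto intro: borel_measurable_continuous_onI)
    define r where "r = ps / (ps - 1)"
    have r: "1 < r" "1 / ps + 1 / r = 1" using ps1 by (auto simp: r_def field_simps)
    define A where "A = (LINT x|lborel. \<bar>D x\<bar> powr r) powr (1 / r)"
    define B where "B = (LINT x|lborel. \<bar>\<theta> x\<bar> powr p') powr (1 / p')"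
    have AB: "0 \<le> A" "0 \<le> B" by (auto simp: A_def B_def)
    have Di: "integrable lborel (\<lambda>x. \<bar>D x\<bar> powr r)" by (rule test_function_abs_powr_integrable[OF Dt]) (use r in simp)
    have Ti: "integrable lborel (\<lambda>x. \<bar>\<theta> x\<bar> powr p')" by (rule test_function_abs_powr_integrable[OF \<theta>]) (use exponents(14) in simp)
    have vl: "locally_integrable v" "locally_integrable g" using g by (auto simp: has_weak_gradient_def)
    have pl: "locally_integrable (\<phi> j)" "locally_integrable (grad (\<phi> j))" for j
      using test_function_weak_gradient[OF \<phi>] by (auto simp: has_weak_gradient_def)
    have iv: "integrable lborel (\<lambda>x. v x * D x)" using integrable_test_mult[OF vl(1) M'] by (simp add: mult.commute)
    have ip: "integrable lborel (\<lambda>x. \<phi> j x * D x)" for j using integrable_test_mult[OF pl(1) M'] by (simp add: mult.commute)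
    have igb: "integrable lborel (\<lambda>x. \<theta> x * (g x \<bullet> b))" using integrable_test_mult[OF locally_integrable_inner[OF vl(2)] M] by simp
    have ipb: "integrable lborel (\<lambda>x. \<theta> x * (grad (\<phi> j) x \<bullet> b))" for j using integrable_test_mult[OF locally_integrable_inner[OF pl(2)] M] by simp
    \<comment> \<open>h is the difference of \<open>v - \<phi> j\<close> and
      \<open>w - \<phi> j\<close>. The first is turned by the weak gradients into a gradient error
      that is small in L^p, tested with \<open>\<theta>\<close>; the second is small in L^ps by
      Fatou's lemma.\<close>
    have bound: "\<bar>LINT x|lborel. h x * D x\<bar> \<le> (A * ?C + B) * (1 / 4 ^ j)" for j
    proof -
      note h1 = holder_abs[OF ps1 r, of "\<lambda>x. w x - \<phi> j x" lborel D, OF _ _ fat(1) Di]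
      have i1: "integrable lborel (\<lambda>x. (w x - \<phi> j x) * D x)" by (rule h1(1)) auto
      have b1: "\<bar>LINT x|lborel. (w x - \<phi> j x) * D x\<bar> \<le> A * (?C * (1 / 4 ^ j))"
      proof -
        have "\<bar>LINT x|lborel. (w x - \<phi> j x) * D x\<bar> \<le> (LINT x|lborel. \<bar>w x - \<phi> j x\<bar> powr ps) powr (1 / ps) * A"
          unfolding A_def by (rule h1(2)) auto
        also have "(LINT x|lborel. \<bar>w x - \<phi> j x\<bar> powr ps) powr (1 / ps) \<le> ((?C * (1 / 4 ^ j)) powr ps) powr (1 / ps)"
          by (intro powr_mono2 fat(2)) (use ps1 in \<open>auto intro: Bochner_Integration.integral_nonneg\<close>)
        also have "\<dots> = ?C * (1 / 4 ^ j)" using ps1 C0 by (simp add: powr_powr)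
        finally show ?thesis using AB by (simp add: mult.commute mult_right_mono)
      qed
      define f where "f x = (g x - grad (\<phi> j) x) \<bullet> b" for x
      have [measurable]: "f \<in> borel_measurable borel" unfolding f_def[abs_def] by measurable
      have fle: "\<bar>f x\<bar> \<le> e j x" for x unfolding f_def e_def by (rule Basis_le_norm[OF b])
      have fi: "integrable lborel (\<lambda>x. \<bar>f x\<bar> powr p)"
        by (rule Bochner_Integration.integrable_bound[OF ei[of j]]) (use fle p1 in \<open>auto intro!: AE_I2 powr_mono2\<close>)
      have "\<bar>LINT x|lborel. f x * \<theta> x\<bar> \<le> (LINT x|lborel. \<bar>f x\<bar> powr p) powr (1 / p) * B"
        unfolding B_def by (rule holder_abs(2)[OF p1 exponents(14) ex(7) _ _ fi Ti]) auto
      also have "(LINT x|lborel. \<bar>f x\<bar> powr p) powr (1 / p) \<le> (LINT x|lborel. e j x powr p) powr (1 / p)"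
        by (intro powr_mono2 integral_mono[OF fi ei]) (use fle p1 in \<open>auto intro: Bochner_Integration.integral_nonneg\<close>)
      also have "\<dots> \<le> 1 / 4 ^ j" by (rule eL)
      finally have b2: "\<bar>LINT x|lborel. f x * \<theta> x\<bar> \<le> 1 / 4 ^ j * B" using AB by (simp add: mult_right_mono)
      have wg: "(LINT x|lborel. v x * D x) = - (LINT x|lborel. \<theta> x * (g x \<bullet> b))"
        "(LINT x|lborel. \<phi> j x * D x) = - (LINT x|lborel. \<theta> x * (grad (\<phi> j) x \<bullet> b))"
        using g test_function_weak_gradient[OF \<phi>, of j] \<theta> b unfolding has_weak_gradient_iff D_def by blast+
      have "(LINT x|lborel. f x * \<theta> x) = (LINT x|lborel. \<theta> x * (g x \<bullet> b)) - (LINT x|lborel. \<theta> x * (grad (\<phi> j) x \<bullet> b))"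
        using igb ipb[of j] by (simp add: f_def inner_diff_left right_diff_distrib mult.commute)
      moreover have "(LINT x|lborel. h x * D x) = (LINT x|lborel. v x * D x - \<phi> j x * D x - (w x - \<phi> j x) * D x)"
        by (simp add: h_def algebra_simps)
      ultimately have "(LINT x|lborel. h x * D x) = - (LINT x|lborel. f x * \<theta> x) - (LINT x|lborel. (w x - \<phi> j x) * D x)"
        using iv ip[of j] i1 wg by simp
      then have "\<bar>LINT x|lborel. h x * D x\<bar> \<le> 1 / 4 ^ j * B + A * (?C * (1 / 4 ^ j))" using b1 b2 by linarith
      moreover have "z * B + A * (?C * z) = (A * ?C + B) * z" for z by (simp add: algebra_simps)
      ultimately show ?thesis by (simp only:)
    qed
    have "(\<lambda>j. (1 / 4) ^ j :: real) \<longlonglongrightarrow> 0" by (rule LIMSEQ_realpow_zero) auto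
    then have "(\<lambda>j. (A * ?C + B) * (1 / 4 ^ j)) \<longlonglongrightarrow> (A * ?C + B) * 0"
      by (intro tendsto_mult tendsto_const) (simp add: power_one_over)
    then have "\<bar>LINT x|lborel. h x * D x\<bar> \<le> (A * ?C + B) * 0" by (rule LIMSEQ_le_const) (use bound in blast)
    then show "(LINT x|lborel. h x * (grad \<theta> x \<bullet> b)) = 0" by (simp add: D_def)
  qed
  with wc show ?thesis by eventually_elim (simp add: h_def)
qed

text \<open>Approximation in gradient gives convergence almost everywhere, so Fatou's lemma carries
  the inequality from test functions to \<open>v\<close>; by Minkowski's inequality the energies
  exceed the gradient norm of \<open>v\<close> by at most a vanishing error.\<close>

theorem hsm_D1p:
  fixes v :: "(real ^ 'k) \<times> (real ^ 'm) \<Rightarrow> real"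
  assumes v: "v \<in> D1p p"
  shows "integrable lborel (\<lambda>x. \<bar>v x\<bar> powr q / norm (fst x))"
    and "\<mu> * (real CARD('k) - 1) * (LINT x|lborel. \<bar>v x\<bar> powr q / norm (fst x))
      \<le> a * I * (gradient_norm p v / (a * I powr (1 / p))) powr q"
proof -
  have vps: "integrable lborel (\<lambda>x. \<bar>v x\<bar> powr ps)" and [measurable]: "v \<in> borel_measurable borel"
    using v unfolding D1p_def in_Lp_def sobolev_conjugate_eq by auto
  obtain g where g: "has_weak_gradient v g" using v unfolding D1p_def by auto
  have gi: "integrable lborel (\<lambda>x. norm (g x) powr p)"
    using v gradient_norm_eq(2)[OF g, of p] unfolding D1p_def by auto
  have [measurable]: "g \<in> borel_measurable borel" using has_weak_gradient_measurable g by blast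
  have gn: "gradient_norm p v = (LINT x|lborel. norm (g x) powr p) powr (1 / p)" by (rule gradient_norm_eq(1)[OF g])
  have "\<forall>j. \<exists>\<phi>. test_function \<phi> \<and> gradient_norm p (\<lambda>x. v x - \<phi> x) < 1 / 4 ^ j"
    using v unfolding D1p_def by auto
  then obtain \<phi> where \<phi>: "\<And>j. test_function (\<phi> j)" and ap: "\<And>j. gradient_norm p (\<lambda>x. v x - \<phi> j x) < 1 / 4 ^ j"
    by metis
  have close: "(LINT x|lborel. norm (g x - grad (\<phi> j) x) powr p) powr (1 / p) \<le> 1 / 4 ^ j" for j
    using ap[of j] gradient_norm_eq(1)[OF has_weak_gradient_diff[OF g test_function_weak_gradient[OF \<phi>]], of p j] by simp
  have ae: "AE x in lborel. (\<lambda>j. \<phi> j x) \<longlonglongrightarrow> v x"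
    by (rule AE_limit_of_gradient_approximation[OF vps g gi \<phi> close])
  have sm: "smooth (\<phi> j)" for j using \<phi> by (simp add: test_function_def)
  have pm[measurable]: "\<phi> j \<in> borel_measurable borel" for j by (rule borel_measurable_continuous_onI[OF smooth_continuous[OF sm]])
  have gm[measurable]: "grad (\<phi> j) \<in> borel_measurable borel" for j by (rule borel_measurable_continuous_onI[OF smooth_grad_continuous[OF sm]])
  have gpi: "integrable lborel (\<lambda>x. norm (grad (\<phi> j) x) powr p)" for j
    by (rule test_function_grad_powr_integrable[OF \<phi>]) (use p1 in simp)
  have en: "energy (\<phi> j) \<le> gradient_norm p v + 1 / 4 ^ j" for j
  proof -
    let ?e = "\<lambda>x. norm (g x - grad (\<phi> j) x)"
    have ei: "integrable lborel (\<lambda>x. ?e x powr p)"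
    proof (rule Bochner_Integration.integrable_bound[OF minkowski(1)[OF p1, of "\<lambda>x. norm (g x)" "\<lambda>x. norm (grad (\<phi> j) x)" lborel, OF norm_ge_zero norm_ge_zero _ _ gi gpi]])
      show "AE x in lborel. norm (?e x powr p) \<le> norm ((norm (g x) + norm (grad (\<phi> j) x)) powr p)"
        by (rule AE_I2) (use p1 norm_triangle_ineq4 in \<open>auto intro!: powr_mono2\<close>)
    qed auto
    note mk = minkowski[OF p1, of "\<lambda>x. norm (g x)" ?e lborel, OF norm_ge_zero norm_ge_zero _ _ gi ei]
    have "(LINT x|lborel. norm (grad (\<phi> j) x) powr p) \<le> (LINT x|lborel. (norm (g x) + ?e x) powr p)"
    proof (rule integral_mono[OF gpi])
      show "integrable lborel (\<lambda>x. (norm (g x) + ?e x) powr p)" by (rule mk(1)) auto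
      show "norm (grad (\<phi> j) x) powr p \<le> (norm (g x) + ?e x) powr p" for x
        by (intro powr_mono2) (use p1 norm_triangle_ineq4[of "g x" "g x - grad (\<phi> j) x"] in auto)
    qed
    then have "energy (\<phi> j) \<le> (LINT x|lborel. (norm (g x) + ?e x) powr p) powr (1 / p)"
      unfolding energy_def by (intro powr_mono2) (use p1 in \<open>auto intro: Bochner_Integration.integral_nonneg\<close>)
    also have "\<dots> \<le> gradient_norm p v + (LINT x|lborel. ?e x powr p) powr (1 / p)"
      unfolding gn by (rule mk(2)) auto
    finally show ?thesis using close[of j] by linarith
  qed
  define k where "k = \<mu> * (real CARD('k) - 1)"
  have k0: "k > 0" unfolding k_def using \<mu> k2 by simp
  have G0: "0 \<le> gradient_norm p v" unfolding gradient_norm_def by simp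
  define d where "d = a * I powr (1 / p)"
  have d0: "d > 0" unfolding d_def using exponents(2) IJ_pos by simp
  define c where "c j = a * I * ((gradient_norm p v + 1 / 4 ^ j) / d) powr q / k" for j :: nat
  have lim: "c \<longlonglongrightarrow> a * I * (gradient_norm p v / d) powr q / k"
  proof -
    have "(\<lambda>j. (1 / 4) ^ j :: real) \<longlonglongrightarrow> 0" by (rule LIMSEQ_realpow_zero) auto
    then have z: "(\<lambda>j. 1 / 4 ^ j :: real) \<longlonglongrightarrow> 0" by (simp add: power_one_over)
    have "(\<lambda>j. (gradient_norm p v + 1 / 4 ^ j) / d) \<longlonglongrightarrow> (gradient_norm p v + 0) / d"
      by (intro tendsto_intros z) (use d0 in simp)
    then have L: "(\<lambda>j. ((gradient_norm p v + 1 / 4 ^ j) / d) powr q) \<longlonglongrightarrow> (gradient_norm p v / d) powr q"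
      by (intro tendsto_powr2) (use d0 G0 exponents(13) in \<open>auto intro!: always_eventually\<close>)
    show ?thesis unfolding c_def[abs_def]
      by (intro tendsto_divide tendsto_mult tendsto_const L) (use k0 in simp)
  qed
  have le: "(LINT x|lborel. \<bar>\<phi> j x\<bar> powr q / norm (fst x)) \<le> c j" for j
  proof -
    have "k * (LINT x|lborel. \<bar>\<phi> j x\<bar> powr q / norm (fst x)) \<le> a * I * (energy (\<phi> j) / d) powr q"
      using hsm_test(2)[OF \<phi>] unfolding k_def d_def .
    also have "\<dots> \<le> a * I * ((gradient_norm p v + 1 / 4 ^ j) / d) powr q"
      by (intro mult_left_mono powr_mono2 divide_right_mono en) (use exponents(2,13) IJ_pos d0 in \<open>auto simp: energy_def\<close>)
    finally show ?thesis unfolding c_def using k0 by (simp add: field_simps)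
  qed
  have ae': "AE x in lborel. (\<lambda>j. \<bar>\<phi> j x\<bar> powr q / norm (fst x)) \<longlonglongrightarrow> \<bar>v x\<bar> powr q / norm (fst x)"
    using ae
  proof eventually_elim
    case (elim x)
    have "(\<lambda>j. \<bar>\<phi> j x\<bar> powr q) \<longlonglongrightarrow> \<bar>v x\<bar> powr q"
      by (intro tendsto_powr2 tendsto_rabs elim tendsto_const) (use exponents(13) in auto)
    then show ?case unfolding divide_inverse by (rule tendsto_mult_right)
  qed
  have vm: "(\<lambda>x. \<bar>v x\<bar> powr q / norm (fst x)) \<in> borel_measurable lborel" by measurable
  note F = fatou_bound[OF borel_measurable_integrable[OF hsm_test(1)[OF \<phi>]] vm _ _ hsm_test(1)[OF \<phi>] le lim ae']
  show "integrable lborel (\<lambda>x. \<bar>v x\<bar> powr q / norm (fst x))" by (rule F(1)) auto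
  have "(LINT x|lborel. \<bar>v x\<bar> powr q / norm (fst x)) \<le> a * I * (gradient_norm p v / d) powr q / k" by (rule F(2)) auto
  then show "\<mu> * (real CARD('k) - 1) * (LINT x|lborel. \<bar>v x\<bar> powr q / norm (fst x))
      \<le> a * I * (gradient_norm p v / (a * I powr (1 / p))) powr q"
    unfolding d_def[symmetric] k_def[symmetric] using k0 by (simp add: field_simps)
qed

end

subsection \<open>The extremal functions\<close>

text \<open>For \<open>\<delta> > 0\<close> this is a smooth regularisation of \<open>(rho \<mu> \<zeta> x)\<^sup>2\<close>, which is the case \<open>\<delta> = 0\<close>;
  \<open>half_grad\<close> is half its gradient.\<close>

definition reg_norm :: "real \<Rightarrow> (real ^ 'k) \<times> (real ^ 'm) \<Rightarrow> real" where
  "reg_norm \<delta> x = (\<delta>\<^sup>2 + fst x \<bullet> fst x) powr (1 / 2)"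

definition rho_sq :: "real \<Rightarrow> real ^ 'm \<Rightarrow> real \<Rightarrow> (real ^ 'k) \<times> (real ^ 'm) \<Rightarrow> real" where
  "rho_sq \<mu> \<zeta> \<delta> x = (\<mu> + reg_norm \<delta> x) * (\<mu> + reg_norm \<delta> x) + (snd x - \<zeta>) \<bullet> (snd x - \<zeta>)"

definition half_grad :: "real \<Rightarrow> real ^ 'm \<Rightarrow> real \<Rightarrow> (real ^ 'k) \<times> (real ^ 'm) \<Rightarrow> (real ^ 'k) \<times> (real ^ 'm)" where
  "half_grad \<mu> \<zeta> \<delta> x = (((\<mu> + reg_norm \<delta> x) / reg_norm \<delta> x) *\<^sub>R fst x, snd x - \<zeta>)"

lemma reg_norm_0: "reg_norm 0 x = norm (fst x)"
  by (simp add: reg_norm_def powr_half_sqrt norm_eq_sqrt_inner)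

lemma reg_norm_ge: "norm (fst x) \<le> reg_norm \<delta> x"
  unfolding reg_norm_def by (simp add: powr_half_sqrt norm_eq_sqrt_inner)

lemma rho_sq_0: "rho_sq \<mu> \<zeta> 0 x = (rho \<mu> \<zeta> x)\<^sup>2"
  unfolding rho_sq_def reg_norm_0 rho_square
  by (simp add: power2_eq_square[of "\<mu> + norm (fst x)"] dot_square_norm)

lemma half_grad_0: "half_grad \<mu> \<zeta> 0 x = x + offset \<mu> \<zeta> x"
proof -
  have "((\<mu> + norm (fst x)) / norm (fst x)) *\<^sub>R fst x = fst x + \<mu> *\<^sub>R sgn (fst x)"
  proof (cases "fst x = 0")
    case False
    then have e: "(\<mu> + norm (fst x)) / norm (fst x) = 1 + \<mu> / norm (fst x)" by (simp add: add_divide_distrib)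
    show ?thesis unfolding e scaleR_add_left by (simp add: sgn_div_norm divide_inverse)
  qed simp
  then show ?thesis by (simp add: half_grad_def reg_norm_0 offset_def prod_eq_iff)
qed

text \<open>Regularising only enlarges the square of \<rho>, so negative powers of \<rho> dominate
  the regularised functions uniformly in \<delta>.\<close>

lemma rho_sq_ge:
  assumes "\<mu> > 0" shows "(rho \<mu> \<zeta> x)\<^sup>2 \<le> rho_sq \<mu> \<zeta> \<delta> x" "0 < rho_sq \<mu> \<zeta> \<delta> x"
proof -
  have "(\<mu> + norm (fst x)) * (\<mu> + norm (fst x)) \<le> (\<mu> + reg_norm \<delta> x) * (\<mu> + reg_norm \<delta> x)"
  proof -
    have "0 \<le> reg_norm \<delta> x" by (simp add: reg_norm_def)
    then show ?thesis using reg_norm_ge[of x \<delta>] assms by (intro mult_mono) auto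
  qed
  then show le: "(rho \<mu> \<zeta> x)\<^sup>2 \<le> rho_sq \<mu> \<zeta> \<delta> x"
    unfolding rho_sq_0[symmetric] by (simp add: rho_sq_def reg_norm_0)
  then show "0 < rho_sq \<mu> \<zeta> \<delta> x" using rho_ge(4)[OF assms, of \<zeta> x] by (smt (verit) zero_less_power)
qed

text \<open>The inequality provides bounds uniform in \<delta>. The equality off y = 0 evaluates the
  gradient norm and the divergence identity of the extremal exactly.\<close>

lemma norm_half_grad:
  assumes "\<mu> > 0"
  shows "(norm (half_grad \<mu> \<zeta> \<delta> x))\<^sup>2 \<le> rho_sq \<mu> \<zeta> \<delta> x"
    and "fst x \<noteq> 0 \<Longrightarrow> norm (x + offset \<mu> \<zeta> x) = rho \<mu> \<zeta> x"
proof -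
  let ?n = "reg_norm \<delta> x"
  have n0: "0 \<le> ?n" by (simp add: reg_norm_def)
  have "norm (((\<mu> + ?n) / ?n) *\<^sub>R fst x) \<le> \<mu> + ?n"
  proof (cases "?n = 0")
    case False
    then have "norm (((\<mu> + ?n) / ?n) *\<^sub>R fst x) = (\<mu> + ?n) * (norm (fst x) / ?n)" using n0 assms by simp
    also have "\<dots> \<le> (\<mu> + ?n) * 1" using False n0 reg_norm_ge[of x \<delta>] assms by (intro mult_left_mono) auto
    finally show ?thesis by simp
  qed (use assms in simp)
  then have "(norm (((\<mu> + ?n) / ?n) *\<^sub>R fst x))\<^sup>2 \<le> (\<mu> + ?n)\<^sup>2" by (intro power_mono) auto
  then show "(norm (half_grad \<mu> \<zeta> \<delta> x))\<^sup>2 \<le> rho_sq \<mu> \<zeta> \<delta> x"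
    unfolding half_grad_def norm_prod_def rho_sq_def
    by (simp add: power2_eq_square[of "\<mu> + ?n"] power2_norm_eq_inner)
  assume "fst x \<noteq> 0"
  then have "norm (fst x + \<mu> *\<^sub>R sgn (fst x)) = norm (fst x) + \<mu>"
  proof -
    have "fst x + \<mu> *\<^sub>R sgn (fst x) = (norm (fst x) + \<mu>) *\<^sub>R sgn (fst x)"
    proof -
      have e: "(norm (fst x) + \<mu>) * inverse (norm (fst x)) = 1 + \<mu> * inverse (norm (fst x))"
        using \<open>fst x \<noteq> 0\<close> by (simp add: distrib_right)
      show ?thesis unfolding sgn_div_norm scaleR_scaleR e scaleR_add_left by simp
    qed
    then show ?thesis using \<open>fst x \<noteq> 0\<close> assms by (simp add: norm_sgn)
  qed
  then show "norm (x + offset \<mu> \<zeta> x) = rho \<mu> \<zeta> x"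
    by (simp add: norm_prod_def offset_def rho_def add.commute)
qed

lemma rho_sq_has_derivative:
  fixes x :: "(real ^ 'k) \<times> (real ^ 'm)"
  assumes "\<delta> \<noteq> 0 \<or> fst x \<noteq> 0"
  shows "(rho_sq \<mu> \<zeta> \<delta> has_derivative (\<lambda>h. 2 * (half_grad \<mu> \<zeta> \<delta> x \<bullet> h))) (at x)"
proof -
  let ?n = "reg_norm \<delta> x"
  have pos: "0 < \<delta>\<^sup>2 + fst x \<bullet> fst x" using assms by (auto simp: add_pos_nonneg add_nonneg_pos)
  have n: "?n > 0" using pos by (simp add: reg_norm_def)
  have d1: "((\<lambda>x. \<delta>\<^sup>2 + fst x \<bullet> fst x) has_derivative (\<lambda>h. 2 * (fst x \<bullet> fst h))) (at x)"
    by (auto intro!: derivative_eq_intros simp: inner_commute)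
  have d2: "((\<lambda>z. z powr (1 / 2)) has_derivative (*) (1 / 2 * (\<delta>\<^sup>2 + fst x \<bullet> fst x) powr (1 / 2 - 1))) (at (\<delta>\<^sup>2 + fst x \<bullet> fst x))"
    by (rule has_real_derivative_powr[OF pos, unfolded has_field_derivative_def])
  have inv: "(\<delta>\<^sup>2 + fst x \<bullet> fst x) powr (1 / 2 - 1) = 1 / ?n"
    using pos powr_minus[of "\<delta>\<^sup>2 + fst x \<bullet> fst x" "1 / 2"] by (simp add: reg_norm_def inverse_eq_divide)
  have dn: "(reg_norm \<delta> has_derivative (\<lambda>h. (fst x \<bullet> fst h) / ?n)) (at x)"
    using has_derivative_compose[OF d1 d2] unfolding inv by (simp add: reg_norm_def[abs_def])
  have "((\<lambda>x. (\<mu> + reg_norm \<delta> x) * (\<mu> + reg_norm \<delta> x) + (snd x - \<zeta>) \<bullet> (snd x - \<zeta>)) has_derivative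
     (\<lambda>h. (\<mu> + ?n) * ((fst x \<bullet> fst h) / ?n) + ((fst x \<bullet> fst h) / ?n) * (\<mu> + ?n) + ((snd x - \<zeta>) \<bullet> snd h + snd h \<bullet> (snd x - \<zeta>)))) (at x)"
    by (auto intro!: derivative_eq_intros dn)
  moreover have "(\<mu> + ?n) * ((fst x \<bullet> fst h) / ?n) + ((fst x \<bullet> fst h) / ?n) * (\<mu> + ?n) + ((snd x - \<zeta>) \<bullet> snd h + snd h \<bullet> (snd x - \<zeta>))
      = 2 * (half_grad \<mu> \<zeta> \<delta> x \<bullet> h)" for h
  proof -
    have "A * (c / n) + (c / n) * A + (Z + Z) = 2 * (A / n * c + Z)" for A c n Z :: real by (simp add: algebra_simps)
    then show ?thesis by (simp only: half_grad_def inner_prod_def fst_conv snd_conv inner_scaleR_left inner_commute[of "snd h"])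
  qed
  ultimately show ?thesis unfolding rho_sq_def[abs_def] by (simp only:)
qed

lemma rho_sq_powr_has_derivative:
  assumes "\<mu> > 0" "\<delta> \<noteq> 0 \<or> fst x \<noteq> 0"
  shows "((\<lambda>x. rho_sq \<mu> \<zeta> \<delta> x powr (- (e / 2))) has_derivative
     (\<lambda>h. ((- e * rho_sq \<mu> \<zeta> \<delta> x powr (- (e / 2) - 1)) *\<^sub>R half_grad \<mu> \<zeta> \<delta> x) \<bullet> h)) (at x)"
proof -
  have "((\<lambda>z. z powr (- (e / 2))) has_derivative (*) (- (e / 2) * rho_sq \<mu> \<zeta> \<delta> x powr (- (e / 2) - 1))) (at (rho_sq \<mu> \<zeta> \<delta> x))"
    by (rule has_real_derivative_powr[OF rho_sq_ge(2)[OF assms(1)], unfolded has_field_derivative_def])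
  from has_derivative_compose[OF rho_sq_has_derivative[OF assms(2)] this]
  show ?thesis by (simp add: mult_ac)
qed

lemma rho_sq_smooth:
  assumes "\<delta> \<noteq> 0" shows "smooth (rho_sq \<mu> \<zeta> \<delta> :: (real ^ 'k) \<times> (real ^ 'm) \<Rightarrow> real)"
proof -
  have f: "smooth (\<lambda>x :: (real ^ 'k) \<times> (real ^ 'm). fst x \<bullet> i)" for i
    using smooth_inner[of "(i, 0 :: real ^ 'm)"] by (simp add: inner_prod_def)
  have s: "smooth (\<lambda>x :: (real ^ 'k) \<times> (real ^ 'm). snd x \<bullet> i)" for i
    using smooth_inner[of "(0 :: real ^ 'k, i)"] by (simp add: inner_prod_def)
  have ff: "smooth (\<lambda>x :: (real ^ 'k) \<times> (real ^ 'm). fst x \<bullet> fst x)"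
    unfolding euclidean_inner[of "fst x" "fst x" for x :: "(real ^ 'k) \<times> (real ^ 'm)"]
    by (intro smooth_sum smooth_mult f) simp
  have si: "smooth (\<lambda>x :: (real ^ 'k) \<times> (real ^ 'm). (snd x - \<zeta>) \<bullet> i)" for i
    unfolding inner_diff_left by (intro smooth_diff s smooth_const)
  have ss: "smooth (\<lambda>x :: (real ^ 'k) \<times> (real ^ 'm). (snd x - \<zeta>) \<bullet> (snd x - \<zeta>))"
    unfolding euclidean_inner[of "snd x - \<zeta>" "snd x - \<zeta>" for x :: "(real ^ 'k) \<times> (real ^ 'm)"]
    by (intro smooth_sum smooth_mult si) simp
  have n: "smooth (reg_norm \<delta> :: (real ^ 'k) \<times> (real ^ 'm) \<Rightarrow> real)"
    unfolding reg_norm_def[abs_def]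
    by (intro smooth_powr smooth_add smooth_const ff) (use assms in \<open>simp add: add_pos_nonneg\<close>)
  show ?thesis unfolding rho_sq_def[abs_def]
    by (intro smooth_add smooth_mult smooth_const n ss)
qed

section \<open>The bubbles and their approximation by test functions\<close>

context hsm_setup
begin

text \<open>\<open>bubble 0\<close> is r^(-a), the extremal up to a positive factor; nonzero
  \<delta> smooths its singularity on y = 0.\<close>

definition "bubble \<delta> x = rho_sq \<mu> \<zeta> \<delta> (x :: (real ^ 'k) \<times> (real ^ 'm)) powr (- (a / 2))"
definition "bubble_grad \<delta> x = (- a * rho_sq \<mu> \<zeta> \<delta> (x :: (real ^ 'k) \<times> (real ^ 'm)) powr (- (a / 2) - 1)) *\<^sub>R half_grad \<mu> \<zeta> \<delta> x"

lemma rho_sq_0_powr: "rho_sq \<mu> \<zeta> 0 (x :: (real ^ 'k) \<times> (real ^ 'm)) powr (- (e / 2)) = r x powr (- e)"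
proof -
  have "(r x)\<^sup>2 = r x powr 2" using r_pos[of x] by simp
  then show ?thesis unfolding rho_sq_0 by (simp only: powr_powr) simp
qed

lemma gradient_exponent: "- (a + 1) * p = - s"
  using exponents(8) by (simp only: mult_minus_left)

lemma bubble_0: "bubble 0 x = r x powr (- a)"
  unfolding bubble_def by (rule rho_sq_0_powr)

lemma bubble_grad_0: "bubble_grad 0 x = (- a * r x powr (- (a + 2))) *\<^sub>R (x + offset \<mu> \<zeta> x)"
proof -
  have "- (a / 2) - 1 = - ((a + 2) / 2)" by (simp add: field_simps)
  then show ?thesis unfolding bubble_grad_def half_grad_0 by (simp only: rho_sq_0_powr)
qed

lemma bubble_has_derivative:
  "\<delta> \<noteq> 0 \<or> fst x \<noteq> 0 \<Longrightarrow> (bubble \<delta> has_derivative (\<lambda>h. bubble_grad \<delta> x \<bullet> h)) (at x)"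
  unfolding bubble_def[abs_def] bubble_grad_def by (rule rho_sq_powr_has_derivative[OF \<mu>])

text \<open>The bounds do not depend on \<delta> and serve as majorants when \<delta> tends to 0;
  the p-th power of the gradient bound is a multiple of the integrable r^(-s).\<close>

lemma bubble_bounds: "0 \<le> bubble \<delta> x" "bubble \<delta> x \<le> r x powr (- a)"
  "norm (bubble_grad \<delta> x) \<le> a * r x powr (- (a + 1))"
proof -
  let ?P = "rho_sq \<mu> \<zeta> \<delta> x"
  have P: "?P > 0" "r x powr 2 \<le> ?P" using rho_sq_ge[OF \<mu>, where x=x and \<zeta>=\<zeta> and \<delta>=\<delta>] r_pos[of x] by (auto simp: powr_realpow)
  have le: "?P powr (- (e / 2)) \<le> r x powr (- e)" if "e \<ge> 0" for e
  proof -
    have "?P powr (- (e / 2)) \<le> (r x powr 2) powr (- (e / 2))"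
      by (rule powr_mono2') (use that P r_pos[of x] in auto)
    then show ?thesis by (simp add: powr_powr)
  qed
  show "0 \<le> bubble \<delta> x" by (simp add: bubble_def)
  show "bubble \<delta> x \<le> r x powr (- a)" unfolding bubble_def by (rule le) (use exponents(2) in simp)
  have "norm (half_grad \<mu> \<zeta> \<delta> x) \<le> sqrt ?P" by (rule real_le_rsqrt) (rule norm_half_grad(1)[OF \<mu>])
  also have "sqrt ?P = ?P powr (1 / 2)" using P by (simp add: powr_half_sqrt)
  finally have hg: "norm (half_grad \<mu> \<zeta> \<delta> x) \<le> ?P powr (1 / 2)" .
  have "norm (bubble_grad \<delta> x) = a * (?P powr (- (a / 2) - 1) * norm (half_grad \<mu> \<zeta> \<delta> x))"
    using exponents(2) by (simp add: bubble_grad_def)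
  also have "\<dots> \<le> a * (?P powr (- (a / 2) - 1) * ?P powr (1 / 2))"
    using exponents(2) hg by (intro mult_left_mono) auto
  also have "?P powr (- (a / 2) - 1) * ?P powr (1 / 2) = ?P powr (- ((a + 1) / 2))"
  proof -
    have "- (a / 2) - 1 + 1 / 2 = - ((a + 1) / 2)" by (simp add: field_simps)
    then show ?thesis by (simp only: powr_add[symmetric])
  qed
  also have "a * \<dots> \<le> a * r x powr (- (a + 1))" by (intro mult_left_mono le) (use exponents(2) in auto)
  finally show "norm (bubble_grad \<delta> x) \<le> a * r x powr (- (a + 1))" by simp
qed

lemma r_powr_le: "e \<ge> 0 \<Longrightarrow> r x powr (- e) \<le> \<mu> powr (- e)"
  by (rule powr_mono2') (use rho_ge(3)[OF \<mu>, where x=x and \<zeta>=\<zeta>] \<mu> in auto)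

lemma bubble_0_measurable [measurable]: "bubble 0 \<in> borel_measurable borel" "bubble_grad 0 \<in> borel_measurable borel"
proof -
  have "bubble 0 = (\<lambda>x. r x powr (- a))" by (simp add: fun_eq_iff bubble_0)
  then show "bubble 0 \<in> borel_measurable borel" by simp
  have "bubble_grad 0 = (\<lambda>x. (- a * r x powr (- (a + 2))) *\<^sub>R (x + offset \<mu> \<zeta> x))"
    by (rule ext) (rule bubble_grad_0)
  then show "bubble_grad 0 \<in> borel_measurable borel" by simp
qed

text \<open>On y = 0 there is a cone-like singularity, which almost every line misses. The bounds on
  function and gradient come from \<rho> \<ge> \<mu>.\<close>

lemma bubble_weak_gradient: "has_weak_gradient (\<lambda>x. K * bubble 0 x) (\<lambda>x. K *\<^sub>R bubble_grad 0 x)"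
proof (rule has_weak_gradientI_lines)
  show "norm (K * bubble 0 x) \<le> \<bar>K\<bar> * \<mu> powr (- a)" for x
    using bubble_bounds(1,2)[of 0 x] r_powr_le[of a x] exponents(2) by (simp add: abs_mult mult_left_mono)
  show "norm (K *\<^sub>R bubble_grad 0 x) \<le> \<bar>K\<bar> * (a * \<mu> powr (- (a + 1)))" for x
  proof -
    have "norm (bubble_grad 0 x) \<le> a * \<mu> powr (- (a + 1))"
      using bubble_bounds(3)[of 0 x] mult_left_mono[OF r_powr_le[of "a + 1" x], of a] exponents(2) by linarith
    then show ?thesis by (simp add: mult_left_mono)
  qed
  fix b :: "(real ^ 'k) \<times> (real ^ 'm)" assume b: "b \<in> Basis"
  show "AE x in lborel. \<forall>t. ((\<lambda>s. K * bubble 0 (x + s *\<^sub>R b)) has_real_derivative ((K *\<^sub>R bubble_grad 0 (x + t *\<^sub>R b)) \<bullet> b)) (at t)"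
    using AE_line_fst_nonzero[OF b k2]
  proof eventually_elim
    case (elim x)
    show ?case
    proof
      fix t
      have "((\<lambda>s. bubble 0 (x + s *\<^sub>R b)) has_real_derivative (bubble_grad 0 (x + t *\<^sub>R b) \<bullet> b)) (at t)"
        by (rule has_derivative_line[OF bubble_has_derivative]) (use elim in blast)
      from DERIV_cmult[OF this, of K]
      show "((\<lambda>s. K * bubble 0 (x + s *\<^sub>R b)) has_real_derivative ((K *\<^sub>R bubble_grad 0 (x + t *\<^sub>R b)) \<bullet> b)) (at t)" by simp
    qed
  qed
qed simp_all

lemma bubble_limit:
  assumes "fst x \<noteq> 0" and \<delta>: "\<delta> \<longlonglongrightarrow> 0"
  shows "(\<lambda>j. bubble (\<delta> j) x) \<longlonglongrightarrow> bubble 0 x" "(\<lambda>j. bubble_grad (\<delta> j) x) \<longlonglongrightarrow> bubble_grad 0 x"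
proof -
  have pos: "fst x \<bullet> fst x > 0" using assms(1) by simp
  have n: "(\<lambda>j. reg_norm (\<delta> j) x) \<longlonglongrightarrow> reg_norm 0 x"
    unfolding reg_norm_def by (intro tendsto_intros \<delta>) (use pos in auto)
  have n0: "reg_norm 0 x \<noteq> 0" using assms(1) by (simp add: reg_norm_0)
  have P: "(\<lambda>j. rho_sq \<mu> \<zeta> (\<delta> j) x) \<longlonglongrightarrow> rho_sq \<mu> \<zeta> 0 x"
    unfolding rho_sq_def by (intro tendsto_intros n)
  have P0: "rho_sq \<mu> \<zeta> 0 x \<noteq> 0" using rho_sq_ge(2)[OF \<mu>, of \<zeta> 0 x] by simp
  have H: "(\<lambda>j. half_grad \<mu> \<zeta> (\<delta> j) x) \<longlonglongrightarrow> half_grad \<mu> \<zeta> 0 x"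
    unfolding half_grad_def by (intro tendsto_intros n n0)
  show "(\<lambda>j. bubble (\<delta> j) x) \<longlonglongrightarrow> bubble 0 x" unfolding bubble_def by (rule tendsto_powr[OF P tendsto_const P0])
  show "(\<lambda>j. bubble_grad (\<delta> j) x) \<longlonglongrightarrow> bubble_grad 0 x" unfolding bubble_grad_def
    by (intro tendsto_scaleR tendsto_mult tendsto_const tendsto_powr P P0 H)
qed

lemma AE_fst_nonzero: "AE x in lborel. fst (x :: (real ^ 'k) \<times> (real ^ 'm)) \<noteq> 0"
proof -
  obtain b :: "(real ^ 'k) \<times> (real ^ 'm)" where b: "b \<in> Basis" using nonempty_Basis by blast
  from AE_line_fst_nonzero[OF b k2] show ?thesis by eventually_elim (metis add.right_neutral scaleR_zero_left)
qed

text \<open>One parameter does both jobs: \<open>\<delta> j\<close> smooths the singularity on y =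
  0, and the cutoff acts at a distance of order 1 / \<open>\<delta> j\<close>. The gradients
  converge almost everywhere and are dominated by a multiple of r^(-(a+1)).\<close>

lemma bubble_approximation:
  assumes \<epsilon>: "\<epsilon> > 0"
  shows "\<exists>\<phi>. test_function \<phi> \<and> gradient_norm p (\<lambda>x. K * bubble 0 x - \<phi> x) < \<epsilon>"
proof -
  obtain \<eta> :: "(real ^ 'k) \<times> (real ^ 'm) \<Rightarrow> real" where \<eta>: "test_function \<eta>" "\<And>x. 0 \<le> \<eta> x" "\<And>x. \<eta> x \<le> 1"
    "\<And>x. norm x \<le> 1 \<Longrightarrow> \<eta> x = 1" using cutoff_exists by metis
  obtain M where M: "M > 0" "\<And>x. norm x > M \<Longrightarrow> \<eta> x = 0" "\<And>x. norm x > M \<Longrightarrow> grad \<eta> x = 0"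
    using test_function_support[OF \<eta>(1)] by metis
  have \<eta>s: "smooth \<eta>" using \<eta>(1) by (simp add: test_function_def)
  obtain C where C: "C > 0" "\<And>x. norm (grad \<eta> x) \<le> C"
    using bounded_continuous_bounded_support[OF smooth_grad_continuous[OF \<eta>s] M(3)] by metis
  define \<delta> where "\<delta> j = inverse (real (Suc j))" for j
  have \<delta>: "\<delta> j > 0" "\<delta> \<longlonglongrightarrow> 0" for j unfolding \<delta>_def using LIMSEQ_inverse_real_of_nat by auto
  define \<phi> where "\<phi> j x = (K * bubble (\<delta> j) x) * \<eta> (\<delta> j *\<^sub>R x)" for j x
  define D where "D j x = K *\<^sub>R (\<eta> (\<delta> j *\<^sub>R x) *\<^sub>R bubble_grad (\<delta> j) x + (bubble (\<delta> j) x * \<delta> j) *\<^sub>R grad \<eta> (\<delta> j *\<^sub>R x))" for j x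
  have bs: "smooth (bubble (\<delta> j))" for j
    unfolding bubble_def[abs_def] by (rule smooth_powr[OF rho_sq_smooth rho_sq_ge(2)[OF \<mu>]]) (use \<delta>(1)[of j] in simp)
  have \<phi>t: "test_function (\<phi> j)" for j
  proof (rule test_functionI[of _ "cball 0 (M / \<delta> j)"])
    show "smooth (\<phi> j)" unfolding \<phi>_def[abs_def] by (intro smooth_mult smooth_const bs smooth_scale \<eta>s)
    fix x :: "(real ^ 'k) \<times> (real ^ 'm)" assume "x \<notin> cball 0 (M / \<delta> j)"
    then have "norm (\<delta> j *\<^sub>R x) > M" using \<delta>(1)[of j] by (simp add: field_simps)
    then show "\<phi> j x = 0" by (simp add: \<phi>_def M(2))
  qed simp
  have grad: "grad (\<phi> j) x = D j x" for j x
  proof (rule euclidean_eqI)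
    fix b :: "(real ^ 'k) \<times> (real ^ 'm)"
    have d1: "(bubble (\<delta> j) has_derivative (\<lambda>h. bubble_grad (\<delta> j) x \<bullet> h)) (at x)"
      by (rule bubble_has_derivative) (use \<delta>(1)[of j] in simp)
    have d2: "((\<lambda>x. \<eta> (\<delta> j *\<^sub>R x)) has_derivative (\<lambda>h. frechet_derivative \<eta> (at (\<delta> j *\<^sub>R x)) (\<delta> j *\<^sub>R h))) (at x)"
      by (rule has_derivative_compose[OF _ smooth_has_derivative[OF \<eta>s]]) (auto intro!: derivative_eq_intros)
    have "(\<phi> j has_derivative (\<lambda>h. (K * bubble (\<delta> j) x) * frechet_derivative \<eta> (at (\<delta> j *\<^sub>R x)) (\<delta> j *\<^sub>R h) + (K * (bubble_grad (\<delta> j) x \<bullet> h)) * \<eta> (\<delta> j *\<^sub>R x))) (at x)"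
      unfolding \<phi>_def by (rule has_derivative_mult[OF has_derivative_mult_right[OF d1] d2])
    from grad_inner[OF this, of b] show "grad (\<phi> j) x \<bullet> b = D j x \<bullet> b"
      by (simp add: D_def inner_add_left smooth_grad_inner[OF \<eta>s, symmetric] algebra_simps)
  qed
  \<comment> \<open>Bounds \<open>\<delta> j * r x\<close> where the cutoff is not zero, by
    \<open>\<delta> j \<le> 1\<close>. So the term with the gradient of the cutoff, of size
    \<open>\<delta> j\<close> times r^(-a), is at most a multiple of r^(-(a+1)), like the gradient
    of the bubble itself.\<close>
  define c where "c = \<mu> + 2 * M + norm \<zeta>"
  have c0: "c > 0" unfolding c_def using \<mu> M(1) by (simp add: add_pos_nonneg)
  have D_le: "norm (D j x) \<le> \<bar>K\<bar> * (a + c * C) * r x powr (- (a + 1))" for j x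
  proof -
    have 1: "norm (\<eta> (\<delta> j *\<^sub>R x) *\<^sub>R bubble_grad (\<delta> j) x) \<le> a * r x powr (- (a + 1))"
    proof -
      have "norm (\<eta> (\<delta> j *\<^sub>R x) *\<^sub>R bubble_grad (\<delta> j) x) \<le> 1 * norm (bubble_grad (\<delta> j) x)"
        unfolding norm_scaleR by (rule mult_right_mono) (use \<eta>(2,3) in auto)
      then show ?thesis using bubble_bounds(3)[of "\<delta> j" x] by linarith
    qed
    have 2: "norm ((bubble (\<delta> j) x * \<delta> j) *\<^sub>R grad \<eta> (\<delta> j *\<^sub>R x)) \<le> c * C * r x powr (- (a + 1))"
    proof (cases "norm (\<delta> j *\<^sub>R x) > M")
      case True then show ?thesis using M(3)[OF True] c0 C(1) by simp
    next
      case False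
      have dj: "\<delta> j \<le> 1" by (simp add: \<delta>_def inverse_le_1_iff)
      have "\<delta> j * r x \<le> \<delta> j * (\<mu> + 2 * norm x + norm \<zeta>)"
        by (rule mult_left_mono[OF norm_le_rho(2)[OF \<mu>]]) (use \<delta>(1)[of j] in simp)
      also have "\<dots> = \<delta> j * \<mu> + 2 * (\<delta> j * norm x) + \<delta> j * norm \<zeta>" by (simp add: algebra_simps)
      also have "\<dots> \<le> 1 * \<mu> + 2 * M + 1 * norm \<zeta>"
        by (intro add_mono mult_right_mono mult_left_mono dj) (use False \<delta>(1)[of j] \<mu> in auto)
      finally have dr: "\<delta> j * r x \<le> c" by (simp add: c_def)
      have rr: "r x powr (- a) = r x * r x powr (- (a + 1))" using r_pos[of x] powr_add[of "r x" 1 "- (a + 1)"] by simp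
      have "norm ((bubble (\<delta> j) x * \<delta> j) *\<^sub>R grad \<eta> (\<delta> j *\<^sub>R x)) = bubble (\<delta> j) x * \<delta> j * norm (grad \<eta> (\<delta> j *\<^sub>R x))"
        using bubble_bounds(1)[of "\<delta> j" x] \<delta>(1)[of j] by simp
      also have "\<dots> \<le> r x powr (- a) * \<delta> j * C"
        by (intro mult_mono bubble_bounds C(2)) (use \<delta>(1)[of j] in auto)
      also have "\<dots> = (\<delta> j * r x) * (C * r x powr (- (a + 1)))" unfolding rr by (simp add: mult_ac)
      also have "\<dots> \<le> c * (C * r x powr (- (a + 1)))" by (rule mult_right_mono[OF dr]) (use C(1) in simp)
      finally show ?thesis by (simp add: mult.assoc)
    qed
    have "norm (D j x) = \<bar>K\<bar> * norm (\<eta> (\<delta> j *\<^sub>R x) *\<^sub>R bubble_grad (\<delta> j) x + (bubble (\<delta> j) x * \<delta> j) *\<^sub>R grad \<eta> (\<delta> j *\<^sub>R x))"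
      by (simp add: D_def)
    also have "\<dots> \<le> \<bar>K\<bar> * (a * r x powr (- (a + 1)) + c * C * r x powr (- (a + 1)))"
      by (intro mult_left_mono order_trans[OF norm_triangle_ineq] add_mono 1 2) simp
    finally show ?thesis by (simp add: algebra_simps)
  qed
  define A where "A = \<bar>K\<bar> * (a + c * C) + \<bar>K\<bar> * a"
  have A0: "A \<ge> 0" unfolding A_def using exponents(2) c0 C(1) by simp
  have bound: "norm (K *\<^sub>R bubble_grad 0 x - D j x) powr p \<le> A powr p * r x powr (- s)" for j x
  proof -
    have "norm (K *\<^sub>R bubble_grad 0 x) \<le> \<bar>K\<bar> * (a * r x powr (- (a + 1)))" using bubble_bounds(3)[of 0 x] by (simp add: mult_left_mono)
    then have "norm (K *\<^sub>R bubble_grad 0 x - D j x) \<le> A * r x powr (- (a + 1))"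
      using D_le[of j x] norm_triangle_ineq4[of "K *\<^sub>R bubble_grad 0 x" "D j x"] unfolding A_def by (simp add: algebra_simps)
    then have "norm (K *\<^sub>R bubble_grad 0 x - D j x) powr p \<le> (A * r x powr (- (a + 1))) powr p"
      by (intro powr_mono2) (use p1 in auto)
    also have "\<dots> = A powr p * r x powr (- s)" by (simp only: powr_mult powr_powr gradient_exponent)
    finally show ?thesis .
  qed
  have Dm[measurable]: "D j \<in> borel_measurable borel" for j
  proof -
    have "D j = grad (\<phi> j)" using grad by (simp add: fun_eq_iff)
    then show ?thesis using borel_measurable_continuous_onI[OF smooth_grad_continuous[OF test_function_smooth[OF \<phi>t]]] by simp
  qed
  have lim: "(\<lambda>j. LINT x|lborel. norm (K *\<^sub>R bubble_grad 0 x - D j x) powr p) \<longlonglongrightarrow> (LINT x|(lborel :: ((real ^ 'k) \<times> (real ^ 'm)) measure). 0)"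
  proof (rule integral_dominated_convergence[where w="\<lambda>x. A powr p * r x powr (- s)"])
    show "integrable lborel (\<lambda>x. A powr p * r x powr (- s))"
      by (rule integrable_mult_right[OF r_powr_integrable[OF exponents(10)]])
    show "AE x in lborel. norm (norm (K *\<^sub>R bubble_grad 0 x - D j x) powr p) \<le> A powr p * r x powr (- s)" for j
      by (rule AE_I2) (use bound[of _ j] in simp)
    show "AE x in lborel. (\<lambda>j. norm (K *\<^sub>R bubble_grad 0 x - D j x) powr p) \<longlonglongrightarrow> 0"
      using AE_fst_nonzero
    proof eventually_elim
      case (elim x)
      note bl = bubble_limit[OF elim \<delta>(2)]
      have sx: "(\<lambda>j. \<delta> j *\<^sub>R x) \<longlonglongrightarrow> 0 *\<^sub>R x" by (intro tendsto_scaleR \<delta>(2) tendsto_const)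
      have "(\<lambda>j. \<eta> (\<delta> j *\<^sub>R x)) \<longlonglongrightarrow> \<eta> (0 *\<^sub>R x)"
        by (rule continuous_on_tendsto_compose[OF smooth_continuous[OF \<eta>s, of UNIV] sx]) auto
      moreover have "(\<lambda>j. grad \<eta> (\<delta> j *\<^sub>R x)) \<longlonglongrightarrow> grad \<eta> (0 *\<^sub>R x)"
        by (rule continuous_on_tendsto_compose[OF smooth_grad_continuous[OF \<eta>s, of UNIV] sx]) auto
      ultimately have "(\<lambda>j. D j x) \<longlonglongrightarrow> K *\<^sub>R (\<eta> (0 *\<^sub>R x) *\<^sub>R bubble_grad 0 x + (bubble 0 x * 0) *\<^sub>R grad \<eta> (0 *\<^sub>R x))"
        unfolding D_def by (intro tendsto_intros bl \<delta>(2))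
      then have "(\<lambda>j. D j x) \<longlonglongrightarrow> K *\<^sub>R bubble_grad 0 x" using \<eta>(4)[of 0] by simp
      then have "(\<lambda>j. K *\<^sub>R bubble_grad 0 x - D j x) \<longlonglongrightarrow> K *\<^sub>R bubble_grad 0 x - K *\<^sub>R bubble_grad 0 x"
        by (intro tendsto_diff tendsto_const)
      then have "(\<lambda>j. norm (K *\<^sub>R bubble_grad 0 x - D j x)) \<longlonglongrightarrow> 0" by (simp add: tendsto_norm_zero)
      then have "(\<lambda>j. norm (K *\<^sub>R bubble_grad 0 x - D j x) powr p) \<longlonglongrightarrow> 0 powr p"
        by (intro tendsto_powr2 tendsto_const) (use p1 in auto)
      then show ?case using p1 by simp
    qed
  qed auto
  have "(\<lambda>j. (LINT x|lborel. norm (K *\<^sub>R bubble_grad 0 x - D j x) powr p) powr (1 / p)) \<longlonglongrightarrow> 0 powr (1 / p)"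
    by (intro tendsto_powr2 tendsto_const)
       (use lim p1 in \<open>auto intro!: always_eventually Bochner_Integration.integral_nonneg\<close>)
  then have "(\<lambda>j. (LINT x|lborel. norm (K *\<^sub>R bubble_grad 0 x - D j x) powr p) powr (1 / p)) \<longlonglongrightarrow> 0" using p1 by simp
  from order_tendstoD(2)[OF this \<epsilon>] obtain j where
    j: "(LINT x|lborel. norm (K *\<^sub>R bubble_grad 0 x - D j x) powr p) powr (1 / p) < \<epsilon>"
    by (auto dest: eventually_happens)
  have "has_weak_gradient (\<lambda>x. K * bubble 0 x - \<phi> j x) (\<lambda>x. K *\<^sub>R bubble_grad 0 x - D j x)"
    using has_weak_gradient_diff[OF bubble_weak_gradient test_function_weak_gradient[OF \<phi>t]] unfolding grad .
  from gradient_norm_eq(1)[OF this, of p] j \<phi>t show ?thesis by metis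
qed

theorem bubble_in_D1p: "(\<lambda>x. K * bubble 0 x) \<in> D1p p"
proof -
  have i1: "integrable lborel (\<lambda>x. \<bar>K * bubble 0 x\<bar> powr ps)"
  proof -
    have "\<bar>K * bubble 0 x\<bar> powr ps = \<bar>K\<bar> powr ps * r x powr (- (N * p / (p - 1)))" for x
      using exponents(7) by (simp add: bubble_0 abs_mult powr_mult powr_powr)
    then show ?thesis using integrable_mult_right[OF r_powr_integrable[OF exponents(9)]] by simp
  qed
  have i2: "integrable lborel (\<lambda>x. norm (K *\<^sub>R bubble_grad 0 x) powr p)"
  proof (rule Bochner_Integration.integrable_bound)
    show "integrable lborel (\<lambda>x. (\<bar>K\<bar> * a) powr p * r x powr (- s))"
      by (rule integrable_mult_right[OF r_powr_integrable[OF exponents(10)]])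
    show "AE x in lborel. norm (norm (K *\<^sub>R bubble_grad 0 x) powr p) \<le> norm ((\<bar>K\<bar> * a) powr p * r x powr (- s))"
    proof (rule AE_I2)
      fix x
      have "norm (K *\<^sub>R bubble_grad 0 x) \<le> (\<bar>K\<bar> * a) * r x powr (- (a + 1))"
        using bubble_bounds(3)[of 0 x] by (simp add: mult_left_mono mult.assoc)
      then have "norm (K *\<^sub>R bubble_grad 0 x) powr p \<le> ((\<bar>K\<bar> * a) * r x powr (- (a + 1))) powr p"
        by (intro powr_mono2) (use p1 in auto)
      also have "\<dots> = (\<bar>K\<bar> * a) powr p * r x powr (- s)" by (simp only: powr_mult powr_powr gradient_exponent)
      finally show "norm (norm (K *\<^sub>R bubble_grad 0 x) powr p) \<le> norm ((\<bar>K\<bar> * a) powr p * r x powr (- s))" by simp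
    qed
  qed simp
  show ?thesis
    unfolding D1p_def sobolev_conjugate_eq
    using i1 i2 bubble_weak_gradient[of K] gradient_norm_eq(2)[OF bubble_weak_gradient[of K], of p] bubble_approximation[of _ K]
    by (auto simp: in_Lp_def)
qed

end

section \<open>The equality case\<close>

context hsm_setup
begin

lemma rho_line_at_infinity:
  fixes x b :: "(real ^ 'k) \<times> (real ^ 'm)"
  assumes b: "b \<in> Basis"
  shows "filterlim (\<lambda>t. r (x + t *\<^sub>R b)) at_top at_top" "filterlim (\<lambda>t. r (x + t *\<^sub>R b)) at_top at_bot"
proof -
  have lower: "norm v > 2 * Z + norm \<zeta> \<Longrightarrow> Z \<le> r v" for v :: "(real ^ 'k) \<times> (real ^ 'm)" and Z
    using norm_le_rho(1)[OF \<mu>, of v \<zeta>] by linarith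
  show "filterlim (\<lambda>t. r (x + t *\<^sub>R b)) at_top at_top" unfolding filterlim_at_top
    by (intro allI eventually_mono[OF eventually_outside_ball(1)[OF b]] lower)
  show "filterlim (\<lambda>t. r (x + t *\<^sub>R b)) at_top at_bot" unfolding filterlim_at_top
    by (intro allI eventually_mono[OF eventually_outside_ball(2)[OF b]] lower)
qed

text \<open>The equality case: the divergence of \<open>r\<^sup>-\<^sup>s X\<close>, where \<open>X x = x + offset \<mu> \<zeta> x\<close>, integrates to zero.\<close>

lemma bubble_hardy_term:
  "integrable lborel (\<lambda>x. r x powr (- s) / norm (fst x))"
  "\<mu> * (real CARD('k) - 1) * (LINT x|lborel. r x powr (- s) / norm (fst x)) = a * I"
proof -
  define X where "X x = x + offset \<mu> \<zeta> x" for x :: "(real ^ 'k) \<times> (real ^ 'm)"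
  define w where "w x = r x powr (- s)" for x
  define w' where "w' b x = - s * r x powr (- (s + 2)) * (X x \<bullet> b)" for b x
  define S' where "S' b x = 1 + \<mu> * sgn_deriv b x" for b x :: "(real ^ 'k) \<times> (real ^ 'm)"
  have Xm[measurable]: "X \<in> borel_measurable borel" unfolding X_def[abs_def] by measurable
  have s0: "s > 0" by (rule exponents(11))
  have Xr: "norm (X x) \<le> r x" for x unfolding X_def by (rule norm_add_offset_le[OF \<mu>])
  have wi: "integrable lborel w" unfolding w_def[abs_def] by (rule r_powr_integrable[OF exponents(10)])
  have wm[measurable]: "w \<in> borel_measurable borel" "w' b \<in> borel_measurable borel" "S' b \<in> borel_measurable borel" for b
    unfolding w_def[abs_def] w'_def[abs_def] S'_def[abs_def] by measurable
  have rr: "r x powr (- (s + 2)) * (r x)\<^sup>2 = r x powr (- s)" for x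
  proof -
    have "r x powr (- s) = r x powr (- (s + 2) + 2)" by simp
    also have "\<dots> = r x powr (- (s + 2)) * r x powr 2" by (rule powr_add)
    also have "r x powr 2 = (r x)\<^sup>2" using r_pos[of x] by simp
    finally show ?thesis by simp
  qed
  have wd: "(w has_derivative (\<lambda>h. w' h x)) (at x)" if "fst x \<noteq> 0" for x
  proof -
    have e: "- (s / 2) - 1 = - ((s + 2) / 2)" by (simp add: field_simps)
    have "((\<lambda>x. rho_sq \<mu> \<zeta> 0 x powr (- (s / 2))) has_derivative
     (\<lambda>h. ((- s * rho_sq \<mu> \<zeta> 0 x powr (- (s / 2) - 1)) *\<^sub>R half_grad \<mu> \<zeta> 0 x) \<bullet> h)) (at x)"
      by (rule rho_sq_powr_has_derivative[OF \<mu>]) (use that in simp)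
    then show ?thesis unfolding e rho_sq_0_powr half_grad_0 by (simp add: w_def[abs_def] w'_def X_def)
  qed
  have gi: "integrable lborel (\<lambda>x. w' b x * (X x \<bullet> b))" if b: "b \<in> Basis" for b
  proof (rule Bochner_Integration.integrable_bound[OF integrable_mult_right[OF wi, of s]])
    show "AE x in lborel. norm (w' b x * (X x \<bullet> b)) \<le> norm (s * w x)"
    proof (rule AE_I2)
      fix x
      have "norm (w' b x * (X x \<bullet> b)) = s * (r x powr (- (s + 2)) * (\<bar>X x \<bullet> b\<bar>)\<^sup>2)"
        using s0 by (simp add: w'_def abs_mult power2_eq_square mult_ac)
      also have "\<dots> \<le> s * (r x powr (- (s + 2)) * (r x)\<^sup>2)"
        by (intro mult_left_mono power_mono order_trans[OF Basis_le_norm[OF b] Xr]) (use s0 in auto)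
      finally show "norm (w' b x * (X x \<bullet> b)) \<le> norm (s * w x)" using s0 unfolding rr by (simp add: w_def)
    qed
  qed measurable
  have parts: "integrable lborel (\<lambda>x. w x * S' b x)" "(LINT x|lborel. w x * S' b x) = - (LINT x|lborel. w' b x * (X x \<bullet> b))"
    if b: "b \<in> Basis" for b
  proof -
    have ae: "AE x in lborel. (\<forall>t. ((\<lambda>s. w (x + s *\<^sub>R b)) has_real_derivative w' b (x + t *\<^sub>R b)) (at t)) \<and>
      ((\<forall>t. w (x + t *\<^sub>R b) = 0) \<or>
       (\<forall>t. ((\<lambda>s. X (x + s *\<^sub>R b) \<bullet> b) has_real_derivative S' b (x + t *\<^sub>R b)) (at t)) \<and>
       ((\<lambda>t. w (x + t *\<^sub>R b) * (X (x + t *\<^sub>R b) \<bullet> b)) \<longlongrightarrow> 0) at_top \<and>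
       ((\<lambda>t. w (x + t *\<^sub>R b) * (X (x + t *\<^sub>R b) \<bullet> b)) \<longlongrightarrow> 0) at_bot)"
      using AE_line_fst_nonzero[OF b k2]
    proof eventually_elim
      case (elim x)
      have 1: "((\<lambda>s. w (x + s *\<^sub>R b)) has_real_derivative w' b (x + t *\<^sub>R b)) (at t)" for t
        by (rule has_derivative_line[OF wd]) (use elim in blast)
      have 2: "((\<lambda>s. X (x + s *\<^sub>R b) \<bullet> b) has_real_derivative S' b (x + t *\<^sub>R b)) (at t)" for t
      proof -
        have "((\<lambda>s. (x + s *\<^sub>R b) \<bullet> b) has_real_derivative 1) (at t)"
          using b by (auto intro!: derivative_eq_intros simp: inner_add_left)
        from DERIV_add[OF this offset_line_deriv[of x t b \<mu> \<zeta>]] show ?thesis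
          unfolding X_def S'_def inner_add_left using elim by simp
      qed
      have le: "norm (w y * (X y \<bullet> b)) \<le> r y powr (1 - s)" for y
      proof -
        have "norm (w y * (X y \<bullet> b)) = w y * \<bar>X y \<bullet> b\<bar>" by (simp add: abs_mult w_def)
        also have "\<dots> \<le> w y * r y"
          by (rule mult_left_mono[OF order_trans[OF Basis_le_norm[OF b] Xr]]) (simp add: w_def)
        finally have "norm (w y * (X y \<bullet> b)) \<le> r y powr (- s) * r y" by (simp add: w_def)
        also have "r y powr (- s) * r y = r y powr (1 - s)" using r_pos[of y] powr_add[of "r y" "- s" 1] by simp
        finally show ?thesis .
      qed
      \<comment> \<open>The boundary terms are at most r^(1-s), and s > N \<ge> 2 makes the exponent
        negative.\<close>
      have "N \<ge> 2" unfolding N using k2 by simp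
      then have s1: "1 - s < 0" using exponents(10) by linarith
      have 3: "((\<lambda>t. w (x + t *\<^sub>R b) * (X (x + t *\<^sub>R b) \<bullet> b)) \<longlongrightarrow> 0) at_top"
        by (rule Lim_null_comparison[OF always_eventually tendsto_neg_powr[OF s1 rho_line_at_infinity(1)[OF b]]]) (use le in blast)
      have 4: "((\<lambda>t. w (x + t *\<^sub>R b) * (X (x + t *\<^sub>R b) \<bullet> b)) \<longlongrightarrow> 0) at_bot"
        by (rule Lim_null_comparison[OF always_eventually tendsto_neg_powr[OF s1 rho_line_at_infinity(2)[OF b]]]) (use le in blast)
      show ?case using 1 2 3 4 by blast
    qed
    have w0: "0 \<le> w x" for x by (simp add: w_def)
    have S0: "0 \<le> S' b x" for x unfolding S'_def using sgn_deriv_nonneg[of b x] \<mu> by simp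
    show "integrable lborel (\<lambda>x. w x * S' b x)" by (rule parts_along(1)[OF b gi[OF b] w0 S0 wm(1,3) ae])
    show "(LINT x|lborel. w x * S' b x) = - (LINT x|lborel. w' b x * (X x \<bullet> b))"
      by (rule parts_along(2)[OF b gi[OF b] w0 S0 wm(1,3) ae])
  qed
  define \<kappa> where "\<kappa> = \<mu> * (real CARD('k) - 1)"
  have \<kappa>: "\<kappa> > 0" unfolding \<kappa>_def using \<mu> k2 by simp
  have sumS: "(\<Sum>b\<in>Basis. w x * S' b x) = N * w x + \<kappa> * (w x / norm (fst x))" for x
  proof -
    have "(\<Sum>b\<in>Basis. w x * S' b x) = w x * (real (card (Basis :: ((real ^ 'k) \<times> (real ^ 'm)) set)) + \<mu> * (\<Sum>b\<in>Basis. sgn_deriv b x))"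
      by (simp add: S'_def sum_distrib_left[symmetric] sum.distrib)
    also have "real (card (Basis :: ((real ^ 'k) \<times> (real ^ 'm)) set)) = N" using N by simp
    finally have "(\<Sum>b\<in>Basis. w x * S' b x) = w x * (N + \<mu> * ((real CARD('k) - 1) / norm (fst x)))"
      by (simp only: sum_sgn_deriv)
    moreover have "W * (N + \<mu> * (A / m)) = N * W + (\<mu> * A) * (W / m)" for W A m :: real by (simp add: algebra_simps)
    ultimately show ?thesis by (simp only: \<kappa>_def)
  qed
  \<comment> \<open>The equality |X| = \<rho> enters here; it is exact off the null set y = 0, where
    \<open>sgn\<close> would lose the shift.\<close>
  have sumw: "(\<Sum>b\<in>Basis. w' b x * (X x \<bullet> b)) = - s * w x" if "fst x \<noteq> 0" for x
  proof -
    have "(\<Sum>b\<in>Basis. w' b x * (X x \<bullet> b)) = - s * r x powr (- (s + 2)) * (X x \<bullet> X x)"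
      unfolding w'_def euclidean_inner[of "X x" "X x"] by (simp add: sum_distrib_left mult.assoc)
    also have "X x \<bullet> X x = (r x)\<^sup>2" using norm_half_grad(2)[OF \<mu> that, of \<zeta>] by (simp add: X_def dot_square_norm)
    finally show ?thesis using rr[of x] by (simp add: w_def mult.assoc)
  qed
  have si: "integrable lborel (\<lambda>x. \<Sum>b\<in>Basis. w x * S' b x)" using parts(1) by simp
  have "integrable lborel (\<lambda>x. (\<Sum>b\<in>Basis. w x * S' b x) - N * w x)"
    by (rule Bochner_Integration.integrable_diff[OF si integrable_mult_right[OF wi]])
  then have "integrable lborel (\<lambda>x. \<kappa> * (w x / norm (fst x)))" unfolding sumS by simp
  from integrable_mult_right[OF this, of "1 / \<kappa>"] have wy: "integrable lborel (\<lambda>x. w x / norm (fst x))"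
    using \<kappa> by simp
  then show "integrable lborel (\<lambda>x. r x powr (- s) / norm (fst x))" by (simp add: w_def)
  have Iw: "(LINT x|lborel. w x) = I" by (simp add: w_def I_def)
  have "N * I + \<kappa> * (LINT x|lborel. w x / norm (fst x)) = (LINT x|lborel. N * w x + \<kappa> * (w x / norm (fst x)))"
  proof -
    have "(LINT x|lborel. N * w x + \<kappa> * (w x / norm (fst x))) = (LINT x|lborel. N * w x) + (LINT x|lborel. \<kappa> * (w x / norm (fst x)))"
      by (rule Bochner_Integration.integral_add[OF integrable_mult_right[OF wi] integrable_mult_right[OF wy]])
    then show ?thesis unfolding integral_mult_right_zero Iw by simp
  qed
  also have "\<dots> = (\<Sum>b\<in>Basis. - (LINT x|lborel. w' b x * (X x \<bullet> b)))"
    unfolding sumS[symmetric] using parts by simp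
  also have "\<dots> = - (LINT x|lborel. (\<Sum>b\<in>Basis. w' b x * (X x \<bullet> b)))"
    using gi by (simp add: sum_negf)
  also have "(LINT x|lborel. (\<Sum>b\<in>Basis. w' b x * (X x \<bullet> b))) = (LINT x|lborel. - s * w x)"
    by (rule integral_cong_AE) (measurable, use AE_fst_nonzero in eventually_elim, rule sumw)
  also have "- (LINT x|lborel. - s * w x) = s * I" unfolding integral_mult_right_zero Iw by simp
  \<comment> \<open>N I plus the Hardy term equals s I, and s - N = a.\<close>
  finally show "\<mu> * (real CARD('k) - 1) * (LINT x|lborel. r x powr (- s) / norm (fst x)) = a * I"
    unfolding \<kappa>_def[symmetric] w_def[symmetric] using exponents(5) by (simp add: algebra_simps)
qed

text \<open>Off y = 0 the vector x + \<open>offset \<mu> \<zeta> x\<close> has length r(x), so the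
  gradient of r^(-a) has length a r^(-(a+1)). Its p-th power is a multiple of r^(-s), and the same
  \<open>I\<close> appears as in the Hardy term.\<close>

lemma bubble_gradient_norm: "gradient_norm p (\<lambda>x. K * bubble 0 x) = \<bar>K\<bar> * (a * I powr (1 / p))"
proof -
  have "AE x in lborel. norm (K *\<^sub>R bubble_grad 0 x) powr p = (\<bar>K\<bar> * a) powr p * r x powr (- s)"
    using AE_fst_nonzero
  proof eventually_elim
    case (elim x)
    have "- (a + 1) = - (a + 2) + 1" by simp
    then have "r x powr (- (a + 1)) = r x powr (- (a + 2) + 1)" by (simp only:)
    also have "\<dots> = r x powr (- (a + 2)) * r x powr 1" by (rule powr_add)
    finally have rr: "r x powr (- (a + 2)) * r x = r x powr (- (a + 1))" using r_pos[of x] by simp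
    have "norm (bubble_grad 0 x) = a * (r x powr (- (a + 2)) * r x)"
      unfolding bubble_grad_0 norm_scaleR norm_half_grad(2)[OF \<mu> elim] using exponents(2) by (simp add: abs_mult)
    then have "norm (K *\<^sub>R bubble_grad 0 x) = (\<bar>K\<bar> * a) * r x powr (- (a + 1))" unfolding rr by (simp add: mult.assoc)
    then show ?case by (simp only: powr_mult powr_powr gradient_exponent)
  qed
  then have "(LINT x|lborel. norm (K *\<^sub>R bubble_grad 0 x) powr p) = (LINT x|lborel. (\<bar>K\<bar> * a) powr p * r x powr (- s))"
    by (intro integral_cong_AE) auto
  also have "\<dots> = (\<bar>K\<bar> * a) powr p * I" unfolding I_def by (rule integral_mult_right_zero)
  finally have "gradient_norm p (\<lambda>x. K * bubble 0 x) = ((\<bar>K\<bar> * a) powr p * I) powr (1 / p)"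
    using gradient_norm_eq(1)[OF bubble_weak_gradient] by simp
  also have "\<dots> = \<bar>K\<bar> * (a * I powr (1 / p))"
    using p1 exponents(2) by (simp add: powr_mult powr_powr)
  finally show ?thesis .
qed

text \<open>What \<open>hsm_D1p\<close> gives after division by \<mu>(k-1) and extraction of the
  q-th root. \<mu> and \<zeta> enter the formula but not the value, since a best constant is
  unique.\<close>

definition "sharp_constant = (a * I / (\<mu> * (real CARD('k) - 1))) powr (1 / q) / (a * I powr (1 / p))"

text \<open>Optimality requires no minimising sequence: equality at \<open>u\<close>, whose gradient
  norm is positive, forces every admissible constant to be at least
  \<open>sharp_constant\<close>.\<close>

theorem bubble_extremal:
  fixes u :: "(real ^ 'k) \<times> (real ^ 'm) \<Rightarrow> real"
  assumes K: "K > 0" and u: "\<And>x. u x = K * bubble 0 x"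
  shows "hsm_best_constant TYPE('k) TYPE('m) p sharp_constant" "hsm_extremal p sharp_constant u"
proof -
  define \<kappa> where "\<kappa> = \<mu> * (real CARD('k) - 1)"
  have \<kappa>: "\<kappa> > 0" unfolding \<kappa>_def using \<mu> k2 by simp
  define d where "d = a * I powr (1 / p)"
  have d: "d > 0" unfolding d_def using exponents(2) IJ_pos by simp
  define c where "c = (a * I / \<kappa>) powr (1 / q)"
  have c: "c \<ge> 0" by (simp add: c_def)
  have S: "sharp_constant = c / d" by (simp add: sharp_constant_def c_def d_def \<kappa>_def)
  have q0: "q > 0" using exponents(13) by simp
  have int_eq: "hsm_integrand p v = (\<lambda>x. \<bar>v x\<bar> powr q / norm (fst x))" for v :: "(real ^ 'k) \<times> (real ^ 'm) \<Rightarrow> real"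
    unfolding hsm_integrand_def[abs_def] hsm_exponent_eq ..
  have norm_eq: "hsm_norm p v = (LINT x|lborel. \<bar>v x\<bar> powr q / norm (fst x)) powr (1 / q)" for v :: "(real ^ 'k) \<times> (real ^ 'm) \<Rightarrow> real"
    unfolding hsm_norm_def hsm_exponent_eq int_eq ..
  have ineq: "hsm_inequality p sharp_constant v" if v: "v \<in> D1p p" for v :: "(real ^ 'k) \<times> (real ^ 'm) \<Rightarrow> real"
  proof -
    let ?W = "LINT x|lborel. \<bar>v x\<bar> powr q / norm (fst x)"
    have W0: "0 \<le> ?W" by (rule Bochner_Integration.integral_nonneg) simp
    have G0: "0 \<le> gradient_norm p v" by (simp add: gradient_norm_def)
    have "\<kappa> * ?W \<le> a * I * (gradient_norm p v / d) powr q" using hsm_D1p(2)[OF v] unfolding \<kappa>_def d_def .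
    then have "?W \<le> a * I / \<kappa> * (gradient_norm p v / d) powr q" using \<kappa> by (simp add: field_simps)
    then have "?W powr (1 / q) \<le> (a * I / \<kappa> * (gradient_norm p v / d) powr q) powr (1 / q)"
      by (intro powr_mono2) (use W0 q0 in auto)
    also have "\<dots> = c * (gradient_norm p v / d)"
      using G0 d q0 by (simp only: powr_mult powr_powr c_def) simp
    finally show ?thesis
      unfolding hsm_inequality_def int_eq norm_eq S using hsm_D1p(1)[OF v] by simp
  qed
  have ud: "u \<in> D1p p" using bubble_in_D1p[of K] u by (simp add: fun_eq_iff[symmetric] ext[OF u])
  have gn: "gradient_norm p u = K * d"
    using bubble_gradient_norm[of K] K by (simp add: ext[OF u] d_def)
  have hn: "hsm_norm p u = K * c"
  proof -
    have "\<bar>u x\<bar> powr q / norm (fst x) = K powr q * (r x powr (- s) / norm (fst x))" for x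
      using K exponents(6) by (simp add: u bubble_0 abs_mult powr_mult powr_powr)
    then have "(LINT x|lborel. \<bar>u x\<bar> powr q / norm (fst x)) = K powr q * (LINT x|lborel. r x powr (- s) / norm (fst x))"
      by (simp only: integral_mult_right_zero)
    also have "(LINT x|lborel. r x powr (- s) / norm (fst x)) = a * I / \<kappa>"
      using bubble_hardy_term(2) \<kappa> unfolding \<kappa>_def[symmetric] by (simp add: field_simps)
    finally have "hsm_norm p u = (K powr q * (a * I / \<kappa>)) powr (1 / q)" unfolding norm_eq by simp
    also have "\<dots> = K * c" using K q0 by (simp only: powr_mult powr_powr c_def) simp
    finally show ?thesis .
  qed
  have eq: "hsm_norm p u = sharp_constant * gradient_norm p u" unfolding hn gn S using d by simp
  have gpos: "gradient_norm p u > 0" unfolding gn using K d by simp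
  show "hsm_best_constant TYPE('k) TYPE('m) p sharp_constant"
    unfolding hsm_best_constant_def
  proof (intro conjI ballI allI impI ineq)
    fix S' assume "\<forall>v \<in> (D1p p :: ((real ^ 'k) \<times> (real ^ 'm) \<Rightarrow> real) set). hsm_inequality p S' v"
    then have "hsm_norm p u \<le> S' * gradient_norm p u" using ud by (simp add: hsm_inequality_def)
    then show "sharp_constant \<le> S'" unfolding eq using gpos by simp
  qed
  have "\<not> (AE x in lborel. u x = 0)"
  proof
    assume "AE x in lborel. u x = 0"
    then have "AE x in lborel. r x powr (- s) = 0"
    proof eventually_elim
      case (elim x) then show ?case using K r_pos[of x] by (simp add: u bubble_0)
    qed
    then have "I = 0" unfolding I_def by (rule integral_eq_zero_AE)
    then show False using IJ_pos by simp
  qed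
  then show "hsm_extremal p sharp_constant u" unfolding hsm_extremal_def using ud eq by blast
qed

end

theorem mainTheorem2:
  fixes n k :: nat and p lam :: real and z0 :: "real ^ 'm"
    and u :: "(real ^ 'k) \<times> (real ^ 'm) \<Rightarrow> real"
  assumes "n \<ge> 4" and "3 \<le> k" and "k \<le> n - 1"
    and "CARD('k) = k" and "CARD('m) = n - k"
    and "1 < p" and "p < real n"
    and "lam > 0"
    and "\<And>y z. u (y, z) =
           lam powr ((real n - p) / p) * hsm_u0 p (real n) (real k) (lam *\<^sub>R y) (lam *\<^sub>R z + z0)"
  shows "\<exists>S. hsm_best_constant TYPE('k) TYPE('m) p S \<and> hsm_extremal p S u"
proof -
  have lam: "lam > 0" by fact
  have N: "real n = real (CARD('k) + CARD('m))" using assms(3,4,5) by simp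
  interpret hsm_setup "1 / lam" p "real n" "- ((1 / lam) *\<^sub>R z0)" "TYPE('k)"
    by unfold_locales (use assms(2,4,6,7,8) N in simp_all)
  \<comment> \<open>The last factor comes from homogeneity: both squares in the bracket of
    \<open>hsm_u0\<close> contain lam^2, and the power -a/2 turns it into lam^(-a).\<close>
  define K where "K = lam powr ((real n - p) / p) * hsm_coefficient p (real n) (real k) * lam powr (- a)"
  have K: "K > 0"
    unfolding K_def hsm_coefficient_def using assms(2,6,7,8) by (intro mult_pos_pos) auto
  have u: "u x = K * bubble 0 x" for x
  proof -
    obtain y z where x: "x = (y, z)" by (cases x)
    have E1: "1 + norm (lam *\<^sub>R y) = lam * (1 / lam + norm y)" using lam by (simp add: distrib_left)
    have "lam *\<^sub>R z + z0 = lam *\<^sub>R (z - (- ((1 / lam) *\<^sub>R z0)))" using lam by (simp add: scaleR_add_right)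
    then have E2: "norm (lam *\<^sub>R z + z0) = lam * norm (z - (- ((1 / lam) *\<^sub>R z0)))" using lam by (metis norm_scaleR abs_of_pos)
    have "(1 + norm (lam *\<^sub>R y))\<^sup>2 + (norm (lam *\<^sub>R z + z0))\<^sup>2 = lam\<^sup>2 * (r x)\<^sup>2"
      by (simp only: E1 E2 rho_square x fst_conv snd_conv power_mult_distrib) (rule distrib_left[symmetric])
    also have "\<dots> = (lam * r x) powr 2"
      using lam r_pos[of x] by (simp add: power_mult_distrib)
    finally have sq: "(1 + norm (lam *\<^sub>R y))\<^sup>2 + (norm (lam *\<^sub>R z + z0))\<^sup>2 = (lam * r x) powr 2" .
    have "2 * (A / (2 * B)) = A / B" for A B :: real by simp
    then have e: "2 * - ((real n - p) / (2 * (p - 1))) = - a" by (simp only: a_def mult_minus_right)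
    have "hsm_u0 p (real n) (real k) (lam *\<^sub>R y) (lam *\<^sub>R z + z0) = hsm_coefficient p (real n) (real k) * (lam * r x) powr (- a)"
      unfolding hsm_u0_def sq powr_powr e ..
    also have "(lam * r x) powr (- a) = lam powr (- a) * bubble 0 x" by (simp only: powr_mult bubble_0)
    finally show ?thesis unfolding x assms(9) by (simp add: K_def mult_ac)
  qed
  show ?thesis using bubble_extremal[OF K u] by blast
qed

end
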